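(* For two simplicial complexes $\mathcal K$ and $\mathcal L$, if either $H^*(\mathcal Z_{\mathcal K})$ or $H^*(\mathcal Z_{\mathcal L})$ is projective over the coefficient ring, then there is an isomorphism of chain complexes $$\mathit{CH}^*(\mathcal Z_{\mathcal K*\mathcal L})\cong\mathit{CH}^*(\mathcal Z_{\mathcal K})\otimes\mathit{CH}^*(\mathcal Z_{\mathcal L}).$$ In particular, $\mathit{HH}^*(\mathcal Z_{\mathcal K*\mathcal L})\cong\mathit{HH}^*(\mathcal Z_{\mathcal K})\otimes\mathit{HH}^*(\mathcal Z_{\mathcal L})$ with field coefficients. The same statement holds for the double homology $\mathit{HH}_*$ (with $H_*$, $\mathit{CH}_*$ and $\mathit{HH}_*$ in place of $H^*$, $\mathit{CH}^*$ and $\mathit{HH}^*$).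
   Context: Coefficients are in a principal ideal domain (by default $\mathbb Z$), and tensor products are over it. A simplicial complex $\mathcal K$ on the vertex set $[m]=\{1,\dots,m\}$ contains $\varnothing$ and all singletons; $\mathcal K_I=\{J\in\mathcal K:J\subset I\}$ is the full subcomplex on $I\subset[m]$. For a complex on another finite vertex set, choose an ordering of the vertices. The join of $\mathcal K$ and $\mathcal L$, on the disjoint union of their vertex sets, is $\mathcal K*\mathcal L=\{I\sqcup J:I\in\mathcal K,J\in\mathcal L\}$. $\mathcal Z_{\mathcal K}=\bigcup_{I\in\mathcal K}\{z\in(D^2)^m:|z_j|=1\text{ if }j\notin I\}$ is the moment-angle complex, with Hochster decompositions $H^{-k,2\ell}(\mathcal Z_{\mathcal K})=\bigoplus_{|I|=\ell}\widetilde H^{\ell-k-1}(\mathcal K_I)$ and $H_{-k,2\ell}(\mathcal Z_{\mathcal K})=\bigoplus_{|I|=\ell}\widetilde H_{\ell-k-1}(\mathcal K_I)$ of total degree $-k+2\ell$. Let $\varepsilon(i,I)=(-1)^{\#\{r\in I:r<i\}}$. $\mathit{CH}^*(\mathcal Z_{\mathcal K})=(H^*(\mathcal Z_{\mathcal K}),d')$, where on $\widetilde H^p(\mathcal K_I)$ one sets $d'=(-1)^{p+1}\sum_{i\in I}\varepsilon(i,I)\psi_{p;i,I}$ with $\psi_{p;i,I}:\widetilde H^p(\mathcal K_I)\to\widetilde H^p(\mathcal K_{I\setminus\{i\}})$ the restriction; and $\mathit{CH}_*(\mathcal Z_{\mathcal K})=(H_*(\mathcal Z_{\mathcal K}),\partial')$,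 where on $\widetilde H_p(\mathcal K_I)$ one sets $\partial'=(-1)^{p+1}\sum_{j\in[m]\setminus I}\varepsilon(j,I)\phi_{p;I,j}$ with $\phi_{p;I,j}:\widetilde H_p(\mathcal K_I)\to\widetilde H_p(\mathcal K_{I\cup\{j\}})$ induced by inclusion. Both square to zero, and $\mathit{HH}^*(\mathcal Z_{\mathcal K})=H(\mathit{CH}^*(\mathcal Z_{\mathcal K}))$, $\mathit{HH}_*(\mathcal Z_{\mathcal K})=H(\mathit{CH}_*(\mathcal Z_{\mathcal K}))$. *)

theory Defs
  imports "HOL-Algebra.Module" "HOL-Algebra.Ring_Divisibility"
begin

section \<open>Modules\<close>

text \<open>
  The ring part (\<open>mult\<close>, \<open>one\<close>) of the record type of modules is meaningless
  for a module and is always left \<open>undefined\<close> below.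
\<close>

definition mod_hom ::
  "('r, 's) ring_scheme \<Rightarrow> ('r, 'a, 'm) module_scheme \<Rightarrow> ('r, 'b, 'n) module_scheme \<Rightarrow> ('a \<Rightarrow> 'b) set"
  where "mod_hom R M N =
    {f \<in> carrier M \<rightarrow> carrier N.
       (\<forall>x\<in>carrier M. \<forall>y\<in>carrier M. f (x \<oplus>\<^bsub>M\<^esub> y) = f x \<oplus>\<^bsub>N\<^esub> f y) \<and>
       (\<forall>a\<in>carrier R. \<forall>x\<in>carrier M. f (a \<odot>\<^bsub>M\<^esub> x) = a \<odot>\<^bsub>N\<^esub> f x)}"

definition free_module :: "('r, 's) ring_scheme \<Rightarrow> 'x set \<Rightarrow> ('r, 'x \<Rightarrow> 'r) module"
  where "free_module R S =
    \<lparr>carrier = {f. (\<forall>x. f x \<in> carrier R) \<and> (\<forall>x. x \<notin> S \<longrightarrow> f x = \<zero>\<^bsub>R\<^esub>) \<and> finite {x. f x \<noteq> \<zero>\<^bsub>R\<^esub>}},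
     mult = undefined, one = undefined,
     zero = (\<lambda>x. \<zero>\<^bsub>R\<^esub>), add = (\<lambda>f g x. f x \<oplus>\<^bsub>R\<^esub> g x),
     smult = (\<lambda>a f x. a \<otimes>\<^bsub>R\<^esub> f x)\<rparr>"

definition basis_elem :: "('r, 's) ring_scheme \<Rightarrow> 'x \<Rightarrow> 'x \<Rightarrow> 'r"
  where "basis_elem R z = (\<lambda>x. if x = z then \<one>\<^bsub>R\<^esub> else \<zero>\<^bsub>R\<^esub>)"

text \<open>
  Projective means direct summand of a free module. It is no restriction to take the
  basis of the free module from the type of elements of \<open>P\<close>: if \<open>P\<close> is a direct summand of
  any free module at all, then the canonical surjection from the free module on
  \<open>carrier P\<close> onto \<open>P\<close> splits.
\<close>

definition projective :: "('r, 's) ring_scheme \<Rightarrow> ('r, 'a, 'm) module_scheme \<Rightarrow> bool"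
  where "projective R P \<longleftrightarrow>
    module R P \<and>
    (\<exists>(S :: 'a set) i q. i \<in> mod_hom R P (free_module R S) \<and> q \<in> mod_hom R (free_module R S) P \<and>
       (\<forall>x\<in>carrier P. q (i x) = x))"

text \<open>
  If \<open>h\<close> is linear and maps \<open>B \<subseteq> M\<close> into \<open>B' \<subseteq> M'\<close>, then \<open>quot_map M' B' h\<close> is the
  induced map from \<open>M/B\<close> to \<open>M'/B'\<close>, where residue classes are cosets.
\<close>

definition quot_map :: "('r, 'b, 'n) module_scheme \<Rightarrow> 'b set \<Rightarrow> ('a \<Rightarrow> 'b) \<Rightarrow> 'a set \<Rightarrow> 'b set"
  where "quot_map M' B' h X = (\<Union>x\<in>X. B' +>\<^bsub>M'\<^esub> h x)"

definition quot_module :: "('r, 'a, 'm) module_scheme \<Rightarrow> 'a set \<Rightarrow> ('r, 'a set) module"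
  where "quot_module M B =
    \<lparr>carrier = a_rcosets\<^bsub>M\<^esub> B, mult = undefined, one = undefined,
     zero = B, add = (\<lambda>X Y. X <+>\<^bsub>M\<^esub> Y),
     smult = (\<lambda>a. quot_map M B (\<lambda>x. a \<odot>\<^bsub>M\<^esub> x))\<rparr>"

definition direct_sum :: "'i set \<Rightarrow> ('i \<Rightarrow> ('r, 'a, 'm) module_scheme) \<Rightarrow> ('r, 'i \<Rightarrow> 'a) module"
  where "direct_sum A M =
    \<lparr>carrier = {x \<in> \<Pi>\<^sub>E i\<in>A. carrier (M i). finite {i \<in> A. x i \<noteq> \<zero>\<^bsub>M i\<^esub>}},
     mult = undefined, one = undefined,
     zero = (\<lambda>i\<in>A. \<zero>\<^bsub>M i\<^esub>), add = (\<lambda>x y. \<lambda>i\<in>A. x i \<oplus>\<^bsub>M i\<^esub> y i),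
     smult = (\<lambda>a x. \<lambda>i\<in>A. a \<odot>\<^bsub>M i\<^esub> x i)\<rparr>"

definition mod_span :: "('r, 's) ring_scheme \<Rightarrow> ('r, 'a, 'm) module_scheme \<Rightarrow> 'a set \<Rightarrow> 'a set"
  where "mod_span R M S = \<Inter>{H. submodule H R M \<and> S \<subseteq> H}"

subsection \<open>Tensor products\<close>

text \<open>
  The tensor product of \<open>M\<close> and \<open>N\<close> is the free module on all pairs modulo the usual
  bilinearity relations.
\<close>

definition tensor_free ::
  "('r, 's) ring_scheme \<Rightarrow> ('r, 'a, 'm) module_scheme \<Rightarrow> ('r, 'b, 'n) module_scheme \<Rightarrow> ('r, 'a \<times> 'b \<Rightarrow> 'r) module"
  where "tensor_free R M N = free_module R (carrier M \<times> carrier N)"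

definition tensor_relators ::
  "('r, 's) ring_scheme \<Rightarrow> ('r, 'a, 'm) module_scheme \<Rightarrow> ('r, 'b, 'n) module_scheme \<Rightarrow> ('a \<times> 'b \<Rightarrow> 'r) set"
  where "tensor_relators R M N = (let F = tensor_free R M N; e = basis_elem R in
    {e (x \<oplus>\<^bsub>M\<^esub> x', y) \<ominus>\<^bsub>F\<^esub> (e (x, y) \<oplus>\<^bsub>F\<^esub> e (x', y)) | x x' y.
       x \<in> carrier M \<and> x' \<in> carrier M \<and> y \<in> carrier N} \<union>
    {e (x, y \<oplus>\<^bsub>N\<^esub> y') \<ominus>\<^bsub>F\<^esub> (e (x, y) \<oplus>\<^bsub>F\<^esub> e (x, y')) | x y y'.
       x \<in> carrier M \<and> y \<in> carrier N \<and> y' \<in> carrier N} \<union>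
    {e (a \<odot>\<^bsub>M\<^esub> x, y) \<ominus>\<^bsub>F\<^esub> a \<odot>\<^bsub>F\<^esub> e (x, y) | a x y.
       a \<in> carrier R \<and> x \<in> carrier M \<and> y \<in> carrier N} \<union>
    {e (x, a \<odot>\<^bsub>N\<^esub> y) \<ominus>\<^bsub>F\<^esub> a \<odot>\<^bsub>F\<^esub> e (x, y) | a x y.
       a \<in> carrier R \<and> x \<in> carrier M \<and> y \<in> carrier N})"

definition tensor_kernel ::
  "('r, 's) ring_scheme \<Rightarrow> ('r, 'a, 'm) module_scheme \<Rightarrow> ('r, 'b, 'n) module_scheme \<Rightarrow> ('a \<times> 'b \<Rightarrow> 'r) set"
  where "tensor_kernel R M N = mod_span R (tensor_free R M N) (tensor_relators R M N)"

definition tensor_module ::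
  "('r, 's) ring_scheme \<Rightarrow> ('r, 'a, 'm) module_scheme \<Rightarrow> ('r, 'b, 'n) module_scheme \<Rightarrow> ('r, ('a \<times> 'b \<Rightarrow> 'r) set) module"
  where "tensor_module R M N = quot_module (tensor_free R M N) (tensor_kernel R M N)"

definition pure_tensor ::
  "('r, 's) ring_scheme \<Rightarrow> ('r, 'a, 'm) module_scheme \<Rightarrow> ('r, 'b, 'n) module_scheme \<Rightarrow> 'a \<Rightarrow> 'b \<Rightarrow> ('a \<times> 'b \<Rightarrow> 'r) set"
  where "pure_tensor R M N x y = tensor_kernel R M N +>\<^bsub>tensor_free R M N\<^esub> basis_elem R (x, y)"

section \<open>Bigraded modules and complexes\<close>

text \<open>
  Bigraded modules are internally graded: the total module together with its submodules
  of homogeneous elements. The total degree of bidegree \<open>(a, b)\<close> is \<open>a + b\<close>.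
\<close>

record ('r, 'a) bigraded_module =
  total :: "('r, 'a) module"
  part :: "int \<times> int \<Rightarrow> 'a set"

record ('r, 'a) bigraded_complex = "('r, 'a) bigraded_module" +
  diff :: "'a \<Rightarrow> 'a"

definition bigraded_iso ::
  "('r, 's) ring_scheme \<Rightarrow> ('r, 'a, 'm) bigraded_module_scheme \<Rightarrow> ('r, 'b, 'n) bigraded_module_scheme \<Rightarrow> ('a \<Rightarrow> 'b) set"
  where "bigraded_iso R M N =
    {f \<in> mod_hom R (total M) (total N).
       bij_betw f (carrier (total M)) (carrier (total N)) \<and> (\<forall>u. f ` part M u = part N u)}"

definition isomorphic_bigraded ::
  "('r, 's) ring_scheme \<Rightarrow> ('r, 'a, 'm) bigraded_module_scheme \<Rightarrow> ('r, 'b, 'n) bigraded_module_scheme \<Rightarrow> bool"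
  where "isomorphic_bigraded R M N \<longleftrightarrow> (\<exists>f. f \<in> bigraded_iso R M N)"

definition isomorphic_complexes ::
  "('r, 's) ring_scheme \<Rightarrow> ('r, 'a) bigraded_complex \<Rightarrow> ('r, 'b) bigraded_complex \<Rightarrow> bool"
  where "isomorphic_complexes R C D \<longleftrightarrow>
    (\<exists>f \<in> bigraded_iso R C D. \<forall>x\<in>carrier (total C). f (diff C x) = diff D (f x))"

definition ring_sign :: "('r, 's) ring_scheme \<Rightarrow> int \<Rightarrow> 'r"
  where "ring_sign R k = (if even k then \<one>\<^bsub>R\<^esub> else \<ominus>\<^bsub>R\<^esub> \<one>\<^bsub>R\<^esub>)"

definition bigraded_tensor ::
  "('r, 's) ring_scheme \<Rightarrow> ('r, 'a, 'm) bigraded_module_scheme \<Rightarrow> ('r, 'b, 'n) bigraded_module_scheme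
    \<Rightarrow> ('r, ('a \<times> 'b \<Rightarrow> 'r) set) bigraded_module"
  where "bigraded_tensor R M N =
    \<lparr>total = tensor_module R (total M) (total N),
     part = (\<lambda>w. mod_span R (tensor_module R (total M) (total N))
       {pure_tensor R (total M) (total N) x y | x y.
          \<exists>u v. x \<in> part M u \<and> y \<in> part N v \<and> w = (fst u + fst v, snd u + snd v)})\<rparr>"

text \<open>
  The differential of a tensor product is the unique linear map \<open>d\<close> such that
  \<open>d (x \<otimes> y) = d x \<otimes> y + (-1)\<^bsup>deg x\<^esup> x \<otimes> d y\<close>, where \<open>x\<close> is homogeneous of total
  degree \<open>deg x\<close>. Off the carrier it is \<open>undefined\<close>, so that it is unique as a HOL function.
\<close>

definition tensor_diff ::
  "('r, 's) ring_scheme \<Rightarrow> ('r, 'a) bigraded_complex \<Rightarrow> ('r, 'b) bigraded_complex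
    \<Rightarrow> ('a \<times> 'b \<Rightarrow> 'r) set \<Rightarrow> ('a \<times> 'b \<Rightarrow> 'r) set"
  where "tensor_diff R C D =
    (let T = tensor_module R (total C) (total D); t = pure_tensor R (total C) (total D) in
     THE d. d \<in> mod_hom R T T \<and> d \<in> extensional (carrier T) \<and>
       (\<forall>a b. \<forall>x\<in>part C (a, b). \<forall>y\<in>carrier (total D).
          d (t x y) = t (diff C x) y \<oplus>\<^bsub>T\<^esub> ring_sign R (a + b) \<odot>\<^bsub>T\<^esub> t x (diff D y)))"

definition complex_tensor ::
  "('r, 's) ring_scheme \<Rightarrow> ('r, 'a) bigraded_complex \<Rightarrow> ('r, 'b) bigraded_complex
    \<Rightarrow> ('r, ('a \<times> 'b \<Rightarrow> 'r) set) bigraded_complex"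
  where "complex_tensor R C D =
    \<lparr>total = total (bigraded_tensor R C D), part = part (bigraded_tensor R C D),
     diff = tensor_diff R C D\<rparr>"

definition diff_kernel :: "('r, 'a) bigraded_complex \<Rightarrow> 'a set"
  where "diff_kernel C = {x \<in> carrier (total C). diff C x = \<zero>\<^bsub>total C\<^esub>}"

definition diff_image :: "('r, 'a) bigraded_complex \<Rightarrow> 'a set"
  where "diff_image C = diff C ` carrier (total C)"

definition complex_homology :: "('r, 'a) bigraded_complex \<Rightarrow> ('r, 'a set) bigraded_module"
  where "complex_homology C =
    \<lparr>total = quot_module (total C\<lparr>carrier := diff_kernel C\<rparr>) (diff_image C),
     part = (\<lambda>u. (\<lambda>x. diff_image C +>\<^bsub>total C\<^esub> x) ` (part C u \<inter> diff_kernel C))\<rparr>"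

section \<open>Simplicial complexes\<close>

definition simplicial_complex :: "'v set \<Rightarrow> 'v set set \<Rightarrow> bool"
  where "simplicial_complex V K \<longleftrightarrow>
    finite V \<and> K \<subseteq> Pow V \<and> {} \<in> K \<and> (\<forall>v\<in>V. {v} \<in> K) \<and> (\<forall>F\<in>K. \<forall>G. G \<subseteq> F \<longrightarrow> G \<in> K)"

definition full_subcomplex :: "'v set set \<Rightarrow> 'v set \<Rightarrow> 'v set set"
  where "full_subcomplex K I = {J \<in> K. J \<subseteq> I}"

definition simplicial_join :: "'v set set \<Rightarrow> 'w set set \<Rightarrow> ('v + 'w) set set"
  where "simplicial_join K L = {Sum_Type.Plus I J | I J. I \<in> K \<and> J \<in> L}"

text \<open>
  The ordering of the vertices is a reflexive linear order \<open>r\<close>;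
  \<open>vertex_sign R r i I\<close> is \<open>\<epsilon>(i, I)\<close> as an element of \<open>R\<close>.
\<close>

definition vertex_sign :: "('r, 's) ring_scheme \<Rightarrow> 'v rel \<Rightarrow> 'v \<Rightarrow> 'v set \<Rightarrow> 'r"
  where "vertex_sign R r i I = ring_sign R (int (card {k \<in> I. k \<noteq> i \<and> (k, i) \<in> r}))"

definition faces :: "'v set set \<Rightarrow> int \<Rightarrow> 'v set set"
  where "faces K p = {F \<in> K. int (card F) = p + 1}"

text \<open>
  The augmented simplicial chains and cochains of degree \<open>p\<close> (the empty face has degree \<open>-1\<close>).
  Both are functions on the \<open>p\<close>-faces, each oriented by the vertex order, and are extended
  by zero to all sets of vertices.
\<close>

definition simplicial_chains :: "('r, 's) ring_scheme \<Rightarrow> 'v set set \<Rightarrow> int \<Rightarrow> ('r, 'v set \<Rightarrow> 'r) module"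
  where "simplicial_chains R K p = free_module R (faces K p)"

text \<open>
  The boundary of the face \<open>F\<close> is the sum of \<open>\<epsilon>(j, F) (F - {j})\<close> over \<open>j \<in> F\<close>;
  \<open>simplicial_boundary\<close> collects the coefficients of each face \<open>G = F - {j}\<close>, and
  \<open>simplicial_coboundary\<close> is the transpose.
\<close>

definition simplicial_boundary ::
  "('r, 's) ring_scheme \<Rightarrow> 'v rel \<Rightarrow> 'v set set \<Rightarrow> ('v set \<Rightarrow> 'r) \<Rightarrow> 'v set \<Rightarrow> 'r"
  where "simplicial_boundary R r K c = (\<lambda>G. if G \<in> K then
      \<Oplus>\<^bsub>R\<^esub> j\<in>{j. j \<notin> G \<and> insert j G \<in> K}. vertex_sign R r j (insert j G) \<otimes>\<^bsub>R\<^esub> c (insert j G)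
    else \<zero>\<^bsub>R\<^esub>)"

definition simplicial_coboundary ::
  "('r, 's) ring_scheme \<Rightarrow> 'v rel \<Rightarrow> 'v set set \<Rightarrow> ('v set \<Rightarrow> 'r) \<Rightarrow> 'v set \<Rightarrow> 'r"
  where "simplicial_coboundary R r K f = (\<lambda>F. if F \<in> K then
      \<Oplus>\<^bsub>R\<^esub> j\<in>F. vertex_sign R r j F \<otimes>\<^bsub>R\<^esub> f (F - {j})
    else \<zero>\<^bsub>R\<^esub>)"

definition cycles where "cycles R r K p =
  {c \<in> carrier (simplicial_chains R K p). simplicial_boundary R r K c = (\<lambda>F. \<zero>\<^bsub>R\<^esub>)}"

definition boundaries where "boundaries R r K p =
  simplicial_boundary R r K ` carrier (simplicial_chains R K (p + 1))"

definition cocycles where "cocycles R r K p =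
  {f \<in> carrier (simplicial_chains R K p). simplicial_coboundary R r K f = (\<lambda>F. \<zero>\<^bsub>R\<^esub>)}"

definition coboundaries where "coboundaries R r K p =
  simplicial_coboundary R r K ` carrier (simplicial_chains R K (p - 1))"

definition reduced_homology ::
  "('r, 's) ring_scheme \<Rightarrow> 'v rel \<Rightarrow> 'v set set \<Rightarrow> int \<Rightarrow> ('r, ('v set \<Rightarrow> 'r) set) module"
  where "reduced_homology R r K p =
    quot_module (simplicial_chains R K p\<lparr>carrier := cycles R r K p\<rparr>) (boundaries R r K p)"

definition reduced_cohomology ::
  "('r, 's) ring_scheme \<Rightarrow> 'v rel \<Rightarrow> 'v set set \<Rightarrow> int \<Rightarrow> ('r, ('v set \<Rightarrow> 'r) set) module"
  where "reduced_cohomology R r K p =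
    quot_module (simplicial_chains R K p\<lparr>carrier := cocycles R r K p\<rparr>) (coboundaries R r K p)"

definition homology_inclusion ::
  "('r, 's) ring_scheme \<Rightarrow> 'v rel \<Rightarrow> 'v set set \<Rightarrow> int \<Rightarrow> ('v set \<Rightarrow> 'r) set \<Rightarrow> ('v set \<Rightarrow> 'r) set"
  \<comment> \<open>into the homology of \<open>K'\<close> from that of any subcomplex; on chains this is extension by zero,
      which is the identity in the present encoding\<close>
  where "homology_inclusion R r K' p =
    quot_map (simplicial_chains R K' p) (boundaries R r K' p) (\<lambda>c. c)"

definition cohomology_restriction ::
  "('r, 's) ring_scheme \<Rightarrow> 'v rel \<Rightarrow> 'v set set \<Rightarrow> int \<Rightarrow> ('v set \<Rightarrow> 'r) set \<Rightarrow> ('v set \<Rightarrow> 'r) set"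
  \<comment> \<open>to the subcomplex \<open>K'\<close> from any complex containing it\<close>
  where "cohomology_restriction R r K' p =
    quot_map (simplicial_chains R K' p) (coboundaries R r K' p)
      (\<lambda>f F. if F \<in> K' then f F else \<zero>\<^bsub>R\<^esub>)"

section \<open>Double (co)homology of moment-angle complexes\<close>

text \<open>
  The (co)homology of the moment-angle complex is taken in its Hochster decomposition, as the sum
  of the reduced (co)homology in all degrees \<open>p\<close> of all full subcomplexes \<open>K\<^sub>I\<close>. The summand
  \<open>(I, p)\<close> has bidegree \<open>(-k, 2l)\<close> with \<open>l = |I|\<close> and \<open>p = l - k - 1\<close>.
\<close>

definition hochster_index :: "'v set \<Rightarrow> ('v set \<times> int) set"
  where "hochster_index V = Pow V \<times> UNIV"

definition hochster_bidegree :: "'v set \<times> int \<Rightarrow> int \<times> int"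
  where "hochster_bidegree = (\<lambda>(I, p). (- (int (card I) - p - 1), 2 * int (card I)))"

definition hochster_part ::
  "'v set \<Rightarrow> ('v set \<times> int \<Rightarrow> ('r, 'a) module) \<Rightarrow> int \<times> int \<Rightarrow> ('v set \<times> int \<Rightarrow> 'a) set"
  where "hochster_part V M u =
    {x \<in> carrier (direct_sum (hochster_index V) M).
       \<forall>j\<in>hochster_index V. hochster_bidegree j \<noteq> u \<longrightarrow> x j = \<zero>\<^bsub>M j\<^esub>}"

definition full_cohomology ::
  "('r, 's) ring_scheme \<Rightarrow> 'v rel \<Rightarrow> 'v set set \<Rightarrow> 'v set \<times> int \<Rightarrow> ('r, ('v set \<Rightarrow> 'r) set) module"
  where "full_cohomology R r K = (\<lambda>(I, p). reduced_cohomology R r (full_subcomplex K I) p)"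

definition full_homology ::
  "('r, 's) ring_scheme \<Rightarrow> 'v rel \<Rightarrow> 'v set set \<Rightarrow> 'v set \<times> int \<Rightarrow> ('r, ('v set \<Rightarrow> 'r) set) module"
  where "full_homology R r K = (\<lambda>(I, p). reduced_homology R r (full_subcomplex K I) p)"

definition ZK_cohomology ::
  "('r, 's) ring_scheme \<Rightarrow> 'v set \<Rightarrow> 'v rel \<Rightarrow> 'v set set \<Rightarrow> ('r, 'v set \<times> int \<Rightarrow> ('v set \<Rightarrow> 'r) set) bigraded_module"
  where "ZK_cohomology R V r K =
    \<lparr>total = direct_sum (hochster_index V) (full_cohomology R r K),
     part = hochster_part V (full_cohomology R r K)\<rparr>"

definition ZK_homology ::
  "('r, 's) ring_scheme \<Rightarrow> 'v set \<Rightarrow> 'v rel \<Rightarrow> 'v set set \<Rightarrow> ('r, 'v set \<times> int \<Rightarrow> ('v set \<Rightarrow> 'r) set) bigraded_module"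
  where "ZK_homology R V r K =
    \<lparr>total = direct_sum (hochster_index V) (full_homology R r K),
     part = hochster_part V (full_homology R r K)\<rparr>"

text \<open>
  The component of \<open>d' x\<close> at \<open>(I, p)\<close> collects the contributions of the components of \<open>x\<close>
  at \<open>(I \<union> {i}, p)\<close> with \<open>i \<notin> I\<close>; that of \<open>\<partial>' x\<close> collects those at \<open>(I - {j}, p)\<close>
  with \<open>j \<in> I\<close>.
\<close>

definition CH_cohomology ::
  "('r, 's) ring_scheme \<Rightarrow> 'v set \<Rightarrow> 'v rel \<Rightarrow> 'v set set \<Rightarrow> ('r, 'v set \<times> int \<Rightarrow> ('v set \<Rightarrow> 'r) set) bigraded_complex"
  where "CH_cohomology R V r K =
    \<lparr>total = total (ZK_cohomology R V r K), part = part (ZK_cohomology R V r K),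
     diff = (\<lambda>x. \<lambda>(I, p)\<in>hochster_index V.
       \<Oplus>\<^bsub>full_cohomology R r K (I, p)\<^esub> i\<in>V - I.
         (ring_sign R (p + 1) \<otimes>\<^bsub>R\<^esub> vertex_sign R r i (insert i I)) \<odot>\<^bsub>full_cohomology R r K (I, p)\<^esub>
           cohomology_restriction R r (full_subcomplex K I) p (x (insert i I, p)))\<rparr>"

definition CH_homology ::
  "('r, 's) ring_scheme \<Rightarrow> 'v set \<Rightarrow> 'v rel \<Rightarrow> 'v set set \<Rightarrow> ('r, 'v set \<times> int \<Rightarrow> ('v set \<Rightarrow> 'r) set) bigraded_complex"
  where "CH_homology R V r K =
    \<lparr>total = total (ZK_homology R V r K), part = part (ZK_homology R V r K),
     diff = (\<lambda>x. \<lambda>(I, p)\<in>hochster_index V.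
       \<Oplus>\<^bsub>full_homology R r K (I, p)\<^esub> j\<in>I.
         (ring_sign R (p + 1) \<otimes>\<^bsub>R\<^esub> vertex_sign R r j (I - {j})) \<odot>\<^bsub>full_homology R r K (I, p)\<^esub>
           homology_inclusion R r (full_subcomplex K I) p (x (I - {j}, p)))\<rparr>"

definition HH_cohomology ::
  "('r, 's) ring_scheme \<Rightarrow> 'v set \<Rightarrow> 'v rel \<Rightarrow> 'v set set \<Rightarrow> ('r, ('v set \<times> int \<Rightarrow> ('v set \<Rightarrow> 'r) set) set) bigraded_module"
  where "HH_cohomology R V r K = complex_homology (CH_cohomology R V r K)"

definition HH_homology ::
  "('r, 's) ring_scheme \<Rightarrow> 'v set \<Rightarrow> 'v rel \<Rightarrow> 'v set set \<Rightarrow> ('r, ('v set \<times> int \<Rightarrow> ('v set \<Rightarrow> 'r) set) set) bigraded_module"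
  where "HH_homology R V r K = complex_homology (CH_homology R V r K)"

end

theory Submission
  imports Defs
begin

text \<open>
  Write \<open>A\<^sub>K\<close> for the free module on the pairs \<open>(I, F)\<close> with \<open>F \<in> K\<close> and \<open>F \<subseteq> I \<subseteq> V\<close>. It carries two
  anticommuting differentials: the simplicial (co)boundary, which changes \<open>F\<close>, and a second one, which
  changes \<open>I\<close>. The homology of the first is \<open>CH\<close>, with the differential of \<open>CH\<close> induced by the second.
  Up to signs on the basis, \<open>A\<^sub>K\<^sub>*\<^sub>L\<close> is the tensor product of \<open>A\<^sub>K\<close> and \<open>A\<^sub>L\<close>, and both differentials are
  derivations for the total degree \<open>|I| + |F|\<close>, so the cross product maps the tensor product of the \<open>CH\<close> of
  \<open>K\<close> and \<open>L\<close> to that of the join, compatibly with differentials and bidegrees. Over a principal ideal domain it is injective, because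
  submodules of finite free modules are projective and hence the projection from cycles to homology
  extends to all chains. It is surjective if the homology of one factor is projective, since that factor
  then splits. Over a field the same argument, applied to \<open>CH\<close> in place of \<open>A\<^sub>K\<close>, gives the statement on
  double (co)homology. Transposed integer matrices give homology from cohomology.
\<close>

section \<open>Linear maps\<close>

text \<open>\<open>CH\<close> is defined on classes and the join has an arbitrary vertex order, so
  two comparisons shape the proof. Homology is handled through any surjection from cycles whose
  kernel is the boundaries; the Hochster sum of reduced (co)homologies is then the homology of one
  finite free complex. For the order, the parity of inversions against the order placing
  \<open>V\<close> before \<open>W\<close> corrects the signs, once on supports and once on faces.
  The factor \<open>(-1)^(p+1)\<close> in the differential of \<open>CH\<close> becomes
  \<open>(-1)^card F\<close> on a face \<open>F\<close>; it is what makes the two differentials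
  anticommute. The tensor product asks for the sign of the total degree on the left, whereas
  incidence numbers of a join see only \<open>card F\<close> or only \<open>card I\<close>; a sign
  quadratic in the cardinalities removes this discrepancy for both differentials at once. A
  splitting of a left factor is also made odd, so that it anticommutes with the degree sign.\<close>

context abelian_group
begin

lemma a_inv_zero [simp]: "\<ominus> \<zero> = \<zero>"
  by (rule minus_equality) auto

lemma diff_self [simp]: "x \<in> carrier G \<Longrightarrow> x \<ominus> x = \<zero>"
  by (simp add: a_minus_def r_neg)

lemma diff_zero [simp]: "x \<in> carrier G \<Longrightarrow> x \<ominus> \<zero> = x"
  by (simp add: a_minus_def)

lemma diff_add_cancel [simp]:
  "x \<in> carrier G \<Longrightarrow> y \<in> carrier G \<Longrightarrow> (x \<ominus> y) \<oplus> y = x"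
  by (simp add: a_minus_def a_assoc l_neg)

lemma add_diff_cancel [simp]:
  "x \<in> carrier G \<Longrightarrow> y \<in> carrier G \<Longrightarrow> (x \<oplus> y) \<ominus> y = x"
  by (simp add: a_minus_def a_assoc r_neg)

lemma add_diff_cancel' [simp]:
  "x \<in> carrier G \<Longrightarrow> y \<in> carrier G \<Longrightarrow> x \<oplus> (y \<ominus> x) = y"
  using diff_add_cancel[of y x] by (simp add: a_comm)

lemma diff_eq_zero_iff:
  assumes "x \<in> carrier G" "y \<in> carrier G"
  shows "x \<ominus> y = \<zero> \<longleftrightarrow> x = y"
  by (metis assms diff_add_cancel diff_self l_zero)

end

lemma mod_homI:
  assumes "\<And>x. x \<in> carrier M \<Longrightarrow> f x \<in> carrier N"
    and "\<And>x y. x \<in> carrier M \<Longrightarrow> y \<in> carrier M \<Longrightarrow> f (x \<oplus>\<^bsub>M\<^esub> y) = f x \<oplus>\<^bsub>N\<^esub> f y"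
    and "\<And>a x. a \<in> carrier R \<Longrightarrow> x \<in> carrier M \<Longrightarrow> f (a \<odot>\<^bsub>M\<^esub> x) = a \<odot>\<^bsub>N\<^esub> f x"
  shows "f \<in> mod_hom R M N"
  using assms unfolding mod_hom_def by blast

lemma mod_hom_closed [simp]: "f \<in> mod_hom R M N \<Longrightarrow> x \<in> carrier M \<Longrightarrow> f x \<in> carrier N"
  unfolding mod_hom_def by blast

lemma mod_hom_add:
  "f \<in> mod_hom R M N \<Longrightarrow> x \<in> carrier M \<Longrightarrow> y \<in> carrier M \<Longrightarrow> f (x \<oplus>\<^bsub>M\<^esub> y) = f x \<oplus>\<^bsub>N\<^esub> f y"
  unfolding mod_hom_def by blast

lemma mod_hom_smult:
  "f \<in> mod_hom R M N \<Longrightarrow> a \<in> carrier R \<Longrightarrow> x \<in> carrier M \<Longrightarrow> f (a \<odot>\<^bsub>M\<^esub> x) = a \<odot>\<^bsub>N\<^esub> f x"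
  unfolding mod_hom_def by blast

lemma mod_hom_zero:
  assumes "module R M" "module R N" "f \<in> mod_hom R M N"
  shows "f \<zero>\<^bsub>M\<^esub> = \<zero>\<^bsub>N\<^esub>"
proof -
  interpret M: module R M by fact
  interpret N: module R N by fact
  have "f (\<zero>\<^bsub>R\<^esub> \<odot>\<^bsub>M\<^esub> \<zero>\<^bsub>M\<^esub>) = \<zero>\<^bsub>R\<^esub> \<odot>\<^bsub>N\<^esub> f \<zero>\<^bsub>M\<^esub>"
    using assms(3) by (intro mod_hom_smult) auto
  then show ?thesis using assms(3) by simp
qed

lemma mod_hom_minus:
  assumes "module R M" "module R N" "f \<in> mod_hom R M N" "x \<in> carrier M"
  shows "f (\<ominus>\<^bsub>M\<^esub> x) = \<ominus>\<^bsub>N\<^esub> f x"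
proof -
  interpret M: module R M by fact
  interpret N: module R N by fact
  have "f (\<ominus>\<^bsub>M\<^esub> x) \<oplus>\<^bsub>N\<^esub> f x = \<zero>\<^bsub>N\<^esub>"
    using mod_hom_add[OF assms(3), of "\<ominus>\<^bsub>M\<^esub> x" x] assms mod_hom_zero[OF assms(1,2,3)]
    by (simp add: M.l_neg)
  then show ?thesis using assms by (simp add: N.minus_equality)
qed

lemma mod_hom_diff:
  assumes "module R M" "module R N" "f \<in> mod_hom R M N" "x \<in> carrier M" "y \<in> carrier M"
  shows "f (x \<ominus>\<^bsub>M\<^esub> y) = f x \<ominus>\<^bsub>N\<^esub> f y"
proof -
  interpret M: module R M by fact
  show ?thesis
    using assms by (simp add: a_minus_def mod_hom_add mod_hom_minus)
qed

lemma mod_hom_comp: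
  assumes "f \<in> mod_hom R M N" "g \<in> mod_hom R N P"
  shows "(\<lambda>x. g (f x)) \<in> mod_hom R M P"
  using assms by (auto intro!: mod_homI simp: mod_hom_add mod_hom_smult)

lemma mod_hom_id: "(\<lambda>x. x) \<in> mod_hom R M M"
  by (auto intro!: mod_homI)

lemma mod_hom_cong:
  assumes "module R M" "f \<in> mod_hom R M N" "\<And>x. x \<in> carrier M \<Longrightarrow> f x = g x"
  shows "g \<in> mod_hom R M N"
proof -
  interpret M: module R M by fact
  show ?thesis
    by (rule mod_homI) (use assms in \<open>auto simp: mod_hom_add mod_hom_smult simp flip: assms(3)\<close>)
qed

lemma mod_hom_plus:
  assumes "module R N" "f \<in> mod_hom R M N" "g \<in> mod_hom R M N"
  shows "(\<lambda>x. f x \<oplus>\<^bsub>N\<^esub> g x) \<in> mod_hom R M N"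
proof -
  interpret N: module R N by fact
  show ?thesis using assms
    by (auto intro!: mod_homI simp: mod_hom_add mod_hom_smult N.a_ac N.smult_r_distr)
qed

lemma mod_hom_uminus:
  assumes "module R N" "f \<in> mod_hom R M N"
  shows "(\<lambda>x. \<ominus>\<^bsub>N\<^esub> f x) \<in> mod_hom R M N"
proof -
  interpret N: module R N by fact
  show ?thesis using assms
    by (auto intro!: mod_homI simp: mod_hom_add mod_hom_smult N.minus_add N.smult_r_minus)
qed

lemma mod_hom_sub:
  assumes "module R N" "f \<in> mod_hom R M N" "g \<in> mod_hom R M N"
  shows "(\<lambda>x. f x \<ominus>\<^bsub>N\<^esub> g x) \<in> mod_hom R M N"
  unfolding a_minus_def by (intro mod_hom_plus mod_hom_uminus assms)

lemma mod_hom_const_zero: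
  assumes "module R N" shows "(\<lambda>x. \<zero>\<^bsub>N\<^esub>) \<in> mod_hom R M N"
proof -
  interpret N: module R N by fact
  show ?thesis by (auto intro!: mod_homI)
qed

lemma mod_hom_finsum:
  assumes "module R M" "module R N" "f \<in> mod_hom R M N" "finite A" "g \<in> A \<rightarrow> carrier M"
  shows "f (\<Oplus>\<^bsub>M\<^esub>i\<in>A. g i) = (\<Oplus>\<^bsub>N\<^esub>i\<in>A. f (g i))"
proof -
  interpret M: module R M by fact
  interpret N: module R N by fact
  show ?thesis using assms(4,5)
  proof (induction A)
    case empty
    then show ?case using mod_hom_zero[OF assms(1,2,3)] by simp
  next
    case (insert x A)
    have "f (\<Oplus>\<^bsub>M\<^esub>i\<in>insert x A. g i) = f (g x \<oplus>\<^bsub>M\<^esub> (\<Oplus>\<^bsub>M\<^esub>i\<in>A. g i))"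
      using insert by (subst M.finsum_insert) auto
    also have "\<dots> = f (g x) \<oplus>\<^bsub>N\<^esub> f (\<Oplus>\<^bsub>M\<^esub>i\<in>A. g i)"
      using insert by (intro mod_hom_add[OF assms(3)] M.finsum_closed) auto
    also have "\<dots> = (\<Oplus>\<^bsub>N\<^esub>i\<in>insert x A. f (g i))"
      using insert assms(3) by (subst N.finsum_insert) (auto simp: Pi_iff)
    finally show ?case .
  qed
qed

lemma mod_hom_inj_onI:
  assumes "module R M" "module R N" "f \<in> mod_hom R M N"
    and "\<And>x. x \<in> carrier M \<Longrightarrow> f x = \<zero>\<^bsub>N\<^esub> \<Longrightarrow> x = \<zero>\<^bsub>M\<^esub>"
  shows "inj_on f (carrier M)"
proof (rule inj_onI)
  interpret M: module R M by fact
  interpret N: module R N by fact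
  fix x y assume x: "x \<in> carrier M" "y \<in> carrier M" "f x = f y"
  then have "f (x \<ominus>\<^bsub>M\<^esub> y) = \<zero>\<^bsub>N\<^esub>"
    using assms(3) by (simp add: mod_hom_diff[OF assms(1,2,3)])
  then have "x \<ominus>\<^bsub>M\<^esub> y = \<zero>\<^bsub>M\<^esub>" using assms(4) x by simp
  then show "x = y" using x by (simp add: M.diff_eq_zero_iff)
qed

lemma mod_hom_inverse:
  assumes "module R M" "f \<in> mod_hom R M N" "bij_betw f (carrier M) (carrier N)"
  shows "inv_into (carrier M) f \<in> mod_hom R N M"
proof -
  interpret M: module R M by fact
  let ?g = "inv_into (carrier M) f"
  have inj: "inj_on f (carrier M)" and im: "f ` carrier M = carrier N"
    using assms(3) by (auto simp: bij_betw_def)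
  have gf: "?g (f x) = x" if "x \<in> carrier M" for x using inj that by simp
  show ?thesis
  proof (rule mod_homI)
    fix x assume "x \<in> carrier N"
    then obtain x' where x: "x' \<in> carrier M" "x = f x'" using im by auto
    then show "?g x \<in> carrier M" by (simp add: gf)
    { fix a assume a: "a \<in> carrier R"
      have "?g (a \<odot>\<^bsub>N\<^esub> f x') = ?g (f (a \<odot>\<^bsub>M\<^esub> x'))" using x a assms by (simp add: mod_hom_smult)
      also have "\<dots> = a \<odot>\<^bsub>M\<^esub> ?g x" using x a gf by simp
      finally show "?g (a \<odot>\<^bsub>N\<^esub> x) = a \<odot>\<^bsub>M\<^esub> ?g x" using x by simp }
    fix y assume "y \<in> carrier N"
    then obtain y' where y: "y' \<in> carrier M" "y = f y'" using im by auto
    have "?g (f x' \<oplus>\<^bsub>N\<^esub> f y') = ?g (f (x' \<oplus>\<^bsub>M\<^esub> y'))" using x y assms by (simp add: mod_hom_add)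
    also have "\<dots> = ?g x \<oplus>\<^bsub>M\<^esub> ?g y" using x y gf by simp
    finally show "?g (x \<oplus>\<^bsub>N\<^esub> y) = ?g x \<oplus>\<^bsub>M\<^esub> ?g y" using x y by simp
  qed
qed

text \<open>This is the universal property of a quotient, with \<open>Q\<close> known only as the
  target of a surjection. Any choice of preimages works, because \<open>f\<close> takes the same
  value on elements with the same image; linearity follows by computing with preimages. It yields
  the maps out of tensor products and the maps induced on homology.\<close>

lemma surjection_factor:
  assumes "module R M" "module R N" "p \<in> mod_hom R M Q" "p ` carrier M = carrier Q"
    and "f \<in> mod_hom R M N"
    and ker: "\<And>x y. x \<in> carrier M \<Longrightarrow> y \<in> carrier M \<Longrightarrow> p x = p y \<Longrightarrow> f x = f y"
  obtains g where "g \<in> mod_hom R Q N" "\<And>x. x \<in> carrier M \<Longrightarrow> g (p x) = f x"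
proof
  interpret M: module R M by fact
  let ?g = "\<lambda>z. f (inv_into (carrier M) p z)"
  show gp: "?g (p x) = f x" if "x \<in> carrier M" for x
    using that ker[of "inv_into (carrier M) p (p x)" x]
    by (metis f_inv_into_f image_eqI inv_into_into)
  show "?g \<in> mod_hom R Q N"
  proof (rule mod_homI)
    fix x assume "x \<in> carrier Q"
    then obtain x' where x: "x' \<in> carrier M" "x = p x'" using assms(4) by auto
    then show "?g x \<in> carrier N" using gp assms(5) by simp
    { fix a assume a: "a \<in> carrier R"
      have "?g (a \<odot>\<^bsub>Q\<^esub> x) = ?g (p (a \<odot>\<^bsub>M\<^esub> x'))" using x a assms(3) by (simp add: mod_hom_smult)
      also have "\<dots> = a \<odot>\<^bsub>N\<^esub> ?g x" using x a gp assms(5) by (simp add: mod_hom_smult)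
      finally show "?g (a \<odot>\<^bsub>Q\<^esub> x) = a \<odot>\<^bsub>N\<^esub> ?g x" . }
    fix y assume "y \<in> carrier Q"
    then obtain y' where y: "y' \<in> carrier M" "y = p y'" using assms(4) by auto
    have "?g (x \<oplus>\<^bsub>Q\<^esub> y) = ?g (p (x' \<oplus>\<^bsub>M\<^esub> y'))" using x y assms(3) by (simp add: mod_hom_add)
    also have "\<dots> = ?g x \<oplus>\<^bsub>N\<^esub> ?g y" using x y gp assms(5) by (simp add: mod_hom_add)
    finally show "?g (x \<oplus>\<^bsub>Q\<^esub> y) = ?g x \<oplus>\<^bsub>N\<^esub> ?g y" .
  qed
qed

text \<open>Every module axiom is an identity or the existence of a negative, and a surjection
  compatible with the operations carries both over. \<open>Q\<close> is merely a record beforehand,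
  so the zero has to be matched separately.\<close>

lemma module_image:
  assumes "module R M" "f ` carrier M = carrier Q"
    and "\<And>x y. x \<in> carrier M \<Longrightarrow> y \<in> carrier M \<Longrightarrow> f (x \<oplus>\<^bsub>M\<^esub> y) = f x \<oplus>\<^bsub>Q\<^esub> f y"
    and "\<And>a x. a \<in> carrier R \<Longrightarrow> x \<in> carrier M \<Longrightarrow> f (a \<odot>\<^bsub>M\<^esub> x) = a \<odot>\<^bsub>Q\<^esub> f x"
    and "f \<zero>\<^bsub>M\<^esub> = \<zero>\<^bsub>Q\<^esub>"
  shows "module R Q"
proof -
  interpret M: module R M by fact
  have im: "\<exists>x'\<in>carrier M. x = f x'" if "x \<in> carrier Q" for x using assms(2) that by auto
  have cl: "f x \<in> carrier Q" if "x \<in> carrier M" for x using assms(2) that by auto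
  show ?thesis
  proof (rule moduleI)
    show "cring R" ..
    show "abelian_group Q"
    proof (rule abelian_groupI)
      show "\<exists>y\<in>carrier Q. y \<oplus>\<^bsub>Q\<^esub> x = \<zero>\<^bsub>Q\<^esub>" if x: "x \<in> carrier Q" for x
      proof -
        obtain x' where x': "x' \<in> carrier M" "x = f x'" using im x by blast
        have "f (\<ominus>\<^bsub>M\<^esub> x') \<oplus>\<^bsub>Q\<^esub> x = \<zero>\<^bsub>Q\<^esub>"
          using x' assms(3)[of "\<ominus>\<^bsub>M\<^esub> x'" x'] assms(5) by (simp add: M.l_neg)
        then show ?thesis using x' cl by (metis M.a_inv_closed)
      qed
    next
      fix x y z assume "x \<in> carrier Q" "y \<in> carrier Q" "z \<in> carrier Q"
      then obtain x' y' z' where *: "x' \<in> carrier M" "x = f x'" "y' \<in> carrier M" "y = f y'"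
        "z' \<in> carrier M" "z = f z'" using im by meson
      then show "x \<oplus>\<^bsub>Q\<^esub> y \<oplus>\<^bsub>Q\<^esub> z = x \<oplus>\<^bsub>Q\<^esub> (y \<oplus>\<^bsub>Q\<^esub> z)"
        by (simp flip: assms(3) add: M.a_assoc)
    next
      fix x y assume "x \<in> carrier Q" "y \<in> carrier Q"
      then obtain x' y' where *: "x' \<in> carrier M" "x = f x'" "y' \<in> carrier M" "y = f y'"
        using im by meson
      then show "x \<oplus>\<^bsub>Q\<^esub> y \<in> carrier Q" "x \<oplus>\<^bsub>Q\<^esub> y = y \<oplus>\<^bsub>Q\<^esub> x"
        by (simp_all flip: assms(3) add: M.a_comm cl)
    next
      show "\<zero>\<^bsub>Q\<^esub> \<in> carrier Q" using assms(5) cl by (metis M.zero_closed)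
      fix x assume "x \<in> carrier Q"
      then obtain x' where *: "x' \<in> carrier M" "x = f x'" using im by meson
      then show "\<zero>\<^bsub>Q\<^esub> \<oplus>\<^bsub>Q\<^esub> x = x" using assms(3)[of "\<zero>\<^bsub>M\<^esub>" x'] assms(5) by simp
    qed
  next
    fix a x assume a: "a \<in> carrier R" and "x \<in> carrier Q"
    then obtain x' where x: "x' \<in> carrier M" "x = f x'" using im by meson
    show "a \<odot>\<^bsub>Q\<^esub> x \<in> carrier Q" using a x by (simp flip: assms(4) add: cl)
    fix b assume b: "b \<in> carrier R"
    show "(a \<oplus>\<^bsub>R\<^esub> b) \<odot>\<^bsub>Q\<^esub> x = a \<odot>\<^bsub>Q\<^esub> x \<oplus>\<^bsub>Q\<^esub> b \<odot>\<^bsub>Q\<^esub> x"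
      using a b x by (simp flip: assms(3,4) add: M.smult_l_distr)
    show "(a \<otimes>\<^bsub>R\<^esub> b) \<odot>\<^bsub>Q\<^esub> x = a \<odot>\<^bsub>Q\<^esub> (b \<odot>\<^bsub>Q\<^esub> x)"
      using a b x by (simp flip: assms(3,4) add: M.smult_assoc1)
  next
    fix a x y assume a: "a \<in> carrier R" and "x \<in> carrier Q" "y \<in> carrier Q"
    then obtain x' y' where *: "x' \<in> carrier M" "x = f x'" "y' \<in> carrier M" "y = f y'"
        using im by meson
    then show "a \<odot>\<^bsub>Q\<^esub> (x \<oplus>\<^bsub>Q\<^esub> y) = a \<odot>\<^bsub>Q\<^esub> x \<oplus>\<^bsub>Q\<^esub> a \<odot>\<^bsub>Q\<^esub> y"
      using a by (simp flip: assms(3,4) add: M.smult_r_distr)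
  next
    fix x assume "x \<in> carrier Q"
    then obtain x' where x: "x' \<in> carrier M" "x = f x'" using im by meson
    show "\<one>\<^bsub>R\<^esub> \<odot>\<^bsub>Q\<^esub> x = x" using x assms(4)[of "\<one>\<^bsub>R\<^esub>" x'] by simp
  qed
qed

section \<open>Submodules and quotients\<close>

lemma submodule_kernel:
  assumes "module R M" "module R N" "f \<in> mod_hom R M N"
  shows "submodule {x \<in> carrier M. f x = \<zero>\<^bsub>N\<^esub>} R M"
proof -
  interpret M: module R M by fact
  interpret N: module R N by fact
  show ?thesis
    by (rule M.submoduleI)
      (use assms in \<open>auto simp: mod_hom_zero mod_hom_minus mod_hom_add mod_hom_smult\<close>)
qed

lemma submodule_image:
  assumes "module R M" "module R N" "f \<in> mod_hom R M N"
  shows "submodule (f ` carrier M) R N"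
proof -
  interpret M: module R M by fact
  interpret N: module R N by fact
  show ?thesis
  proof (rule N.submoduleI)
    show "\<zero>\<^bsub>N\<^esub> \<in> f ` carrier M" using mod_hom_zero[OF assms] by (metis M.zero_closed imageI)
    show "\<ominus>\<^bsub>N\<^esub> a \<in> f ` carrier M" if "a \<in> f ` carrier M" for a
      using that mod_hom_minus[OF assms, symmetric] by auto
    show "a \<oplus>\<^bsub>N\<^esub> b \<in> f ` carrier M" if "a \<in> f ` carrier M" "b \<in> f ` carrier M" for a b
      using that mod_hom_add[OF assms(3)] by (metis (no_types, lifting) M.a_closed image_iff)
    show "a \<odot>\<^bsub>N\<^esub> b \<in> f ` carrier M" if "a \<in> carrier R" "b \<in> f ` carrier M" for a b
      using that mod_hom_smult[OF assms(3)] by (metis (no_types, lifting) M.smult_closed image_iff)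
  qed (use assms in auto)
qed

lemma submodule_sub:
  assumes "submodule H R M" shows "H \<subseteq> carrier M"
  using submodule.axioms(1)[OF assms] subgroup.subset by fastforce

lemma submodule_zero: "submodule H R M \<Longrightarrow> \<zero>\<^bsub>M\<^esub> \<in> H"
  using submodule.axioms(1) subgroup.one_closed by fastforce

lemma submodule_add: "submodule H R M \<Longrightarrow> x \<in> H \<Longrightarrow> y \<in> H \<Longrightarrow> x \<oplus>\<^bsub>M\<^esub> y \<in> H"
  using submodule.axioms(1) subgroup.m_closed by fastforce

lemma submodule_minus: "submodule H R M \<Longrightarrow> x \<in> H \<Longrightarrow> \<ominus>\<^bsub>M\<^esub> x \<in> H"
  unfolding a_inv_def using submodule.axioms(1) subgroup.m_inv_closed by fastforce

lemma submodule_diff: "submodule H R M \<Longrightarrow> x \<in> H \<Longrightarrow> y \<in> H \<Longrightarrow> x \<ominus>\<^bsub>M\<^esub> y \<in> H"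
  by (simp add: a_minus_def submodule_add submodule_minus)

lemma submodule_smult: "submodule H R M \<Longrightarrow> a \<in> carrier R \<Longrightarrow> x \<in> H \<Longrightarrow> a \<odot>\<^bsub>M\<^esub> x \<in> H"
  by (rule submodule.smult_closed)

lemma submodule_finsum:
  assumes "module R M" "submodule H R M" "finite A" "g \<in> A \<rightarrow> H"
  shows "(\<Oplus>\<^bsub>M\<^esub>i\<in>A. g i) \<in> H"
proof -
  interpret M: module R M by fact
  have sub: "H \<subseteq> carrier M" by (rule submodule_sub) fact
  show ?thesis using assms(3,4)
  proof (induction A)
    case empty
    then show ?case using submodule_zero[OF assms(2)] by simp
  next
    case (insert x A)
    then have "(\<Oplus>\<^bsub>M\<^esub>i\<in>insert x A. g i) = g x \<oplus>\<^bsub>M\<^esub> (\<Oplus>\<^bsub>M\<^esub>i\<in>A. g i)"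
      using sub by (intro M.finsum_insert) auto
    then show ?case using insert assms(2) by (auto intro: submodule_add)
  qed
qed

lemma submodule_module:
  assumes "module R M" "submodule H R M" shows "module R (M\<lparr>carrier := H\<rparr>)"
  using assms by (intro submodule.submodule_is_module)

lemma submodule_restrict:
  assumes "module R M" "submodule H R M" "submodule B R M" "B \<subseteq> H"
  shows "submodule B R (M\<lparr>carrier := H\<rparr>)"
proof -
  interpret H: module R "M\<lparr>carrier := H\<rparr>" by (rule submodule_module) fact+
  have B: "module R (M\<lparr>carrier := B\<rparr>)" by (rule submodule_module) fact+
  show ?thesis
    by (rule H.module_incl_imp_submodule) (use assms B in auto)
qed

lemma submodule_a_inv:
  assumes "module R M" "submodule H R M" "x \<in> H"
  shows "\<ominus>\<^bsub>M\<lparr>carrier := H\<rparr>\<^esub> x = \<ominus>\<^bsub>M\<^esub> x"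
proof -
  interpret M: module R M by fact
  interpret H: module R "M\<lparr>carrier := H\<rparr>" by (rule submodule_module) fact+
  have x: "x \<in> carrier M" using submodule_sub assms by blast
  show ?thesis
  proof (rule H.minus_equality)
    show "\<ominus>\<^bsub>M\<^esub> x \<oplus>\<^bsub>M\<lparr>carrier := H\<rparr>\<^esub> x = \<zero>\<^bsub>M\<lparr>carrier := H\<rparr>\<^esub>"
      using x by (simp add: M.l_neg)
  qed (use assms submodule_minus in auto)
qed

lemma mod_hom_submodule:
  assumes "submodule H R M" "f \<in> mod_hom R M N"
  shows "f \<in> mod_hom R (M\<lparr>carrier := H\<rparr>) N"
proof -
  note submodule_sub[OF assms(1)]
  then show ?thesis using assms(2)
    by (intro mod_homI) (auto simp: mod_hom_add mod_hom_smult subset_iff)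
qed

lemma mod_hom_into_submodule:
  assumes "f \<in> mod_hom R M N" "\<And>x. x \<in> carrier M \<Longrightarrow> f x \<in> H"
  shows "f \<in> mod_hom R M (N\<lparr>carrier := H\<rparr>)"
  using assms by (intro mod_homI) (auto simp: mod_hom_add mod_hom_smult)

lemma mod_span_mono: "S \<subseteq> T \<Longrightarrow> mod_span R M S \<subseteq> mod_span R M T"
  by (auto simp: mod_span_def)

lemma mod_span_base: "x \<in> S \<Longrightarrow> x \<in> mod_span R M S"
  by (auto simp: mod_span_def)

lemma mod_span_minimal: "submodule H R M \<Longrightarrow> S \<subseteq> H \<Longrightarrow> mod_span R M S \<subseteq> H"
  by (auto simp: mod_span_def)

lemma submodule_span:
  assumes "module R M" "S \<subseteq> carrier M"
  shows "submodule (mod_span R M S) R M"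
proof -
  interpret M: module R M by fact
  show ?thesis
  proof (rule M.submoduleI)
    show "mod_span R M S \<subseteq> carrier M"
      by (rule mod_span_minimal) (use assms M.carrier_is_submodule in auto)
  qed (auto simp: mod_span_def intro: submodule_zero submodule_minus submodule_add submodule_smult)
qed

text \<open>The elements where the two maps agree form the kernel of their difference, a submodule.
  Uniqueness arguments on free modules and tensor products go through this.\<close>

lemma mod_hom_span_eq:
  assumes "module R M" "module R N" "f \<in> mod_hom R M N" "g \<in> mod_hom R M N"
    and "carrier M \<subseteq> mod_span R M S" "S \<subseteq> carrier M" "\<And>x. x \<in> S \<Longrightarrow> f x = g x" "x \<in> carrier M"
  shows "f x = g x"
proof -
  interpret M: module R M by fact
  interpret N: module R N by fact
  have "submodule {x \<in> carrier M. f x \<ominus>\<^bsub>N\<^esub> g x = \<zero>\<^bsub>N\<^esub>} R M"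
    by (intro submodule_kernel mod_hom_sub assms)
  moreover have "S \<subseteq> {x \<in> carrier M. f x \<ominus>\<^bsub>N\<^esub> g x = \<zero>\<^bsub>N\<^esub>}"
    using assms by (auto simp: N.diff_eq_zero_iff subset_iff)
  ultimately have "mod_span R M S \<subseteq> {x \<in> carrier M. f x \<ominus>\<^bsub>N\<^esub> g x = \<zero>\<^bsub>N\<^esub>}" by (rule mod_span_minimal)
  then have "f x \<ominus>\<^bsub>N\<^esub> g x = \<zero>\<^bsub>N\<^esub>" using assms(5,8) by auto
  then show ?thesis using assms(3,4,8) by (simp add: N.diff_eq_zero_iff)
qed

text \<open>The preimage of \<open>H\<close> is a submodule, so it contains the span of
  \<open>S\<close> as soon as it contains \<open>S\<close>.\<close>

lemma mod_hom_span_into: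
  assumes "module R M" "module R N" "f \<in> mod_hom R M N" "submodule H R N"
    and "\<And>x. x \<in> S \<Longrightarrow> f x \<in> H" "S \<subseteq> carrier M" "x \<in> mod_span R M S"
  shows "f x \<in> H"
proof -
  interpret M: module R M by fact
  interpret N: module R N by fact
  have "submodule {x \<in> carrier M. f x \<in> H} R M"
    by (rule M.submoduleI)
      (use assms submodule_zero submodule_minus submodule_add submodule_smult in
        \<open>auto simp: mod_hom_zero mod_hom_minus mod_hom_add mod_hom_smult\<close>)
  then have "mod_span R M S \<subseteq> {x \<in> carrier M. f x \<in> H}"
    by (rule mod_span_minimal) (use assms in auto)
  then show ?thesis using assms(7) by blast
qed

section \<open>Cosets and quotient modules\<close>

lemma submodule_abelian_subgroup:
  assumes "module R M" "submodule B R M"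
  shows "abelian_subgroup B M"
proof -
  interpret M: module R M by fact
  show ?thesis
    by (rule abelian_subgroupI3)
      (use assms in \<open>auto simp: additive_subgroup_def submodule_def M.abelian_group_axioms\<close>)
qed

lemma coset_eq_iff:
  assumes "module R M" "submodule B R M" "x \<in> carrier M" "y \<in> carrier M"
  shows "B +>\<^bsub>M\<^esub> x = B +>\<^bsub>M\<^esub> y \<longleftrightarrow> x \<ominus>\<^bsub>M\<^esub> y \<in> B"
proof -
  interpret M: module R M by fact
  interpret B: abelian_subgroup B M by (rule submodule_abelian_subgroup) fact+
  show ?thesis
    using assms B.a_rcos_module[of y x] M.a_repr_independence[of x B y] B.a_rcos_self[of x] submodule.axioms(1)[OF assms(2)]
    by (auto simp: a_minus_def)
qed

lemma coset_zero_iff: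
  assumes "module R M" "submodule B R M" "x \<in> carrier M"
  shows "B +>\<^bsub>M\<^esub> x = B \<longleftrightarrow> x \<in> B"
proof -
  interpret M: module R M by fact
  have "B +>\<^bsub>M\<^esub> \<zero>\<^bsub>M\<^esub> = B"
    using M.a_coset_add_zero submodule_sub[OF assms(2)] by blast
  then show ?thesis using coset_eq_iff[OF assms, of "\<zero>\<^bsub>M\<^esub>"] assms(3)
    by simp
qed

lemma mem_coset_iff:
  assumes "module R M" "submodule B R M" "x \<in> carrier M"
  shows "y \<in> B +>\<^bsub>M\<^esub> x \<longleftrightarrow> (\<exists>b\<in>B. y = b \<oplus>\<^bsub>M\<^esub> x)"
  by (auto simp: a_r_coset_def r_coset_def)

text \<open>The definition of \<open>quot_map\<close> takes a union over all representatives. Two of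
  them differ by an element of \<open>B\<close>, whose image lies in \<open>B'\<close>, so all
  cosets in this union coincide.\<close>

lemma quot_map_coset:
  assumes "module R M" "submodule B R M" "module R M'" "submodule B' R M'"
    and "h \<in> mod_hom R (M\<lparr>carrier := Z\<rparr>) M'" "submodule Z R M" "B \<subseteq> Z" "\<And>b. b \<in> B \<Longrightarrow> h b \<in> B'" "x \<in> Z"
  shows "quot_map M' B' h (B +>\<^bsub>M\<^esub> x) = B' +>\<^bsub>M'\<^esub> h x"
proof -
  interpret M: module R M by fact
  interpret M': module R M' by fact
  have ZM: "Z \<subseteq> carrier M" by (rule submodule_sub) fact
  have *: "B' +>\<^bsub>M'\<^esub> h y = B' +>\<^bsub>M'\<^esub> h x" if "y \<in> B +>\<^bsub>M\<^esub> x" for y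
  proof -
    have "\<exists>b\<in>B. y = b \<oplus>\<^bsub>M\<^esub> x"
      using that mem_coset_iff[OF assms(1,2) subsetD[OF ZM assms(9)]] by simp
    then obtain b where b: "b \<in> B" "y = b \<oplus>\<^bsub>M\<^esub> x" ..
    have c: "h b \<in> B'" "h b \<in> carrier M'" "h x \<in> carrier M'"
      using b assms submodule_sub[OF assms(4)] mod_hom_closed[OF assms(5)] by auto
    have hy: "h y = h b \<oplus>\<^bsub>M'\<^esub> h x"
      using b assms mod_hom_add[OF assms(5), of b x] by auto
    have "h y \<ominus>\<^bsub>M'\<^esub> h x = h b" using c by (simp add: hy a_minus_def M'.a_assoc M'.r_neg)
    then show ?thesis using c by (subst coset_eq_iff[OF assms(3,4)]) (simp_all add: hy)
  qed
  have "x \<in> B +>\<^bsub>M\<^esub> x"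
    unfolding mem_coset_iff[OF assms(1,2) subsetD[OF ZM assms(9)]]
    using submodule_zero[OF assms(2)] assms(9) ZM by (auto intro!: bexI[of _ "\<zero>\<^bsub>M\<^esub>"])
  then show ?thesis unfolding quot_map_def using * by blast
qed

context
  fixes R :: "('r, 's) ring_scheme" and M :: "('r, 'a, 'm) module_scheme" and B
  assumes M: "module R M" and B: "submodule B R M"
begin

lemma quot_module_add:
  assumes "x \<in> carrier M" "y \<in> carrier M"
  shows "(B +>\<^bsub>M\<^esub> x) \<oplus>\<^bsub>quot_module M B\<^esub> (B +>\<^bsub>M\<^esub> y) = B +>\<^bsub>M\<^esub> (x \<oplus>\<^bsub>M\<^esub> y)"
proof -
  interpret B: abelian_subgroup B M by (rule submodule_abelian_subgroup[OF M B])
  show ?thesis using assms by (simp add: quot_module_def B.a_rcos_sum)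
qed

lemma quot_module_smult:
  assumes "a \<in> carrier R" "x \<in> carrier M"
  shows "a \<odot>\<^bsub>quot_module M B\<^esub> (B +>\<^bsub>M\<^esub> x) = B +>\<^bsub>M\<^esub> (a \<odot>\<^bsub>M\<^esub> x)"
proof -
  interpret M: module R M by (rule M)
  have "(\<lambda>x. a \<odot>\<^bsub>M\<^esub> x) \<in> mod_hom R M M"
    using assms by (auto intro!: mod_homI simp: M.smult_r_distr simp flip: M.smult_assoc1 simp: M.R.m_comm)
  then show ?thesis
    unfolding quot_module_def
    using assms B quot_map_coset[OF M B M B, of "\<lambda>x. a \<odot>\<^bsub>M\<^esub> x" "carrier M" x] submodule_sub[OF B]
    by (simp add: M.carrier_is_submodule submodule_smult)
qed

lemma quot_module_carrier: "carrier (quot_module M B) = (\<lambda>x. B +>\<^bsub>M\<^esub> x) ` carrier M"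
  by (auto simp: quot_module_def A_RCOSETS_def RCOSETS_def a_r_coset_def)

lemma quot_module_module: "module R (quot_module M B)"
proof (rule module_image[OF M, where f = "\<lambda>x. B +>\<^bsub>M\<^esub> x"])
  interpret M: module R M by (rule M)
  show "B +>\<^bsub>M\<^esub> \<zero>\<^bsub>M\<^esub> = \<zero>\<^bsub>quot_module M B\<^esub>"
    using coset_zero_iff[OF M B M.zero_closed] submodule_zero[OF B] by (simp add: quot_module_def)
qed (auto simp: quot_module_carrier quot_module_add quot_module_smult)

lemma quot_module_proj: "(\<lambda>x. B +>\<^bsub>M\<^esub> x) \<in> mod_hom R M (quot_module M B)"
  by (rule mod_homI) (auto simp: quot_module_carrier quot_module_add quot_module_smult)

lemma quot_module_zero: "\<zero>\<^bsub>quot_module M B\<^esub> = B"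
  by (simp add: quot_module_def)

end

section \<open>Free modules and direct sums\<close>

lemma free_module_simps [simp]:
  "f \<in> carrier (free_module R S) \<longleftrightarrow>
     (\<forall>x. f x \<in> carrier R) \<and> (\<forall>x. x \<notin> S \<longrightarrow> f x = \<zero>\<^bsub>R\<^esub>) \<and> finite {x. f x \<noteq> \<zero>\<^bsub>R\<^esub>}"
  "\<zero>\<^bsub>free_module R S\<^esub> = (\<lambda>x. \<zero>\<^bsub>R\<^esub>)"
  "f \<oplus>\<^bsub>free_module R S\<^esub> g = (\<lambda>x. f x \<oplus>\<^bsub>R\<^esub> g x)"
  "a \<odot>\<^bsub>free_module R S\<^esub> f = (\<lambda>x. a \<otimes>\<^bsub>R\<^esub> f x)"
  by (auto simp: free_module_def)

lemma free_module_module: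
  assumes "cring R" shows "module R (free_module R S)"
proof -
  interpret cring R by fact
  have add: "finite {x. f x \<oplus>\<^bsub>R\<^esub> g x \<noteq> \<zero>\<^bsub>R\<^esub>}"
    if "finite {x. f x \<noteq> \<zero>\<^bsub>R\<^esub>}" "finite {x. g x \<noteq> \<zero>\<^bsub>R\<^esub>}" for f g :: "'c \<Rightarrow> 'a"
    by (rule finite_subset[OF _ finite_UnI[OF that]]) auto
  have smult: "finite {x. a \<otimes>\<^bsub>R\<^esub> f x \<noteq> \<zero>\<^bsub>R\<^esub>}"
    if "finite {x. f x \<noteq> \<zero>\<^bsub>R\<^esub>}" "a \<in> carrier R" for f :: "'c \<Rightarrow> 'a" and a
    by (rule finite_subset[OF _ that(1)]) (use that in auto)
  show ?thesis
  proof (rule moduleI)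
    show "abelian_group (free_module R S)"
    proof (rule abelian_groupI)
      fix f assume f: "f \<in> carrier (free_module R S)"
      show "\<exists>g\<in>carrier (free_module R S). g \<oplus>\<^bsub>free_module R S\<^esub> f = \<zero>\<^bsub>free_module R S\<^esub>"
      proof (rule bexI[of _ "\<lambda>x. \<ominus>\<^bsub>R\<^esub> f x"])
        have "finite {x. \<ominus>\<^bsub>R\<^esub> f x \<noteq> \<zero>\<^bsub>R\<^esub>}"
          by (rule finite_subset[of _ "{x. f x \<noteq> \<zero>\<^bsub>R\<^esub>}"]) (use f in auto)
        then show "(\<lambda>x. \<ominus>\<^bsub>R\<^esub> f x) \<in> carrier (free_module R S)" using f by auto
      qed (use f in \<open>auto simp: l_neg\<close>)
    qed (auto simp: add a_ac intro!: ext)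
  qed (use assms in \<open>auto simp: smult l_distr r_distr m_assoc\<close>)
qed

lemma finite_free_module_carrier:
  assumes "finite S"
  shows "f \<in> carrier (free_module R S) \<longleftrightarrow> (\<forall>x. f x \<in> carrier R) \<and> (\<forall>x. x \<notin> S \<longrightarrow> f x = \<zero>\<^bsub>R\<^esub>)"
  using finite_subset[of "{x. f x \<noteq> \<zero>\<^bsub>R\<^esub>}" S] assms by auto

lemma free_module_minus:
  assumes "cring R" "f \<in> carrier (free_module R S)"
  shows "\<ominus>\<^bsub>free_module R S\<^esub> f = (\<lambda>x. \<ominus>\<^bsub>R\<^esub> f x)"
proof -
  interpret cring R by fact
  interpret F: module R "free_module R S" by (rule free_module_module) fact
  have fin: "finite {x. \<ominus>\<^bsub>R\<^esub> f x \<noteq> \<zero>\<^bsub>R\<^esub>}"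
    by (rule finite_subset[of _ "{x. f x \<noteq> \<zero>\<^bsub>R\<^esub>}"]) (use assms in auto)
  show ?thesis
    by (rule F.minus_equality) (use assms fin in \<open>auto simp: l_neg\<close>)
qed

lemma basis_elem_carrier:
  assumes "cring R" "x \<in> S" shows "basis_elem R x \<in> carrier (free_module R S)"
proof -
  interpret cring R by fact
  have "finite {y. basis_elem R x y \<noteq> \<zero>\<^bsub>R\<^esub>}"
    by (rule finite_subset[of _ "{x}"]) (auto simp: basis_elem_def)
  then show ?thesis using assms by (auto simp: basis_elem_def)
qed

text \<open>The support is finite, so one point of it can be split off at a time: the remaining
  function vanishes there and its support lies in a smaller finite set.\<close>

lemma free_module_induct [consumes 2, case_names zero add]:
  assumes "cring R" "f \<in> carrier (free_module R S)"
    and zero: "P (\<lambda>x. \<zero>\<^bsub>R\<^esub>)"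
    and add: "\<And>f a x. f \<in> carrier (free_module R S) \<Longrightarrow> a \<in> carrier R \<Longrightarrow> x \<in> S \<Longrightarrow> P f \<Longrightarrow>
      P (a \<odot>\<^bsub>free_module R S\<^esub> basis_elem R x \<oplus>\<^bsub>free_module R S\<^esub> f)"
  shows "P f"
proof -
  interpret cring R by fact
  have "finite U \<Longrightarrow> f \<in> carrier (free_module R S) \<Longrightarrow> {x. f x \<noteq> \<zero>\<^bsub>R\<^esub>} \<subseteq> U \<Longrightarrow> P f" for U f
  proof (induction U arbitrary: f rule: finite_induct)
    case empty
    then have "f = (\<lambda>x. \<zero>\<^bsub>R\<^esub>)" by auto
    then show ?case using zero by simp
  next
    case (insert y U)
    show ?case
    proof (cases "f y = \<zero>\<^bsub>R\<^esub>")
      case True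
      then show ?thesis using insert by (intro insert.IH) auto
    next
      case False
      then have y: "y \<in> S" "f y \<in> carrier R" using insert.prems by auto
      let ?g = "f(y := \<zero>\<^bsub>R\<^esub>)"
      have "finite {x. ?g x \<noteq> \<zero>\<^bsub>R\<^esub>}"
        by (rule finite_subset[of _ "{x. f x \<noteq> \<zero>\<^bsub>R\<^esub>}"]) (use insert in auto)
      then have g: "?g \<in> carrier (free_module R S)" using insert.prems by auto
      then have "P ?g" using insert.prems by (intro insert.IH) auto
      then have "P (f y \<odot>\<^bsub>free_module R S\<^esub> basis_elem R y \<oplus>\<^bsub>free_module R S\<^esub> ?g)" using add g y by blast
      also have "f y \<odot>\<^bsub>free_module R S\<^esub> basis_elem R y \<oplus>\<^bsub>free_module R S\<^esub> ?g = f"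
        using insert.prems by (auto simp: basis_elem_def)
      finally show ?thesis .
    qed
  qed
  then show ?thesis using assms(2) by auto
qed

lemma free_module_span:
  assumes "cring R"
  shows "carrier (free_module R S) \<subseteq> mod_span R (free_module R S) (basis_elem R ` S)"
proof
  interpret F: module R "free_module R S" by (rule free_module_module) fact
  have sub: "submodule (mod_span R (free_module R S) (basis_elem R ` S)) R (free_module R S)"
    by (rule submodule_span[OF F.module_axioms]) (auto intro!: basis_elem_carrier assms simp del: free_module_simps)
  fix f assume "f \<in> carrier (free_module R S)"
  with assms show "f \<in> mod_span R (free_module R S) (basis_elem R ` S)"
  proof (induction rule: free_module_induct)
    case zero
    then show ?case using submodule_zero[OF sub] by simp
  next
    case (add f a x)
    then show ?case
      by (intro submodule_add[OF sub] submodule_smult[OF sub] mod_span_base[OF imageI]) assumption+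
  qed
qed

lemma free_module_lift:
  assumes "module R N" "\<And>x. x \<in> S \<Longrightarrow> g x \<in> carrier N"
  obtains f where "f \<in> mod_hom R (free_module R S) N" "\<And>x. x \<in> S \<Longrightarrow> f (basis_elem R x) = g x"
proof
  interpret N: module R N by fact
  let ?f = "\<lambda>f. \<Oplus>\<^bsub>N\<^esub>x\<in>{x. f x \<noteq> \<zero>\<^bsub>R\<^esub>}. f x \<odot>\<^bsub>N\<^esub> g x"
  \<comment> \<open>The support of a sum can be smaller than the union of the supports, and that of
    a multiple smaller than the original one. Enlarging the index set inside \<open>S\<close> lets
    the sums be compared termwise.\<close>
  have ext: "?f f = (\<Oplus>\<^bsub>N\<^esub>x\<in>U. f x \<odot>\<^bsub>N\<^esub> g x)"
    if "finite U" "{x. f x \<noteq> \<zero>\<^bsub>R\<^esub>} \<subseteq> U" "U \<subseteq> S" "\<And>x. f x \<in> carrier R" for U f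
    using that assms(2) by (intro N.add.finprod_mono_neutral_cong_left) auto
  show "?f (basis_elem R x) = g x" if x: "x \<in> S" for x
  proof -
    have "?f (basis_elem R x) = (\<Oplus>\<^bsub>N\<^esub>y\<in>{x}. basis_elem R x y \<odot>\<^bsub>N\<^esub> g y)"
      using x by (intro ext) (auto simp: basis_elem_def split: if_splits)
    then show ?thesis using assms(2) x by (simp add: basis_elem_def)
  qed
  show "?f \<in> mod_hom R (free_module R S) N"
  proof (rule mod_homI)
    fix f assume f: "f \<in> carrier (free_module R S)"
    then have sup: "{x. f x \<noteq> \<zero>\<^bsub>R\<^esub>} \<subseteq> S" by auto
    show "?f f \<in> carrier N" using f assms(2) by (intro N.finsum_closed) auto
    { fix a assume a: "a \<in> carrier R"
      have gS: "g x \<in> carrier N" if "f x \<noteq> \<zero>\<^bsub>R\<^esub>" for x using f assms(2) that by auto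
      have "?f (a \<odot>\<^bsub>free_module R S\<^esub> f) = (\<Oplus>\<^bsub>N\<^esub>x\<in>{x. f x \<noteq> \<zero>\<^bsub>R\<^esub>}. (a \<odot>\<^bsub>free_module R S\<^esub> f) x \<odot>\<^bsub>N\<^esub> g x)"
        using a f sup by (intro ext) auto
      also have "\<dots> = (\<Oplus>\<^bsub>N\<^esub>x\<in>{x. f x \<noteq> \<zero>\<^bsub>R\<^esub>}. a \<odot>\<^bsub>N\<^esub> (f x \<odot>\<^bsub>N\<^esub> g x))"
        using a f gS by (intro N.finsum_cong') (auto simp: N.smult_assoc1)
      also have "\<dots> = a \<odot>\<^bsub>N\<^esub> ?f f"
        using a f gS by (intro N.finsum_smult_ldistr[symmetric]) auto
      finally show "?f (a \<odot>\<^bsub>free_module R S\<^esub> f) = a \<odot>\<^bsub>N\<^esub> ?f f" . }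
    fix h assume h: "h \<in> carrier (free_module R S)"
    let ?U = "{x. f x \<noteq> \<zero>\<^bsub>R\<^esub>} \<union> {x. h x \<noteq> \<zero>\<^bsub>R\<^esub>}"
    have U: "finite ?U" "?U \<subseteq> S" using f h by auto
    have gS: "g x \<in> carrier N" if "x \<in> ?U" for x using U assms(2) that by blast
    have "?f (f \<oplus>\<^bsub>free_module R S\<^esub> h) = (\<Oplus>\<^bsub>N\<^esub>x\<in>?U. (f \<oplus>\<^bsub>free_module R S\<^esub> h) x \<odot>\<^bsub>N\<^esub> g x)"
      using f h U by (intro ext) auto
    also have "\<dots> = (\<Oplus>\<^bsub>N\<^esub>x\<in>?U. f x \<odot>\<^bsub>N\<^esub> g x \<oplus>\<^bsub>N\<^esub> h x \<odot>\<^bsub>N\<^esub> g x)"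
      using f h gS by (intro N.finsum_cong') (auto simp: N.smult_l_distr)
    also have "\<dots> = (\<Oplus>\<^bsub>N\<^esub>x\<in>?U. f x \<odot>\<^bsub>N\<^esub> g x) \<oplus>\<^bsub>N\<^esub> (\<Oplus>\<^bsub>N\<^esub>x\<in>?U. h x \<odot>\<^bsub>N\<^esub> g x)"
      using f h gS U(1) by (intro N.finsum_addf) auto
    also have "\<dots> = ?f f \<oplus>\<^bsub>N\<^esub> ?f h"
      using ext[OF U(1) _ U(2), of f] ext[OF U(1) _ U(2), of h] f h by simp
    finally show "?f (f \<oplus>\<^bsub>free_module R S\<^esub> h) = ?f f \<oplus>\<^bsub>N\<^esub> ?f h" .
  qed
qed


section \<open>Direct sums\<close>

lemma direct_sum_simps [simp]:
  "x \<in> carrier (direct_sum A M) \<longleftrightarrow>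
     x \<in> extensional A \<and> (\<forall>i\<in>A. x i \<in> carrier (M i)) \<and> finite {i \<in> A. x i \<noteq> \<zero>\<^bsub>M i\<^esub>}"
  "\<zero>\<^bsub>direct_sum A M\<^esub> = (\<lambda>i\<in>A. \<zero>\<^bsub>M i\<^esub>)"
  "x \<oplus>\<^bsub>direct_sum A M\<^esub> y = (\<lambda>i\<in>A. x i \<oplus>\<^bsub>M i\<^esub> y i)"
  "a \<odot>\<^bsub>direct_sum A M\<^esub> x = (\<lambda>i\<in>A. a \<odot>\<^bsub>M i\<^esub> x i)"
  by (auto simp: direct_sum_def PiE_iff)

lemma direct_sum_module:
  assumes "cring R" "\<And>i. i \<in> A \<Longrightarrow> module R (M i)"
  shows "module R (direct_sum A M)"
proof (rule moduleI)
  note ag = module.axioms(2)[OF assms(2)]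
  note am = abelian_group.axioms(1)[OF ag]
  note mon = abelian_monoid.l_zero[OF am] abelian_monoid.zero_closed[OF am] abelian_monoid.a_closed[OF am]
    abelian_group.a_inv_closed[OF ag] abelian_group.a_inv_zero[OF ag]
  note mod = module.smult_closed[OF assms(2)] module.smult_r_null[OF assms(2)] module.smult_one[OF assms(2)]
  have add: "finite {i \<in> A. x i \<oplus>\<^bsub>M i\<^esub> y i \<noteq> \<zero>\<^bsub>M i\<^esub>}"
    if "finite {i \<in> A. x i \<noteq> \<zero>\<^bsub>M i\<^esub>}" "finite {i \<in> A. y i \<noteq> \<zero>\<^bsub>M i\<^esub>}" for x y
    by (rule finite_subset[OF _ finite_UnI[OF that]]) (auto simp: mon)
  have smult: "finite {i \<in> A. a \<odot>\<^bsub>M i\<^esub> x i \<noteq> \<zero>\<^bsub>M i\<^esub>}"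
    if "finite {i \<in> A. x i \<noteq> \<zero>\<^bsub>M i\<^esub>}" "a \<in> carrier R" for x a
    by (rule finite_subset[OF _ that(1)]) (use that in \<open>auto simp: mod\<close>)
  show "cring R" by fact
  show "abelian_group (direct_sum A M)"
  proof (rule abelian_groupI)
    fix x assume x: "x \<in> carrier (direct_sum A M)"
    show "\<exists>y\<in>carrier (direct_sum A M). y \<oplus>\<^bsub>direct_sum A M\<^esub> x = \<zero>\<^bsub>direct_sum A M\<^esub>"
    proof (rule bexI[of _ "\<lambda>i\<in>A. \<ominus>\<^bsub>M i\<^esub> x i"])
      have "finite {i \<in> A. \<ominus>\<^bsub>M i\<^esub> x i \<noteq> \<zero>\<^bsub>M i\<^esub>}"
        by (rule finite_subset[of _ "{i \<in> A. x i \<noteq> \<zero>\<^bsub>M i\<^esub>}"]) (use x in \<open>auto simp: mon\<close>)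
      then show "(\<lambda>i\<in>A. \<ominus>\<^bsub>M i\<^esub> x i) \<in> carrier (direct_sum A M)"
        using x by (simp add: mon cong: conj_cong)
      show "(\<lambda>i\<in>A. \<ominus>\<^bsub>M i\<^esub> x i) \<oplus>\<^bsub>direct_sum A M\<^esub> x = \<zero>\<^bsub>direct_sum A M\<^esub>"
        using x by (auto simp: abelian_group.l_neg[OF ag] intro!: restrict_ext)
    qed
  next
    fix x y z assume x: "x \<in> carrier (direct_sum A M)" and y: "y \<in> carrier (direct_sum A M)"
      and z: "z \<in> carrier (direct_sum A M)"
    show "x \<oplus>\<^bsub>direct_sum A M\<^esub> y \<oplus>\<^bsub>direct_sum A M\<^esub> z = x \<oplus>\<^bsub>direct_sum A M\<^esub> (y \<oplus>\<^bsub>direct_sum A M\<^esub> z)"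
      using x y z by (auto simp: abelian_monoid.a_assoc[OF am] intro!: restrict_ext)
  next
    fix x y assume x: "x \<in> carrier (direct_sum A M)" and y: "y \<in> carrier (direct_sum A M)"
    show "x \<oplus>\<^bsub>direct_sum A M\<^esub> y \<in> carrier (direct_sum A M)"
      using x y by (simp add: mon add cong: conj_cong)
    show "x \<oplus>\<^bsub>direct_sum A M\<^esub> y = y \<oplus>\<^bsub>direct_sum A M\<^esub> x"
      using x y by (auto simp: abelian_monoid.a_comm[OF am] intro!: restrict_ext)
  next
    show "\<zero>\<^bsub>direct_sum A M\<^esub> \<in> carrier (direct_sum A M)" by (simp add: mon cong: conj_cong)
  next
    fix x assume x: "x \<in> carrier (direct_sum A M)"
    then show "\<zero>\<^bsub>direct_sum A M\<^esub> \<oplus>\<^bsub>direct_sum A M\<^esub> x = x"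
      by (auto simp: mon extensional_def)
  qed
next
  fix a x assume a: "a \<in> carrier R" and x: "x \<in> carrier (direct_sum A M)"
  note mod = module.smult_closed[OF assms(2)] module.smult_r_null[OF assms(2)]
  have "finite {i \<in> A. a \<odot>\<^bsub>M i\<^esub> x i \<noteq> \<zero>\<^bsub>M i\<^esub>}"
    by (rule finite_subset[of _ "{i \<in> A. x i \<noteq> \<zero>\<^bsub>M i\<^esub>}"]) (use a x in \<open>auto simp: mod\<close>)
  then show "a \<odot>\<^bsub>direct_sum A M\<^esub> x \<in> carrier (direct_sum A M)"
    using a x by (simp add: mod cong: conj_cong)
  fix b assume b: "b \<in> carrier R"
  show "(a \<oplus>\<^bsub>R\<^esub> b) \<odot>\<^bsub>direct_sum A M\<^esub> x = a \<odot>\<^bsub>direct_sum A M\<^esub> x \<oplus>\<^bsub>direct_sum A M\<^esub> b \<odot>\<^bsub>direct_sum A M\<^esub> x"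
    using a b x by (auto simp: module.smult_l_distr[OF assms(2)] intro!: restrict_ext)
  show "(a \<otimes>\<^bsub>R\<^esub> b) \<odot>\<^bsub>direct_sum A M\<^esub> x = a \<odot>\<^bsub>direct_sum A M\<^esub> (b \<odot>\<^bsub>direct_sum A M\<^esub> x)"
    using a b x by (auto simp: module.smult_assoc1[OF assms(2)] intro!: restrict_ext)
next
  fix a x y assume a: "a \<in> carrier R" and x: "x \<in> carrier (direct_sum A M)"
    and y: "y \<in> carrier (direct_sum A M)"
  show "a \<odot>\<^bsub>direct_sum A M\<^esub> (x \<oplus>\<^bsub>direct_sum A M\<^esub> y) =
      a \<odot>\<^bsub>direct_sum A M\<^esub> x \<oplus>\<^bsub>direct_sum A M\<^esub> a \<odot>\<^bsub>direct_sum A M\<^esub> y"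
    using a x y by (auto simp: module.smult_r_distr[OF assms(2)] intro!: restrict_ext)
next
  fix x assume x: "x \<in> carrier (direct_sum A M)"
  then show "\<one>\<^bsub>R\<^esub> \<odot>\<^bsub>direct_sum A M\<^esub> x = x"
    by (auto simp: module.smult_one[OF assms(2)] extensional_def)
qed

lemmas free_module_carrier = free_module_simps(1)
declare free_module_simps(1,3,4) [simp del]
lemmas direct_sum_carrier = direct_sum_simps(1)
declare direct_sum_simps(1) [simp del]

lemma free_module_apply [simp]:
  "(f \<oplus>\<^bsub>free_module R S\<^esub> g) x = f x \<oplus>\<^bsub>R\<^esub> g x"
  "(a \<odot>\<^bsub>free_module R S\<^esub> f) x = a \<otimes>\<^bsub>R\<^esub> f x"
  by (simp_all add: free_module_simps)

section \<open>Tensor products\<close>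

definition bilinear_map where
  "bilinear_map R M N P b \<longleftrightarrow>
     (\<forall>x\<in>carrier M. b x \<in> mod_hom R N P) \<and> (\<forall>y\<in>carrier N. (\<lambda>x. b x y) \<in> mod_hom R M P)"

lemma bilinear_mapI:
  assumes "\<And>x y. x \<in> carrier M \<Longrightarrow> y \<in> carrier N \<Longrightarrow> b x y \<in> carrier P"
    and "\<And>x x' y. x \<in> carrier M \<Longrightarrow> x' \<in> carrier M \<Longrightarrow> y \<in> carrier N \<Longrightarrow>
      b (x \<oplus>\<^bsub>M\<^esub> x') y = b x y \<oplus>\<^bsub>P\<^esub> b x' y"
    and "\<And>x y y'. x \<in> carrier M \<Longrightarrow> y \<in> carrier N \<Longrightarrow> y' \<in> carrier N \<Longrightarrow>
      b x (y \<oplus>\<^bsub>N\<^esub> y') = b x y \<oplus>\<^bsub>P\<^esub> b x y'"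
    and "\<And>a x y. a \<in> carrier R \<Longrightarrow> x \<in> carrier M \<Longrightarrow> y \<in> carrier N \<Longrightarrow> b (a \<odot>\<^bsub>M\<^esub> x) y = a \<odot>\<^bsub>P\<^esub> b x y"
    and "\<And>a x y. a \<in> carrier R \<Longrightarrow> x \<in> carrier M \<Longrightarrow> y \<in> carrier N \<Longrightarrow> b x (a \<odot>\<^bsub>N\<^esub> y) = a \<odot>\<^bsub>P\<^esub> b x y"
  shows "bilinear_map R M N P b"
  unfolding bilinear_map_def by (intro conjI ballI mod_homI) (use assms in auto)

lemma bilinear_left: "bilinear_map R M N P b \<Longrightarrow> y \<in> carrier N \<Longrightarrow> (\<lambda>x. b x y) \<in> mod_hom R M P"
  unfolding bilinear_map_def by blast

lemma bilinear_right: "bilinear_map R M N P b \<Longrightarrow> x \<in> carrier M \<Longrightarrow> b x \<in> mod_hom R N P"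
  unfolding bilinear_map_def by blast

lemma bilinear_closed:
  "bilinear_map R M N P b \<Longrightarrow> x \<in> carrier M \<Longrightarrow> y \<in> carrier N \<Longrightarrow> b x y \<in> carrier P"
  using bilinear_right mod_hom_closed by metis

lemma bilinear_comp:
  assumes "bilinear_map R M N P b" "f \<in> mod_hom R M' M" "g \<in> mod_hom R N' N" "h \<in> mod_hom R P P'"
  shows "bilinear_map R M' N' P' (\<lambda>x y. h (b (f x) (g y)))"
  unfolding bilinear_map_def
proof (intro conjI ballI)
  fix x assume "x \<in> carrier M'"
  then show "(\<lambda>y. h (b (f x) (g y))) \<in> mod_hom R N' P'"
    using mod_hom_comp[OF mod_hom_comp[OF assms(3) bilinear_right[OF assms(1), of "f x"]] assms(4)] assms(2)
    by simp
next
  fix y assume "y \<in> carrier N'"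
  then show "(\<lambda>x. h (b (f x) (g y))) \<in> mod_hom R M' P'"
    using mod_hom_comp[OF mod_hom_comp[OF assms(2) bilinear_left[OF assms(1), of "g y"]] assms(4)] assms(3)
    by simp
qed

lemma bilinear_plus:
  assumes "module R P" "bilinear_map R M N P b" "bilinear_map R M N P c"
  shows "bilinear_map R M N P (\<lambda>x y. b x y \<oplus>\<^bsub>P\<^esub> c x y)"
  using assms unfolding bilinear_map_def by (simp add: mod_hom_plus)

lemma bilinear_zero_left:
  assumes "module R M" "module R P" "bilinear_map R M N P b" "y \<in> carrier N"
  shows "b \<zero>\<^bsub>M\<^esub> y = \<zero>\<^bsub>P\<^esub>"
  using mod_hom_zero[OF assms(1,2) bilinear_left[OF assms(3,4)]] .

lemma bilinear_zero_right:
  assumes "module R N" "module R P" "bilinear_map R M N P b" "x \<in> carrier M"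
  shows "b x \<zero>\<^bsub>N\<^esub> = \<zero>\<^bsub>P\<^esub>"
  using mod_hom_zero[OF assms(1,2) bilinear_right[OF assms(3,4)]] .

context
  fixes R :: "('r, 's) ring_scheme" and M :: "('r, 'a, 'm) module_scheme" and N :: "('r, 'b, 'n) module_scheme"
  assumes M: "module R M" and N: "module R N"
begin

interpretation M: module R M by (rule M)
interpretation N: module R N by (rule N)

lemma tensor_free_module: "module R (tensor_free R M N)"
  unfolding tensor_free_def by (rule free_module_module) (rule M.R.is_cring)

interpretation F: module R "tensor_free R M N" by (rule tensor_free_module)

lemma tensor_basis_closed:
  "x \<in> carrier M \<Longrightarrow> y \<in> carrier N \<Longrightarrow> basis_elem R (x, y) \<in> carrier (tensor_free R M N)"
  unfolding tensor_free_def by (rule basis_elem_carrier) (auto simp: M.R.is_cring)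

lemma tensor_relators_closed: "tensor_relators R M N \<subseteq> carrier (tensor_free R M N)"
  unfolding tensor_relators_def Let_def
  by (auto intro!: F.minus_closed F.a_closed F.smult_closed tensor_basis_closed)

lemma tensor_kernel_submodule: "submodule (tensor_kernel R M N) R (tensor_free R M N)"
  unfolding tensor_kernel_def by (rule submodule_span[OF tensor_free_module tensor_relators_closed])

lemma tensor_module_module: "module R (tensor_module R M N)"
  unfolding tensor_module_def by (rule quot_module_module[OF tensor_free_module tensor_kernel_submodule])

lemma tensor_proj:
  "(\<lambda>f. tensor_kernel R M N +>\<^bsub>tensor_free R M N\<^esub> f) \<in> mod_hom R (tensor_free R M N) (tensor_module R M N)"
  unfolding tensor_module_def by (rule quot_module_proj[OF tensor_free_module tensor_kernel_submodule])

lemma tensor_proj_surj: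
  "(\<lambda>f. tensor_kernel R M N +>\<^bsub>tensor_free R M N\<^esub> f) ` carrier (tensor_free R M N) =
    carrier (tensor_module R M N)"
  unfolding tensor_module_def by (rule quot_module_carrier[OF tensor_free_module tensor_kernel_submodule, symmetric])

lemma tensor_proj_eq:
  assumes "f \<ominus>\<^bsub>tensor_free R M N\<^esub> g \<in> tensor_relators R M N"
    "f \<in> carrier (tensor_free R M N)" "g \<in> carrier (tensor_free R M N)"
  shows "tensor_kernel R M N +>\<^bsub>tensor_free R M N\<^esub> f = tensor_kernel R M N +>\<^bsub>tensor_free R M N\<^esub> g"
  using assms coset_eq_iff[OF tensor_free_module tensor_kernel_submodule]
  by (simp add: tensor_kernel_def mod_span_base)

lemma pure_tensor_bilinear: "bilinear_map R M N (tensor_module R M N) (pure_tensor R M N)"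
proof (rule bilinear_mapI)
  fix x y assume x: "x \<in> carrier M" and y: "y \<in> carrier N"
  show "pure_tensor R M N x y \<in> carrier (tensor_module R M N)"
    unfolding pure_tensor_def using x y tensor_basis_closed by (intro mod_hom_closed[OF tensor_proj])
  { fix x' assume x': "x' \<in> carrier M"
    show "pure_tensor R M N (x \<oplus>\<^bsub>M\<^esub> x') y =
        pure_tensor R M N x y \<oplus>\<^bsub>tensor_module R M N\<^esub> pure_tensor R M N x' y"
      unfolding pure_tensor_def
        mod_hom_add[OF tensor_proj tensor_basis_closed[OF x y] tensor_basis_closed[OF x' y], symmetric]
      using x x' y
      by (intro tensor_proj_eq) (auto simp: tensor_relators_def Let_def intro!: tensor_basis_closed) }
  { fix y' assume y': "y' \<in> carrier N"
    show "pure_tensor R M N x (y \<oplus>\<^bsub>N\<^esub> y') =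
        pure_tensor R M N x y \<oplus>\<^bsub>tensor_module R M N\<^esub> pure_tensor R M N x y'"
      unfolding pure_tensor_def
        mod_hom_add[OF tensor_proj tensor_basis_closed[OF x y] tensor_basis_closed[OF x y'], symmetric]
      using x y y'
      by (intro tensor_proj_eq) (auto simp: tensor_relators_def Let_def intro!: tensor_basis_closed) }
  { fix a assume a: "a \<in> carrier R"
    show "pure_tensor R M N (a \<odot>\<^bsub>M\<^esub> x) y = a \<odot>\<^bsub>tensor_module R M N\<^esub> pure_tensor R M N x y"
      unfolding pure_tensor_def mod_hom_smult[OF tensor_proj a tensor_basis_closed[OF x y], symmetric]
      using x y a
      by (intro tensor_proj_eq F.smult_closed) (auto simp: tensor_relators_def Let_def intro!: tensor_basis_closed)
    show "pure_tensor R M N x (a \<odot>\<^bsub>N\<^esub> y) = a \<odot>\<^bsub>tensor_module R M N\<^esub> pure_tensor R M N x y"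
      unfolding pure_tensor_def mod_hom_smult[OF tensor_proj a tensor_basis_closed[OF x y], symmetric]
      using x y a
      by (intro tensor_proj_eq F.smult_closed) (auto simp: tensor_relators_def Let_def intro!: tensor_basis_closed) }
qed

lemma tensor_span:
  "carrier (tensor_module R M N) \<subseteq>
    mod_span R (tensor_module R M N) {pure_tensor R M N x y | x y. x \<in> carrier M \<and> y \<in> carrier N}"
    (is "_ \<subseteq> mod_span R ?T ?S")
proof
  fix z assume "z \<in> carrier ?T"
  then obtain f where f: "f \<in> carrier (tensor_free R M N)"
    "z = tensor_kernel R M N +>\<^bsub>tensor_free R M N\<^esub> f" unfolding tensor_proj_surj[symmetric] by blast
  have S: "?S \<subseteq> carrier ?T" using bilinear_closed[OF pure_tensor_bilinear] by auto
  have "f \<in> mod_span R (tensor_free R M N) (basis_elem R ` (carrier M \<times> carrier N))"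
    using free_module_span[OF M.R.is_cring] f(1) unfolding tensor_free_def by blast
  then have "tensor_kernel R M N +>\<^bsub>tensor_free R M N\<^esub> f \<in> mod_span R ?T ?S"
  proof (rule mod_hom_span_into[OF tensor_free_module tensor_module_module tensor_proj, rotated -1])
    show "submodule (mod_span R ?T ?S) R ?T" by (rule submodule_span[OF tensor_module_module S])
    show "tensor_kernel R M N +>\<^bsub>tensor_free R M N\<^esub> b \<in> mod_span R ?T ?S"
      if "b \<in> basis_elem R ` (carrier M \<times> carrier N)" for b
      using that by (intro mod_span_base) (auto simp: pure_tensor_def)
    show "basis_elem R ` (carrier M \<times> carrier N) \<subseteq> carrier (tensor_free R M N)"
      by (auto intro: tensor_basis_closed)
  qed
  then show "z \<in> mod_span R ?T ?S" using f by simp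
qed

text \<open>Extending \<open>b\<close> linearly to the free module on pairs sends each of the four
  kinds of relators to zero, because \<open>b\<close> is bilinear. Its kernel is a submodule, so it
  contains the span of the relators, and the map descends to the cosets.\<close>

lemma tensor_lift:
  fixes P :: "('r, 'c, 'p) module_scheme"
  assumes P: "module R P" and b: "bilinear_map R M N P b"
  obtains f where "f \<in> mod_hom R (tensor_module R M N) P"
    "\<And>x y. x \<in> carrier M \<Longrightarrow> y \<in> carrier N \<Longrightarrow> f (pure_tensor R M N x y) = b x y"
proof -
  interpret P: module R P by (rule P)
  have bc: "\<And>z. z \<in> carrier M \<times> carrier N \<Longrightarrow> b (fst z) (snd z) \<in> carrier P"
    using bilinear_closed[OF b] by auto
  obtain g where g: "g \<in> mod_hom R (tensor_free R M N) P"
    "\<And>z. z \<in> carrier M \<times> carrier N \<Longrightarrow> g (basis_elem R z) = b (fst z) (snd z)"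
    using free_module_lift[OF P, of "carrier M \<times> carrier N" "\<lambda>z. b (fst z) (snd z)"] bc
    unfolding tensor_free_def by blast
  let ?K = "{f \<in> carrier (tensor_free R M N). g f = \<zero>\<^bsub>P\<^esub>}"
  have gb: "g (basis_elem R (x, y)) = b x y" if "x \<in> carrier M" "y \<in> carrier N" for x y
    using g(2)[of "(x, y)"] that by simp
  note [simp] = bilinear_closed[OF b] tensor_basis_closed
  have "tensor_relators R M N \<subseteq> ?K"
  proof
    fix f assume f: "f \<in> tensor_relators R M N"
    have "g f = \<zero>\<^bsub>P\<^esub>"
      using f unfolding tensor_relators_def Let_def
      by (auto simp: mod_hom_diff[OF tensor_free_module P g(1)] mod_hom_add[OF g(1)] mod_hom_smult[OF g(1)] gb
          mod_hom_add[OF bilinear_left[OF b]] mod_hom_add[OF bilinear_right[OF b]]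
          mod_hom_smult[OF bilinear_left[OF b]] mod_hom_smult[OF bilinear_right[OF b]])
    then show "f \<in> ?K" using f tensor_relators_closed by auto
  qed
  then have K: "tensor_kernel R M N \<subseteq> ?K"
    unfolding tensor_kernel_def
    by (rule mod_span_minimal[OF submodule_kernel[OF tensor_free_module P g(1)]])
  obtain f where f: "f \<in> mod_hom R (tensor_module R M N) P"
    "\<And>x. x \<in> carrier (tensor_free R M N) \<Longrightarrow> f (tensor_kernel R M N +>\<^bsub>tensor_free R M N\<^esub> x) = g x"
  proof (rule surjection_factor[OF tensor_free_module P tensor_proj tensor_proj_surj g(1)])
    fix x y assume xy: "x \<in> carrier (tensor_free R M N)" "y \<in> carrier (tensor_free R M N)"
      and "tensor_kernel R M N +>\<^bsub>tensor_free R M N\<^esub> x = tensor_kernel R M N +>\<^bsub>tensor_free R M N\<^esub> y"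
    then have "x \<ominus>\<^bsub>tensor_free R M N\<^esub> y \<in> ?K"
      using K coset_eq_iff[OF tensor_free_module tensor_kernel_submodule xy] by blast
    then have "g x \<ominus>\<^bsub>P\<^esub> g y = \<zero>\<^bsub>P\<^esub>" using mod_hom_diff[OF tensor_free_module P g(1) xy] by simp
    then show "g x = g y" using xy g(1) by (simp add: P.diff_eq_zero_iff)
  qed blast
  have "f (pure_tensor R M N x y) = b x y" if "x \<in> carrier M" "y \<in> carrier N" for x y
    unfolding pure_tensor_def using that by (simp add: f(2) gb)
  with f(1) show thesis by (rule that)
qed

lemma tensor_pure_closed:
  "x \<in> carrier M \<Longrightarrow> y \<in> carrier N \<Longrightarrow> pure_tensor R M N x y \<in> carrier (tensor_module R M N)"
  by (rule bilinear_closed[OF pure_tensor_bilinear])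

lemma tensor_hom_eq:
  assumes "module R P" "f \<in> mod_hom R (tensor_module R M N) P" "g \<in> mod_hom R (tensor_module R M N) P"
    and "\<And>x y. x \<in> carrier M \<Longrightarrow> y \<in> carrier N \<Longrightarrow> f (pure_tensor R M N x y) = g (pure_tensor R M N x y)"
    and "t \<in> carrier (tensor_module R M N)"
  shows "f t = g t"
  by (rule mod_hom_span_eq[OF tensor_module_module assms(1,2,3) tensor_span])
    (use assms tensor_pure_closed in auto)

end

section \<open>Finite free modules and their retracts\<close>

lemma free_module_expand:
  assumes "module R N" "finite S" "g \<in> mod_hom R (free_module R S) N" "f \<in> carrier (free_module R S)"
  shows "g f = (\<Oplus>\<^bsub>N\<^esub>s\<in>S. f s \<odot>\<^bsub>N\<^esub> g (basis_elem R s))"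
proof -
  interpret N: module R N by fact
  have F: "module R (free_module R S)" by (rule free_module_module) (rule N.R.is_cring)
  have gb: "g (basis_elem R s) \<in> carrier N" if "s \<in> S" for s
    by (rule mod_hom_closed[OF assms(3) basis_elem_carrier[OF N.R.is_cring that]])
  show ?thesis
  proof (rule mod_hom_span_eq[OF F assms(1,3) _ free_module_span[OF N.R.is_cring] _ _ assms(4)])
    show "(\<lambda>f. \<Oplus>\<^bsub>N\<^esub>s\<in>S. f s \<odot>\<^bsub>N\<^esub> g (basis_elem R s)) \<in> mod_hom R (free_module R S) N"
    proof (rule mod_homI)
      fix x assume x: "x \<in> carrier (free_module R S)"
      then have xs: "x s \<in> carrier R" for s by (simp add: free_module_carrier)
      show "(\<Oplus>\<^bsub>N\<^esub>s\<in>S. x s \<odot>\<^bsub>N\<^esub> g (basis_elem R s)) \<in> carrier N"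
        using xs gb by (intro N.finsum_closed) auto
      { fix a assume a: "a \<in> carrier R"
        have "(\<Oplus>\<^bsub>N\<^esub>s\<in>S. (a \<odot>\<^bsub>free_module R S\<^esub> x) s \<odot>\<^bsub>N\<^esub> g (basis_elem R s)) =
            (\<Oplus>\<^bsub>N\<^esub>s\<in>S. a \<odot>\<^bsub>N\<^esub> (x s \<odot>\<^bsub>N\<^esub> g (basis_elem R s)))"
          using xs gb a by (intro N.finsum_cong') (auto simp: N.smult_assoc1)
        then show "(\<Oplus>\<^bsub>N\<^esub>s\<in>S. (a \<odot>\<^bsub>free_module R S\<^esub> x) s \<odot>\<^bsub>N\<^esub> g (basis_elem R s)) =
            a \<odot>\<^bsub>N\<^esub> (\<Oplus>\<^bsub>N\<^esub>s\<in>S. x s \<odot>\<^bsub>N\<^esub> g (basis_elem R s))"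
          using xs gb a by (subst N.finsum_smult_ldistr) (auto simp: assms(2)) }
      fix y assume y: "y \<in> carrier (free_module R S)"
      then have ys: "y s \<in> carrier R" for s by (simp add: free_module_carrier)
      have "(\<Oplus>\<^bsub>N\<^esub>s\<in>S. (x \<oplus>\<^bsub>free_module R S\<^esub> y) s \<odot>\<^bsub>N\<^esub> g (basis_elem R s)) =
          (\<Oplus>\<^bsub>N\<^esub>s\<in>S. x s \<odot>\<^bsub>N\<^esub> g (basis_elem R s) \<oplus>\<^bsub>N\<^esub> y s \<odot>\<^bsub>N\<^esub> g (basis_elem R s))"
        using xs ys gb by (intro N.finsum_cong') (auto simp: N.smult_l_distr)
      then show "(\<Oplus>\<^bsub>N\<^esub>s\<in>S. (x \<oplus>\<^bsub>free_module R S\<^esub> y) s \<odot>\<^bsub>N\<^esub> g (basis_elem R s)) =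
          (\<Oplus>\<^bsub>N\<^esub>s\<in>S. x s \<odot>\<^bsub>N\<^esub> g (basis_elem R s)) \<oplus>\<^bsub>N\<^esub> (\<Oplus>\<^bsub>N\<^esub>s\<in>S. y s \<odot>\<^bsub>N\<^esub> g (basis_elem R s))"
        using xs ys gb by (subst N.finsum_addf[symmetric]) (auto simp: assms(2))
    qed
    show "basis_elem R ` S \<subseteq> carrier (free_module R S)"
      using basis_elem_carrier[OF N.R.is_cring] by auto
    fix e assume "e \<in> basis_elem R ` S"
    then obtain s where s: "s \<in> S" "e = basis_elem R s" by auto
    have "(\<Oplus>\<^bsub>N\<^esub>t\<in>S. e t \<odot>\<^bsub>N\<^esub> g (basis_elem R t)) =
        (\<Oplus>\<^bsub>N\<^esub>t\<in>S. if s = t then g (basis_elem R t) else \<zero>\<^bsub>N\<^esub>)"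
      using gb s by (intro N.finsum_cong') (auto simp: basis_elem_def)
    also have "\<dots> = g e" using N.finsum_singleton[OF s(1) assms(2), of "\<lambda>t. g (basis_elem R t)"] gb s by auto
    finally show "g e = (\<Oplus>\<^bsub>N\<^esub>t\<in>S. e t \<odot>\<^bsub>N\<^esub> g (basis_elem R t))" ..
  qed
qed

text \<open>A finite dual basis: \<open>i\<close> gives the coordinates, and the images of the basis
  elements under \<open>p\<close> are the vectors. Retracts are considered besides free modules
  because the second Kuenneth step, over a field, starts from a homology module without a chosen
  basis.\<close>

definition finite_retract where
  "finite_retract R M S i p \<longleftrightarrow> finite S \<and> i \<in> mod_hom R M (free_module R S) \<and>
     p \<in> mod_hom R (free_module R S) M \<and> (\<forall>x\<in>carrier M. p (i x) = x)"

lemma finite_retract_free: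
  "finite S \<Longrightarrow> finite_retract R (free_module R S) S (\<lambda>x. x) (\<lambda>x. x)"
  by (simp add: finite_retract_def mod_hom_id)

lemma finite_retract_expand:
  assumes "module R M" "finite_retract R M S i p" "x \<in> carrier M"
  shows "x = (\<Oplus>\<^bsub>M\<^esub>s\<in>S. i x s \<odot>\<^bsub>M\<^esub> p (basis_elem R s))"
  using free_module_expand[OF assms(1), of S p "i x"] assms(2,3) by (auto simp: finite_retract_def)

section \<open>Splittings for submodules of finite free modules\<close>

lemma submodule_vanishing:
  assumes "cring R" "submodule H R (free_module R S)"
  shows "submodule {f \<in> H. f x = \<zero>\<^bsub>R\<^esub>} R (free_module R S)"
proof -
  interpret cring R by fact
  interpret F: module R "free_module R S" by (rule free_module_module) fact
  note HF = submodule_sub[OF assms(2)]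
  show ?thesis
  proof (rule F.submoduleI)
    fix f assume f: "f \<in> {f \<in> H. f x = \<zero>\<^bsub>R\<^esub>}"
    then have "f \<in> carrier (free_module R S)" using HF by blast
    then show "\<ominus>\<^bsub>free_module R S\<^esub> f \<in> {f \<in> H. f x = \<zero>\<^bsub>R\<^esub>}"
      using f submodule_minus[OF assms(2), of f] free_module_minus[OF assms(1), of f S] by simp
  qed (use HF submodule_zero[OF assms(2)] submodule_add[OF assms(2)] submodule_smult[OF assms(2)] in auto)
qed

text \<open>Evaluation at a point is linear, so the values on a submodule are closed under addition
  and under multiplication by ring elements. Over a principal ideal domain this ideal has a single
  generator, from which the inductive splitting starts.\<close>

lemma evaluation_ideal:
  assumes "cring R" "submodule H R (free_module R S)"
  shows "ideal ((\<lambda>f. f x) ` H) R"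
proof -
  interpret cring R by fact
  interpret F: module R "free_module R S" by (rule free_module_module) fact
  note HF = submodule_sub[OF assms(2)]
  have c: "f x \<in> carrier R" if "f \<in> H" for f using HF that by (auto simp: free_module_carrier)
  have smult: "a \<otimes>\<^bsub>R\<^esub> f x \<in> (\<lambda>f. f x) ` H" if "f \<in> H" "a \<in> carrier R" for f a
    by (rule image_eqI[OF _ submodule_smult[OF assms(2) that(2,1)]]) simp
  show ?thesis
  proof (rule idealI)
    show "ring R" by (rule ring_axioms)
    show "subgroup ((\<lambda>f. f x) ` H) (add_monoid R)"
    proof (rule add.subgroupI)
      show "(\<lambda>f. f x) ` H \<subseteq> carrier R" using c by auto
      show "(\<lambda>f. f x) ` H \<noteq> {}" using submodule_zero[OF assms(2)] by auto
      fix a assume "a \<in> (\<lambda>f. f x) ` H"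
      then obtain f where f: "f \<in> H" "a = f x" by auto
      have "\<ominus>\<^bsub>R\<^esub> \<one>\<^bsub>R\<^esub> \<otimes>\<^bsub>R\<^esub> f x \<in> (\<lambda>f. f x) ` H" by (rule smult) (use f in auto)
      then show "\<ominus>\<^bsub>R\<^esub> a \<in> (\<lambda>f. f x) ` H" using f c by (simp add: l_minus)
      fix b assume "b \<in> (\<lambda>f. f x) ` H"
      then obtain g where g: "g \<in> H" "b = g x" by auto
      then show "a \<oplus>\<^bsub>R\<^esub> b \<in> (\<lambda>f. f x) ` H"
        using f by (intro image_eqI[OF _ submodule_add[OF assms(2), of f g]]) auto
    qed
    fix a b assume a: "a \<in> (\<lambda>f. f x) ` H" and b: "b \<in> carrier R"
    then show "b \<otimes>\<^bsub>R\<^esub> a \<in> (\<lambda>f. f x) ` H" using smult by auto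
    then show "a \<otimes>\<^bsub>R\<^esub> b \<in> (\<lambda>f. f x) ` H" using a b c m_comm by auto
  qed
qed

text \<open>The induction runs over a set \<open>U\<close> containing the supports: all values at a point are multiples of the value of
  one element, and subtracting the multiple of that element shrinks \<open>U\<close>.\<close>

lemma free_submodule_section_aux:
  assumes R: "principal_domain R" and C: "module R C" and d: "d \<in> mod_hom R C (free_module R S)"
    and "finite U" "submodule H R (free_module R S)" "H \<subseteq> d ` carrier C"
    and "\<And>f x. f \<in> H \<Longrightarrow> x \<notin> U \<Longrightarrow> f x = \<zero>\<^bsub>R\<^esub>"
  shows "\<exists>s \<in> mod_hom R (free_module R S\<lparr>carrier := H\<rparr>) C. \<forall>y\<in>H. d (s y) = y"
  using assms(4-)
proof (induction U arbitrary: H rule: finite_induct)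
  case empty
  interpret C: module R C by (rule C)
  have "H = {\<lambda>x. \<zero>\<^bsub>R\<^esub>}" using empty submodule_zero[OF empty(1)] by auto
  moreover have "d \<zero>\<^bsub>C\<^esub> = (\<lambda>x. \<zero>\<^bsub>R\<^esub>)"
    using mod_hom_zero[OF C free_module_module[OF C.R.is_cring] d] by simp
  ultimately show ?case by (intro bexI[OF _ mod_hom_const_zero[OF C]]) auto
next
  case (insert x U)
  interpret C: module R C by (rule C)
  interpret R: principal_domain R by (rule R)
  let ?F = "free_module R S"
  interpret F: module R ?F by (rule free_module_module) (rule C.R.is_cring)
  note HF = submodule_sub[OF insert.prems(1)]
  have c: "f x \<in> carrier R" if "f \<in> H" for f using HF that by (auto simp: free_module_carrier)
  obtain a where a: "a \<in> carrier R" "(\<lambda>f. f x) ` H = PIdl\<^bsub>R\<^esub> a"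
    using R.exists_gen[OF evaluation_ideal[OF C.R.is_cring insert.prems(1)]] by metis
  define H' where "H' = {f \<in> H. f x = \<zero>\<^bsub>R\<^esub>}"
  have H': "submodule H' R ?F" unfolding H'_def by (rule submodule_vanishing[OF C.R.is_cring insert.prems(1)])
  have supp: "f y = \<zero>\<^bsub>R\<^esub>" if "f \<in> H'" "y \<notin> U" for f y
    using that insert.prems(3)[of f y] by (cases "y = x") (auto simp: H'_def)
  have "\<exists>s \<in> mod_hom R (?F\<lparr>carrier := H'\<rparr>) C. \<forall>y\<in>H'. d (s y) = y"
    proof (rule insert.IH[OF H'])
    show "H' \<subseteq> d ` carrier C" using insert.prems(2) by (auto simp: H'_def)
  qed (rule supp)
  then obtain s where s: "s \<in> mod_hom R (?F\<lparr>carrier := H'\<rparr>) C" "\<And>y. y \<in> H' \<Longrightarrow> d (s y) = y" by blast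
  show ?case
  proof (cases "a = \<zero>\<^bsub>R\<^esub>")
    case True
    \<comment> \<open>With generator zero every element of \<open>H\<close> vanishes at
      \<open>x\<close>, and the section for the smaller submodule already serves.\<close>
    then have "f x = \<zero>\<^bsub>R\<^esub>" if "f \<in> H" for f using a(2) that by (auto simp: cgenideal_def)
    then have "H' = H" by (auto simp: H'_def)
    with s show ?thesis by blast
  next
    case False
    have "a \<in> (\<lambda>f. f x) ` H" unfolding a(2) by (rule C.R.cgenideal_self[OF a(1)])
    then obtain g where g: "g \<in> H" "g x = a" by auto
    then obtain e where e: "e \<in> carrier C" "d e = g" using insert.prems(2) by auto
    have "\<exists>k. k \<in> carrier R \<and> f x = k \<otimes>\<^bsub>R\<^esub> a" if "f \<in> H" for f
      using a(2) that by (auto simp: cgenideal_def image_def)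
    then obtain k where k: "\<And>f. f \<in> H \<Longrightarrow> k f \<in> carrier R" "\<And>f. f \<in> H \<Longrightarrow> f x = k f \<otimes>\<^bsub>R\<^esub> a" by metis
    \<comment> \<open>Cancelling the nonzero \<open>a\<close> in a domain makes the coefficient
      unique; this turns the choice \<open>k\<close> into a linear function.\<close>
    have kI: "k f = m" if "f \<in> H" "m \<in> carrier R" "f x = m \<otimes>\<^bsub>R\<^esub> a" for f m
      using k[OF that(1)] that(2,3) a(1) False R.m_rcancel by auto
    have kadd: "k (f \<oplus>\<^bsub>?F\<^esub> f') = k f \<oplus>\<^bsub>R\<^esub> k f'" if "f \<in> H" "f' \<in> H" for f f'
      using that submodule_add[OF insert.prems(1) that] k a(1) by (intro kI) (auto simp: C.R.l_distr)
    have ksmult: "k (m \<odot>\<^bsub>?F\<^esub> f) = m \<otimes>\<^bsub>R\<^esub> k f" if "f \<in> H" "m \<in> carrier R" for f m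
      using that submodule_smult[OF insert.prems(1) that(2,1)] k a(1) by (intro kI) (auto simp: C.R.m_assoc)
    define r where "r f = f \<ominus>\<^bsub>?F\<^esub> k f \<odot>\<^bsub>?F\<^esub> g" for f
    have gF: "g \<in> carrier ?F" using g HF by blast
    have rH: "r f \<in> H'" if f: "f \<in> H" for f
    proof -
      have "r f \<in> H" unfolding r_def
        by (intro submodule_diff[OF insert.prems(1)] submodule_smult[OF insert.prems(1)] f g k)
      moreover have "r f x = f x \<oplus>\<^bsub>R\<^esub> \<ominus>\<^bsub>R\<^esub> (k f \<otimes>\<^bsub>R\<^esub> g x)"
        unfolding r_def a_minus_def
        using free_module_minus[OF C.R.is_cring, of "k f \<odot>\<^bsub>?F\<^esub> g" S] F.smult_closed[OF k(1)[OF f] gF] by simp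
      ultimately show ?thesis using k[OF f] g a(1) by (auto simp: H'_def C.R.r_neg)
    qed
    \<comment> \<open>\<open>P\<close> is arbitrary because the same functional is multiplied with
      \<open>g\<close> in the free module and with its preimage \<open>e\<close> in
      \<open>C\<close>.\<close>
    have khom: "(\<lambda>f. k f \<odot>\<^bsub>P\<^esub> z) \<in> mod_hom R (?F\<lparr>carrier := H\<rparr>) P" if "module R P" "z \<in> carrier P" for P :: "('a, 'z, 'q) module_scheme" and z
    proof -
      interpret P: module R P by fact
      show ?thesis using that k
        by (intro mod_homI) (auto simp: kadd ksmult P.smult_l_distr P.smult_assoc1)
    qed
    have Hm: "module R (?F\<lparr>carrier := H\<rparr>)" by (rule submodule_module[OF F.module_axioms insert.prems(1)])
    have rhom: "r \<in> mod_hom R (?F\<lparr>carrier := H\<rparr>) (?F\<lparr>carrier := H'\<rparr>)"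
      unfolding r_def
      by (rule mod_hom_into_submodule,
          rule mod_hom_sub[OF F.module_axioms mod_hom_submodule[OF insert.prems(1) mod_hom_id] khom[OF F.module_axioms gF]])
        (use rH in \<open>auto simp: r_def\<close>)
    show ?thesis
    proof (intro bexI ballI)
      \<comment> \<open>The remainder \<open>r f\<close> vanishes at \<open>x\<close> and is lifted
        by the induction hypothesis; the multiple of \<open>g\<close> is lifted by the chosen
        preimage \<open>e\<close>.\<close>
      show "(\<lambda>f. s (r f) \<oplus>\<^bsub>C\<^esub> k f \<odot>\<^bsub>C\<^esub> e) \<in> mod_hom R (?F\<lparr>carrier := H\<rparr>) C"
        by (rule mod_hom_plus[OF C mod_hom_comp[OF rhom s(1)] khom[OF C e(1)]])
      fix f assume f: "f \<in> H"
      have "s (r f) \<in> carrier C" using mod_hom_closed[OF s(1)] rH[OF f] by simp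
      then have "d (s (r f) \<oplus>\<^bsub>C\<^esub> k f \<odot>\<^bsub>C\<^esub> e) = r f \<oplus>\<^bsub>?F\<^esub> k f \<odot>\<^bsub>?F\<^esub> g"
        using e k[OF f] s(2)[OF rH[OF f]] by (simp add: mod_hom_add[OF d] mod_hom_smult[OF d])
      also have "\<dots> = f"
        unfolding r_def using f HF k[OF f] gF
        by (intro F.diff_add_cancel F.smult_closed) auto
      finally show "d (s (r f) \<oplus>\<^bsub>C\<^esub> k f \<odot>\<^bsub>C\<^esub> e) = f" .
    qed
  qed
qed

text \<open>The image of \<open>d\<close> is a submodule of a finite free module, hence projective
  over a principal ideal domain, so the surjection onto it splits.\<close>

lemma free_submodule_section:
  assumes "principal_domain R" "module R C" "finite S" "d \<in> mod_hom R C (free_module R S)"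
  obtains s where "s \<in> mod_hom R (free_module R S\<lparr>carrier := d ` carrier C\<rparr>) C"
    "\<And>y. y \<in> d ` carrier C \<Longrightarrow> d (s y) = y"
proof -
  interpret C: module R C by fact
  have "submodule (d ` carrier C) R (free_module R S)"
    by (rule submodule_image[OF assms(2) free_module_module[OF C.R.is_cring] assms(4)])
  then show thesis
    using free_submodule_section_aux[OF assms(1,2,4,3), of "d ` carrier C"] that
      mod_hom_closed[OF assms(4)] by (force simp: free_module_carrier)
qed

text \<open>Over a field every subspace has a complement. The induction runs over a set containing
  the supports: an element that is nonzero at \<open>x\<close> can be scaled to take the value one
  there, and \<open>f x\<close> times it is removed from an arbitrary \<open>f\<close> before the
  retraction onto the smaller subspace is applied.\<close>

lemma field_submodule_retraction_aux:
  assumes R: "field R" and "finite U" "submodule H R (free_module R S)"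
    and "\<And>f x. f \<in> H \<Longrightarrow> x \<notin> U \<Longrightarrow> f x = \<zero>\<^bsub>R\<^esub>"
  shows "\<exists>r \<in> mod_hom R (free_module R S) (free_module R S).
    (\<forall>f\<in>carrier (free_module R S). r f \<in> H) \<and> (\<forall>f\<in>H. r f = f)"
  using assms(2-)
proof (induction U arbitrary: H rule: finite_induct)
  case empty
  interpret R: field R by (rule R)
  have F: "module R (free_module R S)" by (rule free_module_module) (rule R.is_cring)
  have "H = {\<lambda>x. \<zero>\<^bsub>R\<^esub>}" using empty submodule_zero[OF empty(1)] by auto
  then show ?case using submodule_zero[OF empty(1)]
    by (intro bexI[OF _ mod_hom_const_zero[OF F]]) auto
next
  case (insert x U)
  interpret R: field R by (rule R)
  let ?F = "free_module R S"
  interpret F: module R ?F by (rule free_module_module) (rule R.is_cring)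
  note HF = submodule_sub[OF insert.prems(1)]
  define H' where "H' = {f \<in> H. f x = \<zero>\<^bsub>R\<^esub>}"
  have H': "submodule H' R ?F" unfolding H'_def by (rule submodule_vanishing[OF R.is_cring insert.prems(1)])
  have supp: "f y = \<zero>\<^bsub>R\<^esub>" if "f \<in> H'" "y \<notin> U" for f y
    using that insert.prems(2)[of f y] by (cases "y = x") (auto simp: H'_def)
  have "\<exists>r \<in> mod_hom R ?F ?F. (\<forall>f\<in>carrier ?F. r f \<in> H') \<and> (\<forall>f\<in>H'. r f = f)"
    by (rule insert.IH[OF H']) (rule supp)
  then obtain r where r: "r \<in> mod_hom R ?F ?F" "\<And>f. f \<in> carrier ?F \<Longrightarrow> r f \<in> H'"
    "\<And>f. f \<in> H' \<Longrightarrow> r f = f" by blast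
  show ?case
  proof (cases "H' = H")
    case True
    with r show ?thesis by blast
  next
    case False
    then obtain g0 where g0: "g0 \<in> H" "g0 x \<noteq> \<zero>\<^bsub>R\<^esub>" by (auto simp: H'_def)
    then have u: "g0 x \<in> Units R" using HF by (auto simp: R.field_Units free_module_carrier)
    define g where "g = inv\<^bsub>R\<^esub> (g0 x) \<odot>\<^bsub>?F\<^esub> g0"
    have g: "g \<in> H" "g x = \<one>\<^bsub>R\<^esub>"
      unfolding g_def using u g0 by (auto intro!: submodule_smult[OF insert.prems(1)])
    have gF: "g \<in> carrier ?F" using g HF by blast
    have fx: "f x \<in> carrier R" if "f \<in> carrier ?F" for f using that by (simp add: free_module_carrier)
    have ehom: "(\<lambda>f. f x \<odot>\<^bsub>?F\<^esub> g) \<in> mod_hom R ?F ?F"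
      by (rule mod_homI) (use gF fx in \<open>auto simp: F.smult_l_distr F.smult_assoc1\<close>)
    let ?q = "\<lambda>f. f \<ominus>\<^bsub>?F\<^esub> f x \<odot>\<^bsub>?F\<^esub> g"
    have qhom: "?q \<in> mod_hom R ?F ?F" by (rule mod_hom_sub[OF F.module_axioms mod_hom_id ehom])
    show ?thesis
    proof (intro bexI ballI conjI)
      show "(\<lambda>f. r (?q f) \<oplus>\<^bsub>?F\<^esub> f x \<odot>\<^bsub>?F\<^esub> g) \<in> mod_hom R ?F ?F"
        by (rule mod_hom_plus[OF F.module_axioms mod_hom_comp[OF qhom r(1)] ehom])
      show "r (?q f) \<oplus>\<^bsub>?F\<^esub> f x \<odot>\<^bsub>?F\<^esub> g \<in> H" if f: "f \<in> carrier ?F" for f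
        using r(2)[OF mod_hom_closed[OF qhom f]] fx[OF f] g
        by (intro submodule_add[OF insert.prems(1)] submodule_smult[OF insert.prems(1)]) (auto simp: H'_def)
      show "r (?q f) \<oplus>\<^bsub>?F\<^esub> f x \<odot>\<^bsub>?F\<^esub> g = f" if f: "f \<in> H" for f
      proof -
        have fF: "f \<in> carrier ?F" using f HF by blast
        have "?q f x = f x \<oplus>\<^bsub>R\<^esub> \<ominus>\<^bsub>R\<^esub> (f x \<otimes>\<^bsub>R\<^esub> g x)"
          unfolding a_minus_def
          using free_module_minus[OF R.is_cring F.smult_closed[OF fx[OF fF] gF]] by simp
        then have "?q f \<in> H'"
          unfolding H'_def using fx[OF fF] f g
          by (auto simp: R.r_neg intro!: submodule_diff[OF insert.prems(1)] submodule_smult[OF insert.prems(1)] )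
        then have "r (?q f) = ?q f" by (rule r(3))
        then show ?thesis using F.diff_add_cancel[OF fF F.smult_closed[OF fx[OF fF] gF]] by simp
      qed
    qed
  qed
qed

lemma field_submodule_retraction:
  assumes "field R" "finite S" "submodule H R (free_module R S)"
  obtains r where "r \<in> mod_hom R (free_module R S) (free_module R S)"
    "\<And>f. f \<in> carrier (free_module R S) \<Longrightarrow> r f \<in> H" "\<And>f. f \<in> H \<Longrightarrow> r f = f"
  using field_submodule_retraction_aux[OF assms(1,2,3)] submodule_sub[OF assms(3)]
  by (force simp: free_module_carrier)

declare mod_hom_closed [simp del]

section \<open>Homology through a presentation\<close>

text \<open>Homology is any module \<open>H\<close> with a surjection \<open>pr\<close> from the
  cycles whose kernel is the boundaries. This covers the direct sum of the reduced (co)homology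
  modules, where a class is a family of cosets, as well as the single cosets of
  \<open>complex_homology\<close>.\<close>

locale presented_homology =
  fixes R :: "('r, 's) ring_scheme" and A :: "('r, 'a, 'm) module_scheme"
    and H :: "('r, 'h, 'n) module_scheme" and d :: "'a \<Rightarrow> 'a" and pr :: "'a \<Rightarrow> 'h"
  assumes A_module: "module R A" and H_module: "module R H"
    and d_hom: "d \<in> mod_hom R A A"
    and d_d: "x \<in> carrier A \<Longrightarrow> d (d x) = \<zero>\<^bsub>A\<^esub>"
    and pr_hom: "pr \<in> mod_hom R (A\<lparr>carrier := {x \<in> carrier A. d x = \<zero>\<^bsub>A\<^esub>}\<rparr>) H"
    and pr_surj: "pr ` {x \<in> carrier A. d x = \<zero>\<^bsub>A\<^esub>} = carrier H"
    and pr_zero_iff: "x \<in> carrier A \<Longrightarrow> d x = \<zero>\<^bsub>A\<^esub> \<Longrightarrow> pr x = \<zero>\<^bsub>H\<^esub> \<longleftrightarrow> x \<in> d ` carrier A"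
begin

sublocale A: module R A by (rule A_module)
sublocale H: module R H by (rule H_module)

definition cyc where "cyc = {x \<in> carrier A. d x = \<zero>\<^bsub>A\<^esub>}"

lemma cyc_iff: "x \<in> cyc \<longleftrightarrow> x \<in> carrier A \<and> d x = \<zero>\<^bsub>A\<^esub>"
  unfolding cyc_def by blast
lemma cyc_carrier [simp]: "x \<in> cyc \<Longrightarrow> x \<in> carrier A" unfolding cyc_iff by blast
lemma cyc_d [simp]: "x \<in> cyc \<Longrightarrow> d x = \<zero>\<^bsub>A\<^esub>" unfolding cyc_iff by blast
lemma cycI: "x \<in> carrier A \<Longrightarrow> d x = \<zero>\<^bsub>A\<^esub> \<Longrightarrow> x \<in> cyc" unfolding cyc_iff by blast
lemma d_cyc [simp]: "x \<in> carrier A \<Longrightarrow> d x \<in> cyc"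
  using mod_hom_closed[OF d_hom] d_d unfolding cyc_iff by blast
lemma d_closed [simp]: "x \<in> carrier A \<Longrightarrow> d x \<in> carrier A" by (rule mod_hom_closed[OF d_hom])

lemma cyc_submodule: "submodule cyc R A"
  unfolding cyc_def by (rule submodule_kernel[OF A_module A_module d_hom])

lemma cyc_module: "module R (A\<lparr>carrier := cyc\<rparr>)"
  by (rule submodule_module[OF A_module cyc_submodule])

lemma pr_cyc_hom: "pr \<in> mod_hom R (A\<lparr>carrier := cyc\<rparr>) H"
  using pr_hom unfolding cyc_def .

lemma pr_closed [simp]: "z \<in> cyc \<Longrightarrow> pr z \<in> carrier H"
  using mod_hom_closed[OF pr_cyc_hom] by simp

lemma pr_add: "z \<in> cyc \<Longrightarrow> w \<in> cyc \<Longrightarrow> pr (z \<oplus>\<^bsub>A\<^esub> w) = pr z \<oplus>\<^bsub>H\<^esub> pr w"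
  using mod_hom_add[OF pr_cyc_hom] by simp

lemma pr_smult: "a \<in> carrier R \<Longrightarrow> z \<in> cyc \<Longrightarrow> pr (a \<odot>\<^bsub>A\<^esub> z) = a \<odot>\<^bsub>H\<^esub> pr z"
  using mod_hom_smult[OF pr_cyc_hom] by simp

lemma pr_minus: "z \<in> cyc \<Longrightarrow> pr (\<ominus>\<^bsub>A\<^esub> z) = \<ominus>\<^bsub>H\<^esub> pr z"
  using mod_hom_minus[OF cyc_module H_module pr_cyc_hom, of z] submodule_a_inv[OF A_module cyc_submodule] by simp

lemma pr_diff: "z \<in> cyc \<Longrightarrow> w \<in> cyc \<Longrightarrow> pr (z \<ominus>\<^bsub>A\<^esub> w) = pr z \<ominus>\<^bsub>H\<^esub> pr w"
  by (simp add: a_minus_def pr_add pr_minus submodule_minus[OF cyc_submodule])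

lemma pr_zero: "pr \<zero>\<^bsub>A\<^esub> = \<zero>\<^bsub>H\<^esub>"
  using mod_hom_zero[OF cyc_module H_module pr_cyc_hom] by simp

lemma pr_d [simp]: "x \<in> carrier A \<Longrightarrow> pr (d x) = \<zero>\<^bsub>H\<^esub>"
  using pr_zero_iff[of "d x"] by (simp add: d_d)

lemma pr_zeroE:
  assumes "z \<in> cyc" "pr z = \<zero>\<^bsub>H\<^esub>" obtains x where "x \<in> carrier A" "z = d x"
  using assms pr_zero_iff[of z] by auto

lemma pr_eqE:
  assumes "z \<in> cyc" "w \<in> cyc" "pr z = pr w"
  obtains x where "x \<in> carrier A" "z = w \<oplus>\<^bsub>A\<^esub> d x"
proof -
  have "z \<ominus>\<^bsub>A\<^esub> w \<in> cyc" using assms by (intro submodule_diff[OF cyc_submodule])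
  moreover have "pr (z \<ominus>\<^bsub>A\<^esub> w) = \<zero>\<^bsub>H\<^esub>" using assms by (simp add: pr_diff)
  ultimately obtain x where x: "x \<in> carrier A" "z \<ominus>\<^bsub>A\<^esub> w = d x" by (rule pr_zeroE)
  have "z = (z \<ominus>\<^bsub>A\<^esub> w) \<oplus>\<^bsub>A\<^esub> w" using assms by simp
  then have "z = w \<oplus>\<^bsub>A\<^esub> d x" using x assms by (simp add: A.M.a_comm)
  with x(1) show thesis by (rule that)
qed

lemma prE:
  assumes "h \<in> carrier H" obtains z where "z \<in> cyc" "h = pr z"
  using assms pr_surj unfolding cyc_def by blast

text \<open>Over a principal ideal domain the boundaries of a submodule of a finite free module form a
  projective module, so \<open>d\<close> splits over its image and the cycles are a direct summand.\<close>

lemma boundary_section: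
  assumes "principal_domain R" "finite_retract R A S i p"
  obtains s where "s \<in> mod_hom R (A\<lparr>carrier := d ` carrier A\<rparr>) A"
    "\<And>y. y \<in> d ` carrier A \<Longrightarrow> d (s y) = y"
proof -
  have S: "finite S" and i: "i \<in> mod_hom R A (free_module R S)"
    and p: "p \<in> mod_hom R (free_module R S) A" and pi: "\<And>x. x \<in> carrier A \<Longrightarrow> p (i x) = x"
    using assms(2) by (auto simp: finite_retract_def)
  have F: "module R (free_module R S)" by (rule free_module_module) (rule A.R.is_cring)
  obtain s where s: "s \<in> mod_hom R (free_module R S\<lparr>carrier := (\<lambda>x. i (d x)) ` carrier A\<rparr>) A"
    "\<And>y. y \<in> (\<lambda>x. i (d x)) ` carrier A \<Longrightarrow> i (d (s y)) = y"
    by (rule free_submodule_section[OF assms(1) A_module S mod_hom_comp[OF d_hom i]]) (rule that)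
  have dA: "submodule (d ` carrier A) R A" by (rule submodule_image[OF A_module A_module d_hom])
  have "i \<in> mod_hom R (A\<lparr>carrier := d ` carrier A\<rparr>) (free_module R S\<lparr>carrier := (\<lambda>x. i (d x)) ` carrier A\<rparr>)"
    by (rule mod_hom_into_submodule[OF mod_hom_submodule[OF dA i]]) auto
  then have si: "(\<lambda>y. s (i y)) \<in> mod_hom R (A\<lparr>carrier := d ` carrier A\<rparr>) A" by (rule mod_hom_comp[OF _ s(1)])
  moreover have "d (s (i y)) = y" if "y \<in> d ` carrier A" for y
  proof -
    have "s (i y) \<in> carrier A" using mod_hom_closed[OF si] that by simp
    then have "d (s (i y)) = p (i (d (s (i y))))" by (simp add: pi)
    also have "i (d (s (i y))) = i y" using that by (intro s(2)) auto
    finally show ?thesis using that pi by auto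
  qed
  ultimately show thesis by (rule that)
qed

text \<open>Subtracting \<open>s (d x)\<close> from \<open>x\<close> leaves a cycle and fixes the
  cycles, so it is a projection of \<open>A\<close> onto them; \<open>pr\<close> composed with it is
  the extension.\<close>

lemma pr_extension:
  assumes "principal_domain R" "finite_retract R A S i p"
  obtains q where "q \<in> mod_hom R A H" "\<And>z. z \<in> cyc \<Longrightarrow> q z = pr z"
proof -
  obtain s where s: "s \<in> mod_hom R (A\<lparr>carrier := d ` carrier A\<rparr>) A"
    "\<And>y. y \<in> d ` carrier A \<Longrightarrow> d (s y) = y" by (rule boundary_section[OF assms]) (rule that)
  have sd: "(\<lambda>x. s (d x)) \<in> mod_hom R A A"
    by (rule mod_hom_comp[OF mod_hom_into_submodule[OF d_hom] s(1)]) auto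
  have sc: "s (d x) \<in> carrier A" if "x \<in> carrier A" for x using mod_hom_closed[OF sd that] .
  have c: "x \<ominus>\<^bsub>A\<^esub> s (d x) \<in> cyc" if "x \<in> carrier A" for x
    using that sc s(2) by (intro cycI) (auto simp: mod_hom_diff[OF A_module A_module d_hom])
  have "(\<lambda>x. x \<ominus>\<^bsub>A\<^esub> s (d x)) \<in> mod_hom R A (A\<lparr>carrier := cyc\<rparr>)"
    by (rule mod_hom_into_submodule[OF mod_hom_sub[OF A_module mod_hom_id sd]]) (rule c)
  then have "(\<lambda>x. pr (x \<ominus>\<^bsub>A\<^esub> s (d x))) \<in> mod_hom R A H" by (rule mod_hom_comp[OF _ pr_cyc_hom])
  moreover have "pr (z \<ominus>\<^bsub>A\<^esub> s (d z)) = pr z" if "z \<in> cyc" for z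
  proof -
    have "s (d z) = \<zero>\<^bsub>A\<^esub>"
      using mod_hom_zero[OF A_module A_module sd] that mod_hom_zero[OF A_module A_module d_hom] by simp
    then show ?thesis using that by simp
  qed
  ultimately show thesis by (rule that)
qed

text \<open>If classes lift linearly to cycles by \<open>t\<close>, the boundaries are a direct
  summand of all of \<open>A\<close>: \<open>c\<close> projects onto the cycles, and
  \<open>g\<close> subtracts the chosen representative of the class, which lands in the boundaries
  and fixes them. Applying the section \<open>s\<close> of \<open>d\<close> to \<open>g\<close>
  gives \<open>h\<close>.\<close>

lemma splitting_from_section:
  assumes "principal_domain R" "finite_retract R A S i p"
    and "t \<in> mod_hom R H A" "\<And>x. x \<in> carrier H \<Longrightarrow> t x \<in> cyc" "\<And>x. x \<in> carrier H \<Longrightarrow> pr (t x) = x"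
  obtains h where "h \<in> mod_hom R A A" "\<And>x. x \<in> carrier A \<Longrightarrow> d (h (d x)) = d x"
proof -
  obtain s where s: "s \<in> mod_hom R (A\<lparr>carrier := d ` carrier A\<rparr>) A"
    "\<And>y. y \<in> d ` carrier A \<Longrightarrow> d (s y) = y" by (rule boundary_section[OF assms(1,2)]) (rule that)
  obtain q where q: "q \<in> mod_hom R A H" "\<And>z. z \<in> cyc \<Longrightarrow> q z = pr z" by (rule pr_extension[OF assms(1,2)]) (rule that)
  have sd: "(\<lambda>x. s (d x)) \<in> mod_hom R A A"
    by (rule mod_hom_comp[OF mod_hom_into_submodule[OF d_hom] s(1)]) auto
  have sc: "s (d x) \<in> carrier A" if "x \<in> carrier A" for x using mod_hom_closed[OF sd that] .
  define c where "c x = x \<ominus>\<^bsub>A\<^esub> s (d x)" for x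
  have c: "c \<in> mod_hom R A A" unfolding c_def by (rule mod_hom_sub[OF A_module mod_hom_id sd])
  have c_cyc: "c x \<in> cyc" if "x \<in> carrier A" for x
    unfolding c_def using that sc s(2) by (intro cycI) (auto simp: mod_hom_diff[OF A_module A_module d_hom])
  define g where "g x = c x \<ominus>\<^bsub>A\<^esub> t (q (c x))" for x
  have g: "g \<in> mod_hom R A A"
    unfolding g_def by (rule mod_hom_sub[OF A_module c mod_hom_comp[OF mod_hom_comp[OF c q(1)] assms(3)]])
  have tc: "t (q (c x)) \<in> cyc" if "x \<in> carrier A" for x
    using that by (intro assms(4) mod_hom_closed[OF q(1)] mod_hom_closed[OF c])
  have gb: "g x \<in> d ` carrier A" if x: "x \<in> carrier A" for x
  proof -
    have gc: "g x \<in> cyc" unfolding g_def by (rule submodule_diff[OF cyc_submodule c_cyc[OF x] tc[OF x]])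
    have "pr (g x) = \<zero>\<^bsub>H\<^esub>"
      unfolding g_def using c_cyc[OF x] tc[OF x] q by (simp add: pr_diff assms(5))
    then show ?thesis using pr_zeroE[OF gc] by blast
  qed
  have gd: "g (d x) = d x" if x: "x \<in> carrier A" for x
  proof -
    have "s (d (d x)) = \<zero>\<^bsub>A\<^esub>"
      using mod_hom_zero[OF A_module A_module sd] x mod_hom_zero[OF A_module A_module d_hom] by (simp add: d_d)
    then have "c (d x) = d x" unfolding c_def using x by simp
    moreover have "q (d x) = \<zero>\<^bsub>H\<^esub>" using q(2)[of "d x"] x by simp
    ultimately show ?thesis unfolding g_def using x mod_hom_zero[OF H_module A_module assms(3)] by simp
  qed
  have "(\<lambda>x. s (g x)) \<in> mod_hom R A A"
    by (rule mod_hom_comp[OF mod_hom_into_submodule[OF g gb] s(1)])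
  moreover have "d (s (g (d x))) = d x" if x: "x \<in> carrier A" for x
    using s(2)[OF gb, of "d x"] gd x by simp
  ultimately show thesis by (rule that)
qed

text \<open>A retraction \<open>g\<close> of \<open>A\<close> onto the boundaries yields
  \<open>f = 1 - g\<close>, which kills boundaries and changes a cycle only by a boundary. Hence
  \<open>f\<close> descends to homology and picks representatives linearly. The retraction is built
  in the ambient free module and brought back by \<open>p\<close>.\<close>

lemma field_section:
  assumes "field R" "finite_retract R A S i p"
  obtains t where "t \<in> mod_hom R H A" "\<And>x. x \<in> carrier H \<Longrightarrow> t x \<in> cyc" "\<And>x. x \<in> carrier H \<Longrightarrow> pr (t x) = x"
proof -
  have S: "finite S" and i: "i \<in> mod_hom R A (free_module R S)"
    and p: "p \<in> mod_hom R (free_module R S) A" and pi: "\<And>x. x \<in> carrier A \<Longrightarrow> p (i x) = x"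
    using assms(2) by (auto simp: finite_retract_def)
  have F: "module R (free_module R S)" by (rule free_module_module) (rule A.R.is_cring)
  have "submodule ((\<lambda>x. i (d x)) ` carrier A) R (free_module R S)"
    by (rule submodule_image[OF A_module F mod_hom_comp[OF d_hom i]])
  then obtain r where r: "r \<in> mod_hom R (free_module R S) (free_module R S)"
    "\<And>f. f \<in> carrier (free_module R S) \<Longrightarrow> r f \<in> (\<lambda>x. i (d x)) ` carrier A"
    "\<And>f. f \<in> (\<lambda>x. i (d x)) ` carrier A \<Longrightarrow> r f = f"
    by (rule field_submodule_retraction[OF assms(1) S]) blast
  define g where "g x = p (r (i x))" for x
  have g: "g \<in> mod_hom R A A" unfolding g_def by (rule mod_hom_comp[OF mod_hom_comp[OF i r(1)] p])
  have gb: "g x \<in> d ` carrier A" if x: "x \<in> carrier A" for x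
    using r(2)[OF mod_hom_closed[OF i x]] by (auto simp: g_def pi)
  have gd: "g (d x) = d x" if x: "x \<in> carrier A" for x
    using r(3)[of "i (d x)"] x by (simp add: g_def pi)
  define f where "f x = x \<ominus>\<^bsub>A\<^esub> g x" for x
  have f: "f \<in> mod_hom R (A\<lparr>carrier := cyc\<rparr>) A"
    unfolding f_def by (rule mod_hom_submodule[OF cyc_submodule mod_hom_sub[OF A_module mod_hom_id g]])
  have gz: "g z \<in> cyc" if "z \<in> cyc" for z using gb[of z] that by auto
  have fz: "f z \<in> cyc" if "z \<in> cyc" for z
    unfolding f_def by (rule submodule_diff[OF cyc_submodule that gz[OF that]])
  have wd: "f z = f w" if zw: "z \<in> cyc" "w \<in> cyc" "pr z = pr w" for z w
  proof -
    obtain x where x: "x \<in> carrier A" "z = w \<oplus>\<^bsub>A\<^esub> d x" using pr_eqE[OF zw] .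
    have "f z = f w \<oplus>\<^bsub>A\<^esub> f (d x)" using mod_hom_add[OF f, of w "d x"] x zw by simp
    also have "f (d x) = \<zero>\<^bsub>A\<^esub>" unfolding f_def using x gd by simp
    finally show ?thesis using mod_hom_closed[OF f, of w] zw by simp
  qed
  have surj: "pr ` carrier (A\<lparr>carrier := cyc\<rparr>) = carrier H" using pr_surj unfolding cyc_def by simp
  have wd': "f z = f w" if "z \<in> carrier (A\<lparr>carrier := cyc\<rparr>)" "w \<in> carrier (A\<lparr>carrier := cyc\<rparr>)" "pr z = pr w" for z w
    by (rule wd) (use that in simp_all)
  obtain t where t: "t \<in> mod_hom R H A" and t': "\<And>z. z \<in> carrier (A\<lparr>carrier := cyc\<rparr>) \<Longrightarrow> t (pr z) = f z"
  proof (rule surjection_factor[OF cyc_module A_module pr_cyc_hom surj f])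
    show "f z = f w" if "z \<in> carrier (A\<lparr>carrier := cyc\<rparr>)" "w \<in> carrier (A\<lparr>carrier := cyc\<rparr>)" "pr z = pr w" for z w
      using that by (rule wd')
  qed (rule that)
  note t = t t'[simplified]
  show thesis
  proof (rule that[OF t(1)])
    fix x assume "x \<in> carrier H"
    then obtain z where z: "z \<in> cyc" "x = pr z" by (rule prE)
    show "t x \<in> cyc" using z t(2) fz by simp
    obtain y where y: "y \<in> carrier A" "g z = d y" using gb[of z] z by auto
    have "pr (f z) = pr z \<ominus>\<^bsub>H\<^esub> pr (g z)" unfolding f_def by (rule pr_diff[OF z(1) gz[OF z(1)]])
    then show "pr (t x) = x" using z t(2) y by simp
  qed
qed

text \<open>The image in \<open>H\<close> of each basis element of a free module lifts to a cycle;
  extending these lifts linearly and precomposing with the inclusion of the summand splits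
  \<open>pr\<close>.\<close>

lemma projective_section:
  assumes "projective R H"
  obtains t where "t \<in> mod_hom R H A" "\<And>x. x \<in> carrier H \<Longrightarrow> t x \<in> cyc" "\<And>x. x \<in> carrier H \<Longrightarrow> pr (t x) = x"
proof -
  obtain S :: "'h set" and i q where i: "i \<in> mod_hom R H (free_module R S)"
    and q: "q \<in> mod_hom R (free_module R S) H" and qi: "\<And>x. x \<in> carrier H \<Longrightarrow> q (i x) = x"
    using assms by (auto simp: projective_def)
  have F: "module R (free_module R S)" by (rule free_module_module) (rule A.R.is_cring)
  have e: "basis_elem R x \<in> carrier (free_module R S)" if "x \<in> S" for x
    by (rule basis_elem_carrier[OF A.R.is_cring that])
  have "\<exists>z. x \<in> S \<longrightarrow> z \<in> cyc \<and> pr z = q (basis_elem R x)" for x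
    using prE[OF mod_hom_closed[OF q e[of x]]] by metis
  then obtain z where z: "\<And>x. x \<in> S \<Longrightarrow> z x \<in> cyc \<and> pr (z x) = q (basis_elem R x)" by metis
  obtain f where f: "f \<in> mod_hom R (free_module R S) (A\<lparr>carrier := cyc\<rparr>)"
    "\<And>x. x \<in> S \<Longrightarrow> f (basis_elem R x) = z x"
    by (rule free_module_lift[OF cyc_module, of S z]) (use z in auto)
  have fq: "pr (f y) = q y" if y: "y \<in> carrier (free_module R S)" for y
    by (rule mod_hom_span_eq[OF F H_module mod_hom_comp[OF f(1) pr_cyc_hom] q free_module_span[OF A.R.is_cring] _ _ y])
      (use e z f(2) in auto)
  have fc: "f y \<in> cyc" if y: "y \<in> carrier (free_module R S)" for y using mod_hom_closed[OF f(1) y] by simp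
  have f': "f \<in> mod_hom R (free_module R S) A"
    using f(1) fc by (intro mod_homI) (auto simp: mod_hom_add[OF f(1)] mod_hom_smult[OF f(1)])
  show thesis
    by (rule that[OF mod_hom_comp[OF i f']]) (use mod_hom_closed[OF i] fc fq qi in auto)
qed

end

text \<open>The sign operator of a \<open>\<int>/2\<close>-grading for which \<open>d\<close> is odd; \<open>e0\<close> and \<open>e1\<close> are the projections
  onto the even and the odd part.\<close>

locale parity_grading =
  fixes R :: "('r, 's) ring_scheme" and A :: "('r, 'a, 'm) module_scheme" and d e0 e1 sg :: "'a \<Rightarrow> 'a"
  assumes e0: "e0 \<in> mod_hom R A A" and e1: "e1 \<in> mod_hom R A A"
    and e_sum: "x \<in> carrier A \<Longrightarrow> e0 x \<oplus>\<^bsub>A\<^esub> e1 x = x"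
    and e01: "x \<in> carrier A \<Longrightarrow> e0 (e1 x) = \<zero>\<^bsub>A\<^esub>" "x \<in> carrier A \<Longrightarrow> e1 (e0 x) = \<zero>\<^bsub>A\<^esub>"
    and d_odd: "x \<in> carrier A \<Longrightarrow> d (e0 x) = e1 (d x)" "x \<in> carrier A \<Longrightarrow> d (e1 x) = e0 (d x)"
    and sg: "x \<in> carrier A \<Longrightarrow> sg x = e0 x \<ominus>\<^bsub>A\<^esub> e1 x"
begin

context
  assumes A: "module R A" and d: "d \<in> mod_hom R A A"
begin

interpretation A: module R A by (rule A)

lemma e_closed [simp]: "x \<in> carrier A \<Longrightarrow> e0 x \<in> carrier A" "x \<in> carrier A \<Longrightarrow> e1 x \<in> carrier A"
  by (auto intro: mod_hom_closed[OF e0] mod_hom_closed[OF e1])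

lemma e_idem: assumes "x \<in> carrier A" shows "e0 (e0 x) = e0 x" "e1 (e1 x) = e1 x"
proof -
  have "e0 (e0 x) \<oplus>\<^bsub>A\<^esub> e1 (e0 x) = e0 x" "e0 (e1 x) \<oplus>\<^bsub>A\<^esub> e1 (e1 x) = e1 x"
    using assms by (simp_all add: e_sum del: e01)
  then show "e0 (e0 x) = e0 x" "e1 (e1 x) = e1 x" using assms by (simp_all add: e01)
qed

lemma sg_hom: "sg \<in> mod_hom R A A"
  by (rule mod_hom_cong[OF A mod_hom_sub[OF A e0 e1]]) (simp add: sg)

lemma sg_sg: "x \<in> carrier A \<Longrightarrow> sg (sg x) = x"
  by (simp add: sg mod_hom_diff[OF A A e0] mod_hom_diff[OF A A e1] e_idem e01)
    (simp add: a_minus_def A.M.minus_minus e_sum)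

lemma d_sg: assumes "x \<in> carrier A" shows "d (sg x) = \<ominus>\<^bsub>A\<^esub> sg (d x)"
proof -
  have "d x \<in> carrier A" using assms by (rule mod_hom_closed[OF d])
  then show ?thesis using assms
    by (simp add: sg mod_hom_diff[OF A A d] d_odd) (simp add: a_minus_def A.M.minus_add A.M.minus_minus A.M.a_comm)
qed

text \<open>Only the part of \<open>h\<close> that exchanges even and odd elements is kept. Since
  \<open>d\<close> is odd, this part already satisfies \<open>d k d = d\<close>, and an odd map
  anticommutes with the sign operator, as the homotopy on a left tensor factor requires.\<close>

lemma odd_splitting:
  assumes h: "h \<in> mod_hom R A A" and dhd: "\<And>x. x \<in> carrier A \<Longrightarrow> d (h (d x)) = d x"
  obtains k where "k \<in> mod_hom R A A" "\<And>x. x \<in> carrier A \<Longrightarrow> d (k (d x)) = d x"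
    "\<And>x. x \<in> carrier A \<Longrightarrow> k (sg x) = \<ominus>\<^bsub>A\<^esub> sg (k x)"
proof -
  define k where "k x = e0 (h (e1 x)) \<oplus>\<^bsub>A\<^esub> e1 (h (e0 x))" for x
  note [simp] = mod_hom_closed[OF h] mod_hom_closed[OF d]
  have "k \<in> mod_hom R A A"
    unfolding k_def
    by (rule mod_hom_plus[OF A mod_hom_comp[OF mod_hom_comp[OF e1 h] e0] mod_hom_comp[OF mod_hom_comp[OF e0 h] e1]])
  moreover have "d (k (d x)) = d x" if x: "x \<in> carrier A" for x
  proof -
    have "d (k (d x)) = d (e0 (h (e1 (d x)))) \<oplus>\<^bsub>A\<^esub> d (e1 (h (e0 (d x))))"
      unfolding k_def using x by (simp add: mod_hom_add[OF d])
    also have "\<dots> = e1 (d (h (d (e0 x)))) \<oplus>\<^bsub>A\<^esub> e0 (d (h (d (e1 x))))" using x by (simp add: d_odd)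
    also have "\<dots> = e1 (d (e0 x)) \<oplus>\<^bsub>A\<^esub> e0 (d (e1 x))" using x by (simp add: dhd)
    also have "\<dots> = e1 (d x) \<oplus>\<^bsub>A\<^esub> e0 (d x)" using x by (simp add: d_odd e_idem)
    also have "\<dots> = d x" using x e_sum[of "d x"] by (simp add: A.M.a_comm)
    finally show ?thesis .
  qed
  moreover have "k (sg x) = \<ominus>\<^bsub>A\<^esub> sg (k x)" if x: "x \<in> carrier A" for x
  proof -
    have "k x \<in> carrier A" unfolding k_def using x by simp
    moreover have "e0 (sg x) = e0 x" "e1 (sg x) = \<ominus>\<^bsub>A\<^esub> e1 x"
      using x by (simp_all add: sg mod_hom_diff[OF A A e0] mod_hom_diff[OF A A e1] e_idem e01)
        (simp add: a_minus_def)
    then have "k (sg x) = \<ominus>\<^bsub>A\<^esub> e0 (h (e1 x)) \<oplus>\<^bsub>A\<^esub> e1 (h (e0 x))"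
      unfolding k_def using x by (simp add: mod_hom_minus[OF A A h] mod_hom_minus[OF A A e0])
    moreover have "e0 (k x) = e0 (h (e1 x))" "e1 (k x) = e1 (h (e0 x))"
      unfolding k_def using x by (simp_all add: mod_hom_add[OF e0] mod_hom_add[OF e1] e_idem e01)
    ultimately show ?thesis using x
      by (simp add: sg a_minus_def A.M.minus_add A.M.minus_minus)
  qed
  ultimately show thesis by (rule that)
qed

end

end

section \<open>The Kuenneth theorem\<close>

text \<open>\<open>E\<close> plays the role of the tensor product of \<open>A\<close> and
  \<open>B\<close> through \<open>bt\<close>: \<open>u\<close> provides the existence of linear maps
  out of \<open>E\<close> and \<open>bt_span\<close> their uniqueness. It stays abstract because it
  is a free module on the pairs of the join in one use and the total module of \<open>CH\<close> of
  the join in the other. \<open>sg\<close> stands for multiplication by the sign of the degree, so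
  that \<open>dE_bt\<close> is the Leibniz rule.\<close>

locale kunneth =
  A: presented_homology R A HA dA prA + B: presented_homology R B HB dB prB +
  E: presented_homology R E HE dE prE
  for R :: "('r, 's) ring_scheme" and A :: "('r, 'a, 'm) module_scheme" and HA :: "('r, 'ha, 'n) module_scheme"
    and dA and prA and B :: "('r, 'b, 'k) module_scheme" and HB :: "('r, 'hb, 'l) module_scheme"
    and dB and prB and E :: "('r, 'e, 'q) module_scheme" and HE :: "('r, 'he, 'p) module_scheme"
    and dE and prE +
  fixes sg :: "'a \<Rightarrow> 'a" and bt :: "'a \<Rightarrow> 'b \<Rightarrow> 'e" and u :: "'e \<Rightarrow> ('a \<times> 'b \<Rightarrow> 'r) set"
  assumes sg_hom: "sg \<in> mod_hom R A A" and sg_sg: "a \<in> carrier A \<Longrightarrow> sg (sg a) = a"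
    and dA_sg: "a \<in> carrier A \<Longrightarrow> dA (sg a) = \<ominus>\<^bsub>A\<^esub> sg (dA a)"
    and bt_bilinear: "bilinear_map R A B E bt"
    and bt_span: "carrier E \<subseteq> mod_span R E {bt a b | a b. a \<in> carrier A \<and> b \<in> carrier B}"
    and u_hom: "u \<in> mod_hom R E (tensor_module R A B)"
    and u_bt: "a \<in> carrier A \<Longrightarrow> b \<in> carrier B \<Longrightarrow> u (bt a b) = pure_tensor R A B a b"
    and dE_bt: "a \<in> carrier A \<Longrightarrow> b \<in> carrier B \<Longrightarrow> dE (bt a b) = bt (dA a) b \<oplus>\<^bsub>E\<^esub> bt (sg a) (dB b)"
begin

lemma bt_closed [simp]: "a \<in> carrier A \<Longrightarrow> b \<in> carrier B \<Longrightarrow> bt a b \<in> carrier E"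
  by (rule bilinear_closed[OF bt_bilinear])

lemma sg_closed [simp]: "a \<in> carrier A \<Longrightarrow> sg a \<in> carrier A"
  by (rule mod_hom_closed[OF sg_hom])

lemmas bt_add_left = mod_hom_add[OF bilinear_left[OF bt_bilinear]]
lemmas bt_add_right = mod_hom_add[OF bilinear_right[OF bt_bilinear]]
lemmas bt_smult_left = mod_hom_smult[OF bilinear_left[OF bt_bilinear]]
lemmas bt_smult_right = mod_hom_smult[OF bilinear_right[OF bt_bilinear]]
lemmas bt_zero_left [simp] = bilinear_zero_left[OF A.A_module E.A_module bt_bilinear]
lemmas bt_zero_right [simp] = bilinear_zero_right[OF B.A_module E.A_module bt_bilinear]
lemmas bt_minus_left = mod_hom_minus[OF A.A_module E.A_module bilinear_left[OF bt_bilinear]]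
lemmas bt_diff_left = mod_hom_diff[OF A.A_module E.A_module bilinear_left[OF bt_bilinear]]
lemmas bt_diff_right = mod_hom_diff[OF B.A_module E.A_module bilinear_right[OF bt_bilinear]]

lemma E_lift:
  fixes P :: "('r, 'c, 'd) module_scheme"
  assumes P: "module R P" and b: "bilinear_map R A B P b"
  obtains f where "f \<in> mod_hom R E P" "\<And>x y. x \<in> carrier A \<Longrightarrow> y \<in> carrier B \<Longrightarrow> f (bt x y) = b x y"
proof -
  obtain f where f: "f \<in> mod_hom R (tensor_module R A B) P"
    "\<And>x y. x \<in> carrier A \<Longrightarrow> y \<in> carrier B \<Longrightarrow> f (pure_tensor R A B x y) = b x y"
    by (rule tensor_lift[OF A.A_module B.A_module P b]) (rule that)
  show thesis
    by (rule that[OF mod_hom_comp[OF u_hom f(1)]]) (simp add: u_bt f(2))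
qed

lemma E_hom_eq:
  assumes "module R P" "f \<in> mod_hom R E P" "g \<in> mod_hom R E P"
    and "\<And>x y. x \<in> carrier A \<Longrightarrow> y \<in> carrier B \<Longrightarrow> f (bt x y) = g (bt x y)" "e \<in> carrier E"
  shows "f e = g e"
  by (rule mod_hom_span_eq[OF E.A_module assms(1-3) bt_span]) (use assms in auto)

lemma E_lift_hom:
  assumes f: "f \<in> mod_hom R A A" and g: "g \<in> mod_hom R B B"
  obtains k where "k \<in> mod_hom R E E"
    "\<And>x y. x \<in> carrier A \<Longrightarrow> y \<in> carrier B \<Longrightarrow> k (bt x y) = bt (f x) (g y)"
  by (rule E_lift[OF E.A_module bilinear_comp[OF bt_bilinear f g mod_hom_id]]) (rule that)

lemma bt_cyc: "z \<in> A.cyc \<Longrightarrow> w \<in> B.cyc \<Longrightarrow> bt z w \<in> E.cyc"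
  by (rule E.cycI) (simp_all add: dE_bt)

lemma prE_bt_boundary_left: "a \<in> carrier A \<Longrightarrow> w \<in> B.cyc \<Longrightarrow> prE (bt (dA a) w) = \<zero>\<^bsub>HE\<^esub>"
  using E.pr_d[of "bt a w"] by (simp add: dE_bt)

text \<open>A preimage of \<open>bt z (dB b)\<close> under \<open>dE\<close> is
  \<open>bt (sg z) b\<close>: the sign operator is an involution, and it keeps \<open>z\<close> a
  cycle since it anticommutes with \<open>dA\<close>.\<close>

lemma prE_bt_boundary_right:
  assumes "z \<in> A.cyc" "b \<in> carrier B" shows "prE (bt z (dB b)) = \<zero>\<^bsub>HE\<^esub>"
proof -
  have "dA (sg z) = \<zero>\<^bsub>A\<^esub>"
    using assms mod_hom_zero[OF A.A_module A.A_module sg_hom] by (simp add: dA_sg)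
  then have "dE (bt (sg z) b) = bt z (dB b)" using assms by (simp add: dE_bt sg_sg)
  then show ?thesis using E.pr_d[of "bt (sg z) b"] assms by simp
qed

lemma prE_bt_cong:
  assumes "z \<in> A.cyc" "z' \<in> A.cyc" "w \<in> B.cyc" "w' \<in> B.cyc" "prA z = prA z'" "prB w = prB w'"
  shows "prE (bt z w) = prE (bt z' w')"
proof -
  obtain a where a: "a \<in> carrier A" "z = z' \<oplus>\<^bsub>A\<^esub> dA a" using A.pr_eqE assms by metis
  obtain b where b: "b \<in> carrier B" "w = w' \<oplus>\<^bsub>B\<^esub> dB b" using B.pr_eqE assms by metis
  have "bt z w = bt z' w \<oplus>\<^bsub>E\<^esub> bt (dA a) w" using a assms by (simp add: bt_add_left)
  also have "bt z' w = bt z' w' \<oplus>\<^bsub>E\<^esub> bt z' (dB b)" using b assms by (simp add: bt_add_right)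
  finally show ?thesis
    using a b assms
    by (simp add: E.pr_add bt_cyc submodule_add[OF E.cyc_submodule] prE_bt_boundary_left prE_bt_boundary_right)
qed

text \<open>Representing cycles are picked arbitrarily. Bilinearity appears only after passing to
  classes, where the product does not depend on the representatives.\<close>

lemma cross_product:
  obtains ka where "ka \<in> mod_hom R (tensor_module R HA HB) HE"
    "\<And>z w. z \<in> A.cyc \<Longrightarrow> w \<in> B.cyc \<Longrightarrow> ka (pure_tensor R HA HB (prA z) (prB w)) = prE (bt z w)"
proof -
  define r where "r x = (SOME z. z \<in> A.cyc \<and> prA z = x)" for x
  define r' where "r' x = (SOME z. z \<in> B.cyc \<and> prB z = x)" for x
  have r: "r x \<in> A.cyc" "prA (r x) = x" if "x \<in> carrier HA" for x
    using someI_ex[of "\<lambda>z. z \<in> A.cyc \<and> prA z = x"] A.prE[OF that] unfolding r_def by metis+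
  have r': "r' x \<in> B.cyc" "prB (r' x) = x" if "x \<in> carrier HB" for x
    using someI_ex[of "\<lambda>z. z \<in> B.cyc \<and> prB z = x"] B.prE[OF that] unfolding r'_def by metis+
  note bc [simp] = bt_cyc submodule_add[OF A.cyc_submodule] submodule_add[OF B.cyc_submodule]
    submodule_smult[OF A.cyc_submodule] submodule_smult[OF B.cyc_submodule]
  have "bilinear_map R HA HB HE (\<lambda>x y. prE (bt (r x) (r' y)))"
  proof (rule bilinear_mapI)
    fix x y assume x: "x \<in> carrier HA" and y: "y \<in> carrier HB"
    show "prE (bt (r x) (r' y)) \<in> carrier HE" using x y r r' by simp
    { fix x' assume x': "x' \<in> carrier HA"
      have "prE (bt (r (x \<oplus>\<^bsub>HA\<^esub> x')) (r' y)) = prE (bt (r x \<oplus>\<^bsub>A\<^esub> r x') (r' y))"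
        using x x' y by (intro prE_bt_cong) (simp_all add: r r' A.pr_add)
      then show "prE (bt (r (x \<oplus>\<^bsub>HA\<^esub> x')) (r' y)) = prE (bt (r x) (r' y)) \<oplus>\<^bsub>HE\<^esub> prE (bt (r x') (r' y))"
        using x x' y by (simp add: r r' bt_add_left E.pr_add) }
    { fix y' assume y': "y' \<in> carrier HB"
      have "prE (bt (r x) (r' (y \<oplus>\<^bsub>HB\<^esub> y'))) = prE (bt (r x) (r' y \<oplus>\<^bsub>B\<^esub> r' y'))"
        using x y y' by (intro prE_bt_cong) (simp_all add: r r' B.pr_add)
      then show "prE (bt (r x) (r' (y \<oplus>\<^bsub>HB\<^esub> y'))) = prE (bt (r x) (r' y)) \<oplus>\<^bsub>HE\<^esub> prE (bt (r x) (r' y'))"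
        using x y y' by (simp add: r r' bt_add_right E.pr_add) }
    { fix a assume a: "a \<in> carrier R"
      have "prE (bt (r (a \<odot>\<^bsub>HA\<^esub> x)) (r' y)) = prE (bt (a \<odot>\<^bsub>A\<^esub> r x) (r' y))"
        using x y a by (intro prE_bt_cong) (simp_all add: r r' A.pr_smult)
      then show "prE (bt (r (a \<odot>\<^bsub>HA\<^esub> x)) (r' y)) = a \<odot>\<^bsub>HE\<^esub> prE (bt (r x) (r' y))"
        using x y a by (simp add: r r' bt_smult_left E.pr_smult)
      have "prE (bt (r x) (r' (a \<odot>\<^bsub>HB\<^esub> y))) = prE (bt (r x) (a \<odot>\<^bsub>B\<^esub> r' y))"
        using x y a by (intro prE_bt_cong) (simp_all add: r r' B.pr_smult)
      then show "prE (bt (r x) (r' (a \<odot>\<^bsub>HB\<^esub> y))) = a \<odot>\<^bsub>HE\<^esub> prE (bt (r x) (r' y))"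
        using x y a by (simp add: r r' bt_smult_right E.pr_smult) }
  qed
  then obtain ka where ka: "ka \<in> mod_hom R (tensor_module R HA HB) HE"
    "\<And>x y. x \<in> carrier HA \<Longrightarrow> y \<in> carrier HB \<Longrightarrow> ka (pure_tensor R HA HB x y) = prE (bt (r x) (r' y))"
    by (rule tensor_lift[OF A.H_module B.H_module E.H_module]) (rule that)
  have "ka (pure_tensor R HA HB (prA z) (prB w)) = prE (bt z w)" if "z \<in> A.cyc" "w \<in> B.cyc" for z w
    unfolding ka(2)[OF A.pr_closed[OF that(1)] B.pr_closed[OF that(2)]]
    using that by (intro prE_bt_cong) (simp_all add: r r')
  with ka(1) show thesis by (rule that)
qed

text \<open>Fixed by choice so that later facts speak of one map; on the carrier of the tensor
  product it is determined by its values on pure tensors.\<close>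

definition cross where
  "cross = (SOME ka. ka \<in> mod_hom R (tensor_module R HA HB) HE \<and>
    (\<forall>z\<in>A.cyc. \<forall>w\<in>B.cyc. ka (pure_tensor R HA HB (prA z) (prB w)) = prE (bt z w)))"

lemma cross_hom: "cross \<in> mod_hom R (tensor_module R HA HB) HE"
  and cross_pure: "z \<in> A.cyc \<Longrightarrow> w \<in> B.cyc \<Longrightarrow> cross (pure_tensor R HA HB (prA z) (prB w)) = prE (bt z w)"
proof -
  have "\<exists>ka. ka \<in> mod_hom R (tensor_module R HA HB) HE \<and>
    (\<forall>z\<in>A.cyc. \<forall>w\<in>B.cyc. ka (pure_tensor R HA HB (prA z) (prB w)) = prE (bt z w))"
    by (rule cross_product) blast
  from someI_ex[OF this] show "cross \<in> mod_hom R (tensor_module R HA HB) HE"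
    and "z \<in> A.cyc \<Longrightarrow> w \<in> B.cyc \<Longrightarrow> cross (pure_tensor R HA HB (prA z) (prB w)) = prE (bt z w)"
    unfolding cross_def[symmetric] by blast+
qed

abbreviation "T \<equiv> tensor_module R HA HB"
abbreviation "pt \<equiv> pure_tensor R HA HB"

lemma T_module: "module R T" by (rule tensor_module_module[OF A.H_module B.H_module])
sublocale T: module R T by (rule T_module)
lemma pt_closed [simp]: "x \<in> carrier HA \<Longrightarrow> y \<in> carrier HB \<Longrightarrow> pt x y \<in> carrier T"
  by (rule tensor_pure_closed[OF A.H_module B.H_module])

text \<open>Extensions \<open>qA\<close> and \<open>qB\<close> of the projections to all of \<open>A\<close> and \<open>B\<close> induce a retraction of the cross product.\<close>

lemma cross_inj:
  assumes qA: "qA \<in> mod_hom R A HA" "\<And>z. z \<in> A.cyc \<Longrightarrow> qA z = prA z"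
    and qB: "qB \<in> mod_hom R B HB" "\<And>z. z \<in> B.cyc \<Longrightarrow> qB z = prB z"
  shows "inj_on cross (carrier T)"
proof (rule mod_hom_inj_onI[OF T_module E.H_module cross_hom])
  note ptb = pure_tensor_bilinear[OF A.H_module B.H_module]
  obtain Ph where Ph: "Ph \<in> mod_hom R E T"
    "\<And>x y. x \<in> carrier A \<Longrightarrow> y \<in> carrier B \<Longrightarrow> Ph (bt x y) = pt (qA x) (qB y)"
    by (rule E_lift[OF T_module bilinear_comp[OF ptb qA(1) qB(1) mod_hom_id]]) (rule that)
  note [simp] = mod_hom_closed[OF qA(1)] mod_hom_closed[OF qB(1)]
  have qd: "qA (dA a) = \<zero>\<^bsub>HA\<^esub>" "qB (dB b) = \<zero>\<^bsub>HB\<^esub>" if "a \<in> carrier A" "b \<in> carrier B" for a b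
    using that by (simp_all add: qA(2) qB(2))
  \<comment> \<open>Both extended projections vanish on boundaries, so each of the two terms of the
    Leibniz rule dies.\<close>
  have Phd: "Ph (dE e) = \<zero>\<^bsub>T\<^esub>" if e: "e \<in> carrier E" for e
  proof (rule E_hom_eq[OF T_module mod_hom_comp[OF E.d_hom Ph(1)] mod_hom_const_zero[OF T_module] _ e])
    fix a b assume "a \<in> carrier A" "b \<in> carrier B"
    then show "Ph (dE (bt a b)) = \<zero>\<^bsub>T\<^esub>"
      by (simp add: dE_bt mod_hom_add[OF Ph(1)] Ph(2) qd bilinear_zero_left[OF A.H_module T_module ptb]
          bilinear_zero_right[OF B.H_module T_module ptb])
  qed
  \<comment> \<open>\<open>Ph\<close> acts on chains and \<open>cross\<close> on tensors of classes.
    \<open>?X\<close> collects the tensors whose cross product is represented by a cycle that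
    \<open>Ph\<close> sends back to the tensor; it is a submodule containing the pure
    tensors.\<close>
  let ?X = "{t \<in> carrier T. \<exists>e\<in>E.cyc. cross t = prE e \<and> Ph e = t}"
  have "submodule ?X R T"
  proof (rule T.submoduleI)
    show "\<zero>\<^bsub>T\<^esub> \<in> ?X"
      using mod_hom_zero[OF T_module E.H_module cross_hom] mod_hom_zero[OF E.A_module T_module Ph(1)]
        submodule_zero[OF E.cyc_submodule] E.pr_zero by (auto intro!: bexI[of _ "\<zero>\<^bsub>E\<^esub>"])
  next
    fix t assume "t \<in> ?X"
    then obtain e where e: "t \<in> carrier T" "e \<in> E.cyc" "cross t = prE e" "Ph e = t" by auto
    then have "cross (\<ominus>\<^bsub>T\<^esub> t) = prE (\<ominus>\<^bsub>E\<^esub> e)" "Ph (\<ominus>\<^bsub>E\<^esub> e) = \<ominus>\<^bsub>T\<^esub> t"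
      by (simp_all add: mod_hom_minus[OF T_module E.H_module cross_hom] E.pr_minus mod_hom_minus[OF E.A_module T_module Ph(1)])
    then show "\<ominus>\<^bsub>T\<^esub> t \<in> ?X" using e submodule_minus[OF E.cyc_submodule] by blast
    fix t' assume "t' \<in> ?X"
    then obtain e' where e': "t' \<in> carrier T" "e' \<in> E.cyc" "cross t' = prE e'" "Ph e' = t'" by auto
    then have "cross (t \<oplus>\<^bsub>T\<^esub> t') = prE (e \<oplus>\<^bsub>E\<^esub> e')" "Ph (e \<oplus>\<^bsub>E\<^esub> e') = t \<oplus>\<^bsub>T\<^esub> t'"
      using e by (simp_all add: mod_hom_add[OF cross_hom] E.pr_add mod_hom_add[OF Ph(1)])
    then show "t \<oplus>\<^bsub>T\<^esub> t' \<in> ?X" using e e' submodule_add[OF E.cyc_submodule] by blast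
  next
    fix a t assume a: "a \<in> carrier R" and "t \<in> ?X"
    then obtain e where e: "t \<in> carrier T" "e \<in> E.cyc" "cross t = prE e" "Ph e = t" by auto
    then have "cross (a \<odot>\<^bsub>T\<^esub> t) = prE (a \<odot>\<^bsub>E\<^esub> e)" "Ph (a \<odot>\<^bsub>E\<^esub> e) = a \<odot>\<^bsub>T\<^esub> t"
      using a by (simp_all add: mod_hom_smult[OF cross_hom] E.pr_smult mod_hom_smult[OF Ph(1)])
    then show "a \<odot>\<^bsub>T\<^esub> t \<in> ?X" using e a submodule_smult[OF E.cyc_submodule] by blast
  qed auto
  moreover have "{pt x y | x y. x \<in> carrier HA \<and> y \<in> carrier HB} \<subseteq> ?X"
  proof safe
    fix x y assume "x \<in> carrier HA" "y \<in> carrier HB"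
    then obtain z w where zw: "z \<in> A.cyc" "x = prA z" "w \<in> B.cyc" "y = prB w"
      using A.prE B.prE by metis
    then have "cross (pt x y) = prE (bt z w)" "Ph (bt z w) = pt x y"
      by (simp_all add: cross_pure Ph(2) qA(2) qB(2))
    then show "\<exists>e\<in>E.cyc. cross (pt x y) = prE e \<and> Ph e = pt x y" using bt_cyc zw by blast
  qed simp
  ultimately have "mod_span R T {pt x y | x y. x \<in> carrier HA \<and> y \<in> carrier HB} \<subseteq> ?X"
    by (rule mod_span_minimal)
  then have all: "carrier T \<subseteq> ?X" using tensor_span[OF A.H_module B.H_module] by (rule order_trans[rotated])
  fix t assume t: "t \<in> carrier T" "cross t = \<zero>\<^bsub>HE\<^esub>"
  then obtain e where e: "e \<in> E.cyc" "cross t = prE e" "Ph e = t" using all by blast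
  \<comment> \<open>A representing cycle of the zero class is a boundary, which \<open>Ph\<close>
    kills.\<close>
  obtain x where x: "x \<in> carrier E" "e = dE x" using E.pr_zeroE[OF e(1)] e(2) t(2) by metis
  then show "t = \<zero>\<^bsub>T\<^esub>" using e(3) Phd by simp
qed

lemma cross_surjI:
  assumes "\<And>e. e \<in> E.cyc \<Longrightarrow> prE e \<in> cross ` carrier T"
  shows "cross ` carrier T = carrier HE"
  using assms E.prE mod_hom_closed[OF cross_hom] by (metis image_subsetI subsetI subset_antisym)

text \<open>Products of cycles have classes in the image by construction, and the image is closed
  under finite sums. Surjectivity is thereby reduced to writing a cycle, up to a boundary, as such a
  sum.\<close>

lemma cross_sum_bt:
  assumes "finite S" "\<And>s. s \<in> S \<Longrightarrow> f s \<in> A.cyc" "\<And>s. s \<in> S \<Longrightarrow> g s \<in> B.cyc"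
  shows "prE (\<Oplus>\<^bsub>E\<^esub>s\<in>S. bt (f s) (g s)) \<in> cross ` carrier T"
proof -
  have "prE (\<Oplus>\<^bsub>E\<^esub>s\<in>S. bt (f s) (g s)) = (\<Oplus>\<^bsub>HE\<^esub>s\<in>S. prE (bt (f s) (g s)))"
    using assms(1,2,3)
  proof (induction S rule: finite_induct)
    case empty
    then show ?case by (simp add: E.pr_zero)
  next
    case (insert s S)
    have "(\<Oplus>\<^bsub>E\<^esub>s\<in>S. bt (f s) (g s)) \<in> E.cyc"
      using insert by (intro submodule_finsum[OF E.A_module E.cyc_submodule]) (auto intro!: bt_cyc)
    then show ?case
      using insert by (simp add: bt_cyc Pi_def E.pr_add)
  qed
  also have "\<dots> = (\<Oplus>\<^bsub>HE\<^esub>s\<in>S. cross (pt (prA (f s)) (prB (g s))))"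
    using assms by (intro E.H.finsum_cong') (auto simp: cross_pure bt_cyc)
  also have "\<dots> = cross (\<Oplus>\<^bsub>T\<^esub>s\<in>S. pt (prA (f s)) (prB (g s)))"
    using assms by (intro mod_hom_finsum[OF T_module E.H_module cross_hom, symmetric]) auto
  finally show ?thesis using assms by (auto intro!: imageI T.finsum_closed)
qed

text \<open>A splitting \<open>h\<close> of \<open>d\<close> on one factor gives the map \<open>P = 1 - d h - h d\<close> of that factor into its
  cycles, and \<open>P\<close> is homotopic to the identity on \<open>E\<close>. Expanding a cycle of \<open>E\<close> along a dual basis of the
  same factor, the coefficients in the other factor are cycles.\<close>

lemma cross_surj_left:
  assumes h: "h \<in> mod_hom R A A" and dhd: "\<And>a. a \<in> carrier A \<Longrightarrow> dA (h (dA a)) = dA a"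
    and h_sg: "\<And>a. a \<in> carrier A \<Longrightarrow> h (sg a) = \<ominus>\<^bsub>A\<^esub> sg (h a)"
    and ret: "finite_retract R A S i p"
  shows "cross ` carrier T = carrier HE"
proof (rule cross_surjI)
  have S: "finite S" and i: "i \<in> mod_hom R A (free_module R S)"
    and p: "p \<in> mod_hom R (free_module R S) A"
    using ret by (auto simp: finite_retract_def)
  note [simp] = mod_hom_closed[OF h]
  define P where "P a = a \<ominus>\<^bsub>A\<^esub> (dA (h a) \<oplus>\<^bsub>A\<^esub> h (dA a))" for a
  have P: "P \<in> mod_hom R A A" unfolding P_def
    by (intro mod_hom_sub mod_hom_plus mod_hom_id mod_hom_comp[OF h A.d_hom] mod_hom_comp[OF A.d_hom h] A.A_module)
  note [simp] = mod_hom_closed[OF P]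
  have dP: "dA (P a) = \<zero>\<^bsub>A\<^esub>" if "a \<in> carrier A" for a
    using that by (simp add: P_def mod_hom_diff[OF A.A_module A.A_module A.d_hom] mod_hom_add[OF A.d_hom] A.d_d dhd)
  obtain k where k: "k \<in> mod_hom R E E" "\<And>x y. x \<in> carrier A \<Longrightarrow> y \<in> carrier B \<Longrightarrow> k (bt x y) = bt (h x) y"
    by (rule E_lift_hom[OF h mod_hom_id]) (rule that)
  obtain Q where Q: "Q \<in> mod_hom R E E" "\<And>x y. x \<in> carrier A \<Longrightarrow> y \<in> carrier B \<Longrightarrow> Q (bt x y) = bt (P x) y"
    by (rule E_lift_hom[OF P mod_hom_id]) (rule that)
  \<comment> \<open>\<open>N\<close> and \<open>G\<close> separate the second term of the Leibniz
    rule into the differential of the right factor and the sign of the left one.\<close>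
  obtain N where N: "N \<in> mod_hom R E E" "\<And>x y. x \<in> carrier A \<Longrightarrow> y \<in> carrier B \<Longrightarrow> N (bt x y) = bt x (dB y)"
    by (rule E_lift_hom[OF mod_hom_id B.d_hom]) (rule that)
  obtain G where G: "G \<in> mod_hom R E E" "\<And>x y. x \<in> carrier A \<Longrightarrow> y \<in> carrier B \<Longrightarrow> G (bt x y) = bt (sg x) y"
    by (rule E_lift_hom[OF sg_hom mod_hom_id]) (rule that)
  note [simp] = mod_hom_closed[OF Q(1)] mod_hom_closed[OF N(1)] mod_hom_closed[OF G(1)] mod_hom_closed[OF k(1)]
  have homotopy: "(dE (k e) \<oplus>\<^bsub>E\<^esub> k (dE e)) \<oplus>\<^bsub>E\<^esub> Q e = e" if e: "e \<in> carrier E" for e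
  proof (rule E_hom_eq[OF E.A_module _ mod_hom_id _ e])
    show "(\<lambda>e. (dE (k e) \<oplus>\<^bsub>E\<^esub> k (dE e)) \<oplus>\<^bsub>E\<^esub> Q e) \<in> mod_hom R E E"
      by (intro mod_hom_plus E.A_module mod_hom_comp[OF k(1) E.d_hom] mod_hom_comp[OF E.d_hom k(1)] Q(1))
    fix a b assume ab: "a \<in> carrier A" "b \<in> carrier B"
    \<comment> \<open>The two terms containing \<open>dB b\<close> cancel because \<open>h\<close>
      anticommutes with \<open>sg\<close>.\<close>
    have "dE (k (bt a b)) \<oplus>\<^bsub>E\<^esub> k (dE (bt a b)) =
        (bt (dA (h a)) b \<oplus>\<^bsub>E\<^esub> bt (sg (h a)) (dB b)) \<oplus>\<^bsub>E\<^esub> (bt (h (dA a)) b \<oplus>\<^bsub>E\<^esub> \<ominus>\<^bsub>E\<^esub> bt (sg (h a)) (dB b))"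
      using ab by (simp add: k dE_bt mod_hom_add[OF k(1)] h_sg bt_minus_left)
    also have "\<dots> = bt (dA (h a)) b \<oplus>\<^bsub>E\<^esub> bt (h (dA a)) b"
      using ab by (simp add: E.A.M.a_ac E.A.M.r_neg)
    also have "\<dots> = bt (dA (h a) \<oplus>\<^bsub>A\<^esub> h (dA a)) b" using ab by (simp add: bt_add_left)
    finally show "(dE (k (bt a b)) \<oplus>\<^bsub>E\<^esub> k (dE (bt a b))) \<oplus>\<^bsub>E\<^esub> Q (bt a b) = bt a b"
      using ab by (simp add: Q(2) P_def bt_diff_left)
  qed
  have prQ: "Q e \<in> E.cyc" "prE (Q e) = prE e" if e: "e \<in> E.cyc" for e
  proof -
    have e': "dE (k e) \<oplus>\<^bsub>E\<^esub> Q e = e"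
      using homotopy[of e] e mod_hom_zero[OF E.A_module E.A_module k(1)] by simp
    have "Q e = (Q e \<oplus>\<^bsub>E\<^esub> dE (k e)) \<ominus>\<^bsub>E\<^esub> dE (k e)" using e by simp
    also have "\<dots> = e \<ominus>\<^bsub>E\<^esub> dE (k e)" using e' e by (simp add: E.A.M.a_comm)
    finally have Qe: "Q e = e \<ominus>\<^bsub>E\<^esub> dE (k e)" .
    show "Q e \<in> E.cyc" unfolding Qe using e by (intro submodule_diff[OF E.cyc_submodule]) auto
    show "prE (Q e) = prE e" unfolding Qe using e by (simp add: E.pr_diff)
  qed
  have GG: "G (G e) = e" if "e \<in> carrier E" for e
    by (rule E_hom_eq[OF E.A_module mod_hom_comp[OF G(1) G(1)] mod_hom_id _ that]) (simp add: G(2) sg_sg)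
  \<comment> \<open>The values of \<open>P\<close> are cycles, so only the term with
    \<open>dB\<close> survives on the image of \<open>Q\<close>.\<close>
  have dQ: "dE (Q e) = G (N (Q e))" if "e \<in> carrier E" for e
    by (rule E_hom_eq[OF E.A_module mod_hom_comp[OF Q(1) E.d_hom] mod_hom_comp[OF mod_hom_comp[OF Q(1) N(1)] G(1)] _ that])
      (simp add: G(2) N(2) Q(2) dE_bt dP)
  \<comment> \<open>\<open>G\<close> is an involution and can be cancelled, so the differential of
    the right factor alone annihilates \<open>Q e\<close>.\<close>
  have NQ: "N (Q e) = \<zero>\<^bsub>E\<^esub>" if e: "e \<in> E.cyc" for e
  proof -
    have "G (G (N (Q e))) = G \<zero>\<^bsub>E\<^esub>" using dQ[of e] prQ(1)[OF e] e by simp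
    then show ?thesis using GG[of "N (Q e)"] e mod_hom_zero[OF E.A_module E.A_module G(1)] by simp
  qed
  have icl: "i a s \<in> carrier R" if "a \<in> carrier A" for a s
    using mod_hom_closed[OF i that] by (simp add: free_module_carrier)
  \<comment> \<open>\<open>c s\<close> contracts the left factor with the coordinate
    \<open>s\<close> of the dual basis and lands in \<open>B\<close>.\<close>
  have "\<exists>c. c \<in> mod_hom R E B \<and> (\<forall>a\<in>carrier A. \<forall>b\<in>carrier B. c (bt a b) = i a s \<odot>\<^bsub>B\<^esub> b)" for s
  proof -
    have "bilinear_map R A B B (\<lambda>a b. i a s \<odot>\<^bsub>B\<^esub> b)"
    proof (rule bilinear_mapI)
      show "i x s \<odot>\<^bsub>B\<^esub> (a \<odot>\<^bsub>B\<^esub> y) = a \<odot>\<^bsub>B\<^esub> (i x s \<odot>\<^bsub>B\<^esub> y)"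
        if "a \<in> carrier R" "x \<in> carrier A" "y \<in> carrier B" for a x y
        using that icl by (simp flip: B.A.smult_assoc1 add: A.A.R.m_comm)
    qed (simp_all add: icl mod_hom_add[OF i] mod_hom_smult[OF i] B.A.smult_l_distr B.A.smult_r_distr
        B.A.smult_assoc1)
    from E_lift[OF B.A_module this] show ?thesis by metis
  qed
  then obtain c where c: "\<And>s. c s \<in> mod_hom R E B"
    "\<And>s a b. a \<in> carrier A \<Longrightarrow> b \<in> carrier B \<Longrightarrow> c s (bt a b) = i a s \<odot>\<^bsub>B\<^esub> b" by metis
  note [simp] = mod_hom_closed[OF c(1)]
  have cN: "c s (N e) = dB (c s e)" if "e \<in> carrier E" for s e
    by (rule E_hom_eq[OF B.A_module mod_hom_comp[OF N(1) c(1)] mod_hom_comp[OF c(1) B.d_hom] _ that])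
      (simp add: N(2) c(2) mod_hom_smult[OF B.d_hom] icl)
  define f where "f s = P (p (basis_elem R s))" for s
  have pe: "p (basis_elem R s) \<in> carrier A" if "s \<in> S" for s
    by (rule mod_hom_closed[OF p basis_elem_carrier[OF A.A.R.is_cring that]])
  have f: "f s \<in> A.cyc" if "s \<in> S" for s
    unfolding f_def using pe[OF that] dP by (intro A.cycI) auto
  have fc [simp]: "f s \<in> carrier A" if "s \<in> S" for s using f that by simp
  have Q_expand: "Q e = (\<Oplus>\<^bsub>E\<^esub>s\<in>S. bt (f s) (c s e))" if e: "e \<in> carrier E" for e
  proof (rule E_hom_eq[OF E.A_module Q(1) _ _ e])
    show "(\<lambda>e. \<Oplus>\<^bsub>E\<^esub>s\<in>S. bt (f s) (c s e)) \<in> mod_hom R E E"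
    proof (rule mod_homI)
      fix x assume x: "x \<in> carrier E"
      show "(\<Oplus>\<^bsub>E\<^esub>s\<in>S. bt (f s) (c s x)) \<in> carrier E" using x by (intro E.A.finsum_closed) auto
      { fix a assume a: "a \<in> carrier R"
        have "(\<Oplus>\<^bsub>E\<^esub>s\<in>S. bt (f s) (c s (a \<odot>\<^bsub>E\<^esub> x))) = (\<Oplus>\<^bsub>E\<^esub>s\<in>S. a \<odot>\<^bsub>E\<^esub> bt (f s) (c s x))"
          using x a by (intro E.A.finsum_cong') (auto simp: mod_hom_smult[OF c(1)] bt_smult_right)
        then show "(\<Oplus>\<^bsub>E\<^esub>s\<in>S. bt (f s) (c s (a \<odot>\<^bsub>E\<^esub> x))) = a \<odot>\<^bsub>E\<^esub> (\<Oplus>\<^bsub>E\<^esub>s\<in>S. bt (f s) (c s x))"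
          using x a S by (subst E.A.finsum_smult_ldistr) auto }
      fix y assume y: "y \<in> carrier E"
      have "(\<Oplus>\<^bsub>E\<^esub>s\<in>S. bt (f s) (c s (x \<oplus>\<^bsub>E\<^esub> y))) = (\<Oplus>\<^bsub>E\<^esub>s\<in>S. bt (f s) (c s x) \<oplus>\<^bsub>E\<^esub> bt (f s) (c s y))"
        using x y by (intro E.A.finsum_cong') (auto simp: mod_hom_add[OF c(1)] bt_add_right)
      then show "(\<Oplus>\<^bsub>E\<^esub>s\<in>S. bt (f s) (c s (x \<oplus>\<^bsub>E\<^esub> y))) =
          (\<Oplus>\<^bsub>E\<^esub>s\<in>S. bt (f s) (c s x)) \<oplus>\<^bsub>E\<^esub> (\<Oplus>\<^bsub>E\<^esub>s\<in>S. bt (f s) (c s y))"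
        using x y by (subst E.A.finsum_addf[symmetric]) auto
    qed
    fix a b assume ab: "a \<in> carrier A" "b \<in> carrier B"
    have hom: "(\<lambda>x. bt (P x) b) \<in> mod_hom R A E"
      by (rule mod_hom_comp[OF P bilinear_left[OF bt_bilinear ab(2)]])
    have "Q (bt a b) = bt (P a) b" using ab by (simp add: Q(2))
    also have "\<dots> = bt (P (\<Oplus>\<^bsub>A\<^esub>s\<in>S. i a s \<odot>\<^bsub>A\<^esub> p (basis_elem R s))) b"
      using finite_retract_expand[OF A.A_module ret ab(1)] by simp
    also have "\<dots> = (\<Oplus>\<^bsub>E\<^esub>s\<in>S. bt (P (i a s \<odot>\<^bsub>A\<^esub> p (basis_elem R s))) b)"
      using ab pe icl by (intro mod_hom_finsum[OF A.A_module E.A_module hom S]) auto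
    also have "\<dots> = (\<Oplus>\<^bsub>E\<^esub>s\<in>S. bt (f s) (c s (bt a b)))"
      using ab pe icl by (intro E.A.finsum_cong')
        (auto simp: mod_hom_smult[OF P] bt_smult_left bt_smult_right f_def c(2))
    finally show "Q (bt a b) = (\<Oplus>\<^bsub>E\<^esub>s\<in>S. bt (f s) (c s (bt a b)))" .
  qed
  fix e assume e: "e \<in> E.cyc"
  have Qe: "Q e \<in> carrier E" using prQ(1)[OF e] by simp
  \<comment> \<open>\<open>Q\<close> is applied twice for two reasons: the inner one makes the
    coefficients in \<open>B\<close> cycles, the outer one replaces the dual basis vectors in
    \<open>A\<close> by cycles.\<close>
  have "prE e = prE (Q (Q e))" using prQ[OF e] prQ[OF prQ(1)[OF e]] by simp
  also have "Q (Q e) = (\<Oplus>\<^bsub>E\<^esub>s\<in>S. bt (f s) (c s (Q e)))" by (rule Q_expand[OF Qe])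
  also have "prE \<dots> \<in> cross ` carrier T"
  proof (rule cross_sum_bt[OF S f])
    show "c s (Q e) \<in> B.cyc" if "s \<in> S" for s
      using cN[OF Qe, of s] NQ[OF e] mod_hom_zero[OF E.A_module B.A_module c(1)] Qe by (intro B.cycI) auto
  qed
  finally show "prE e \<in> cross ` carrier T" .
qed

text \<open>The argument mirrors that for the left factor. The homotopy is
  \<open>bt (sg x) (h y)\<close>, whose sign operator itself produces the cancellation, so every
  splitting \<open>h\<close> of \<open>dB\<close> serves; the differential of the left factor then
  appears without a sign.\<close>

lemma cross_surj_right:
  assumes h: "h \<in> mod_hom R B B" and dhd: "\<And>b. b \<in> carrier B \<Longrightarrow> dB (h (dB b)) = dB b"
    and ret: "finite_retract R B S i p"
  shows "cross ` carrier T = carrier HE"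
proof (rule cross_surjI)
  have S: "finite S" and i: "i \<in> mod_hom R B (free_module R S)"
    and p: "p \<in> mod_hom R (free_module R S) B"
    using ret by (auto simp: finite_retract_def)
  note [simp] = mod_hom_closed[OF h]
  define P where "P a = a \<ominus>\<^bsub>B\<^esub> (dB (h a) \<oplus>\<^bsub>B\<^esub> h (dB a))" for a
  have P: "P \<in> mod_hom R B B" unfolding P_def
    by (intro mod_hom_sub mod_hom_plus mod_hom_id mod_hom_comp[OF h B.d_hom] mod_hom_comp[OF B.d_hom h] B.A_module)
  note [simp] = mod_hom_closed[OF P]
  have dP: "dB (P a) = \<zero>\<^bsub>B\<^esub>" if "a \<in> carrier B" for a
    using that by (simp add: P_def mod_hom_diff[OF B.A_module B.A_module B.d_hom] mod_hom_add[OF B.d_hom] B.d_d dhd)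
  obtain k where k: "k \<in> mod_hom R E E" "\<And>x y. x \<in> carrier A \<Longrightarrow> y \<in> carrier B \<Longrightarrow> k (bt x y) = bt (sg x) (h y)"
    by (rule E_lift_hom[OF sg_hom h]) (rule that)
  obtain Q where Q: "Q \<in> mod_hom R E E" "\<And>x y. x \<in> carrier A \<Longrightarrow> y \<in> carrier B \<Longrightarrow> Q (bt x y) = bt x (P y)"
    by (rule E_lift_hom[OF mod_hom_id P]) (rule that)
  obtain N where N: "N \<in> mod_hom R E E" "\<And>x y. x \<in> carrier A \<Longrightarrow> y \<in> carrier B \<Longrightarrow> N (bt x y) = bt (dA x) y"
    by (rule E_lift_hom[OF A.d_hom mod_hom_id]) (rule that)
  note [simp] = mod_hom_closed[OF Q(1)] mod_hom_closed[OF N(1)] mod_hom_closed[OF k(1)]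
  have homotopy: "(dE (k e) \<oplus>\<^bsub>E\<^esub> k (dE e)) \<oplus>\<^bsub>E\<^esub> Q e = e" if e: "e \<in> carrier E" for e
  proof (rule E_hom_eq[OF E.A_module _ mod_hom_id _ e])
    show "(\<lambda>e. (dE (k e) \<oplus>\<^bsub>E\<^esub> k (dE e)) \<oplus>\<^bsub>E\<^esub> Q e) \<in> mod_hom R E E"
      by (intro mod_hom_plus E.A_module mod_hom_comp[OF k(1) E.d_hom] mod_hom_comp[OF E.d_hom k(1)] Q(1))
    fix a b assume ab: "a \<in> carrier A" "b \<in> carrier B"
    \<comment> \<open>The two terms containing \<open>h b\<close> cancel because \<open>dA\<close>
      anticommutes with \<open>sg\<close>.\<close>
    have "dE (k (bt a b)) \<oplus>\<^bsub>E\<^esub> k (dE (bt a b)) =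
        (\<ominus>\<^bsub>E\<^esub> bt (sg (dA a)) (h b) \<oplus>\<^bsub>E\<^esub> bt a (dB (h b))) \<oplus>\<^bsub>E\<^esub> (bt (sg (dA a)) (h b) \<oplus>\<^bsub>E\<^esub> bt a (h (dB b)))"
      using ab by (simp add: k dE_bt mod_hom_add[OF k(1)] dA_sg bt_minus_left sg_sg)
    also have "\<dots> = bt a (dB (h b)) \<oplus>\<^bsub>E\<^esub> bt a (h (dB b))"
      using ab by (simp add: E.A.M.a_ac E.A.M.r_neg E.A.M.r_neg1 E.A.M.r_neg2)
    also have "\<dots> = bt a (dB (h b) \<oplus>\<^bsub>B\<^esub> h (dB b))" using ab by (simp add: bt_add_right)
    finally show "(dE (k (bt a b)) \<oplus>\<^bsub>E\<^esub> k (dE (bt a b))) \<oplus>\<^bsub>E\<^esub> Q (bt a b) = bt a b"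
      using ab by (simp add: Q(2) P_def bt_diff_right)
  qed
  have prQ: "Q e \<in> E.cyc" "prE (Q e) = prE e" if e: "e \<in> E.cyc" for e
  proof -
    have e': "dE (k e) \<oplus>\<^bsub>E\<^esub> Q e = e"
      using homotopy[of e] e mod_hom_zero[OF E.A_module E.A_module k(1)] by simp
    have "Q e = (Q e \<oplus>\<^bsub>E\<^esub> dE (k e)) \<ominus>\<^bsub>E\<^esub> dE (k e)" using e by simp
    also have "\<dots> = e \<ominus>\<^bsub>E\<^esub> dE (k e)" using e' e by (simp add: E.A.M.a_comm)
    finally have Qe: "Q e = e \<ominus>\<^bsub>E\<^esub> dE (k e)" .
    show "Q e \<in> E.cyc" unfolding Qe using e by (intro submodule_diff[OF E.cyc_submodule]) auto
    show "prE (Q e) = prE e" unfolding Qe using e by (simp add: E.pr_diff)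
  qed
  have dQ: "dE (Q e) = N (Q e)" if "e \<in> carrier E" for e
    by (rule E_hom_eq[OF E.A_module mod_hom_comp[OF Q(1) E.d_hom] mod_hom_comp[OF Q(1) N(1)] _ that])
      (simp add: N(2) Q(2) dE_bt dP)
  have icl: "i a s \<in> carrier R" if "a \<in> carrier B" for a s
    using mod_hom_closed[OF i that] by (simp add: free_module_carrier)
  have "\<exists>c. c \<in> mod_hom R E A \<and> (\<forall>a\<in>carrier A. \<forall>b\<in>carrier B. c (bt a b) = i b s \<odot>\<^bsub>A\<^esub> a)" for s
  proof -
    have "bilinear_map R A B A (\<lambda>a b. i b s \<odot>\<^bsub>A\<^esub> a)"
    proof (rule bilinear_mapI)
      show "i y s \<odot>\<^bsub>A\<^esub> (a \<odot>\<^bsub>A\<^esub> x) = a \<odot>\<^bsub>A\<^esub> (i y s \<odot>\<^bsub>A\<^esub> x)"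
        if "a \<in> carrier R" "x \<in> carrier A" "y \<in> carrier B" for a x y
        using that icl by (simp flip: A.A.smult_assoc1 add: A.A.R.m_comm)
    qed (simp_all add: icl mod_hom_add[OF i] mod_hom_smult[OF i] A.A.smult_l_distr A.A.smult_r_distr
        A.A.smult_assoc1)
    from E_lift[OF A.A_module this] show ?thesis by metis
  qed
  then obtain c where c: "\<And>s. c s \<in> mod_hom R E A"
    "\<And>s a b. a \<in> carrier A \<Longrightarrow> b \<in> carrier B \<Longrightarrow> c s (bt a b) = i b s \<odot>\<^bsub>A\<^esub> a" by metis
  note [simp] = mod_hom_closed[OF c(1)]
  have cN: "c s (N e) = dA (c s e)" if "e \<in> carrier E" for s e
    by (rule E_hom_eq[OF A.A_module mod_hom_comp[OF N(1) c(1)] mod_hom_comp[OF c(1) A.d_hom] _ that])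
      (simp add: N(2) c(2) mod_hom_smult[OF A.d_hom] icl)
  define f where "f s = P (p (basis_elem R s))" for s
  have pe: "p (basis_elem R s) \<in> carrier B" if "s \<in> S" for s
    by (rule mod_hom_closed[OF p basis_elem_carrier[OF A.A.R.is_cring that]])
  have f: "f s \<in> B.cyc" if "s \<in> S" for s
    unfolding f_def using pe[OF that] dP by (intro B.cycI) auto
  have fc [simp]: "f s \<in> carrier B" if "s \<in> S" for s using f that by simp
  have Q_expand: "Q e = (\<Oplus>\<^bsub>E\<^esub>s\<in>S. bt (c s e) (f s))" if e: "e \<in> carrier E" for e
  proof (rule E_hom_eq[OF E.A_module Q(1) _ _ e])
    show "(\<lambda>e. \<Oplus>\<^bsub>E\<^esub>s\<in>S. bt (c s e) (f s)) \<in> mod_hom R E E"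
    proof (rule mod_homI)
      fix x assume x: "x \<in> carrier E"
      show "(\<Oplus>\<^bsub>E\<^esub>s\<in>S. bt (c s x) (f s)) \<in> carrier E" using x by (intro E.A.finsum_closed) auto
      { fix a assume a: "a \<in> carrier R"
        have "(\<Oplus>\<^bsub>E\<^esub>s\<in>S. bt (c s (a \<odot>\<^bsub>E\<^esub> x)) (f s)) = (\<Oplus>\<^bsub>E\<^esub>s\<in>S. a \<odot>\<^bsub>E\<^esub> bt (c s x) (f s))"
          using x a by (intro E.A.finsum_cong') (auto simp: mod_hom_smult[OF c(1)] bt_smult_left)
        then show "(\<Oplus>\<^bsub>E\<^esub>s\<in>S. bt (c s (a \<odot>\<^bsub>E\<^esub> x)) (f s)) = a \<odot>\<^bsub>E\<^esub> (\<Oplus>\<^bsub>E\<^esub>s\<in>S. bt (c s x) (f s))"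
          using x a S by (subst E.A.finsum_smult_ldistr) auto }
      fix y assume y: "y \<in> carrier E"
      have "(\<Oplus>\<^bsub>E\<^esub>s\<in>S. bt (c s (x \<oplus>\<^bsub>E\<^esub> y)) (f s)) = (\<Oplus>\<^bsub>E\<^esub>s\<in>S. bt (c s x) (f s) \<oplus>\<^bsub>E\<^esub> bt (c s y) (f s))"
        using x y by (intro E.A.finsum_cong') (auto simp: mod_hom_add[OF c(1)] bt_add_left)
      then show "(\<Oplus>\<^bsub>E\<^esub>s\<in>S. bt (c s (x \<oplus>\<^bsub>E\<^esub> y)) (f s)) =
          (\<Oplus>\<^bsub>E\<^esub>s\<in>S. bt (c s x) (f s)) \<oplus>\<^bsub>E\<^esub> (\<Oplus>\<^bsub>E\<^esub>s\<in>S. bt (c s y) (f s))"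
        using x y by (subst E.A.finsum_addf[symmetric]) auto
    qed
    fix a b assume ab: "a \<in> carrier A" "b \<in> carrier B"
    have hom: "(\<lambda>x. bt a (P x)) \<in> mod_hom R B E"
      by (rule mod_hom_comp[OF P bilinear_right[OF bt_bilinear ab(1)]])
    have "Q (bt a b) = bt a (P b)" using ab by (simp add: Q(2))
    also have "\<dots> = bt a (P (\<Oplus>\<^bsub>B\<^esub>s\<in>S. i b s \<odot>\<^bsub>B\<^esub> p (basis_elem R s)))"
      using finite_retract_expand[OF B.A_module ret ab(2)] by simp
    also have "\<dots> = (\<Oplus>\<^bsub>E\<^esub>s\<in>S. bt a (P (i b s \<odot>\<^bsub>B\<^esub> p (basis_elem R s))))"
      using ab pe icl by (intro mod_hom_finsum[OF B.A_module E.A_module hom S]) auto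
    also have "\<dots> = (\<Oplus>\<^bsub>E\<^esub>s\<in>S. bt (c s (bt a b)) (f s))"
      using ab pe icl by (intro E.A.finsum_cong')
        (auto simp: mod_hom_smult[OF P] bt_smult_left bt_smult_right f_def c(2))
    finally show "Q (bt a b) = (\<Oplus>\<^bsub>E\<^esub>s\<in>S. bt (c s (bt a b)) (f s))" .
  qed
  fix e assume e: "e \<in> E.cyc"
  have Qe: "Q e \<in> carrier E" using prQ(1)[OF e] by simp
  have "prE e = prE (Q (Q e))" using prQ[OF e] prQ[OF prQ(1)[OF e]] by simp
  also have "Q (Q e) = (\<Oplus>\<^bsub>E\<^esub>s\<in>S. bt (c s (Q e)) (f s))" by (rule Q_expand[OF Qe])
  also have "prE \<dots> \<in> cross ` carrier T"
  proof (rule cross_sum_bt[OF S _ f])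
    show "c s (Q e) \<in> A.cyc" if "s \<in> S" for s
      using cN[OF Qe, of s] dQ[of e] prQ(1)[OF e] e mod_hom_zero[OF E.A_module A.A_module c(1)] Qe
      by (intro A.cycI) auto
  qed
  finally show "prE e \<in> cross ` carrier T" .
qed

end

section \<open>Bigradings\<close>

text \<open>The grading is carried by the projections \<open>rho\<close>, which turns direct-sum
  arguments into computations with linear maps. Each element has finitely many components, in a set
  of degrees that may depend on the element.\<close>

locale bigrading =
  fixes R :: "('r, 's) ring_scheme" and M :: "('r, 'a, 'm) module_scheme"
    and gr :: "int \<times> int \<Rightarrow> 'a set" and rho :: "int \<times> int \<Rightarrow> 'a \<Rightarrow> 'a"
  assumes M_module: "module R M"
    and rho_hom: "rho u \<in> mod_hom R M M"
    and rho_gr: "x \<in> carrier M \<Longrightarrow> rho u x \<in> gr u"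
    and gr_rho: "x \<in> gr u \<Longrightarrow> rho u x = x"
    and gr_carrier: "gr u \<subseteq> carrier M"
    and rho_gr_other: "x \<in> gr v \<Longrightarrow> u \<noteq> v \<Longrightarrow> rho u x = \<zero>\<^bsub>M\<^esub>"
    and gr_sum: "x \<in> carrier M \<Longrightarrow> \<exists>U. finite U \<and> x = (\<Oplus>\<^bsub>M\<^esub>u\<in>U. rho u x)"
begin

lemma rho_closed [simp]: "x \<in> carrier M \<Longrightarrow> rho u x \<in> carrier M"
  by (rule mod_hom_closed[OF rho_hom])

lemma gr_iff: "x \<in> gr u \<longleftrightarrow> x \<in> carrier M \<and> rho u x = x"
  using rho_gr gr_rho gr_carrier by (metis subsetD)

lemma gr_submodule: "submodule (gr u) R M"
proof -
  interpret M: module R M by (rule M_module)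
  show ?thesis
    by (rule M.submoduleI)
      (auto simp: gr_iff mod_hom_zero[OF M_module M_module rho_hom] mod_hom_minus[OF M_module M_module rho_hom]
        mod_hom_add[OF rho_hom] mod_hom_smult[OF rho_hom])
qed

lemma gr_span: "carrier M \<subseteq> mod_span R M (\<Union>u. gr u)"
proof
  fix x assume x: "x \<in> carrier M"
  then obtain U where U: "finite U" "x = (\<Oplus>\<^bsub>M\<^esub>u\<in>U. rho u x)" using gr_sum by blast
  have "(\<Oplus>\<^bsub>M\<^esub>u\<in>U. rho u x) \<in> mod_span R M (\<Union>u. gr u)"
  proof (rule submodule_finsum[OF M_module submodule_span[OF M_module] U(1)])
    show "(\<Union>u. gr u) \<subseteq> carrier M" using gr_carrier by blast
    show "(\<lambda>u. rho u x) \<in> U \<rightarrow> mod_span R M (\<Union>u. gr u)" using rho_gr[OF x] by (blast intro: mod_span_base)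
  qed
  then show "x \<in> mod_span R M (\<Union>u. gr u)" using U(2) by simp
qed

end

text \<open>The projections send cycles to cycles, as \<open>d\<close> intertwines
  \<open>rho u\<close> with \<open>rho (sh u)\<close>. Surjectivity of the shift enters for
  boundaries: the component of \<open>d x\<close> in degree \<open>u\<close> is \<open>d\<close> of
  the component of \<open>x\<close> in a degree that \<open>sh\<close> moves to
  \<open>u\<close>.\<close>

lemma (in presented_homology) homology_bigrading:
  assumes gr: "bigrading R A gr rho" and sh: "surj sh"
    and d_rho: "\<And>u x. x \<in> carrier A \<Longrightarrow> d (rho u x) = rho (sh u) (d x)"
  obtains rho' where "bigrading R H (\<lambda>u. pr ` (cyc \<inter> gr u)) rho'"
    "\<And>u z. z \<in> cyc \<Longrightarrow> rho' u (pr z) = pr (rho u z)"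
proof -
  interpret gr: bigrading R A gr rho by (rule gr)
  have rho_cyc [simp]: "rho u z \<in> cyc" if "z \<in> cyc" for u z
    using that mod_hom_zero[OF A_module A_module gr.rho_hom] by (intro cycI) (simp_all add: d_rho)
  have hom: "(\<lambda>z. pr (rho u z)) \<in> mod_hom R (A\<lparr>carrier := cyc\<rparr>) H" for u
  proof -
    have "rho u \<in> mod_hom R (A\<lparr>carrier := cyc\<rparr>) (A\<lparr>carrier := cyc\<rparr>)"
      by (rule mod_hom_into_submodule[OF mod_hom_submodule[OF cyc_submodule gr.rho_hom]]) simp
    then show ?thesis by (rule mod_hom_comp[OF _ pr_cyc_hom])
  qed
  have surj: "pr ` carrier (A\<lparr>carrier := cyc\<rparr>) = carrier H" using pr_surj unfolding cyc_def by simp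
  have "\<exists>f. f \<in> mod_hom R H H \<and> (\<forall>z\<in>cyc. f (pr z) = pr (rho u z))" for u
  proof -
    have wd: "pr (rho u z) = pr (rho u w)" if zw: "z \<in> cyc" "w \<in> cyc" "pr z = pr w" for z w
    proof -
      obtain x where x: "x \<in> carrier A" "z = w \<oplus>\<^bsub>A\<^esub> d x" using pr_eqE[OF zw] .
      obtain v where v: "u = sh v" using sh by (rule surjE)
      have "rho u z = rho u w \<oplus>\<^bsub>A\<^esub> d (rho v x)"
        using x zw by (simp add: mod_hom_add[OF gr.rho_hom] v d_rho)
      then show ?thesis using x zw by (simp add: pr_add)
    qed
    obtain f where "f \<in> mod_hom R H H" "\<And>z. z \<in> carrier (A\<lparr>carrier := cyc\<rparr>) \<Longrightarrow> f (pr z) = pr (rho u z)"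
    proof (rule surjection_factor[OF cyc_module H_module pr_cyc_hom surj hom])
      show "pr (rho u z) = pr (rho u w)"
        if "z \<in> carrier (A\<lparr>carrier := cyc\<rparr>)" "w \<in> carrier (A\<lparr>carrier := cyc\<rparr>)" "pr z = pr w" for z w
        by (rule wd) (use that in simp_all)
    qed (rule that)
    then show ?thesis by auto
  qed
  then obtain rho' where r: "\<And>u. rho' u \<in> mod_hom R H H"
    "\<And>u z. z \<in> cyc \<Longrightarrow> rho' u (pr z) = pr (rho u z)" by metis
  have "bigrading R H (\<lambda>u. pr ` (cyc \<inter> gr u)) rho'"
  proof
    show "rho' u \<in> mod_hom R H H" for u by (rule r)
    show "rho' u x \<in> pr ` (cyc \<inter> gr u)" if "x \<in> carrier H" for x u
    proof -
      from that obtain z where z: "z \<in> cyc" "x = pr z" by (rule prE)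
      then show ?thesis using r(2)[OF z(1), of u] gr.rho_gr[of z u] rho_cyc[of z u] by auto
    qed
    show "rho' u x = x" if "x \<in> pr ` (cyc \<inter> gr u)" for x u
      using that r(2)[of _ u] gr.gr_rho[of _ u] by auto
    show "pr ` (cyc \<inter> gr u) \<subseteq> carrier H" for u by auto
    show "rho' u x = \<zero>\<^bsub>H\<^esub>" if "x \<in> pr ` (cyc \<inter> gr v)" "u \<noteq> v" for x u v
      using that r(2)[of _ u] gr.rho_gr_other[of _ v u] pr_zero by auto
    show "\<exists>U. finite U \<and> x = (\<Oplus>\<^bsub>H\<^esub>u\<in>U. rho' u x)" if "x \<in> carrier H" for x
    proof -
      from that obtain z where z: "z \<in> cyc" "x = pr z" by (rule prE)
      obtain U where U: "finite U" "z = (\<Oplus>\<^bsub>A\<^esub>u\<in>U. rho u z)" using gr.gr_sum[of z] z by auto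
      have "pr (\<Oplus>\<^bsub>A\<^esub>u\<in>U. rho u z) = (\<Oplus>\<^bsub>H\<^esub>u\<in>U. rho' u x)"
        using U(1)
      proof (induction U rule: finite_induct)
        case (insert u U)
        have "(\<Oplus>\<^bsub>A\<^esub>u\<in>U. rho u z) \<in> cyc"
          using insert z by (intro submodule_finsum[OF A_module cyc_submodule]) auto
        then show ?case
          using insert z mod_hom_closed[OF r(1) that] by (simp add: Pi_def pr_add r(2))
      qed (simp add: pr_zero)
      then show ?thesis using U z by metis
    qed
  qed
  then show thesis using r(2) by (rule that)
qed

text \<open>A homogeneous \<open>y\<close> has a preimage \<open>t\<close> in the span of the
  homogeneous generators. Projecting \<open>f t\<close> to degree \<open>u\<close> kills the
  generators of other degrees, and what remains comes from generators of degree \<open>u\<close>.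
  Surjectivity of the total map thus determines the image of every graded piece.\<close>

lemma graded_surjection_image:
  fixes G :: "int \<times> int \<Rightarrow> 'a set"
  assumes gr: "bigrading R H gr rho" and T: "module R T"
    and f: "f \<in> mod_hom R T H" "f ` carrier T = carrier H"
    and G: "\<And>u. G u \<subseteq> carrier T" "carrier T \<subseteq> mod_span R T (\<Union>u. G u)" "\<And>u x. x \<in> G u \<Longrightarrow> f x \<in> gr u"
  shows "f ` mod_span R T (G u) = gr u"
proof
  interpret gr: bigrading R H gr rho by (rule gr)
  interpret T: module R T by (rule T)
  interpret H: module R H by (rule gr.M_module)
  have sub: "submodule (mod_span R T (G u)) R T" by (rule submodule_span[OF T G(1)])
  show "f ` mod_span R T (G u) \<subseteq> gr u"
    using mod_hom_span_into[OF T gr.M_module f(1) gr.gr_submodule[of u] G(3)[of _ u] G(1)[of u]] by blast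
  have im: "submodule (f ` mod_span R T (G u)) R H"
    using submodule_image[OF submodule_module[OF T sub] gr.M_module mod_hom_submodule[OF sub f(1)]] by simp
  show "gr u \<subseteq> f ` mod_span R T (G u)"
  proof
    fix y assume y: "y \<in> gr u"
    then obtain t where t: "t \<in> carrier T" "y = f t" using f(2) gr.gr_carrier by (metis imageE subsetD)
    have "rho u (f t) \<in> f ` mod_span R T (G u)"
    proof (rule mod_hom_span_into[OF T gr.M_module mod_hom_comp[OF f(1) gr.rho_hom] im])
      show "t \<in> mod_span R T (\<Union>u. G u)" using t G(2) by auto
      show "rho u (f x) \<in> f ` mod_span R T (G u)" if "x \<in> (\<Union>u. G u)" for x
      proof -
        from that obtain v where v: "x \<in> G v" by blast
        show ?thesis
        proof (cases "u = v")
          case True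
          then have "rho u (f x) = f x" using G(3)[OF v] gr.gr_rho by blast
          then show ?thesis using v True mod_span_base by (metis imageI)
        next
          case False
          then have "rho u (f x) = \<zero>\<^bsub>H\<^esub>" using gr.rho_gr_other[OF G(3)[OF v]] by blast
          then show ?thesis using submodule_zero[OF im] by simp
        qed
      qed
    qed (use G(1) in blast)
    then show "y \<in> f ` mod_span R T (G u)" using t y gr.gr_rho by simp
  qed
qed

section \<open>Graded generators and the differential of a tensor product\<close>

lemma tensor_span_generators:
  assumes M: "module R M" and N: "module R N"
    and SM: "SM \<subseteq> carrier M" "carrier M \<subseteq> mod_span R M SM"
    and SN: "SN \<subseteq> carrier N" "carrier N \<subseteq> mod_span R N SN"
  shows "carrier (tensor_module R M N) \<subseteq>
    mod_span R (tensor_module R M N) {pure_tensor R M N x y | x y. x \<in> SM \<and> y \<in> SN}"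
proof -
  let ?T = "tensor_module R M N" and ?S = "{pure_tensor R M N x y | x y. x \<in> SM \<and> y \<in> SN}"
  note T = tensor_module_module[OF M N] and bl = pure_tensor_bilinear[OF M N]
  have S: "?S \<subseteq> carrier ?T" using SM(1) SN(1) tensor_pure_closed[OF M N] by blast
  note sub = submodule_span[OF T S]
  have 1: "pure_tensor R M N x y \<in> mod_span R ?T ?S" if x: "x \<in> carrier M" and y: "y \<in> SN" for x y
  proof (rule mod_hom_span_into[OF M T bilinear_left[OF bl] sub _ SM(1)])
    show "pure_tensor R M N a y \<in> mod_span R ?T ?S" if "a \<in> SM" for a using that y by (intro mod_span_base) blast
  qed (use x y SM SN in auto)
  have 2: "pure_tensor R M N x y \<in> mod_span R ?T ?S" if x: "x \<in> carrier M" and y: "y \<in> carrier N" for x y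
    by (rule mod_hom_span_into[OF N T bilinear_right[OF bl x] sub 1[OF x] SN(1)]) (use y SN in auto)
  have "mod_span R ?T {pure_tensor R M N x y | x y. x \<in> carrier M \<and> y \<in> carrier N} \<subseteq> mod_span R ?T ?S"
    by (rule mod_span_minimal[OF sub]) (use 2 in auto)
  then show ?thesis using tensor_span[OF M N] by blast
qed

text \<open>The formula with \<open>g\<close> is bilinear on all elements, so a linear map
  satisfying it exists; on homogeneous \<open>x\<close> the operator \<open>g\<close> is the sign of
  the definition. Tensors with a homogeneous left factor span, which gives the uniqueness that the
  definite description requires.\<close>

lemma tensor_diff_spec:
  assumes gr: "bigrading R (total C) (part C) rho" and D: "module R (total D)"
    and dC: "diff C \<in> mod_hom R (total C) (total C)" and dD: "diff D \<in> mod_hom R (total D) (total D)"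
    and g: "g \<in> mod_hom R (total C) (total C)"
    and g_part: "\<And>a b x. x \<in> part C (a, b) \<Longrightarrow> g x = ring_sign R (a + b) \<odot>\<^bsub>total C\<^esub> x"
  shows "tensor_diff R C D \<in> mod_hom R (tensor_module R (total C) (total D)) (tensor_module R (total C) (total D))"
    and "x \<in> carrier (total C) \<Longrightarrow> y \<in> carrier (total D) \<Longrightarrow>
      tensor_diff R C D (pure_tensor R (total C) (total D) x y) =
        pure_tensor R (total C) (total D) (diff C x) y \<oplus>\<^bsub>tensor_module R (total C) (total D)\<^esub>
        pure_tensor R (total C) (total D) (g x) (diff D y)"
proof -
  interpret gr: bigrading R "total C" "part C" rho by (rule gr)
  note C = gr.M_module
  interpret C: module R "total C" by (rule C)
  interpret D: module R "total D" by (rule D)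
  let ?T = "tensor_module R (total C) (total D)" and ?t = "pure_tensor R (total C) (total D)"
  note T = tensor_module_module[OF C D] and bl = pure_tensor_bilinear[OF C D]
  interpret T: module R ?T by (rule T)
  have sign: "ring_sign R k \<in> carrier R" for k by (simp add: ring_sign_def)
  let ?P = "\<lambda>d. d \<in> mod_hom R ?T ?T \<and> d \<in> extensional (carrier ?T) \<and>
       (\<forall>a b. \<forall>x\<in>part C (a, b). \<forall>y\<in>carrier (total D).
          d (?t x y) = ?t (diff C x) y \<oplus>\<^bsub>?T\<^esub> ring_sign R (a + b) \<odot>\<^bsub>?T\<^esub> ?t x (diff D y))"
  have "bilinear_map R (total C) (total D) ?T (\<lambda>x y. ?t (diff C x) y \<oplus>\<^bsub>?T\<^esub> ?t (g x) (diff D y))"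
    by (intro bilinear_plus T bilinear_comp[OF bl dC mod_hom_id mod_hom_id] bilinear_comp[OF bl g dD mod_hom_id])
  then obtain d0 where d0: "d0 \<in> mod_hom R ?T ?T"
    "\<And>x y. x \<in> carrier (total C) \<Longrightarrow> y \<in> carrier (total D) \<Longrightarrow>
       d0 (?t x y) = ?t (diff C x) y \<oplus>\<^bsub>?T\<^esub> ?t (g x) (diff D y)"
    by (rule tensor_lift[OF C D T]) (rule that)
  \<comment> \<open>Restriction to the carrier makes the map extensional, so that uniqueness is an
    equality of functions.\<close>
  define d where "d = restrict d0 (carrier ?T)"
  have d: "d \<in> mod_hom R ?T ?T" by (rule mod_hom_cong[OF T d0(1)]) (simp add: d_def)
  have dt: "d (?t x y) = ?t (diff C x) y \<oplus>\<^bsub>?T\<^esub> ?t (g x) (diff D y)"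
    if "x \<in> carrier (total C)" "y \<in> carrier (total D)" for x y
    using d0(2)[OF that] tensor_pure_closed[OF C D that] by (simp add: d_def)
  have P: "?P d"
  proof (intro conjI allI ballI)
    fix a b x y assume x: "x \<in> part C (a, b)" and y: "y \<in> carrier (total D)"
    have xC: "x \<in> carrier (total C)" using x gr.gr_carrier by blast
    have "?t (g x) (diff D y) = ring_sign R (a + b) \<odot>\<^bsub>?T\<^esub> ?t x (diff D y)"
      using mod_hom_smult[OF bilinear_left[OF bl mod_hom_closed[OF dD y]] sign xC] g_part[OF x] by simp
    then show "d (?t x y) = ?t (diff C x) y \<oplus>\<^bsub>?T\<^esub> ring_sign R (a + b) \<odot>\<^bsub>?T\<^esub> ?t x (diff D y)"
      using dt[OF xC y] by simp
  qed (use d in \<open>auto simp: d_def\<close>)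
  have uniq: "d' = d" if P': "?P d'" for d'
  proof (rule extensionalityI)
    show "d' \<in> extensional (carrier ?T)" "d \<in> extensional (carrier ?T)" using P P' by auto
    fix z assume z: "z \<in> carrier ?T"
    let ?S = "{?t x y | x y. x \<in> (\<Union>u. part C u) \<and> y \<in> carrier (total D)}"
    have UC: "(\<Union>u. part C u) \<subseteq> carrier (total C)" using gr.gr_carrier by blast
    show "d' z = d z"
    proof (rule mod_hom_span_eq[OF T T _ d _ _ _ z, of d' ?S])
      show "d' \<in> mod_hom R ?T ?T" using P' by blast
      have "carrier (total D) \<subseteq> mod_span R (total D) (carrier (total D))" by (auto intro: mod_span_base)
      then show "carrier ?T \<subseteq> mod_span R ?T ?S"
        by (intro tensor_span_generators[OF C D UC gr.gr_span]) auto
      show "?S \<subseteq> carrier ?T" using UC tensor_pure_closed[OF C D] by blast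
      fix s assume "s \<in> ?S"
      then obtain a b x y where "s = ?t x y" "x \<in> part C (a, b)" "y \<in> carrier (total D)" by auto
      then show "d' s = d s" using P P' by simp
    qed
  qed
  have "tensor_diff R C D = d"
    unfolding tensor_diff_def Let_def using P uniq by (intro the_equality) blast+
  then show "tensor_diff R C D \<in> mod_hom R ?T ?T"
    and "x \<in> carrier (total C) \<Longrightarrow> y \<in> carrier (total D) \<Longrightarrow>
      tensor_diff R C D (?t x y) = ?t (diff C x) y \<oplus>\<^bsub>?T\<^esub> ?t (g x) (diff D y)"
    using d dt by simp_all
qed

section \<open>Homology of a complex\<close>

lemma coset_carrier_update: "B +>\<^bsub>M\<lparr>carrier := Z\<rparr>\<^esub> x = B +>\<^bsub>M\<^esub> x"
  by (simp add: a_r_coset_def r_coset_def)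

lemma complex_homology_presented:
  assumes C: "module R (total C)" and d: "diff C \<in> mod_hom R (total C) (total C)"
    and dd: "\<And>x. x \<in> carrier (total C) \<Longrightarrow> diff C (diff C x) = \<zero>\<^bsub>total C\<^esub>"
  shows "presented_homology R (total C) (total (complex_homology C)) (diff C) (\<lambda>x. diff_image C +>\<^bsub>total C\<^esub> x)"
proof -
  interpret C: module R "total C" by (rule C)
  let ?Z = "diff_kernel C" and ?B = "diff_image C"
  have Z: "submodule ?Z R (total C)" unfolding diff_kernel_def by (rule submodule_kernel[OF C C d])
  have B: "submodule ?B R (total C)" unfolding diff_image_def by (rule submodule_image[OF C C d])
  have BZ: "?B \<subseteq> ?Z" unfolding diff_image_def diff_kernel_def using dd mod_hom_closed[OF d] by auto
  note Zm = submodule_module[OF C Z] and BZs = submodule_restrict[OF C Z B BZ]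
  show ?thesis
  proof (rule presented_homology.intro)
    show "module R (total (complex_homology C))"
      unfolding complex_homology_def using quot_module_module[OF Zm BZs] by simp
    show "(\<lambda>x. ?B +>\<^bsub>total C\<^esub> x) \<in> mod_hom R (total C\<lparr>carrier := {x \<in> carrier (total C). diff C x = \<zero>\<^bsub>total C\<^esub>}\<rparr>) (total (complex_homology C))"
      unfolding complex_homology_def using quot_module_proj[OF Zm BZs]
      by (simp add: coset_carrier_update diff_kernel_def)
    show "(\<lambda>x. ?B +>\<^bsub>total C\<^esub> x) ` {x \<in> carrier (total C). diff C x = \<zero>\<^bsub>total C\<^esub>} = carrier (total (complex_homology C))"
      unfolding complex_homology_def using quot_module_carrier[OF Zm BZs]
      by (simp add: coset_carrier_update diff_kernel_def)
    fix x assume x: "x \<in> carrier (total C)" "diff C x = \<zero>\<^bsub>total C\<^esub>"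
    have "\<zero>\<^bsub>total (complex_homology C)\<^esub> = ?B" unfolding complex_homology_def by (simp add: quot_module_def)
    then show "?B +>\<^bsub>total C\<^esub> x = \<zero>\<^bsub>total (complex_homology C)\<^esub> \<longleftrightarrow> x \<in> diff C ` carrier (total C)"
      using coset_zero_iff[OF C B x(1)] by (simp add: diff_image_def)
  qed (use C d dd in auto)
qed

section \<open>Integer matrices\<close>

text \<open>The canonical map from the integers to \<open>R\<close>. Signs and incidence numbers are
  kept as integers, so that the matrix identities are proved once for all rings.\<close>

definition ring_int :: "('r, 's) ring_scheme \<Rightarrow> int \<Rightarrow> 'r" where
  "ring_int R k = add_pow R k \<one>\<^bsub>R\<^esub>"

context cring
begin

lemma ring_int_closed [simp]: "ring_int R k \<in> carrier R"
  by (simp add: ring_int_def)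

lemma ring_int_0 [simp]: "ring_int R 0 = \<zero>"
  by (simp add: ring_int_def add_pow_def int_pow_def)

lemma ring_int_1 [simp]: "ring_int R 1 = \<one>"
  by (simp add: ring_int_def add_pow_def int_pow_def)

lemma ring_int_add: "ring_int R (k + l) = ring_int R k \<oplus> ring_int R l"
  unfolding ring_int_def by (rule add.int_pow_mult) simp

lemma ring_int_mult: "ring_int R (k * l) = ring_int R k \<otimes> ring_int R l"
proof -
  have "ring_int R k \<otimes> ring_int R l = [k] \<cdot> (\<one> \<otimes> [l] \<cdot> \<one>)"
    unfolding ring_int_def by (rule add_pow_ldistr_int) simp_all
  also have "\<dots> = [k] \<cdot> ([l] \<cdot> \<one>)" by simp
  also have "\<dots> = [(l * k)] \<cdot> \<one>" by (simp add: add.int_pow_pow)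
  finally show ?thesis by (simp add: ring_int_def mult.commute)
qed

lemma ring_int_minus: "ring_int R (- k) = \<ominus> ring_int R k"
  by (rule minus_equality[symmetric]) (simp_all flip: ring_int_add)

lemma ring_int_sum: "finite X \<Longrightarrow> ring_int R (sum f X) = (\<Oplus>x\<in>X. ring_int R (f x))"
  by (induction X rule: finite_induct) (simp_all add: ring_int_add)

lemma ring_sign_eq: "ring_sign R k = ring_int R (if even k then 1 else - 1)"
  by (simp add: ring_sign_def ring_int_minus)

end

text \<open>\<open>m x y\<close> is the coefficient of \<open>x\<close> in the image of the basis
  element \<open>y\<close>. Transposing is therefore swapping the arguments of \<open>m\<close>,
  which turns coboundaries into boundaries.\<close>

definition matrix_map ::
  "('r, 's) ring_scheme \<Rightarrow> 'x set \<Rightarrow> ('x \<Rightarrow> 'x \<Rightarrow> int) \<Rightarrow> ('x \<Rightarrow> 'r) \<Rightarrow> 'x \<Rightarrow> 'r" where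
  "matrix_map R S m f =
    (\<lambda>x. if x \<in> S then \<Oplus>\<^bsub>R\<^esub>y\<in>S. ring_int R (m x y) \<otimes>\<^bsub>R\<^esub> f y else \<zero>\<^bsub>R\<^esub>)"

lemma matrix_map_hom:
  assumes "cring R" "finite S"
  shows "matrix_map R S m \<in> mod_hom R (free_module R S) (free_module R S)"
proof -
  interpret cring R by fact
  note fc = finite_free_module_carrier[OF assms(2)]
  show ?thesis
  proof (rule mod_homI)
    fix f assume "f \<in> carrier (free_module R S)"
    then have f: "\<And>x. f x \<in> carrier R" by (simp add: fc)
    then show "matrix_map R S m f \<in> carrier (free_module R S)"
      by (auto simp: fc matrix_map_def intro!: finsum_closed)
    { fix a assume a: "a \<in> carrier R"
      have "(\<Oplus>\<^bsub>R\<^esub>y\<in>S. ring_int R (m x y) \<otimes>\<^bsub>R\<^esub> (a \<otimes>\<^bsub>R\<^esub> f y)) =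
          a \<otimes>\<^bsub>R\<^esub> (\<Oplus>\<^bsub>R\<^esub>y\<in>S. ring_int R (m x y) \<otimes>\<^bsub>R\<^esub> f y)" for x
        using f a by (subst finsum_rdistr[OF assms(2) a]) (auto intro!: finsum_cong' simp: m_lcomm)
      then show "matrix_map R S m (a \<odot>\<^bsub>free_module R S\<^esub> f) = a \<odot>\<^bsub>free_module R S\<^esub> matrix_map R S m f"
        using a by (auto simp: matrix_map_def) }
    fix g assume "g \<in> carrier (free_module R S)"
    then have g: "\<And>x. g x \<in> carrier R" by (simp add: fc)
    have "(\<Oplus>\<^bsub>R\<^esub>y\<in>S. ring_int R (m x y) \<otimes>\<^bsub>R\<^esub> (f y \<oplus>\<^bsub>R\<^esub> g y)) =
        (\<Oplus>\<^bsub>R\<^esub>y\<in>S. ring_int R (m x y) \<otimes>\<^bsub>R\<^esub> f y) \<oplus>\<^bsub>R\<^esub> (\<Oplus>\<^bsub>R\<^esub>y\<in>S. ring_int R (m x y) \<otimes>\<^bsub>R\<^esub> g y)" for x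
      using f g by (subst finsum_addf[symmetric]) (auto intro!: finsum_cong' simp: r_distr)
    then show "matrix_map R S m (f \<oplus>\<^bsub>free_module R S\<^esub> g) =
        matrix_map R S m f \<oplus>\<^bsub>free_module R S\<^esub> matrix_map R S m g"
      by (auto simp: matrix_map_def)
  qed
qed

lemma matrix_map_basis:
  assumes "cring R" "finite S" "y \<in> S"
  shows "matrix_map R S m (basis_elem R y) = (\<lambda>x. if x \<in> S then ring_int R (m x y) else \<zero>\<^bsub>R\<^esub>)"
proof -
  interpret cring R by fact
  have "(\<Oplus>\<^bsub>R\<^esub>z\<in>S. ring_int R (m x z) \<otimes>\<^bsub>R\<^esub> basis_elem R y z) =
      (\<Oplus>\<^bsub>R\<^esub>z\<in>S. if y = z then ring_int R (m x z) else \<zero>\<^bsub>R\<^esub>)" for x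
    by (intro finsum_cong') (auto simp: basis_elem_def)
  also have "\<dots> x = ring_int R (m x y)" for x
    by (rule finsum_singleton[OF assms(3,2)]) simp
  finally show ?thesis by (auto simp: matrix_map_def)
qed

lemma free_hom_eq:
  assumes "module R N" "f \<in> mod_hom R (free_module R S) N" "g \<in> mod_hom R (free_module R S) N"
    and "\<And>x. x \<in> S \<Longrightarrow> f (basis_elem R x) = g (basis_elem R x)" "z \<in> carrier (free_module R S)"
  shows "f z = g z"
proof -
  interpret N: module R N by fact
  show ?thesis
    by (rule mod_hom_span_eq[OF free_module_module[OF N.R.is_cring] assms(1,2,3) free_module_span[OF N.R.is_cring] _ _ assms(5)])
      (use assms(4) basis_elem_carrier[OF N.R.is_cring] in auto)
qed

lemma matrix_map_comp:
  assumes "cring R" "finite S" "f \<in> carrier (free_module R S)"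
  shows "matrix_map R S m (matrix_map R S n f) = matrix_map R S (\<lambda>x z. \<Sum>y\<in>S. m x y * n y z) f"
proof (rule free_hom_eq[OF free_module_module[OF assms(1)] _ _ _ assms(3)])
  interpret cring R by fact
  show "(\<lambda>f. matrix_map R S m (matrix_map R S n f)) \<in> mod_hom R (free_module R S) (free_module R S)"
    by (rule mod_hom_comp[OF matrix_map_hom[OF assms(1,2)] matrix_map_hom[OF assms(1,2)]])
  show "matrix_map R S (\<lambda>x z. \<Sum>y\<in>S. m x y * n y z) \<in> mod_hom R (free_module R S) (free_module R S)"
    by (intro matrix_map_hom assms)
  fix z assume z: "z \<in> S"
  have "(\<Oplus>\<^bsub>R\<^esub>y\<in>S. ring_int R (m x y) \<otimes>\<^bsub>R\<^esub> (if y \<in> S then ring_int R (n y z) else \<zero>\<^bsub>R\<^esub>)) =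
      ring_int R (\<Sum>y\<in>S. m x y * n y z)" for x
    unfolding ring_int_sum[OF assms(2)] by (intro finsum_cong') (auto simp: ring_int_mult)
  then show "matrix_map R S m (matrix_map R S n (basis_elem R z)) =
      matrix_map R S (\<lambda>x z. \<Sum>y\<in>S. m x y * n y z) (basis_elem R z)"
    unfolding matrix_map_basis[OF assms(1,2) z] by (auto simp: matrix_map_def)
qed

lemma matrix_map_eqI:
  assumes "cring R" "finite S" "f \<in> carrier (free_module R S)" "\<And>x y. x \<in> S \<Longrightarrow> y \<in> S \<Longrightarrow> m x y = n x y"
  shows "matrix_map R S m f = matrix_map R S n f"
proof -
  interpret cring R by fact
  have "f y \<in> carrier R" for y using assms(3) by (simp add: free_module_carrier)
  then show ?thesis
    unfolding matrix_map_def using assms(4) by (auto intro!: ext finsum_cong')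
qed

lemma matrix_map_zero:
  assumes "cring R" "finite S" "f \<in> carrier (free_module R S)" "\<And>x y. x \<in> S \<Longrightarrow> y \<in> S \<Longrightarrow> m x y = 0"
  shows "matrix_map R S m f = (\<lambda>x. \<zero>\<^bsub>R\<^esub>)"
proof -
  interpret cring R by fact
  have f: "f y \<in> carrier R" for y using assms(3) by (simp add: free_module_carrier)
  have "(\<Oplus>\<^bsub>R\<^esub>y\<in>S. ring_int R (m x y) \<otimes>\<^bsub>R\<^esub> f y) = (\<Oplus>\<^bsub>R\<^esub>y\<in>S. \<zero>\<^bsub>R\<^esub>)" if "x \<in> S" for x
    using assms(4)[OF that] f by (intro finsum_cong') auto
  then show ?thesis by (auto simp: matrix_map_def)
qed

lemma matrix_map_uminus:
  assumes "cring R" "finite S" "f \<in> carrier (free_module R S)"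
  shows "matrix_map R S (\<lambda>x y. - m x y) f = \<ominus>\<^bsub>free_module R S\<^esub> matrix_map R S m f"
proof -
  interpret cring R by fact
  note F = free_module_module[OF assms(1)]
  show ?thesis
  proof (rule free_hom_eq[OF F matrix_map_hom[OF assms(1,2)] mod_hom_uminus[OF F matrix_map_hom[OF assms(1,2)]] _ assms(3)])
    fix x assume x: "x \<in> S"
    show "matrix_map R S (\<lambda>x y. - m x y) (basis_elem R x) =
        \<ominus>\<^bsub>free_module R S\<^esub> matrix_map R S m (basis_elem R x)"
      using free_module_minus[OF assms(1) mod_hom_closed[OF matrix_map_hom[OF assms(1,2), of m] basis_elem_carrier[OF assms(1) x]]]
      by (auto simp: matrix_map_basis[OF assms(1,2) x] ring_int_minus)
  qed
qed

section \<open>Degrees on a basis\<close>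

definition homogeneous :: "('r, 's) ring_scheme \<Rightarrow> 'x set \<Rightarrow> ('x \<Rightarrow> 'u) \<Rightarrow> 'u \<Rightarrow> ('x \<Rightarrow> 'r) set" where
  "homogeneous R S dg u = {f \<in> carrier (free_module R S). \<forall>x\<in>S. dg x \<noteq> u \<longrightarrow> f x = \<zero>\<^bsub>R\<^esub>}"

definition mask :: "('r, 's) ring_scheme \<Rightarrow> ('x \<Rightarrow> bool) \<Rightarrow> ('x \<Rightarrow> 'r) \<Rightarrow> 'x \<Rightarrow> 'r" where
  "mask R P f = (\<lambda>x. if P x then f x else \<zero>\<^bsub>R\<^esub>)"

lemma mask_hom:
  assumes "cring R" shows "mask R P \<in> mod_hom R (free_module R S) (free_module R S)"
proof -
  interpret cring R by fact
  have "finite {x. mask R P f x \<noteq> \<zero>\<^bsub>R\<^esub>}" if "finite {x. f x \<noteq> \<zero>\<^bsub>R\<^esub>}" for f :: "'c \<Rightarrow> 'a"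
    by (rule finite_subset[OF _ that]) (auto simp: mask_def)
  then show ?thesis
    by (intro mod_homI) (auto simp: free_module_carrier, auto simp: mask_def)
qed

text \<open>Across a nonzero entry, \<open>P\<close> at the source is equivalent to \<open>Q\<close>
  at the target, so the mask can be moved past the matrix. Shifts of degree and changes of parity
  are both instances.\<close>

lemma matrix_map_mask:
  assumes "cring R" "finite S" "f \<in> carrier (free_module R S)"
    and "\<And>x y. x \<in> S \<Longrightarrow> y \<in> S \<Longrightarrow> m x y \<noteq> 0 \<Longrightarrow> P y \<longleftrightarrow> Q x"
  shows "matrix_map R S m (mask R P f) = mask R Q (matrix_map R S m f)"
proof
  interpret cring R by fact
  have f: "f y \<in> carrier R" for y using assms(3) by (simp add: free_module_carrier)
  fix x
  show "matrix_map R S m (mask R P f) x = mask R Q (matrix_map R S m f) x"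
  proof (cases "x \<in> S")
    case True
    have "(\<Oplus>\<^bsub>R\<^esub>y\<in>S. ring_int R (m x y) \<otimes>\<^bsub>R\<^esub> mask R P f y) =
        (\<Oplus>\<^bsub>R\<^esub>y\<in>S. if Q x then ring_int R (m x y) \<otimes>\<^bsub>R\<^esub> f y else \<zero>\<^bsub>R\<^esub>)"
    proof (rule finsum_cong')
      fix y assume "y \<in> S"
      then show "ring_int R (m x y) \<otimes>\<^bsub>R\<^esub> mask R P f y = (if Q x then ring_int R (m x y) \<otimes>\<^bsub>R\<^esub> f y else \<zero>\<^bsub>R\<^esub>)"
        using assms(4)[OF True, of y] f by (cases "m x y = 0") (auto simp: mask_def)
    qed (use f in auto)
    then show ?thesis using True by (auto simp: matrix_map_def mask_def)
  qed (auto simp: matrix_map_def mask_def)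
qed

lemma free_module_bigrading:
  assumes "cring R" "finite S"
  shows "bigrading R (free_module R S) (homogeneous R S dg) (\<lambda>u. mask R (\<lambda>x. dg x = u))"
proof (rule bigrading.intro)
  interpret cring R by fact
  interpret F: module R "free_module R S" by (rule free_module_module) fact
  show "module R (free_module R S)" by (rule F.module_axioms)
  show "mask R (\<lambda>x. dg x = u) \<in> mod_hom R (free_module R S) (free_module R S)" for u
    by (rule mask_hom) fact
  show "mask R (\<lambda>x. dg x = u) f \<in> homogeneous R S dg u" if f: "f \<in> carrier (free_module R S)" for f u
    using mod_hom_closed[OF mask_hom[OF assms(1)] f] by (auto simp: homogeneous_def mask_def)
  show "mask R (\<lambda>x. dg x = u) f = f" if "f \<in> homogeneous R S dg u" for f u
    using that by (auto simp: homogeneous_def mask_def free_module_carrier intro!: ext) metis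
  show "homogeneous R S dg u \<subseteq> carrier (free_module R S)" for u
    by (auto simp: homogeneous_def)
  show "mask R (\<lambda>x. dg x = u) f = \<zero>\<^bsub>free_module R S\<^esub>" if "f \<in> homogeneous R S dg v" "u \<noteq> v" for f u v
    using that by (auto simp: homogeneous_def mask_def free_module_carrier intro!: ext) metis
  show "\<exists>U. finite U \<and> f = (\<Oplus>\<^bsub>free_module R S\<^esub>u\<in>U. mask R (\<lambda>x. dg x = u) f)"
    if f: "f \<in> carrier (free_module R S)" for f
  proof (intro exI conjI)
    have *: "finite U \<Longrightarrow> (\<Oplus>\<^bsub>free_module R S\<^esub>u\<in>U. mask R (\<lambda>x. dg x = u) f) = mask R (\<lambda>x. dg x \<in> U) f" for U
    proof (induction U rule: finite_induct)
      case empty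
      then show ?case by (simp add: mask_def)
    next
      case (insert u U)
      have c: "mask R (\<lambda>x. dg x = u) f \<in> carrier (free_module R S)" for u
        by (rule mod_hom_closed[OF mask_hom[OF assms(1)] f])
      have fx: "f x \<in> carrier R" for x using f by (simp add: free_module_carrier)
      have "(\<Oplus>\<^bsub>free_module R S\<^esub>u\<in>insert u U. mask R (\<lambda>x. dg x = u) f) =
          mask R (\<lambda>x. dg x = u) f \<oplus>\<^bsub>free_module R S\<^esub> mask R (\<lambda>x. dg x \<in> U) f"
        using insert c by simp
      also have "\<dots> = mask R (\<lambda>x. dg x \<in> insert u U) f"
        using insert(2) fx by (auto simp: mask_def)
      finally show ?case .
    qed
    show "finite (dg ` S)" using assms(2) by simp
    have "mask R (\<lambda>x. dg x \<in> dg ` S) f = f"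
      using f by (fastforce simp: mask_def free_module_carrier)
    then show "f = (\<Oplus>\<^bsub>free_module R S\<^esub>u\<in>dg ` S. mask R (\<lambda>x. dg x = u) f)"
      using * assms(2) by simp
  qed
qed

definition sign_map :: "('r, 's) ring_scheme \<Rightarrow> ('x \<Rightarrow> int) \<Rightarrow> ('x \<Rightarrow> 'r) \<Rightarrow> 'x \<Rightarrow> 'r" where
  "sign_map R n f = (\<lambda>x. ring_sign R (n x) \<otimes>\<^bsub>R\<^esub> f x)"

text \<open>An entry can be nonzero only between basis elements of opposite parity, so the matrix
  exchanges the even and the odd part; on these parts the sign map is the identity and its
  negative.\<close>

lemma sign_map_parity:
  assumes "cring R" "finite S" "\<And>x y. x \<in> S \<Longrightarrow> y \<in> S \<Longrightarrow> m x y \<noteq> 0 \<Longrightarrow> odd (n x - n y)"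
  shows "parity_grading R (free_module R S) (matrix_map R S m)
    (mask R (\<lambda>x. even (n x))) (mask R (\<lambda>x. odd (n x))) (sign_map R n)"
proof (rule parity_grading.intro)
  interpret cring R by fact
  show "mask R (\<lambda>x. even (n x)) \<in> mod_hom R (free_module R S) (free_module R S)"
    "mask R (\<lambda>x. odd (n x)) \<in> mod_hom R (free_module R S) (free_module R S)"
    by (rule mask_hom, fact)+
  fix f assume f: "f \<in> carrier (free_module R S)"
  have fx: "f x \<in> carrier R" for x using f by (simp add: free_module_carrier)
  show "mask R (\<lambda>x. even (n x)) f \<oplus>\<^bsub>free_module R S\<^esub> mask R (\<lambda>x. odd (n x)) f = f"
    using fx by (auto simp: mask_def)
  show "mask R (\<lambda>x. even (n x)) (mask R (\<lambda>x. odd (n x)) f) = \<zero>\<^bsub>free_module R S\<^esub>"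
    "mask R (\<lambda>x. odd (n x)) (mask R (\<lambda>x. even (n x)) f) = \<zero>\<^bsub>free_module R S\<^esub>"
    by (auto simp: mask_def)
  show "matrix_map R S m (mask R (\<lambda>x. even (n x)) f) = mask R (\<lambda>x. odd (n x)) (matrix_map R S m f)"
    "matrix_map R S m (mask R (\<lambda>x. odd (n x)) f) = mask R (\<lambda>x. even (n x)) (matrix_map R S m f)"
    using assms(3) by (intro matrix_map_mask[OF assms(1,2) f]; force)+
  show "sign_map R n f = mask R (\<lambda>x. even (n x)) f \<ominus>\<^bsub>free_module R S\<^esub> mask R (\<lambda>x. odd (n x)) f"
    unfolding a_minus_def free_module_minus[OF assms(1) mod_hom_closed[OF mask_hom[OF assms(1)] f]]
    using fx by (auto simp: sign_map_def mask_def ring_sign_def l_minus)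
qed

section \<open>Tensor products of free modules\<close>

lemma bilinear_free_eq:
  assumes "module R P" "bilinear_map R (free_module R S) (free_module R S') P b"
    "bilinear_map R (free_module R S) (free_module R S') P c"
    and "\<And>x y. x \<in> S \<Longrightarrow> y \<in> S' \<Longrightarrow> b (basis_elem R x) (basis_elem R y) = c (basis_elem R x) (basis_elem R y)"
    and "f \<in> carrier (free_module R S)" "g \<in> carrier (free_module R S')"
  shows "b f g = c f g"
proof -
  interpret P: module R P by fact
  have 1: "b (basis_elem R x) g = c (basis_elem R x) g" if "x \<in> S" for x
    by (rule free_hom_eq[OF assms(1) bilinear_right[OF assms(2)] bilinear_right[OF assms(3)] assms(4)[OF that] assms(6)])
      (use that basis_elem_carrier[OF P.R.is_cring] in auto)
  show ?thesis
    by (rule free_hom_eq[OF assms(1) bilinear_left[OF assms(2,6)] bilinear_left[OF assms(3,6)] 1 assms(5)])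
qed

text \<open>A bijection \<open>j\<close> of \<open>S1 \<times> S2\<close> with \<open>S\<close> and signs \<open>tau\<close> identify \<open>R\<^sup>S\<close> with the tensor product.\<close>

locale free_tensor =
  fixes R :: "('r, 's) ring_scheme" and S1 :: "'x set" and S2 :: "'y set" and S :: "'z set"
    and j :: "'x \<Rightarrow> 'y \<Rightarrow> 'z" and tau :: "'x \<Rightarrow> 'y \<Rightarrow> int"
  assumes R_cring: "cring R" and finite_S1: "finite S1" and finite_S2: "finite S2"
    and j_bij: "bij_betw (\<lambda>(x, y). j x y) (S1 \<times> S2) S"
    and tau_sq: "x \<in> S1 \<Longrightarrow> y \<in> S2 \<Longrightarrow> tau x y * tau x y = 1"
begin

sublocale R: cring R by (rule R_cring)

abbreviation "F1 \<equiv> free_module R S1"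
abbreviation "F2 \<equiv> free_module R S2"
abbreviation "F \<equiv> free_module R S"

lemma F1: "module R F1" and F2: "module R F2" and F: "module R F"
  by (rule free_module_module[OF R_cring])+

sublocale F1: module R F1 by (rule F1)
sublocale F2: module R F2 by (rule F2)
sublocale F: module R F by (rule F)

lemma finite_S: "finite S"
  using j_bij finite_S1 finite_S2 bij_betw_finite by blast

lemma j_in [simp]: "x \<in> S1 \<Longrightarrow> y \<in> S2 \<Longrightarrow> j x y \<in> S"
  using j_bij by (auto simp: bij_betw_def)

lemma j_inj: "x \<in> S1 \<Longrightarrow> y \<in> S2 \<Longrightarrow> x' \<in> S1 \<Longrightarrow> y' \<in> S2 \<Longrightarrow> j x y = j x' y' \<longleftrightarrow> x = x' \<and> y = y'"
  using j_bij by (force simp: bij_betw_def inj_on_def)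

lemma jE: assumes "z \<in> S" obtains x y where "x \<in> S1" "y \<in> S2" "z = j x y"
  using j_bij assms by (auto simp: bij_betw_def)

definition j1 where "j1 z = fst (inv_into (S1 \<times> S2) (\<lambda>(x, y). j x y) z)"
definition j2 where "j2 z = snd (inv_into (S1 \<times> S2) (\<lambda>(x, y). j x y) z)"

lemma j12 [simp]: assumes "x \<in> S1" "y \<in> S2" shows "j1 (j x y) = x" "j2 (j x y) = y"
proof -
  have "inv_into (S1 \<times> S2) (\<lambda>(x, y). j x y) ((\<lambda>(x, y). j x y) (x, y)) = (x, y)"
    by (rule inv_into_f_f) (use j_bij assms in \<open>auto simp: bij_betw_def\<close>)
  then show "j1 (j x y) = x" "j2 (j x y) = y" by (simp_all add: j1_def j2_def)
qed

definition bt where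
  "bt f g = (\<lambda>z. if z \<in> S then ring_int R (tau (j1 z) (j2 z)) \<otimes>\<^bsub>R\<^esub> (f (j1 z) \<otimes>\<^bsub>R\<^esub> g (j2 z)) else \<zero>\<^bsub>R\<^esub>)"

lemma bt_bilinear: "bilinear_map R F1 F2 F bt"
  by (rule bilinear_mapI)
    (auto simp: finite_free_module_carrier finite_S finite_S1 finite_S2 bt_def R.r_distr R.l_distr R.m_ac intro!: ext)

lemma bt_basis:
  assumes "x \<in> S1" "y \<in> S2"
  shows "bt (basis_elem R x) (basis_elem R y) = ring_int R (tau x y) \<odot>\<^bsub>F\<^esub> basis_elem R (j x y)"
proof
  fix z
  show "bt (basis_elem R x) (basis_elem R y) z = (ring_int R (tau x y) \<odot>\<^bsub>F\<^esub> basis_elem R (j x y)) z"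
  proof (cases "z \<in> S")
    case True
    then obtain x' y' where "x' \<in> S1" "y' \<in> S2" "z = j x' y'" by (rule jE)
    then show ?thesis using assms by (auto simp: bt_def basis_elem_def j_inj)
  qed (use assms in \<open>auto simp: bt_def basis_elem_def\<close>)
qed

lemma basis_bt:
  assumes "x \<in> S1" "y \<in> S2"
  shows "basis_elem R (j x y) = ring_int R (tau x y) \<odot>\<^bsub>F\<^esub> bt (basis_elem R x) (basis_elem R y)"
  unfolding bt_basis[OF assms]
  using basis_elem_carrier[OF R_cring j_in[OF assms]] tau_sq[OF assms]
  by (simp flip: F.smult_assoc1 R.ring_int_mult)

lemma bt_span: "carrier F \<subseteq> mod_span R F {bt f g | f g. f \<in> carrier F1 \<and> g \<in> carrier F2}"
proof -
  let ?X = "{bt f g | f g. f \<in> carrier F1 \<and> g \<in> carrier F2}"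
  have sub: "submodule (mod_span R F ?X) R F"
    by (rule submodule_span[OF F]) (use bilinear_closed[OF bt_bilinear] in auto)
  have "basis_elem R ` S \<subseteq> mod_span R F ?X"
  proof (safe elim!: jE)
    fix x y assume xy: "x \<in> S1" "y \<in> S2"
    have "bt (basis_elem R x) (basis_elem R y) \<in> ?X" using basis_elem_carrier[OF R_cring xy(1)] basis_elem_carrier[OF R_cring xy(2)] by blast
    then show "basis_elem R (j x y) \<in> mod_span R F ?X"
      unfolding basis_bt[OF xy] by (intro submodule_smult[OF sub] mod_span_base) auto
  qed
  then have "mod_span R F (basis_elem R ` S) \<subseteq> mod_span R F ?X" by (rule mod_span_minimal[OF sub])
  then show ?thesis using free_module_span[OF R_cring] by blast
qed

text \<open>The basis element \<open>j x y\<close> is sent to the pure tensor with the factor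
  \<open>tau x y\<close>. The same factor in \<open>bt\<close> meets it, and the square of a sign is
  one.\<close>

lemma to_tensor:
  obtains u where "u \<in> mod_hom R F (tensor_module R F1 F2)"
    "\<And>f g. f \<in> carrier F1 \<Longrightarrow> g \<in> carrier F2 \<Longrightarrow> u (bt f g) = pure_tensor R F1 F2 f g"
proof -
  note T = tensor_module_module[OF F1 F2]
  interpret T: module R "tensor_module R F1 F2" by (rule T)
  let ?g = "\<lambda>z. ring_int R (tau (j1 z) (j2 z)) \<odot>\<^bsub>tensor_module R F1 F2\<^esub>
      pure_tensor R F1 F2 (basis_elem R (j1 z)) (basis_elem R (j2 z))"
  have pc: "pure_tensor R F1 F2 (basis_elem R x) (basis_elem R y) \<in> carrier (tensor_module R F1 F2)"
    if "x \<in> S1" "y \<in> S2" for x y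
    using that by (intro tensor_pure_closed[OF F1 F2] basis_elem_carrier[OF R_cring])
  have g: "?g z \<in> carrier (tensor_module R F1 F2)" if "z \<in> S" for z
    using that pc by (auto elim!: jE)
  obtain u where u: "u \<in> mod_hom R F (tensor_module R F1 F2)" "\<And>z. z \<in> S \<Longrightarrow> u (basis_elem R z) = ?g z"
    by (rule free_module_lift[OF T, of S ?g]) (use g in auto)
  have "u (bt f h) = pure_tensor R F1 F2 f h" if "f \<in> carrier F1" "h \<in> carrier F2" for f h
  proof (rule bilinear_free_eq[OF T bilinear_comp[OF bt_bilinear mod_hom_id mod_hom_id u(1)] pure_tensor_bilinear[OF F1 F2] _ that])
    fix x y assume xy: "x \<in> S1" "y \<in> S2"
    have "u (bt (basis_elem R x) (basis_elem R y)) = ring_int R (tau x y) \<odot>\<^bsub>tensor_module R F1 F2\<^esub> ?g (j x y)"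
      unfolding bt_basis[OF xy] using xy u
      by (simp add: mod_hom_smult[OF u(1)] basis_elem_carrier[OF R_cring])
    also have "\<dots> = pure_tensor R F1 F2 (basis_elem R x) (basis_elem R y)"
      using xy pc[OF xy] tau_sq[OF xy] by (simp flip: T.smult_assoc1 R.ring_int_mult)
    finally show "u (bt (basis_elem R x) (basis_elem R y)) = pure_tensor R F1 F2 (basis_elem R x) (basis_elem R y)" .
  qed
  with u(1) show thesis by (rule that)
qed

text \<open>Both sides are bilinear, so basis elements suffice, and the hypothesis is the Leibniz
  rule entry by entry. The factors \<open>tau x' y'\<close> and \<open>tau x y\<close> are the
  rescalings of the basis at the source and at the target of the entry.\<close>

lemma bt_leibniz:
  assumes m: "\<And>x x' y y'. x \<in> S1 \<Longrightarrow> x' \<in> S1 \<Longrightarrow> y \<in> S2 \<Longrightarrow> y' \<in> S2 \<Longrightarrow>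
      m (j x y) (j x' y') * tau x' y' =
      tau x y * ((if y = y' then m1 x x' else 0) + (if x = x' then (if even (n x) then 1 else - 1) * m2 y y' else 0))"
    and "f \<in> carrier F1" "g \<in> carrier F2"
  shows "matrix_map R S m (bt f g) = bt (matrix_map R S1 m1 f) g \<oplus>\<^bsub>F\<^esub> bt (sign_map R n f) (matrix_map R S2 m2 g)"
proof (rule bilinear_free_eq[OF F _ _ _ assms(2,3)])
  note h1 = matrix_map_hom[OF R_cring finite_S1] and h2 = matrix_map_hom[OF R_cring finite_S2]
    and h = matrix_map_hom[OF R_cring finite_S]
  have sm: "sign_map R n \<in> mod_hom R F1 F1"
  proof -
    interpret parity_grading R F1 "matrix_map R S1 (\<lambda>x y. 0)" "mask R (\<lambda>x. even (n x))" "mask R (\<lambda>x. odd (n x))" "sign_map R n"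
      by (rule sign_map_parity[OF R_cring finite_S1]) simp
    show ?thesis by (rule sg_hom[OF F1 h1])
  qed
  show "bilinear_map R F1 F2 F (\<lambda>f g. matrix_map R S m (bt f g))"
    by (rule bilinear_comp[OF bt_bilinear mod_hom_id mod_hom_id h])
  show "bilinear_map R F1 F2 F (\<lambda>f g. bt (matrix_map R S1 m1 f) g \<oplus>\<^bsub>F\<^esub> bt (sign_map R n f) (matrix_map R S2 m2 g))"
    by (rule bilinear_plus[OF F bilinear_comp[OF bt_bilinear h1 mod_hom_id mod_hom_id] bilinear_comp[OF bt_bilinear sm h2 mod_hom_id]])
  fix x' y' assume xy': "x' \<in> S1" "y' \<in> S2"
  have "matrix_map R S m (bt (basis_elem R x') (basis_elem R y')) =
      ring_int R (tau x' y') \<odot>\<^bsub>F\<^esub> (\<lambda>z. if z \<in> S then ring_int R (m z (j x' y')) else \<zero>\<^bsub>R\<^esub>)" (is "?l = ?r")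
    unfolding bt_basis[OF xy'] using xy'
    by (simp add: mod_hom_smult[OF h] basis_elem_carrier[OF R_cring] matrix_map_basis[OF R_cring finite_S])
  also have "\<dots> = bt (matrix_map R S1 m1 (basis_elem R x')) (basis_elem R y') \<oplus>\<^bsub>F\<^esub>
      bt (sign_map R n (basis_elem R x')) (matrix_map R S2 m2 (basis_elem R y'))" (is "_ = ?q")
  proof
    fix z
    show "?r z = ?q z"
    proof (cases "z \<in> S")
      case True
      then obtain x y where xy: "x \<in> S1" "y \<in> S2" "z = j x y" by (rule jE)
      have "?r z = ring_int R (m (j x y) (j x' y') * tau x' y')"
        using xy by (simp add: R.ring_int_mult R.m_comm)
      also have "\<dots> = ?q z"
        unfolding m[OF xy(1) xy'(1) xy(2) xy'(2)] matrix_map_basis[OF R_cring finite_S1 xy'(1)]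
          matrix_map_basis[OF R_cring finite_S2 xy'(2)]
        using xy xy'
        by (auto simp: bt_def sign_map_def R.ring_sign_eq basis_elem_def R.ring_int_mult R.ring_int_add R.ring_int_minus R.r_distr)
      finally show ?thesis .
    qed (simp add: bt_def)
  qed
  finally show "?l = ?q" .
qed

end

declare free_module_simps(2) [simp del]

section \<open>Double complexes\<close>

text \<open>Pure tensors of homogeneous classes generate and the cross product adds degrees, so
  surjectivity descends to every bidegree.\<close>

lemma (in kunneth) cross_graded:
  assumes A: "bigrading R HA grA rA" and B: "bigrading R HB grB rB" and E: "bigrading R HE grE rE"
    and surj: "cross ` carrier T = carrier HE"
    and gr: "\<And>u v x y. x \<in> grA u \<Longrightarrow> y \<in> grB v \<Longrightarrow> cross (pt x y) \<in> grE (fst u + fst v, snd u + snd v)"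
  shows "cross ` mod_span R T {pt x y | x y. \<exists>u v. x \<in> grA u \<and> y \<in> grB v \<and> w = (fst u + fst v, snd u + snd v)} = grE w"
proof -
  interpret gA: bigrading R HA grA rA by (rule A)
  interpret gB: bigrading R HB grB rB by (rule B)
  let ?G = "\<lambda>w. {pt x y | x y. \<exists>u v. x \<in> grA u \<and> y \<in> grB v \<and> w = (fst u + fst v, snd u + snd v)}"
  have UA: "(\<Union>u. grA u) \<subseteq> carrier HA" and UB: "(\<Union>u. grB u) \<subseteq> carrier HB"
    using gA.gr_carrier gB.gr_carrier by blast+
  have "{pt x y | x y. x \<in> (\<Union>u. grA u) \<and> y \<in> (\<Union>u. grB u)} \<subseteq> (\<Union>w. ?G w)" by blast
  then have span: "carrier T \<subseteq> mod_span R T (\<Union>w. ?G w)"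
    by (intro order_trans[OF tensor_span_generators[OF A.H_module B.H_module UA gA.gr_span UB gB.gr_span]] mod_span_mono)
  show ?thesis
  proof (rule graded_surjection_image[OF E T_module cross_hom surj _ span])
    show "?G u \<subseteq> carrier T" for u using gA.gr_carrier gB.gr_carrier pt_closed by blast
    show "cross x \<in> grE u" if "x \<in> ?G u" for u x using that gr by blast
  qed
qed

text \<open>Over a field classes lift linearly to cycles, and the class map extends to all of
  \<open>A\<close>. Composed with the dual basis of \<open>A\<close>, these maps make homology a
  retract of the same finite free module, which supplies the dual basis for the second Kuenneth
  step.\<close>

lemma (in presented_homology) field_homology_retract:
  assumes "principal_domain R" "field R" "finite_retract R A S i p"
  obtains i' p' where "finite_retract R H S i' p'"
proof -
  obtain t where t: "t \<in> mod_hom R H A" "\<And>x. x \<in> carrier H \<Longrightarrow> t x \<in> cyc" "\<And>x. x \<in> carrier H \<Longrightarrow> pr (t x) = x"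
    by (rule field_section[OF assms(2,3)]) (rule that)
  obtain q where q: "q \<in> mod_hom R A H" "\<And>z. z \<in> cyc \<Longrightarrow> q z = pr z"
    by (rule pr_extension[OF assms(1,3)]) (rule that)
  have i: "i \<in> mod_hom R A (free_module R S)" and p: "p \<in> mod_hom R (free_module R S) A"
    and pi: "\<And>x. x \<in> carrier A \<Longrightarrow> p (i x) = x" and S: "finite S"
    using assms(3) by (auto simp: finite_retract_def)
  have "finite_retract R H S (\<lambda>x. i (t x)) (\<lambda>f. q (p f))"
    unfolding finite_retract_def
    using mod_hom_comp[OF t(1) i] mod_hom_comp[OF p q(1)] S t q(2) pi by simp
  then show thesis by (rule that)
qed

text \<open>The cross product points from the tensor product to the join, while the isomorphisms
  asked for point the other way.\<close>

lemma bigraded_iso_inverse: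
  assumes "module R (total M)" "\<And>u. part M u \<subseteq> carrier (total M)" "f \<in> bigraded_iso R M N"
  shows "inv_into (carrier (total M)) f \<in> bigraded_iso R N M"
proof -
  have f: "f \<in> mod_hom R (total M) (total N)" "bij_betw f (carrier (total M)) (carrier (total N))"
    "\<And>u. f ` part M u = part N u"
    using assms(3) by (auto simp: bigraded_iso_def)
  then have "inv_into (carrier (total M)) f ` part N u = part M u" for u
    using inv_into_image_cancel[of f "carrier (total M)" "part M u"] assms(2) by (auto simp: bij_betw_def)
  then show ?thesis
    using mod_hom_inverse[OF assms(1) f(1,2)] bij_betw_inv_into[OF f(2)] by (simp add: bigraded_iso_def)
qed

lemma bigraded_tensor_part_carrier:
  assumes "bigrading R (total M) (part M) rM" "bigrading R (total N) (part N) rN"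
  shows "part (bigraded_tensor R M N) w \<subseteq> carrier (tensor_module R (total M) (total N))"
proof -
  interpret M: bigrading R "total M" "part M" rM by fact
  interpret N: bigrading R "total N" "part N" rN by fact
  have "{pure_tensor R (total M) (total N) x y | x y.
      \<exists>u v. x \<in> part M u \<and> y \<in> part N v \<and> w = (fst u + fst v, snd u + snd v)}
      \<subseteq> carrier (tensor_module R (total M) (total N))"
    using tensor_pure_closed[OF M.M_module N.M_module] M.gr_carrier N.gr_carrier by blast
  then show ?thesis
    unfolding bigraded_tensor_def
    by (simp add: mod_span_minimal[OF module.carrier_is_submodule[OF tensor_module_module[OF M.M_module N.M_module]]])
qed

text \<open>\<open>m\<close> is the simplicial differential, with homology \<open>total C\<close>,
  and \<open>m'\<close> induces the differential of \<open>C\<close>. Each matrix has a fixed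
  bidegree, \<open>e\<close> or \<open>e'\<close>, of odd total degree: anticommutation makes
  \<open>m'\<close> descend to homology, and oddness makes the degree sign anticommute with
  both.\<close>

locale double_complex =
  presented_homology R "free_module R S" "total C" "matrix_map R S m" pr
  for R :: "('r, 's) ring_scheme" and S :: "'x set" and C :: "('r, 'h) bigraded_complex"
    and m :: "'x \<Rightarrow> 'x \<Rightarrow> int" and pr :: "('x \<Rightarrow> 'r) \<Rightarrow> 'h" +
  fixes m' :: "'x \<Rightarrow> 'x \<Rightarrow> int" and dg :: "'x \<Rightarrow> int \<times> int" and e e' :: "int \<times> int"
  assumes finite_S: "finite S"
    and dg_m: "x \<in> S \<Longrightarrow> y \<in> S \<Longrightarrow> m x y \<noteq> 0 \<Longrightarrow> dg x = (fst (dg y) + fst e, snd (dg y) + snd e)"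
    and dg_m': "x \<in> S \<Longrightarrow> y \<in> S \<Longrightarrow> m' x y \<noteq> 0 \<Longrightarrow> dg x = (fst (dg y) + fst e', snd (dg y) + snd e')"
    and odd_e: "odd (fst e + snd e)" and odd_e': "odd (fst e' + snd e')"
    and m'_m': "x \<in> S \<Longrightarrow> z \<in> S \<Longrightarrow> (\<Sum>y\<in>S. m' x y * m' y z) = 0"
    and m_m': "x \<in> S \<Longrightarrow> z \<in> S \<Longrightarrow> (\<Sum>y\<in>S. m x y * m' y z) = - (\<Sum>y\<in>S. m' x y * m y z)"
    and part_C: "part C u = pr ` (cyc \<inter> homogeneous R S dg u)"
    and diff_C: "f \<in> cyc \<Longrightarrow> diff C (pr f) = pr (matrix_map R S m' f)"
begin

abbreviation "F \<equiv> free_module R S"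
abbreviation "d \<equiv> matrix_map R S m"
abbreviation "d' \<equiv> matrix_map R S m'"
abbreviation "HC \<equiv> total C"

definition tdg where "tdg x = fst (dg x) + snd (dg x)"
definition sg where "sg = sign_map R tdg"

lemma R_cring: "cring R" by (rule A.R.is_cring)

lemma d'_hom: "d' \<in> mod_hom R F F" by (rule matrix_map_hom[OF R_cring finite_S])
lemma d'_closed [simp]: "x \<in> carrier F \<Longrightarrow> d' x \<in> carrier F" by (rule mod_hom_closed[OF d'_hom])

lemma d'_d': "x \<in> carrier F \<Longrightarrow> d' (d' x) = \<zero>\<^bsub>F\<^esub>"
  using matrix_map_comp[OF R_cring finite_S] matrix_map_zero[OF R_cring finite_S _ m'_m'] by (simp add: free_module_simps(2))

lemma d_d': assumes x: "x \<in> carrier F" shows "d (d' x) = \<ominus>\<^bsub>F\<^esub> d' (d x)"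
proof -
  have "d (d' x) = matrix_map R S (\<lambda>x z. - (\<Sum>y\<in>S. m' x y * m y z)) x"
    unfolding matrix_map_comp[OF R_cring finite_S x] by (rule matrix_map_eqI[OF R_cring finite_S x m_m'])
  also have "\<dots> = \<ominus>\<^bsub>F\<^esub> d' (d x)"
    unfolding matrix_map_comp[OF R_cring finite_S x] by (rule matrix_map_uminus[OF R_cring finite_S x])
  finally show ?thesis .
qed

lemma d'_cyc [simp]: "z \<in> cyc \<Longrightarrow> d' z \<in> cyc"
  using mod_hom_zero[OF A_module A_module d'_hom] by (intro cycI) (simp_all add: d_d')

lemma d'_cyc_hom: "d' \<in> mod_hom R (F\<lparr>carrier := cyc\<rparr>) (F\<lparr>carrier := cyc\<rparr>)"
  by (rule mod_hom_into_submodule[OF mod_hom_submodule[OF cyc_submodule d'_hom]]) simp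

text \<open>\<open>diff C\<close> is a function of the class alone, so its formula on classes
  already shows that \<open>pr (d' z)\<close> depends only on \<open>pr z\<close>. The map induced
  by \<open>d'\<close> is linear and coincides with it.\<close>

lemma diff_hom: "diff C \<in> mod_hom R HC HC"
proof -
  have surj: "pr ` carrier (F\<lparr>carrier := cyc\<rparr>) = carrier HC" using pr_surj unfolding cyc_def by simp
  obtain f where f: "f \<in> mod_hom R HC HC" "\<And>z. z \<in> carrier (F\<lparr>carrier := cyc\<rparr>) \<Longrightarrow> f (pr z) = pr (d' z)"
  proof (rule surjection_factor[OF cyc_module H_module pr_cyc_hom surj mod_hom_comp[OF d'_cyc_hom pr_cyc_hom]])
    fix z w assume "z \<in> carrier (F\<lparr>carrier := cyc\<rparr>)" "w \<in> carrier (F\<lparr>carrier := cyc\<rparr>)" "pr z = pr w"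
    then show "pr (d' z) = pr (d' w)" using diff_C by simp metis
  qed (rule that)
  show ?thesis
  proof (rule mod_hom_cong[OF H_module f(1)])
    fix x assume "x \<in> carrier HC"
    then obtain z where "z \<in> cyc" "x = pr z" by (rule prE)
    then show "f x = diff C x" using f(2) by (simp add: diff_C)
  qed
qed

lemma diff_diff: "x \<in> carrier HC \<Longrightarrow> diff C (diff C x) = \<zero>\<^bsub>HC\<^esub>"
  by (erule prE) (simp add: diff_C d'_d' pr_zero)

lemma grading: "bigrading R F (homogeneous R S dg) (\<lambda>u. mask R (\<lambda>x. dg x = u))"
  by (rule free_module_bigrading[OF R_cring finite_S])

lemma mask_shift:
  assumes "x \<in> carrier F" "\<And>x y. x \<in> S \<Longrightarrow> y \<in> S \<Longrightarrow> n x y \<noteq> 0 \<Longrightarrow> dg x = (fst (dg y) + fst b, snd (dg y) + snd b)"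
  shows "matrix_map R S n (mask R (\<lambda>x. dg x = u) x) =
    mask R (\<lambda>x. dg x = (fst u + fst b, snd u + snd b)) (matrix_map R S n x)"
  by (rule matrix_map_mask[OF R_cring finite_S assms(1)]) (auto simp: assms(2) prod_eq_iff)

lemma surj_shift: "surj (\<lambda>u. (fst u + fst b, snd u + snd b) :: int \<times> int)"
proof (rule surjI)
  show "(\<lambda>u. (fst u + fst b, snd u + snd b)) (fst u - fst b, snd u - snd b) = u" for u by simp
qed

text \<open>Degrees on the basis pass to cycles and then to classes; the shift by \<open>e\<close>
  shows that boundaries split into homogeneous boundaries, while \<open>diff C\<close> inherits the
  shift by \<open>e'\<close>.\<close>

lemma homology_grading:
  obtains rho where "bigrading R HC (part C) rho"
    "\<And>u x. x \<in> carrier HC \<Longrightarrow> diff C (rho u x) = rho (fst u + fst e', snd u + snd e') (diff C x)"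
proof -
  have ms: "d (mask R (\<lambda>s. dg s = u) x) = mask R (\<lambda>s. dg s = (fst u + fst e, snd u + snd e)) (d x)"
    if "x \<in> carrier F" for u x by (rule mask_shift[OF that dg_m])
  obtain rho where rho: "bigrading R HC (\<lambda>u. pr ` (cyc \<inter> homogeneous R S dg u)) rho"
    "\<And>u z. z \<in> cyc \<Longrightarrow> rho u (pr z) = pr (mask R (\<lambda>x. dg x = u) z)"
  proof (rule homology_bigrading[where gr = "homogeneous R S dg" and rho = "\<lambda>u. mask R (\<lambda>x. dg x = u)"
        and sh = "\<lambda>u. (fst u + fst e, snd u + snd e)"])
    fix rho assume "bigrading R HC (\<lambda>u. pr ` (cyc \<inter> homogeneous R S dg u)) rho"
      "\<And>u z. z \<in> cyc \<Longrightarrow> rho u (pr z) = pr (mask R (\<lambda>x. dg x = u) z)"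
    then show thesis by (rule that)
  qed (rule grading surj_shift ms, assumption?)+
  interpret gr: bigrading R F "homogeneous R S dg" "\<lambda>u. mask R (\<lambda>x. dg x = u)" by (rule grading)
  have mc: "mask R (\<lambda>x. dg x = u) z \<in> cyc" if z: "z \<in> cyc" for z u
    using z ms[OF cyc_carrier[OF z], of u] mod_hom_zero[OF A_module A_module gr.rho_hom] gr.rho_closed[of z u]
    by (intro cycI) auto
  have "(\<lambda>u. pr ` (cyc \<inter> homogeneous R S dg u)) = part C" by (rule ext) (simp add: part_C)
  then have "bigrading R HC (part C) rho" using rho(1) by simp
  then show thesis
  proof (rule that)
    fix u x assume "x \<in> carrier HC"
    then obtain z where "z \<in> cyc" "x = pr z" by (rule prE)
    then show "diff C (rho u x) = rho (fst u + fst e', snd u + snd e') (diff C x)"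
      by (simp add: rho(2) diff_C mc mask_shift[OF _ dg_m'])
  qed
qed

lemma parity: "parity_grading R F d (mask R (\<lambda>x. even (tdg x))) (mask R (\<lambda>x. odd (tdg x))) sg"
  unfolding sg_def
proof (rule sign_map_parity[OF R_cring finite_S])
  fix x y assume "x \<in> S" "y \<in> S" "m x y \<noteq> 0"
  from dg_m[OF this] show "odd (tdg x - tdg y)" using odd_e by (simp add: tdg_def)
qed

lemma parity': "parity_grading R F d' (mask R (\<lambda>x. even (tdg x))) (mask R (\<lambda>x. odd (tdg x))) sg"
  unfolding sg_def
proof (rule sign_map_parity[OF R_cring finite_S])
  fix x y assume "x \<in> S" "y \<in> S" "m' x y \<noteq> 0"
  from dg_m'[OF this] show "odd (tdg x - tdg y)" using odd_e' by (simp add: tdg_def)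
qed

lemmas sg_hom = parity_grading.sg_hom[OF parity A_module d_hom]
lemmas sg_sg = parity_grading.sg_sg[OF parity A_module d_hom]
lemmas d_sg = parity_grading.d_sg[OF parity A_module d_hom]
lemmas d'_sg = parity_grading.d_sg[OF parity' A_module d'_hom]

lemma sg_closed [simp]: "x \<in> carrier F \<Longrightarrow> sg x \<in> carrier F" by (rule mod_hom_closed[OF sg_hom])

lemma sg_cyc [simp]: "z \<in> cyc \<Longrightarrow> sg z \<in> cyc"
  using mod_hom_zero[OF A_module A_module sg_hom] by (intro cycI) (simp_all add: d_sg)

lemma sg_homogeneous:
  assumes "z \<in> homogeneous R S dg (a, b)" shows "sg z = ring_sign R (a + b) \<odot>\<^bsub>F\<^esub> z"
proof
  fix x
  have "z x = \<zero>\<^bsub>R\<^esub>" if "\<not> (x \<in> S \<and> dg x = (a, b))"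
    using assms that by (auto simp: homogeneous_def free_module_carrier)
  moreover have "ring_sign R k \<in> carrier R" for k by (simp add: ring_sign_def)
  ultimately show "sg z x = (ring_sign R (a + b) \<odot>\<^bsub>F\<^esub> z) x"
    by (cases "x \<in> S \<and> dg x = (a, b)") (auto simp: sg_def sign_map_def tdg_def)
qed

text \<open>The sign operator anticommutes with \<open>d\<close>, hence maps boundaries to
  boundaries and descends to classes. There it plays the role of \<open>sg\<close> when the Kuenneth
  argument is applied to \<open>C\<close>, and on homogeneous classes it is the sign in
  \<open>tensor_diff\<close>.\<close>

lemma homology_sign:
  obtains g where "g \<in> mod_hom R HC HC" "\<And>z. z \<in> cyc \<Longrightarrow> g (pr z) = pr (sg z)"
    "\<And>x. x \<in> carrier HC \<Longrightarrow> g (g x) = x" "\<And>x. x \<in> carrier HC \<Longrightarrow> diff C (g x) = \<ominus>\<^bsub>HC\<^esub> g (diff C x)"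
    "\<And>a b x. x \<in> part C (a, b) \<Longrightarrow> g x = ring_sign R (a + b) \<odot>\<^bsub>HC\<^esub> x"
proof -
  have surj: "pr ` carrier (F\<lparr>carrier := cyc\<rparr>) = carrier HC" using pr_surj unfolding cyc_def by simp
  have sgc: "sg \<in> mod_hom R (F\<lparr>carrier := cyc\<rparr>) (F\<lparr>carrier := cyc\<rparr>)"
    by (rule mod_hom_into_submodule[OF mod_hom_submodule[OF cyc_submodule sg_hom]]) simp
  obtain g where g: "g \<in> mod_hom R HC HC" and g_pr: "\<And>z. z \<in> carrier (F\<lparr>carrier := cyc\<rparr>) \<Longrightarrow> g (pr z) = pr (sg z)"
  proof (rule surjection_factor[OF cyc_module H_module pr_cyc_hom surj mod_hom_comp[OF sgc pr_cyc_hom]])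
    fix z w assume zw: "z \<in> carrier (F\<lparr>carrier := cyc\<rparr>)" "w \<in> carrier (F\<lparr>carrier := cyc\<rparr>)" "pr z = pr w"
    then have zw': "z \<in> cyc" "w \<in> cyc" by simp_all
    obtain x where x: "x \<in> carrier F" "z = w \<oplus>\<^bsub>F\<^esub> d x" using pr_eqE[OF zw' zw(3)] .
    have "sg (d x) = d (\<ominus>\<^bsub>F\<^esub> sg x)"
      using x by (simp add: mod_hom_minus[OF A_module A_module d_hom] d_sg A.M.minus_minus)
    then have "sg z = sg w \<oplus>\<^bsub>F\<^esub> d (\<ominus>\<^bsub>F\<^esub> sg x)" using x zw' by (simp add: mod_hom_add[OF sg_hom])
    then show "pr (sg z) = pr (sg w)" using x zw' by (simp add: pr_add)
  qed (rule that)
  have g_pr: "g (pr z) = pr (sg z)" if "z \<in> cyc" for z using g_pr that by simp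
  show thesis
  proof (rule that[OF g g_pr])
    show "g (g x) = x" if "x \<in> carrier HC" for x
    proof -
      from that obtain z where "z \<in> cyc" "x = pr z" by (rule prE)
      then show ?thesis by (simp add: g_pr sg_sg)
    qed
    show "diff C (g x) = \<ominus>\<^bsub>HC\<^esub> g (diff C x)" if "x \<in> carrier HC" for x
    proof -
      from that obtain z where "z \<in> cyc" "x = pr z" by (rule prE)
      then show ?thesis by (simp add: g_pr diff_C d'_sg pr_minus)
    qed
    show "g x = ring_sign R (a + b) \<odot>\<^bsub>HC\<^esub> x" if "x \<in> part C (a, b)" for a b x
    proof -
      from that obtain z where z: "z \<in> cyc" "z \<in> homogeneous R S dg (a, b)" "x = pr z" by (auto simp: part_C)
      then show ?thesis by (simp add: g_pr sg_homogeneous pr_smult ring_sign_def)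
    qed
  qed
qed

abbreviation "HH \<equiv> complex_homology C"
abbreviation "prH \<equiv> \<lambda>x. diff_image C +>\<^bsub>HC\<^esub> x"

lemma HH_presented: "presented_homology R HC (total HH) (diff C) prH"
  by (rule complex_homology_presented[OF H_module diff_hom diff_diff])

lemma HH_grading:
  obtains rho where "bigrading R (total HH) (part HH) rho"
proof -
  interpret HH: presented_homology R HC "total HH" "diff C" prH by (rule HH_presented)
  obtain rho where rho: "bigrading R HC (part C) rho"
    "\<And>u x. x \<in> carrier HC \<Longrightarrow> diff C (rho u x) = rho (fst u + fst e', snd u + snd e') (diff C x)"
    by (rule homology_grading) (rule that)
  obtain rho' where "bigrading R (total HH) (\<lambda>u. prH ` (HH.cyc \<inter> part C u)) rho'"
  proof (rule HH.homology_bigrading[where gr = "part C" and rho = rho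
        and sh = "\<lambda>u. (fst u + fst e', snd u + snd e')"])
    fix rho' assume "bigrading R (total HH) (\<lambda>u. prH ` (HH.cyc \<inter> part C u)) rho'"
    then show thesis by (rule that)
  qed (rule rho surj_shift, assumption?)+
  also have "(\<lambda>u. prH ` (HH.cyc \<inter> part C u)) = part HH"
    unfolding complex_homology_def HH.cyc_def diff_kernel_def by (simp add: Int_commute)
  finally show thesis by (rule that)
qed

lemma finite_retract_F: "finite_retract R F S (\<lambda>x. x) (\<lambda>x. x)"
  by (rule finite_retract_free[OF finite_S])

text \<open>Projectivity and the field case both provide a linear choice of representing cycles; the
  splitting is built from it and then made odd.\<close>

lemma odd_splitting:
  assumes "principal_domain R" "projective R HC \<or> field R"
  obtains h where "h \<in> mod_hom R F F" "\<And>x. x \<in> carrier F \<Longrightarrow> d (h (d x)) = d x"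
    "\<And>x. x \<in> carrier F \<Longrightarrow> h (sg x) = \<ominus>\<^bsub>F\<^esub> sg (h x)"
proof -
  obtain t where t: "t \<in> mod_hom R HC F" "\<And>x. x \<in> carrier HC \<Longrightarrow> t x \<in> cyc" "\<And>x. x \<in> carrier HC \<Longrightarrow> pr (t x) = x"
    using assms(2)
  proof
    assume "projective R HC"
    show thesis by (rule projective_section[OF \<open>projective R HC\<close>]) (rule that)
  next
    assume "field R"
    show thesis by (rule field_section[OF \<open>field R\<close> finite_retract_F]) (rule that)
  qed
  obtain h where h: "h \<in> mod_hom R F F" "\<And>x. x \<in> carrier F \<Longrightarrow> d (h (d x)) = d x"
    by (rule splitting_from_section[OF assms(1) finite_retract_F t]) (assumption+, rule that)
  show thesis
    by (rule parity_grading.odd_splitting[OF parity A_module d_hom h]) (assumption, rule that)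
qed

end

text \<open>One sign function \<open>tau\<close> must serve both matrices: the cross product,
  defined through the first differential, has to be compatible with the second. In both rules the
  sign is that of the total degree of the left basis element.\<close>

locale tensor_double_complex =
  K: double_complex R S1 CK mK prK mK' dgK eK eK' + L: double_complex R S2 CL mL prL mL' dgL eL eL' +
  J: double_complex R S CJ mJ prJ mJ' dgJ eJ eJ' + free_tensor R S1 S2 S j tau
  for R :: "('r, 's) ring_scheme" and S1 :: "'x set" and CK :: "('r, 'h) bigraded_complex" and mK prK mK' dgK eK eK'
    and S2 :: "'y set" and CL :: "('r, 'k) bigraded_complex" and mL prL mL' dgL eL eL'
    and S :: "'z set" and CJ :: "('r, 'l) bigraded_complex" and mJ prJ mJ' dgJ eJ eJ' and j tau +
  assumes R_pid: "principal_domain R"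
    and dg_j: "x \<in> S1 \<Longrightarrow> y \<in> S2 \<Longrightarrow> dgJ (j x y) = (fst (dgK x) + fst (dgL y), snd (dgK x) + snd (dgL y))"
    and m_leibniz: "x \<in> S1 \<Longrightarrow> x' \<in> S1 \<Longrightarrow> y \<in> S2 \<Longrightarrow> y' \<in> S2 \<Longrightarrow>
      mJ (j x y) (j x' y') * tau x' y' = tau x y * ((if y = y' then mK x x' else 0) +
        (if x = x' then (if even (fst (dgK x) + snd (dgK x)) then 1 else - 1) * mL y y' else 0))"
    and m'_leibniz: "x \<in> S1 \<Longrightarrow> x' \<in> S1 \<Longrightarrow> y \<in> S2 \<Longrightarrow> y' \<in> S2 \<Longrightarrow>
      mJ' (j x y) (j x' y') * tau x' y' = tau x y * ((if y = y' then mK' x x' else 0) +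
        (if x = x' then (if even (fst (dgK x) + snd (dgK x)) then 1 else - 1) * mL' y y' else 0))"
begin

lemma d_bt: "f \<in> carrier F1 \<Longrightarrow> g \<in> carrier F2 \<Longrightarrow> J.d (bt f g) = bt (K.d f) g \<oplus>\<^bsub>F\<^esub> bt (K.sg f) (L.d g)"
  unfolding K.sg_def by (rule bt_leibniz) (simp_all only: m_leibniz K.tdg_def)

lemma d'_bt: "f \<in> carrier F1 \<Longrightarrow> g \<in> carrier F2 \<Longrightarrow> J.d' (bt f g) = bt (K.d' f) g \<oplus>\<^bsub>F\<^esub> bt (K.sg f) (L.d' g)"
  unfolding K.sg_def by (rule bt_leibniz) (simp_all only: m'_leibniz K.tdg_def)

lemma bt_homogeneous:
  assumes "f \<in> homogeneous R S1 dgK u" "g \<in> homogeneous R S2 dgL v"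
  shows "bt f g \<in> homogeneous R S dgJ (fst u + fst v, snd u + snd v)"
  unfolding homogeneous_def
proof (intro CollectI conjI ballI impI)
  have c: "f \<in> carrier F1" "g \<in> carrier F2" using assms by (auto simp: homogeneous_def)
  then show "bt f g \<in> carrier F" by (rule bilinear_closed[OF bt_bilinear])
  fix z assume "z \<in> S" and ne: "dgJ z \<noteq> (fst u + fst v, snd u + snd v)"
  then obtain x y where z: "x \<in> S1" "y \<in> S2" "z = j x y" by (metis jE)
  have fg: "f x \<in> carrier R" "g y \<in> carrier R" using c by (auto simp: free_module_carrier)
  have "dgK x \<noteq> u \<or> dgL y \<noteq> v" using ne z by (auto simp: dg_j)
  then have "f x = \<zero>\<^bsub>R\<^esub> \<or> g y = \<zero>\<^bsub>R\<^esub>" using assms z by (auto simp: homogeneous_def)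
  then show "bt f g z = \<zero>\<^bsub>R\<^esub>" using z fg by (auto simp: bt_def)
qed

lemma complexes_kunneth:
  obtains u where "kunneth R F1 K.HC K.d prK F2 L.HC L.d prL F J.HC J.d prJ K.sg bt u"
proof -
  obtain u where u: "u \<in> mod_hom R F (tensor_module R F1 F2)"
    "\<And>f g. f \<in> carrier F1 \<Longrightarrow> g \<in> carrier F2 \<Longrightarrow> u (bt f g) = pure_tensor R F1 F2 f g"
    by (rule to_tensor) (rule that)
  have "kunneth R F1 K.HC K.d prK F2 L.HC L.d prL F J.HC J.d prJ K.sg bt u"
  proof (intro kunneth.intro kunneth_axioms.intro)
  qed (fact K.presented_homology_axioms L.presented_homology_axioms J.presented_homology_axioms K.sg_hom K.sg_sg
      K.d_sg bt_bilinear bt_span u d_bt)+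
  then show thesis by (rule that)
qed

text \<open>The cross product is exported together with its values on cycles, so that the second
  differential can be computed on representatives.\<close>

lemma cross_isomorphism:
  assumes "projective R K.HC \<or> projective R L.HC \<or> field R"
  obtains ka where "ka \<in> mod_hom R (tensor_module R K.HC L.HC) J.HC"
    "bij_betw ka (carrier (tensor_module R K.HC L.HC)) (carrier J.HC)"
    "\<And>w. ka ` part (bigraded_tensor R CK CL) w = part CJ w"
    "\<And>x y u v. x \<in> part CK u \<Longrightarrow> y \<in> part CL v \<Longrightarrow>
      ka (pure_tensor R K.HC L.HC x y) \<in> part CJ (fst u + fst v, snd u + snd v)"
    "\<And>z w. z \<in> K.cyc \<Longrightarrow> w \<in> L.cyc \<Longrightarrow>
      ka (pure_tensor R K.HC L.HC (prK z) (prL w)) = prJ (bt z w)"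
    "\<And>z w. z \<in> K.cyc \<Longrightarrow> w \<in> L.cyc \<Longrightarrow> bt z w \<in> J.cyc"
proof -
  obtain u where "kunneth R F1 K.HC K.d prK F2 L.HC L.d prL F J.HC J.d prJ K.sg bt u"
    by (rule complexes_kunneth)
  then interpret k: kunneth R F1 K.HC K.d prK F2 L.HC L.d prL F J.HC J.d prJ K.sg bt u .
  obtain qA where qA: "qA \<in> mod_hom R F1 K.HC" "\<And>z. z \<in> K.cyc \<Longrightarrow> qA z = prK z"
    by (rule K.pr_extension[OF R_pid K.finite_retract_F]) (rule that)
  obtain qB where qB: "qB \<in> mod_hom R F2 L.HC" "\<And>z. z \<in> L.cyc \<Longrightarrow> qB z = prL z"
    by (rule L.pr_extension[OF R_pid L.finite_retract_F]) (rule that)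
  have inj: "inj_on k.cross (carrier k.T)" by (rule k.cross_inj[OF qA qB])
  have surj: "k.cross ` carrier k.T = carrier J.HC"
  \<comment> \<open>A field is treated through the right factor, which leaves projectivity of the
    left one as the other case.\<close>
  proof (cases "projective R L.HC \<or> field R")
    case True
    obtain h where h: "h \<in> mod_hom R F2 F2" "\<And>x. x \<in> carrier F2 \<Longrightarrow> L.d (h (L.d x)) = L.d x"
      by (rule L.odd_splitting[OF R_pid True]) (rule that)
    show ?thesis by (rule k.cross_surj_right[OF h L.finite_retract_F])
  next
    case False
    then have *: "projective R K.HC \<or> field R" using assms by blast
    obtain h where h: "h \<in> mod_hom R F1 F1" "\<And>x. x \<in> carrier F1 \<Longrightarrow> K.d (h (K.d x)) = K.d x"
      "\<And>x. x \<in> carrier F1 \<Longrightarrow> h (K.sg x) = \<ominus>\<^bsub>F1\<^esub> K.sg (h x)"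
      by (rule K.odd_splitting[OF R_pid *]) (rule that)
    show ?thesis by (rule k.cross_surj_left[OF h K.finite_retract_F])
  qed
  have hom: "k.cross (k.pt x y) \<in> part CJ (fst u + fst v, snd u + snd v)"
    if "x \<in> part CK u" "y \<in> part CL v" for x y u v
  proof -
    obtain z where z: "z \<in> K.cyc" "z \<in> homogeneous R S1 dgK u" "x = prK z" using \<open>x \<in> part CK u\<close> by (auto simp: K.part_C)
    obtain w where w: "w \<in> L.cyc" "w \<in> homogeneous R S2 dgL v" "y = prL w" using \<open>y \<in> part CL v\<close> by (auto simp: L.part_C)
    show ?thesis
      using z w k.bt_cyc bt_homogeneous by (auto simp: k.cross_pure J.part_C)
  qed
  obtain rK where rK: "bigrading R K.HC (part CK) rK" by (rule K.homology_grading)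
  obtain rL where rL: "bigrading R L.HC (part CL) rL" by (rule L.homology_grading)
  obtain rJ where rJ: "bigrading R J.HC (part CJ) rJ" by (rule J.homology_grading)
  show thesis
  proof (rule that[OF k.cross_hom _ _ hom k.cross_pure k.bt_cyc])
    show "bij_betw k.cross (carrier k.T) (carrier J.HC)" using inj surj by (simp add: bij_betw_def)
    show "k.cross ` part (bigraded_tensor R CK CL) w = part CJ w" for w
      using k.cross_graded[OF rK rL rJ surj hom] by (simp add: bigraded_tensor_def)
  qed
qed

text \<open>On representing cycles this is the Leibniz rule of \<open>d'\<close> on chains. It makes
  the cross product a chain map and is also the Leibniz hypothesis of the second Kuenneth
  step.\<close>

lemma cross_leibniz:
  assumes ka: "ka \<in> mod_hom R (tensor_module R K.HC L.HC) J.HC"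
    and ka_pr: "\<And>z w. z \<in> K.cyc \<Longrightarrow> w \<in> L.cyc \<Longrightarrow> ka (pure_tensor R K.HC L.HC (prK z) (prL w)) = prJ (bt z w)"
    and bt_cyc: "\<And>z w. z \<in> K.cyc \<Longrightarrow> w \<in> L.cyc \<Longrightarrow> bt z w \<in> J.cyc"
    and g: "\<And>z. z \<in> K.cyc \<Longrightarrow> g (prK z) = prK (K.sg z)"
    and xy: "x \<in> carrier K.HC" "y \<in> carrier L.HC"
  shows "diff CJ (ka (pure_tensor R K.HC L.HC x y)) =
    ka (pure_tensor R K.HC L.HC (diff CK x) y) \<oplus>\<^bsub>J.HC\<^esub> ka (pure_tensor R K.HC L.HC (g x) (diff CL y))"
proof -
  obtain z where z: "z \<in> K.cyc" "x = prK z" using xy(1) by (rule K.prE)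
  obtain w where w: "w \<in> L.cyc" "y = prL w" using xy(2) by (rule L.prE)
  have "diff CJ (ka (pure_tensor R K.HC L.HC x y)) = prJ (J.d' (bt z w))"
    using z w by (simp add: ka_pr J.diff_C bt_cyc)
  also have "\<dots> = prJ (bt (K.d' z) w) \<oplus>\<^bsub>J.HC\<^esub> prJ (bt (K.sg z) (L.d' w))"
    using z w by (simp add: d'_bt J.pr_add bt_cyc)
  finally show ?thesis using z w by (simp add: K.diff_C L.diff_C g ka_pr)
qed

lemma complexes_isomorphic:
  assumes "projective R K.HC \<or> projective R L.HC"
  shows "isomorphic_complexes R CJ (complex_tensor R CK CL)"
proof -
  let ?T = "tensor_module R K.HC L.HC" and ?t = "pure_tensor R K.HC L.HC"
  have T: "module R ?T" by (rule tensor_module_module[OF K.H_module L.H_module])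
  have "projective R K.HC \<or> projective R L.HC \<or> field R" using assms by blast
  then obtain ka where ka: "ka \<in> mod_hom R ?T J.HC" "bij_betw ka (carrier ?T) (carrier J.HC)"
    "\<And>w. ka ` part (bigraded_tensor R CK CL) w = part CJ w"
    "\<And>z w. z \<in> K.cyc \<Longrightarrow> w \<in> L.cyc \<Longrightarrow> ka (?t (prK z) (prL w)) = prJ (bt z w)"
    and bt_cyc: "\<And>z w. z \<in> K.cyc \<Longrightarrow> w \<in> L.cyc \<Longrightarrow> bt z w \<in> J.cyc"
    by (rule cross_isomorphism) (rule that)
  obtain rK where rK: "bigrading R K.HC (part CK) rK" by (rule K.homology_grading)
  obtain rL where rL: "bigrading R L.HC (part CL) rL" by (rule L.homology_grading)
  obtain g where g: "g \<in> mod_hom R K.HC K.HC" "\<And>z. z \<in> K.cyc \<Longrightarrow> g (prK z) = prK (K.sg z)"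
    "\<And>a b x. x \<in> part CK (a, b) \<Longrightarrow> g x = ring_sign R (a + b) \<odot>\<^bsub>K.HC\<^esub> x"
    by (rule K.homology_sign) (rule that)
  note td = tensor_diff_spec[OF rK L.H_module K.diff_hom L.diff_hom g(1,3)]
  have chain: "ka (tensor_diff R CK CL t) = diff CJ (ka t)" if t: "t \<in> carrier ?T" for t
  proof (rule tensor_hom_eq[OF K.H_module L.H_module J.H_module mod_hom_comp[OF td(1) ka(1)] mod_hom_comp[OF ka(1) J.diff_hom] _ t])
    fix x y assume xy: "x \<in> carrier K.HC" "y \<in> carrier L.HC"
    have "ka (tensor_diff R CK CL (?t x y)) = ka (?t (diff CK x) y) \<oplus>\<^bsub>J.HC\<^esub> ka (?t (g x) (diff CL y))"
      using xy tensor_pure_closed[OF K.H_module L.H_module] mod_hom_closed[OF K.diff_hom]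
        mod_hom_closed[OF L.diff_hom] mod_hom_closed[OF g(1)] by (simp add: td(2) mod_hom_add[OF ka(1)])
    also have "\<dots> = diff CJ (ka (?t x y))" by (rule cross_leibniz[OF ka(1,4) bt_cyc g(2) xy, symmetric])
    finally show "ka (tensor_diff R CK CL (?t x y)) = diff CJ (ka (?t x y))" .
  qed
  have iso: "ka \<in> bigraded_iso R (complex_tensor R CK CL) CJ"
    unfolding bigraded_iso_def
  proof (intro CollectI conjI allI)
    show "ka ` part (complex_tensor R CK CL) u = part CJ u" for u
      using ka(3)[of u] by (simp add: complex_tensor_def)
  qed (use ka(1,2) in \<open>simp_all add: complex_tensor_def bigraded_tensor_def\<close>)
  show ?thesis
    unfolding isomorphic_complexes_def
  proof (intro bexI ballI)
    have "inv_into (carrier (total (complex_tensor R CK CL))) ka \<in> bigraded_iso R CJ (complex_tensor R CK CL)"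
    proof (rule bigraded_iso_inverse[OF _ _ iso])
      show "part (complex_tensor R CK CL) u \<subseteq> carrier (total (complex_tensor R CK CL))" for u
        using bigraded_tensor_part_carrier[OF rK rL, of u] by (simp add: complex_tensor_def bigraded_tensor_def)
    qed (simp add: complex_tensor_def bigraded_tensor_def T)
    then show "inv_into (carrier ?T) ka \<in> bigraded_iso R CJ (complex_tensor R CK CL)"
      by (simp add: complex_tensor_def bigraded_tensor_def)
    have inj: "inj_on ka (carrier ?T)" and im: "ka ` carrier ?T = carrier J.HC"
      using ka(2) by (auto simp: bij_betw_def)
    fix x assume "x \<in> carrier J.HC"
    then obtain t where t: "t \<in> carrier ?T" "x = ka t" using im by blast
    have "inv_into (carrier ?T) ka (diff CJ (ka t)) = inv_into (carrier ?T) ka (ka (tensor_diff R CK CL t))"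
      using chain[OF t(1)] by simp
    also have "\<dots> = tensor_diff R CK CL t" using inj mod_hom_closed[OF td(1) t(1)] by simp
    finally show "inv_into (carrier ?T) ka (diff CJ x) = diff (complex_tensor R CK CL) (inv_into (carrier ?T) ka x)"
      using t inj by (simp add: complex_tensor_def)
  qed
qed

text \<open>The bilinear map is \<open>ka\<close> of a pure tensor, and the inverse of
  \<open>ka\<close> leads back to the tensor product. \<open>CH\<close> comes without a basis; the
  retracts of finite free modules that exist over a field take its place.\<close>

lemma homologies_isomorphic:
  assumes field: "field R"
  shows "isomorphic_bigraded R (complex_homology CJ) (bigraded_tensor R (complex_homology CK) (complex_homology CL))"
proof -
  let ?T = "tensor_module R K.HC L.HC" and ?t = "pure_tensor R K.HC L.HC"
  note T = tensor_module_module[OF K.H_module L.H_module] and t_closed = tensor_pure_closed[OF K.H_module L.H_module]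
  have "projective R K.HC \<or> projective R L.HC \<or> field R" using assms by blast
  then obtain ka where ka: "ka \<in> mod_hom R ?T J.HC" "bij_betw ka (carrier ?T) (carrier J.HC)"
    "\<And>x y u v. x \<in> part CK u \<Longrightarrow> y \<in> part CL v \<Longrightarrow> ka (?t x y) \<in> part CJ (fst u + fst v, snd u + snd v)"
    "\<And>z w. z \<in> K.cyc \<Longrightarrow> w \<in> L.cyc \<Longrightarrow> ka (?t (prK z) (prL w)) = prJ (bt z w)"
    and bt_cyc: "\<And>z w. z \<in> K.cyc \<Longrightarrow> w \<in> L.cyc \<Longrightarrow> bt z w \<in> J.cyc"
    by (rule cross_isomorphism) (rule that)
  have inj: "inj_on ka (carrier ?T)" and im: "ka ` carrier ?T = carrier J.HC"
    using ka(2) by (auto simp: bij_betw_def)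
  obtain g where g: "g \<in> mod_hom R K.HC K.HC" "\<And>z. z \<in> K.cyc \<Longrightarrow> g (prK z) = prK (K.sg z)"
    "\<And>x. x \<in> carrier K.HC \<Longrightarrow> g (g x) = x" "\<And>x. x \<in> carrier K.HC \<Longrightarrow> diff CK (g x) = \<ominus>\<^bsub>K.HC\<^esub> g (diff CK x)"
    by (rule K.homology_sign) (rule that)
  interpret k: kunneth R K.HC "total K.HH" "diff CK" K.prH L.HC "total L.HH" "diff CL" L.prH
    J.HC "total J.HH" "diff CJ" J.prH g "\<lambda>x y. ka (?t x y)" "inv_into (carrier ?T) ka"
  proof (intro kunneth.intro kunneth_axioms.intro)
    show "bilinear_map R K.HC L.HC J.HC (\<lambda>x y. ka (?t x y))"
      by (rule bilinear_comp[OF pure_tensor_bilinear[OF K.H_module L.H_module] mod_hom_id mod_hom_id ka(1)])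
    let ?X = "{ka (?t x y) | x y. x \<in> carrier K.HC \<and> y \<in> carrier L.HC}"
    have X: "?X \<subseteq> carrier J.HC" using t_closed mod_hom_closed[OF ka(1)] by blast
    show "carrier J.HC \<subseteq> mod_span R J.HC ?X"
    proof
      fix y assume "y \<in> carrier J.HC"
      then obtain t where t: "t \<in> carrier ?T" "y = ka t" using im by blast
      have "ka t \<in> mod_span R J.HC ?X"
        by (rule mod_hom_span_into[OF T J.H_module ka(1) submodule_span[OF J.H_module X] _ _
              subsetD[OF tensor_span[OF K.H_module L.H_module] t(1)]])
          (use t_closed in \<open>auto intro!: mod_span_base\<close>)
      then show "y \<in> mod_span R J.HC ?X" using t by simp
    qed
    show "inv_into (carrier ?T) ka \<in> mod_hom R J.HC ?T" by (rule mod_hom_inverse[OF T ka(1,2)])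
    show "inv_into (carrier ?T) ka (ka (?t x y)) = ?t x y" if "x \<in> carrier K.HC" "y \<in> carrier L.HC" for x y
      using inj t_closed[OF that] by simp
    show "diff CJ (ka (?t x y)) = ka (?t (diff CK x) y) \<oplus>\<^bsub>J.HC\<^esub> ka (?t (g x) (diff CL y))"
      if "x \<in> carrier K.HC" "y \<in> carrier L.HC" for x y
      by (rule cross_leibniz[OF ka(1,4) bt_cyc g(2) that])
  qed (fact K.HH_presented L.HH_presented J.HH_presented g)+
  obtain iK pK where retK: "finite_retract R K.HC S1 iK pK"
    by (rule K.field_homology_retract[OF R_pid field K.finite_retract_F])
  obtain iL pL where retL: "finite_retract R L.HC S2 iL pL"
    by (rule L.field_homology_retract[OF R_pid field L.finite_retract_F])
  obtain qA where qA: "qA \<in> mod_hom R K.HC (total K.HH)" "\<And>z. z \<in> k.A.cyc \<Longrightarrow> qA z = K.prH z"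
    by (rule k.A.pr_extension[OF R_pid retK]) (rule that)
  obtain qB where qB: "qB \<in> mod_hom R L.HC (total L.HH)" "\<And>z. z \<in> k.B.cyc \<Longrightarrow> qB z = L.prH z"
    by (rule k.B.pr_extension[OF R_pid retL]) (rule that)
  obtain t where t: "t \<in> mod_hom R (total L.HH) L.HC" "\<And>x. x \<in> carrier (total L.HH) \<Longrightarrow> t x \<in> k.B.cyc"
    "\<And>x. x \<in> carrier (total L.HH) \<Longrightarrow> L.prH (t x) = x"
    by (rule k.B.field_section[OF field retL]) (rule that)
  obtain h where h: "h \<in> mod_hom R L.HC L.HC" "\<And>x. x \<in> carrier L.HC \<Longrightarrow> diff CL (h (diff CL x)) = diff CL x"
    by (rule k.B.splitting_from_section[OF R_pid retL t]) (assumption+, rule that)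
  have inj': "inj_on k.cross (carrier k.T)" by (rule k.cross_inj[OF qA qB])
  have surj': "k.cross ` carrier k.T = carrier (total J.HH)" by (rule k.cross_surj_right[OF h retL])
  obtain rK where rK: "bigrading R (total K.HH) (part K.HH) rK" by (rule K.HH_grading)
  obtain rL where rL: "bigrading R (total L.HH) (part L.HH) rL" by (rule L.HH_grading)
  obtain rJ where rJ: "bigrading R (total J.HH) (part J.HH) rJ" by (rule J.HH_grading)
  have hom: "k.cross (k.pt x y) \<in> part J.HH (fst u + fst v, snd u + snd v)"
    if "x \<in> part K.HH u" "y \<in> part L.HH v" for x y u v
  proof -
    obtain a where a: "a \<in> k.A.cyc" "a \<in> part CK u" "x = K.prH a"
      using \<open>x \<in> part K.HH u\<close> unfolding complex_homology_def diff_kernel_def k.A.cyc_def by auto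
    obtain b where b: "b \<in> k.B.cyc" "b \<in> part CL v" "y = L.prH b"
      using \<open>y \<in> part L.HH v\<close> unfolding complex_homology_def diff_kernel_def k.B.cyc_def by auto
    have "k.cross (k.pt x y) = J.prH (ka (?t a b))" using a b by (simp add: k.cross_pure)
    moreover have "ka (?t a b) \<in> part CJ (fst u + fst v, snd u + snd v)" using a b ka(3) by blast
    moreover have "ka (?t a b) \<in> diff_kernel CJ"
      using k.bt_cyc[OF a(1) b(1)] unfolding k.E.cyc_def diff_kernel_def .
    ultimately show ?thesis by (simp add: complex_homology_def)
  qed
  have "k.cross \<in> bigraded_iso R (bigraded_tensor R K.HH L.HH) J.HH"
    unfolding bigraded_iso_def
  proof (intro CollectI conjI allI)
    show "k.cross ` part (bigraded_tensor R K.HH L.HH) u = part J.HH u" for u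
      using k.cross_graded[OF rK rL rJ surj' hom, of u] by (simp add: bigraded_tensor_def)
  qed (use k.cross_hom inj' surj' in \<open>simp_all add: bigraded_tensor_def bij_betw_def\<close>)
  then have "inv_into (carrier (total (bigraded_tensor R K.HH L.HH))) k.cross \<in> bigraded_iso R J.HH (bigraded_tensor R K.HH L.HH)"
  proof (rule bigraded_iso_inverse[rotated 2])
    show "module R (total (bigraded_tensor R K.HH L.HH))" using k.T_module by (simp add: bigraded_tensor_def)
    show "part (bigraded_tensor R K.HH L.HH) u \<subseteq> carrier (total (bigraded_tensor R K.HH L.HH))" for u
      using bigraded_tensor_part_carrier[OF rK rL, of u] by (simp add: bigraded_tensor_def)
  qed
  then show ?thesis unfolding isomorphic_bigraded_def by blast
qed

end

section \<open>Incidence numbers\<close>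

definition eps :: "'v rel \<Rightarrow> 'v \<Rightarrow> 'v set \<Rightarrow> int" where
  "eps r i X = (- 1) ^ card {k \<in> X. k \<noteq> i \<and> (k, i) \<in> r}"

text \<open>The coefficient of the facet \<open>Y\<close> in the boundary of \<open>X\<close>. As a
  sum over \<open>X\<close> it vanishes when \<open>Y\<close> does not arise by deleting one vertex,
  and also for infinite \<open>X\<close>; a nonzero value therefore carries all the needed
  information.\<close>

definition inc :: "'v rel \<Rightarrow> 'v set \<Rightarrow> 'v set \<Rightarrow> int" where
  "inc r X Y = (\<Sum>i\<in>X. if Y = X - {i} then eps r i X else 0)"

lemma (in cring) vertex_sign_eq: "vertex_sign R r i X = ring_int R (eps r i X)"
  by (simp add: vertex_sign_def ring_sign_eq eps_def)

lemma inc_diff: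
  assumes "finite X" "i \<in> X" shows "inc r X (X - {i}) = eps r i X"
proof -
  have "inc r X (X - {i}) = (\<Sum>k\<in>X. if k = i then eps r k X else 0)"
    unfolding inc_def using assms(2) by (intro sum.cong) auto
  then show ?thesis using assms by simp
qed

lemma inc_nonzeroE:
  assumes "inc r X Y \<noteq> 0"
  obtains i where "finite X" "i \<in> X" "Y = X - {i}" "inc r X Y = eps r i X"
proof -
  have "finite X" using assms by (auto simp: inc_def intro: ccontr)
  moreover have "\<exists>i\<in>X. Y = X - {i}"
  proof (rule ccontr)
    assume "\<not> (\<exists>i\<in>X. Y = X - {i})"
    then have "inc r X Y = 0" unfolding inc_def by (intro sum.neutral) auto
    with assms show False ..
  qed
  then obtain i where "i \<in> X" "Y = X - {i}" by blast
  ultimately show thesis using that inc_diff by metis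
qed

lemma eps_remove:
  assumes "finite X" "j \<in> X" "j \<noteq> k"
  shows "eps r k (X - {j}) = (if (j, k) \<in> r then - eps r k X else eps r k X)"
proof (cases "(j, k) \<in> r")
  case True
  have "{i \<in> X. i \<noteq> k \<and> (i, k) \<in> r} = insert j {i \<in> X - {j}. i \<noteq> k \<and> (i, k) \<in> r}"
    using True assms by auto
  then have "card {i \<in> X. i \<noteq> k \<and> (i, k) \<in> r} = Suc (card {i \<in> X - {j}. i \<noteq> k \<and> (i, k) \<in> r})"
    using assms(1) by simp
  then show ?thesis using True by (simp add: eps_def)
next
  case False
  then have "{i \<in> X. i \<noteq> k \<and> (i, k) \<in> r} = {i \<in> X - {j}. i \<noteq> k \<and> (i, k) \<in> r}" by auto
  then show ?thesis using False by (simp add: eps_def)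
qed

lemma linear_order_cases:
  assumes "linear_order_on V r" "j \<in> V" "k \<in> V" "j \<noteq> k"
  shows "(j, k) \<in> r \<longleftrightarrow> (k, j) \<notin> r"
  using assms unfolding order_on_defs total_on_def antisym_def by blast

text \<open>Of two distinct vertices exactly one precedes the other, so deleting one before taking
  the sign of the other flips exactly one of the two signs.\<close>

lemma eps_swap:
  assumes "linear_order_on V r" "X \<subseteq> V" "finite X" "j \<in> X" "k \<in> X" "j \<noteq> k"
  shows "eps r j X * eps r k (X - {j}) = - (eps r k X * eps r j (X - {k}))"
  using assms linear_order_cases[OF assms(1), of j k] by (auto simp: eps_remove)

text \<open>A face of codimension two is reached through exactly two intermediate faces, whose
  contributions cancel by exchanging the order of deletion. \<open>P\<close> has only to contain
  these faces, so faces of a complex and supports are covered alike.\<close>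

lemma inc_inc:
  assumes "linear_order_on V r" "X \<subseteq> V" "finite P" and P: "\<And>Y. inc r X Y \<noteq> 0 \<Longrightarrow> inc r Y Z \<noteq> 0 \<Longrightarrow> Y \<in> P"
  shows "(\<Sum>Y\<in>P. inc r X Y * inc r Y Z) = 0"
proof (cases "\<exists>Y\<in>P. inc r X Y * inc r Y Z \<noteq> 0")
  case True
  then obtain Y where "inc r X Y \<noteq> 0" "inc r Y Z \<noteq> 0" by auto
  then obtain j k where jk: "finite X" "j \<in> X" "Y = X - {j}" "k \<in> X - {j}" "Z = X - {j} - {k}"
    by (metis inc_nonzeroE)
  have fX: "finite (X - {j})" "finite (X - {k})" using jk(1) by auto
  have Zk: "Z = X - {k} - {j}" using jk by auto
  have 1: "inc r X (X - {j}) * inc r (X - {j}) Z = eps r j X * eps r k (X - {j})"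
    using jk fX by (simp add: inc_diff)
  have 2: "inc r X (X - {k}) * inc r (X - {k}) Z = eps r k X * eps r j (X - {k})"
    unfolding Zk using jk fX by (auto simp: inc_diff)
  have e: "eps r i W \<noteq> 0" for i W by (simp add: eps_def)
  have "inc r X (X - {j}) \<noteq> 0" "inc r (X - {j}) Z \<noteq> 0" "inc r X (X - {k}) \<noteq> 0" "inc r (X - {k}) Z \<noteq> 0"
    using 1 2 e by (metis mult_eq_0_iff)+
  then have in_P: "X - {j} \<in> P" "X - {k} \<in> P" using P by auto
  have other: "inc r X Y * inc r Y Z = 0" if "Y \<notin> {X - {j}, X - {k}}" for Y
  proof (rule ccontr)
    assume "inc r X Y * inc r Y Z \<noteq> 0"
    then obtain a b where "a \<in> X" "Y = X - {a}" "b \<in> X - {a}" "Z = X - {a} - {b}"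
      by (metis inc_nonzeroE mult_eq_0_iff)
    then show False using that jk by auto
  qed
  have "(\<Sum>Y\<in>P. inc r X Y * inc r Y Z) = (\<Sum>Y\<in>{X - {j}, X - {k}}. inc r X Y * inc r Y Z)"
    using in_P other assms(3) by (intro sum.mono_neutral_right) auto
  also have "\<dots> = 0"
    using jk eps_swap[OF assms(1,2) jk(1), of j k] 1 2 by (subst sum.insert) auto
  finally show ?thesis .
qed (metis (no_types, lifting) sum.neutral)

text \<open>The parity of the number of inversions between two orders compares their incidence numbers.\<close>

definition inv_sign :: "'v rel \<Rightarrow> 'v rel \<Rightarrow> 'v set \<Rightarrow> int" where
  "inv_sign r t X = (- 1) ^ card {(x, y). x \<in> X \<and> y \<in> X \<and> x \<noteq> y \<and> (x, y) \<in> r \<and> (y, x) \<in> t}"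

lemma inv_sign_sq [simp]: "inv_sign r t X * inv_sign r t X = 1"
  by (simp add: inv_sign_def flip: power_add mult_2)

text \<open>The vertices placed differently relative to \<open>x\<close> by the two orders,
  \<open>?A\<close> and \<open>?B\<close>, are those forming an inversion with \<open>x\<close>;
  \<open>?C\<close> precedes \<open>x\<close> in both. The signs for \<open>t\<close> and
  \<open>r\<close> count \<open>?B\<close> with \<open>?C\<close> and \<open>?A\<close> with
  \<open>?C\<close>, while deleting \<open>x\<close> loses the inversions from \<open>?A\<close> and
  \<open>?B\<close>. The totals agree modulo two.\<close>

lemma eps_inv_sign:
  assumes r: "linear_order_on V r" and t: "linear_order_on V t" and X: "X \<subseteq> V" "finite X" "x \<in> X"
  shows "eps t x X * inv_sign r t (X - {x}) = inv_sign r t X * eps r x X"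
proof -
  let ?I = "\<lambda>X. {(x, y). x \<in> X \<and> y \<in> X \<and> x \<noteq> y \<and> (x, y) \<in> r \<and> (y, x) \<in> t}"
  let ?A = "{y \<in> X. y \<noteq> x \<and> (y, x) \<in> r \<and> (x, y) \<in> t}"
  let ?B = "{y \<in> X. y \<noteq> x \<and> (x, y) \<in> r \<and> (y, x) \<in> t}"
  let ?C = "{y \<in> X. y \<noteq> x \<and> (y, x) \<in> r \<and> (y, x) \<in> t}"
  have xV: "x \<in> V" using X by blast
  have rc: "(x, y) \<in> r \<longleftrightarrow> (y, x) \<notin> r" "(x, y) \<in> t \<longleftrightarrow> (y, x) \<notin> t" if "y \<in> X" "y \<noteq> x" for y
    using linear_order_cases[OF r xV, of y] linear_order_cases[OF t xV, of y] that X(1) by auto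
  have fin: "finite (?I Y)" if "finite Y" for Y
    by (rule finite_subset[of _ "Y \<times> Y"]) (use that in auto)
  have "?I X = ?I (X - {x}) \<union> ((\<lambda>y. (y, x)) ` ?A \<union> (\<lambda>y. (x, y)) ` ?B)" using X(3) by auto
  moreover have "card (?I (X - {x}) \<union> ((\<lambda>y. (y, x)) ` ?A \<union> (\<lambda>y. (x, y)) ` ?B)) =
      card (?I (X - {x})) + (card ((\<lambda>y. (y, x)) ` ?A) + card ((\<lambda>y. (x, y)) ` ?B))"
    using X(2) fin[of "X - {x}"] by (subst card_Un_disjoint, simp, simp, force, subst card_Un_disjoint) auto
  moreover have "card ((\<lambda>y. (y, x)) ` ?A) = card ?A" "card ((\<lambda>y. (x, y)) ` ?B) = card ?B"
    by (auto intro!: card_image inj_onI)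
  ultimately have I: "card (?I X) = card (?I (X - {x})) + (card ?A + card ?B)" by simp
  have "{k \<in> X. k \<noteq> x \<and> (k, x) \<in> r} = ?A \<union> ?C" using rc by auto
  moreover have "card (?A \<union> ?C) = card ?A + card ?C" using X(2) rc by (intro card_Un_disjoint) auto
  ultimately have er: "eps r x X = (- 1) ^ (card ?A + card ?C)" by (simp add: eps_def)
  have "{k \<in> X. k \<noteq> x \<and> (k, x) \<in> t} = ?B \<union> ?C" using rc by auto
  moreover have "card (?B \<union> ?C) = card ?B + card ?C" using X(2) rc by (intro card_Un_disjoint) auto
  ultimately have et: "eps t x X = (- 1) ^ (card ?B + card ?C)" by (simp add: eps_def)
  have sq: "(- 1) ^ n * ((- 1) ^ n * z) = (z::int)" for n z
    by (simp flip: mult.assoc power_add mult_2)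
  show ?thesis
    unfolding inv_sign_def I er et by (simp add: power_add mult.left_commute sq mult.commute)
qed

text \<open>Read as matrices, conjugation by the diagonal signs \<open>inv_sign r t\<close> turns
  the incidence numbers of one order into those of the other.\<close>

lemma inc_inv_sign:
  assumes "linear_order_on V r" "linear_order_on V t" "X \<subseteq> V"
  shows "inc t X Y * inv_sign r t Y = inv_sign r t X * inc r X Y"
proof (cases "\<exists>i\<in>X. finite X \<and> Y = X - {i}")
  case True
  then show ?thesis using eps_inv_sign[OF assms] by (auto simp: inc_diff)
next
  case False
  then have "inc t X Y = 0" "inc r X Y = 0" by (metis inc_nonzeroE)+
  then show ?thesis by simp
qed

section \<open>The ordered disjoint union and its incidence numbers\<close>

definition sum_order :: "'v set \<Rightarrow> 'w set \<Rightarrow> 'v rel \<Rightarrow> 'w rel \<Rightarrow> ('v + 'w) rel" where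
  "sum_order V W r s = {(Inl a, Inl b) | a b. (a, b) \<in> r} \<union> {(Inr a, Inr b) | a b. (a, b) \<in> s} \<union>
     {(Inl a, Inr b) | a b. a \<in> V \<and> b \<in> W}"

lemma sum_order_simps [simp]:
  "(Inl a, Inl b) \<in> sum_order V W r s \<longleftrightarrow> (a, b) \<in> r"
  "(Inr c, Inr d) \<in> sum_order V W r s \<longleftrightarrow> (c, d) \<in> s"
  "(Inl a, Inr d) \<in> sum_order V W r s \<longleftrightarrow> a \<in> V \<and> d \<in> W"
  "(Inr c, Inl b) \<notin> sum_order V W r s"
  by (auto simp: sum_order_def)

lemma sum_order_linear:
  assumes "linear_order_on V r" "linear_order_on W s"
  shows "linear_order_on (Sum_Type.Plus V W) (sum_order V W r s)"
proof -
  have r: "r \<subseteq> V \<times> V" "refl_on V r" "trans r" "antisym r" "total_on V r"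
    and s: "s \<subseteq> W \<times> W" "refl_on W s" "trans s" "antisym s" "total_on W s"
    using assms by (auto simp: order_on_defs)
  have rV: "a \<in> V" "b \<in> V" if "(a, b) \<in> r" for a b using r(1) that by auto
  have sW: "a \<in> W" "b \<in> W" if "(a, b) \<in> s" for a b using s(1) that by auto
  show ?thesis
    unfolding order_on_defs
  proof (intro conjI)
    show "sum_order V W r s \<subseteq> (V <+> W) \<times> (V <+> W)" using r(1) s(1) by (auto simp: sum_order_def)
    show "refl_on (V <+> W) (sum_order V W r s)" using r(2) s(2) by (auto simp: refl_on_def)
    show "trans (sum_order V W r s)"
    proof (rule transI)
      fix x y z assume "(x, y) \<in> sum_order V W r s" "(y, z) \<in> sum_order V W r s"
      then show "(x, z) \<in> sum_order V W r s"
        using rV sW by (cases x; cases y; cases z) (auto dest: transD[OF r(3)] transD[OF s(3)])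
    qed
    show "antisym (sum_order V W r s)"
    proof (rule antisymI)
      fix x y assume "(x, y) \<in> sum_order V W r s" "(y, x) \<in> sum_order V W r s"
      then show "x = y" using antisymD[OF r(4)] antisymD[OF s(4)] by (cases x; cases y) auto
    qed
    show "total_on (V <+> W) (sum_order V W r s)"
      using r(5) s(5) by (auto simp: total_on_def) blast+
  qed
qed

lemma eps_sum_left: "eps (sum_order V W r s) (Inl i) (F <+> G) = eps r i F"
proof -
  have "{k \<in> F <+> G. k \<noteq> Inl i \<and> (k, Inl i) \<in> sum_order V W r s} = Inl ` {k \<in> F. k \<noteq> i \<and> (k, i) \<in> r}"
    by auto
  then show ?thesis by (simp add: eps_def card_image)
qed

lemma eps_sum_right:
  assumes "F \<subseteq> V" "j \<in> W" "finite F" "finite G"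
  shows "eps (sum_order V W r s) (Inr j) (F <+> G) = (- 1) ^ card F * eps s j G"
proof -
  have "{k \<in> F <+> G. k \<noteq> Inr j \<and> (k, Inr j) \<in> sum_order V W r s} = F <+> {k \<in> G. k \<noteq> j \<and> (k, j) \<in> s}"
    using assms by auto
  then show ?thesis using assms by (simp add: eps_def card_Plus power_add)
qed

lemma Plus_eq_vimage: "F <+> G = X \<longleftrightarrow> F = Inl -` X \<and> G = Inr -` X"
proof
  assume "F = Inl -` X \<and> G = Inr -` X"
  then show "F <+> G = X" by (auto simp: Plus_def image_iff) (metis sum.exhaust)
qed auto

lemma Plus_remove:
  "F' <+> G' = (F <+> G) - {Inl i} \<longleftrightarrow> F' = F - {i} \<and> G' = G"
  "F' <+> G' = (F <+> G) - {Inr j} \<longleftrightarrow> F' = F \<and> G' = G - {j}"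
  unfolding Plus_eq_vimage by auto

lemma Plus_eq_iff: "F <+> G = F' <+> G' \<longleftrightarrow> F = F' \<and> G = G'"
  unfolding Plus_eq_vimage by auto

text \<open>Every vertex of \<open>F\<close> precedes those of \<open>G\<close>, so deleting a
  vertex of \<open>G\<close> acquires the sign \<open>(-1)^card F\<close>, while deleting one of
  \<open>F\<close> meets only its predecessors in \<open>F\<close>. This is the Leibniz rule for the
  order placing \<open>V\<close> first.\<close>

lemma inc_sum:
  assumes "F \<subseteq> V" "G \<subseteq> W" "finite F" "finite G"
  shows "inc (sum_order V W r s) (F <+> G) (F' <+> G') =
    (if G = G' then inc r F F' else 0) + (if F = F' then (- 1) ^ card F * inc s G G' else 0)"
proof -
  have "inc (sum_order V W r s) (F <+> G) (F' <+> G') =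
      (\<Sum>i\<in>F. if F' = F - {i} \<and> G' = G then eps r i F else 0) +
      (\<Sum>j\<in>G. if F' = F \<and> G' = G - {j} then eps (sum_order V W r s) (Inr j) (F <+> G) else 0)"
    unfolding inc_def by (simp add: sum.Plus assms(3,4) Plus_remove eps_sum_left cong: if_cong)
  also have "(\<Sum>i\<in>F. if F' = F - {i} \<and> G' = G then eps r i F else 0) = (if G = G' then inc r F F' else 0)"
    by (auto simp: inc_def)
  also have "(\<Sum>j\<in>G. if F' = F \<and> G' = G - {j} then eps (sum_order V W r s) (Inr j) (F <+> G) else 0) =
      (\<Sum>j\<in>G. if F' = F \<and> G' = G - {j} then (- 1) ^ card F * eps s j G else 0)"
    using assms by (intro sum.cong) (auto simp: eps_sum_right)
  also have "\<dots> = (if F = F' then (- 1) ^ card F * inc s G G' else 0)"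
    by (auto simp: inc_def sum_distrib_left intro!: sum.cong)
  finally show ?thesis .
qed

lemma inc_card: "inc r X Y \<noteq> 0 \<Longrightarrow> card X = Suc (card Y)"
  by (erule inc_nonzeroE) (metis card_Suc_Diff1)

section \<open>The bigraded basis of the double complex\<close>

definition pairs :: "'v set \<Rightarrow> 'v set set \<Rightarrow> ('v set \<times> 'v set) set" where
  "pairs V K = {(I, F). I \<subseteq> V \<and> F \<in> K \<and> F \<subseteq> I}"

text \<open>The coboundary on every full subcomplex at once, with the target \<open>x\<close> as the
  first argument.\<close>

definition face_matrix :: "'v rel \<Rightarrow> 'v set \<times> 'v set \<Rightarrow> 'v set \<times> 'v set \<Rightarrow> int" where
  "face_matrix r x y = (if fst x = fst y then inc r (snd x) (snd y) else 0)"

text \<open>A cochain on a face has degree \<open>p\<close> with \<open>p + 1\<close> the number of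
  vertices, so the power of \<open>-1\<close> is the sign \<open>(-1)^(p+1)\<close> in the
  definition of \<open>d'\<close>. The support shrinks from \<open>fst y\<close> to
  \<open>fst x\<close>.\<close>

definition support_matrix :: "'v rel \<Rightarrow> 'v set \<times> 'v set \<Rightarrow> 'v set \<times> 'v set \<Rightarrow> int" where
  "support_matrix r x y = (if snd x = snd y then (- 1) ^ card (snd x) * inc r (fst y) (fst x) else 0)"

text \<open>The bidegree of the Hochster summand to which the pair belongs, the degree of a face
  being one less than its cardinality. For a pair \<open>(I, F)\<close> its total is
  \<open>card I + card F\<close>.\<close>

definition pair_degree :: "'v set \<times> 'v set \<Rightarrow> int \<times> int" where
  "pair_degree x = hochster_bidegree (fst x, int (card (snd x)) - 1)"

lemma pair_degree_simps [simp]: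
  "fst (pair_degree x) = int (card (snd x)) - int (card (fst x))"
  "snd (pair_degree x) = 2 * int (card (fst x))"
  by (simp_all add: pair_degree_def hochster_bidegree_def)

lemma finite_pairs: assumes "simplicial_complex V K" shows "finite (pairs V K)"
proof (rule finite_subset)
  show "pairs V K \<subseteq> Pow V \<times> Pow V" by (auto simp: pairs_def)
  show "finite (Pow V \<times> Pow V)" using assms by (auto simp: simplicial_complex_def)
qed

lemma face_matrix_degree:
  "face_matrix r x y \<noteq> 0 \<Longrightarrow> pair_degree x = (fst (pair_degree y) + 1, snd (pair_degree y) + 0)"
  by (auto simp: face_matrix_def prod_eq_iff dest!: inc_card split: if_splits)

lemma support_matrix_degree:
  "support_matrix r x y \<noteq> 0 \<Longrightarrow> pair_degree x = (fst (pair_degree y) + 1, snd (pair_degree y) + (- 2))"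
  by (auto simp: support_matrix_def prod_eq_iff dest!: inc_card split: if_splits)

context
  fixes V :: "'v set" and r K
  assumes K: "simplicial_complex V K" and r: "linear_order_on V r"
begin

text \<open>For a fixed support this is the cancellation over intermediate faces; closure of
  \<open>K\<close> under subsets places them in the index set.\<close>

lemma face_matrix_square:
  assumes "x \<in> pairs V K" "z \<in> pairs V K"
  shows "(\<Sum>y\<in>pairs V K. face_matrix r x y * face_matrix r y z) = 0"
proof (cases "fst x = fst z")
  case True
  let ?P = "{Y. (fst x, Y) \<in> pairs V K}"
  have "?P \<subseteq> snd ` pairs V K" by force
  then have fin: "finite ?P" using finite_pairs[OF K] by (meson finite_imageI finite_subset)
  have "(\<Sum>y\<in>pairs V K. face_matrix r x y * face_matrix r y z) =
      (\<Sum>y\<in>Pair (fst x) ` ?P. face_matrix r x y * face_matrix r y z)"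
    using finite_pairs[OF K] by (intro sum.mono_neutral_right) (auto simp: face_matrix_def)
  also have "\<dots> = (\<Sum>Y\<in>?P. inc r (snd x) Y * inc r Y (snd z))"
    using True by (subst sum.reindex) (auto simp: inj_on_def face_matrix_def)
  also have "\<dots> = 0"
  proof (rule inc_inc[OF r _ fin])
    show "snd x \<subseteq> V" using assms by (auto simp: pairs_def)
    fix Y assume "inc r (snd x) Y \<noteq> 0"
    then obtain i where "Y = snd x - {i}" by (rule inc_nonzeroE)
    then show "Y \<in> ?P" using assms(1) K by (auto simp: pairs_def simplicial_complex_def)
  qed
  finally show ?thesis .
next
  case False
  then have "face_matrix r x y * face_matrix r y z = 0" for y by (simp add: face_matrix_def)
  then show ?thesis by (intro sum.neutral ballI)
qed

text \<open>The signs depend on the unchanged face and square to one. Supports shrink, so the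
  incidence numbers are composed in the opposite order, from \<open>fst z\<close> down to
  \<open>fst x\<close>.\<close>

lemma support_matrix_square:
  assumes "x \<in> pairs V K" "z \<in> pairs V K"
  shows "(\<Sum>y\<in>pairs V K. support_matrix r x y * support_matrix r y z) = 0"
proof (cases "snd x = snd z")
  case True
  let ?P = "{Y. (Y, snd x) \<in> pairs V K}"
  have "?P \<subseteq> fst ` pairs V K" by force
  then have fin: "finite ?P" using finite_pairs[OF K] by (meson finite_imageI finite_subset)
  have sq: "(- 1) ^ n * a * ((- 1) ^ n * b) = b * (a::int)" for n a b
    by (simp add: mult.commute mult.left_commute flip: power_add mult_2 mult.assoc)
  have "(\<Sum>y\<in>pairs V K. support_matrix r x y * support_matrix r y z) =
      (\<Sum>y\<in>(\<lambda>Y. (Y, snd x)) ` ?P. support_matrix r x y * support_matrix r y z)"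
    using finite_pairs[OF K] by (intro sum.mono_neutral_right) (auto simp: support_matrix_def)
  also have "\<dots> = (\<Sum>Y\<in>?P. inc r (fst z) Y * inc r Y (fst x))"
    using True by (subst sum.reindex) (auto simp: inj_on_def support_matrix_def sq)
  also have "\<dots> = 0"
  proof (rule inc_inc[OF r _ fin])
    show "fst z \<subseteq> V" using assms by (auto simp: pairs_def)
    fix Y assume "inc r (fst z) Y \<noteq> 0"
    then obtain i where 1: "Y = fst z - {i}" by (rule inc_nonzeroE)
    assume "inc r Y (fst x) \<noteq> 0"
    then obtain j where 2: "fst x = Y - {j}" by (rule inc_nonzeroE)
    show "Y \<in> ?P" using assms 1 2 by (auto simp: pairs_def)
  qed
  finally show ?thesis .
next
  case False
  then have "support_matrix r x y * support_matrix r y z = 0" for y by (simp add: support_matrix_def)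
  then show ?thesis by (intro sum.neutral ballI)
qed

text \<open>Each composite has a single possible intermediate pair, and the incidence numbers agree.
  The sign of \<open>support_matrix\<close> is read off the face before the coboundary in one case
  and after it in the other, and these faces differ by one vertex.\<close>

lemma face_support_anticommute:
  assumes "x \<in> pairs V K" "z \<in> pairs V K"
  shows "(\<Sum>y\<in>pairs V K. face_matrix r x y * support_matrix r y z) =
    - (\<Sum>y\<in>pairs V K. support_matrix r x y * face_matrix r y z)"
proof -
  let ?a = "inc r (snd x) (snd z)" and ?b = "inc r (fst z) (fst x)"
  have 1: "(\<Sum>y\<in>pairs V K. face_matrix r x y * support_matrix r y z) = (- 1) ^ card (snd z) * (?a * ?b)"
  proof (cases "?a * ?b = 0")
    case True
    then have "face_matrix r x y * support_matrix r y z = 0" for y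
      by (auto simp: face_matrix_def support_matrix_def)
    then show ?thesis unfolding True mult_zero_right by (intro sum.neutral ballI)
  next
    case False
    then obtain i j where "snd z = snd x - {i}" "fst x = fst z - {j}" by (metis inc_nonzeroE mult_eq_0_iff)
    then have "(fst x, snd z) \<in> pairs V K" using assms by (auto simp: pairs_def)
    then have "(\<Sum>y\<in>pairs V K. face_matrix r x y * support_matrix r y z) =
        (\<Sum>y\<in>{(fst x, snd z)}. face_matrix r x y * support_matrix r y z)"
      using finite_pairs[OF K] by (intro sum.mono_neutral_right) (auto simp: face_matrix_def support_matrix_def)
    then show ?thesis by (simp add: face_matrix_def support_matrix_def)
  qed
  have 2: "(\<Sum>y\<in>pairs V K. support_matrix r x y * face_matrix r y z) = (- 1) ^ card (snd x) * (?a * ?b)"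
  proof (cases "?a * ?b = 0")
    case True
    then have "support_matrix r x y * face_matrix r y z = 0" for y
      by (auto simp: face_matrix_def support_matrix_def)
    then show ?thesis unfolding True mult_zero_right by (intro sum.neutral ballI)
  next
    case False
    then obtain i j where "snd z = snd x - {i}" "fst x = fst z - {j}" by (metis inc_nonzeroE mult_eq_0_iff)
    then have "(fst z, snd x) \<in> pairs V K" using assms by (auto simp: pairs_def)
    then have "(\<Sum>y\<in>pairs V K. support_matrix r x y * face_matrix r y z) =
        (\<Sum>y\<in>{(fst z, snd x)}. support_matrix r x y * face_matrix r y z)"
      using finite_pairs[OF K] by (intro sum.mono_neutral_right) (auto simp: face_matrix_def support_matrix_def)
    then show ?thesis by (simp add: face_matrix_def support_matrix_def)
  qed
  show ?thesis
  proof (cases "?a = 0")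
    case False
    then have "card (snd x) = Suc (card (snd z))" by (rule inc_card)
    then show ?thesis unfolding 1 2 by simp
  qed (simp add: 1 2)
qed

end

section \<open>Joins\<close>

definition pair_join :: "'v set \<times> 'v set \<Rightarrow> 'w set \<times> 'w set \<Rightarrow> ('v + 'w) set \<times> ('v + 'w) set" where
  "pair_join x y = (fst x <+> fst y, snd x <+> snd y)"

text \<open>The factor \<open>(-1)\<close> to the power \<open>card I * card G\<close> makes both differentials
  derivations for the total degree \<open>card I + card F\<close>.\<close>

definition join_sign ::
  "('v + 'w) rel \<Rightarrow> ('v + 'w) rel \<Rightarrow> 'v set \<times> 'v set \<Rightarrow> 'w set \<times> 'w set \<Rightarrow> int" where
  "join_sign q t x y = inv_sign q t (fst x <+> fst y) * inv_sign q t (snd x <+> snd y) *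
     (- 1) ^ (card (fst x) * card (snd y))"

lemma join_sign_sq: "join_sign q t x y * join_sign q t x y = 1"
proof -
  have pw: "(- 1) ^ n * (- 1) ^ n = (1::int)" for n by (simp flip: power_add mult_2)
  have "(a * b * c) * (a * b * c) = (a * a) * (b * b) * (c * c)" for a b c :: int by (simp add: mult_ac)
  then show ?thesis unfolding join_sign_def by (simp only: inv_sign_sq pw mult_1)
qed

lemma pair_join_degree:
  assumes "x \<in> pairs V K" "y \<in> pairs W L" "finite V" "finite W"
  shows "pair_degree (pair_join x y) =
    (fst (pair_degree x) + fst (pair_degree y), snd (pair_degree x) + snd (pair_degree y))"
proof -
  have "fst x \<subseteq> V" "snd x \<subseteq> V" "fst y \<subseteq> W" "snd y \<subseteq> W" using assms(1,2) by (auto simp: pairs_def)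
  then have "finite (fst x)" "finite (snd x)" "finite (fst y)" "finite (snd y)"
    using assms(3,4) finite_subset by blast+
  then show ?thesis by (simp add: prod_eq_iff pair_join_def card_Plus)
qed

lemma pair_join_bij:
  "bij_betw (\<lambda>(x, y). pair_join x y) (pairs V K \<times> pairs W L) (pairs (V <+> W) (simplicial_join K L))"
  unfolding bij_betw_def
proof
  show "inj_on (\<lambda>(x, y). pair_join x y) (pairs V K \<times> pairs W L)"
    by (auto simp: inj_on_def pair_join_def Plus_eq_iff)
  show "(\<lambda>(x, y). pair_join x y) ` (pairs V K \<times> pairs W L) = pairs (V <+> W) (simplicial_join K L)"
  proof (intro equalityI subsetI)
    fix z assume "z \<in> (\<lambda>(x, y). pair_join x y) ` (pairs V K \<times> pairs W L)"
    then show "z \<in> pairs (V <+> W) (simplicial_join K L)"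
      by (auto simp: pairs_def pair_join_def simplicial_join_def) blast+
  next
    fix z assume "z \<in> pairs (V <+> W) (simplicial_join K L)"
    then obtain X F G where z: "z = (X, F <+> G)" "X \<subseteq> V <+> W" "F \<in> K" "G \<in> L" "F <+> G \<subseteq> X"
      by (auto simp: pairs_def simplicial_join_def)
    have X: "X = (Inl -` X) <+> (Inr -` X)" using z(2) by (auto simp: Plus_def)
    have "(Inl -` X, F) \<in> pairs V K" "(Inr -` X, G) \<in> pairs W L" using z by (auto simp: pairs_def)
    moreover have "z = pair_join (Inl -` X, F) (Inr -` X, G)" using z(1) X by (simp add: pair_join_def)
    ultimately show "z \<in> (\<lambda>(x, y). pair_join x y) ` (pairs V K \<times> pairs W L)" by auto
  qed
qed

context
  fixes V :: "'v set" and r K and W :: "'w set" and s L t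
  assumes K: "simplicial_complex V K" and r: "linear_order_on V r"
    and L: "simplicial_complex W L" and s: "linear_order_on W s"
    and t: "linear_order_on (V <+> W) t"
begin

private abbreviation "q \<equiv> sum_order V W r s"

text \<open>Passing to the order \<open>t\<close> contributes \<open>inv_sign\<close> of the faces,
  and the standard order gives \<open>(-1)^card F\<close> for the right factor. There the face gains
  a vertex, so the factor \<open>(-1)^(card I * card G)\<close> of \<open>join_sign\<close>
  contributes a further \<open>(-1)^card I\<close>, completing the sign of the total degree.\<close>

lemma face_matrix_leibniz:
  assumes "x \<in> pairs V K" "x' \<in> pairs V K" "y \<in> pairs W L" "y' \<in> pairs W L"
  shows "face_matrix t (pair_join x y) (pair_join x' y') * join_sign q t x' y' =
    join_sign q t x y * ((if y = y' then face_matrix r x x' else 0) +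
      (if x = x' then (if even (fst (pair_degree x) + snd (pair_degree x)) then 1 else - 1) * face_matrix s y y' else 0))"
proof -
  obtain I F where x: "x = (I, F)" by (cases x)
  obtain I' F' where x': "x' = (I', F')" by (cases x')
  obtain J G where y: "y = (J, G)" by (cases y)
  obtain J' G' where y': "y' = (J', G')" by (cases y')
  have fin: "finite V" "finite W" using K L by (auto simp: simplicial_complex_def)
  have sub: "F \<subseteq> V" "G \<subseteq> W" using assms by (auto simp: x y pairs_def)
  have finF: "finite F" "finite G" using sub fin finite_subset by blast+
  have FG: "F <+> G \<subseteq> V <+> W" using sub by auto
  have main: "inc t (F <+> G) (F' <+> G') * inv_sign q t (F' <+> G') =
      inv_sign q t (F <+> G) * ((if G = G' then inc r F F' else 0) + (if F = F' then (- 1) ^ card F * inc s G G' else 0))"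
    unfolding inc_inv_sign[OF sum_order_linear[OF r s] t FG] inc_sum[OF sub finF] ..
  have par: "(if even (fst (pair_degree x) + snd (pair_degree x)) then 1 else - 1) = (- 1) ^ (card I + card F) * (1::int)"
    by (simp add: x)
  show ?thesis
  proof (cases "I = I' \<and> J = J'")
    case True
    have sg: "(if F = F' then (- 1) ^ card F * inc s G G' else 0) * (- 1) ^ (card I * card G') =
        (if F = F' then (- 1) ^ (card I + card F) * inc s G G' else 0) * (- 1) ^ (card I * card G)"
    proof (cases "inc s G G' = 0")
      case False
      then have "card G = Suc (card G')" by (rule inc_card)
      then show ?thesis by (simp add: power_add mult.commute mult.left_commute)

    qed simp
    have sg1: "(if G = G' then inc r F F' else 0) * (- 1) ^ (card I * card G') =
        (if G = G' then inc r F F' else 0) * (- 1) ^ (card I * card G)" by simp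
    have "face_matrix t (pair_join x y) (pair_join x' y') * join_sign q t x' y' =
        inv_sign q t (I <+> J) * (inc t (F <+> G) (F' <+> G') * inv_sign q t (F' <+> G')) * (- 1) ^ (card I * card G')"
      using True by (simp add: face_matrix_def pair_join_def join_sign_def x x' y y' mult_ac)
    also have "\<dots> = inv_sign q t (I <+> J) * inv_sign q t (F <+> G) *
        ((if G = G' then inc r F F' else 0) * (- 1) ^ (card I * card G') +
         (if F = F' then (- 1) ^ card F * inc s G G' else 0) * (- 1) ^ (card I * card G'))"
      unfolding main by (simp only: distrib_left distrib_right mult_ac)
    also have "\<dots> = join_sign q t x y * ((if G = G' then inc r F F' else 0) + (if F = F' then (- 1) ^ (card I + card F) * inc s G G' else 0))"
      unfolding sg sg1 by (simp only: join_sign_def x y fst_conv snd_conv distrib_left distrib_right mult_ac)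
    finally show ?thesis unfolding par using True by (simp add: face_matrix_def x x' y y')
  next
    case False
    then show ?thesis by (auto simp: face_matrix_def pair_join_def x x' y y' Plus_eq_iff)
  qed
qed

text \<open>The face of the join has \<open>card F + card G\<close> vertices. When the left support
  shrinks, \<open>(-1)^card G\<close> is absorbed by the change of \<open>card I * card G\<close>.
  When the right one shrinks, it is the sign belonging to \<open>support_matrix s\<close>, and
  \<open>(-1)^card F\<close> joins the \<open>(-1)^card I\<close> of the standard order.\<close>

lemma support_matrix_leibniz:
  assumes "x \<in> pairs V K" "x' \<in> pairs V K" "y \<in> pairs W L" "y' \<in> pairs W L"
  shows "support_matrix t (pair_join x y) (pair_join x' y') * join_sign q t x' y' =
    join_sign q t x y * ((if y = y' then support_matrix r x x' else 0) +
      (if x = x' then (if even (fst (pair_degree x) + snd (pair_degree x)) then 1 else - 1) * support_matrix s y y' else 0))"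
proof -
  obtain I F where x: "x = (I, F)" by (cases x)
  obtain I' F' where x': "x' = (I', F')" by (cases x')
  obtain J G where y: "y = (J, G)" by (cases y)
  obtain J' G' where y': "y' = (J', G')" by (cases y')
  have fin: "finite V" "finite W" using K L by (auto simp: simplicial_complex_def)
  have sub: "I' \<subseteq> V" "J' \<subseteq> W" "F \<subseteq> V" "G \<subseteq> W" using assms by (auto simp: x x' y y' pairs_def)
  have fins: "finite I'" "finite J'" "finite F" "finite G" using sub fin finite_subset by blast+
  have IJ: "I' <+> J' \<subseteq> V <+> W" using sub by auto
  \<comment> \<open>The matrix leads from the larger support to the smaller, so the inversion signs
    have to change sides; they square to one.\<close>
  have "inc t (I' <+> J') (I <+> J) * inv_sign q t (I' <+> J') =
      inv_sign q t (I <+> J) * (inc t (I' <+> J') (I <+> J) * inv_sign q t (I <+> J)) * inv_sign q t (I' <+> J')"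
    by (simp add: mult_ac)
  also have "\<dots> = inv_sign q t (I <+> J) * inc q (I' <+> J') (I <+> J)"
    unfolding inc_inv_sign[OF sum_order_linear[OF r s] t IJ]
    by (simp add: mult_ac)
  finally have main: "inc t (I' <+> J') (I <+> J) * inv_sign q t (I' <+> J') =
      inv_sign q t (I <+> J) * ((if J' = J then inc r I' I else 0) + (if I' = I then (- 1) ^ card I' * inc s J' J else 0))"
    unfolding inc_sum[OF sub(1,2) fins(1,2)] .
  have par: "(if even (fst (pair_degree x) + snd (pair_degree x)) then 1 else - 1) = (- 1) ^ (card I + card F) * (1::int)"
    by (simp add: x)
  show ?thesis
  proof (cases "F = F' \<and> G = G'")
    case True
    have sg1: "(if J' = J then inc r I' I else 0) * ((- 1) ^ (card F + card G) * (- 1) ^ (card I' * card G)) =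
        (if J' = J then (- 1) ^ card F * inc r I' I else 0) * (- 1) ^ (card I * card G)"
    proof (cases "inc r I' I = 0")
      case False
      then have "card I' = Suc (card I)" by (rule inc_card)
      then show ?thesis by (simp add: power_add mult.commute mult.left_commute)
    qed simp
    have sg2: "(if I' = I then (- 1) ^ card I' * inc s J' J else 0) * ((- 1) ^ (card F + card G) * (- 1) ^ (card I' * card G)) =
        (if I' = I then (- 1) ^ (card I + card F) * ((- 1) ^ card G * inc s J' J) else 0) * (- 1) ^ (card I * card G)"
      by (simp add: power_add mult_ac)
    have "support_matrix t (pair_join x y) (pair_join x' y') * join_sign q t x' y' =
        (inc t (I' <+> J') (I <+> J) * inv_sign q t (I' <+> J')) * inv_sign q t (F <+> G) *
          ((- 1) ^ (card F + card G) * (- 1) ^ (card I' * card G))"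
      using True fins by (simp add: support_matrix_def pair_join_def join_sign_def x x' y y' card_Plus mult_ac)
    also have "\<dots> = inv_sign q t (I <+> J) * inv_sign q t (F <+> G) *
        ((if J' = J then inc r I' I else 0) * ((- 1) ^ (card F + card G) * (- 1) ^ (card I' * card G)) +
         (if I' = I then (- 1) ^ card I' * inc s J' J else 0) * ((- 1) ^ (card F + card G) * (- 1) ^ (card I' * card G)))"
      unfolding main by (simp only: distrib_left distrib_right mult_ac)
    also have "\<dots> = join_sign q t x y * ((if J' = J then (- 1) ^ card F * inc r I' I else 0) +
        (if I' = I then (- 1) ^ (card I + card F) * ((- 1) ^ card G * inc s J' J) else 0))"
      unfolding sg1 sg2 by (simp only: join_sign_def x y fst_conv snd_conv distrib_left distrib_right mult_ac)
    finally show ?thesis unfolding par using True by (auto simp: support_matrix_def x x' y y')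
  next
    case False
    then show ?thesis by (auto simp: support_matrix_def pair_join_def x x' y y' Plus_eq_iff)
  qed
qed

end

section \<open>The Hochster decomposition\<close>

lemma free_module_finsum_apply:
  assumes "cring R" "finite A" "g \<in> A \<rightarrow> carrier (free_module R S)"
  shows "(\<Oplus>\<^bsub>free_module R S\<^esub>i\<in>A. g i) x = (\<Oplus>\<^bsub>R\<^esub>i\<in>A. g i x)"
proof -
  interpret cring R by fact
  interpret F: module R "free_module R S" by (rule free_module_module) fact
  show ?thesis using assms(2,3)
    by (induction A rule: finite_induct) (simp_all add: free_module_simps(2) free_module_carrier Pi_def)
qed

lemma submodule_finsum_eq:
  assumes "module R M" "submodule H R M" "finite A" "g \<in> A \<rightarrow> H"
  shows "(\<Oplus>\<^bsub>M\<lparr>carrier := H\<rparr>\<^esub>i\<in>A. g i) = (\<Oplus>\<^bsub>M\<^esub>i\<in>A. g i)"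
proof -
  interpret M: module R M by fact
  interpret H: module R "M\<lparr>carrier := H\<rparr>" by (rule submodule_module) fact+
  note HM = submodule_sub[OF assms(2)]
  show ?thesis using assms(3,4)
  proof (induction A rule: finite_induct)
    case (insert x A)
    then have "g x \<in> H" "g \<in> A \<rightarrow> H" by auto
    moreover from this have "g x \<in> carrier M" "g \<in> A \<rightarrow> carrier M" using HM by auto
    ultimately show ?case using insert by simp
  qed simp
qed

text \<open>One interface for cohomology and homology. \<open>op I\<close> is the (co)boundary of
  the full subcomplex on \<open>I\<close>, of degree \<open>e\<close>; \<open>N I\<close> indexes
  the supports \<open>nb I i\<close> from which the second differential reaches \<open>I\<close>,
  with coefficients \<open>cf\<close> and the restriction or inclusion \<open>res\<close>. The slice
  conditions say that \<open>m\<close> and \<open>m'\<close>, seen in one support and one degree,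
  are these maps.\<close>

locale hochster_complex =
  fixes R :: "('r, 's) ring_scheme" and V :: "'v set" and K :: "'v set set"
    and op :: "'v set \<Rightarrow> ('v set \<Rightarrow> 'r) \<Rightarrow> 'v set \<Rightarrow> 'r" and e :: int and e' :: "int \<times> int"
    and m m' :: "'v set \<times> 'v set \<Rightarrow> 'v set \<times> 'v set \<Rightarrow> int"
    and N :: "'v set \<Rightarrow> 'v set" and nb :: "'v set \<Rightarrow> 'v \<Rightarrow> 'v set"
    and cf :: "'v set \<Rightarrow> int \<Rightarrow> 'v \<Rightarrow> int" and res :: "'v set \<Rightarrow> ('v set \<Rightarrow> 'r) \<Rightarrow> 'v set \<Rightarrow> 'r"
    and M :: "'v set \<times> int \<Rightarrow> ('r, ('v set \<Rightarrow> 'r) set) module"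
    and C :: "('r, 'v set \<times> int \<Rightarrow> ('v set \<Rightarrow> 'r) set) bigraded_complex"
  assumes R_cring: "cring R" and K_complex: "simplicial_complex V K"
    and degree_m: "x \<in> pairs V K \<Longrightarrow> y \<in> pairs V K \<Longrightarrow> m x y \<noteq> 0 \<Longrightarrow>
      pair_degree x = (fst (pair_degree y) + e, snd (pair_degree y) + 0)"
    and degree_m': "x \<in> pairs V K \<Longrightarrow> y \<in> pairs V K \<Longrightarrow> m' x y \<noteq> 0 \<Longrightarrow>
      pair_degree x = (fst (pair_degree y) + fst e', snd (pair_degree y) + snd e')"
    and odd_e: "odd e" and odd_e': "odd (fst e' + snd e')"
    and m_m: "x \<in> pairs V K \<Longrightarrow> z \<in> pairs V K \<Longrightarrow> (\<Sum>y\<in>pairs V K. m x y * m y z) = 0"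
    and m'_m': "x \<in> pairs V K \<Longrightarrow> z \<in> pairs V K \<Longrightarrow> (\<Sum>y\<in>pairs V K. m' x y * m' y z) = 0"
    and m_m': "x \<in> pairs V K \<Longrightarrow> z \<in> pairs V K \<Longrightarrow>
      (\<Sum>y\<in>pairs V K. m x y * m' y z) = - (\<Sum>y\<in>pairs V K. m' x y * m y z)"
    and op_slice: "f \<in> carrier (free_module R (pairs V K)) \<Longrightarrow> I \<subseteq> V \<Longrightarrow>
      (\<lambda>F. if int (card F) = p + e + 1 then matrix_map R (pairs V K) m f (I, F) else \<zero>\<^bsub>R\<^esub>) =
      op I (\<lambda>F. if int (card F) = p + 1 then f (I, F) else \<zero>\<^bsub>R\<^esub>)"
    and res_slice: "f \<in> carrier (free_module R (pairs V K)) \<Longrightarrow> I \<subseteq> V \<Longrightarrow> int (card F) = p + 1 \<Longrightarrow>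
      matrix_map R (pairs V K) m' f (I, F) =
      (\<Oplus>\<^bsub>R\<^esub>i\<in>N I. ring_int R (cf I p i) \<otimes>\<^bsub>R\<^esub> res I (\<lambda>F. if int (card F) = p + 1 then f (nb I i, F) else \<zero>\<^bsub>R\<^esub>) F)"
    and finite_N: "I \<subseteq> V \<Longrightarrow> finite (N I)"
    and nb_sub: "I \<subseteq> V \<Longrightarrow> i \<in> N I \<Longrightarrow> nb I i \<subseteq> V"
    and res_hom: "I \<subseteq> V \<Longrightarrow> i \<in> N I \<Longrightarrow> res I \<in> mod_hom R
      (simplicial_chains R (full_subcomplex K (nb I i)) p) (simplicial_chains R (full_subcomplex K I) p)"
    and res_op: "I \<subseteq> V \<Longrightarrow> i \<in> N I \<Longrightarrow> c \<in> carrier (simplicial_chains R (full_subcomplex K (nb I i)) p) \<Longrightarrow>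
      res I (op (nb I i) c) = op I (res I c)"
    and M_eq: "M (I, p) = quot_module (simplicial_chains R (full_subcomplex K I) p\<lparr>carrier :=
        {c \<in> carrier (simplicial_chains R (full_subcomplex K I) p). op I c = (\<lambda>F. \<zero>\<^bsub>R\<^esub>)}\<rparr>)
        (op I ` carrier (simplicial_chains R (full_subcomplex K I) (p - e)))"
    and total_C: "total C = direct_sum (hochster_index V) M"
    and part_C: "part C = hochster_part V M"
    and diff_C: "diff C = (\<lambda>x. \<lambda>(I, p)\<in>hochster_index V. \<Oplus>\<^bsub>M (I, p)\<^esub>i\<in>N I.
        ring_int R (cf I p i) \<odot>\<^bsub>M (I, p)\<^esub>
          quot_map (simplicial_chains R (full_subcomplex K I) p)
            (op I ` carrier (simplicial_chains R (full_subcomplex K I) (p - e))) (res I) (x (nb I i, p)))"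
begin

sublocale R: cring R by (rule R_cring)

abbreviation "S \<equiv> pairs V K"
abbreviation "A \<equiv> free_module R S"
abbreviation "d \<equiv> matrix_map R S m"
abbreviation "d' \<equiv> matrix_map R S m'"

definition ch where "ch I p = simplicial_chains R (full_subcomplex K I) p"
text \<open>The component with support \<open>I\<close> and degree \<open>p\<close>, as a chain on
  the full subcomplex; \<open>glue\<close> reassembles such components, the degree being determined
  by the face.\<close>

definition slice :: "('v set \<times> 'v set \<Rightarrow> 'r) \<Rightarrow> 'v set \<Rightarrow> int \<Rightarrow> 'v set \<Rightarrow> 'r" where
  "slice f I p = (\<lambda>F. if int (card F) = p + 1 then f (I, F) else \<zero>\<^bsub>R\<^esub>)"
definition glue :: "('v set \<Rightarrow> int \<Rightarrow> 'v set \<Rightarrow> 'r) \<Rightarrow> 'v set \<times> 'v set \<Rightarrow> 'r" where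
  "glue c = (\<lambda>x. if x \<in> S then c (fst x) (int (card (snd x)) - 1) (snd x) else \<zero>\<^bsub>R\<^esub>)"
definition cy where "cy I p = {c \<in> carrier (ch I p). op I c = (\<lambda>F. \<zero>\<^bsub>R\<^esub>)}"
definition bd where "bd I p = op I ` carrier (ch I (p - e))"
definition pr :: "('v set \<times> 'v set \<Rightarrow> 'r) \<Rightarrow> 'v set \<times> int \<Rightarrow> ('v set \<Rightarrow> 'r) set" where
  "pr f = (\<lambda>(I, p)\<in>hochster_index V. bd I p +>\<^bsub>ch I p\<^esub> slice f I p)"

lemma finite_S: "finite S" by (rule finite_pairs[OF K_complex])
lemma finite_V: "finite V" using K_complex by (simp add: simplicial_complex_def)

lemma finite_faces: "finite (faces (full_subcomplex K I) p)"
proof (rule finite_subset)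
  show "faces (full_subcomplex K I) p \<subseteq> Pow V"
    using K_complex by (auto simp: faces_def full_subcomplex_def simplicial_complex_def)
qed (simp add: finite_V)

lemma A_module: "module R A" by (rule free_module_module[OF R_cring])
lemma ch_module: "module R (ch I p)" unfolding ch_def simplicial_chains_def by (rule free_module_module[OF R_cring])

sublocale A: module R A by (rule A_module)

lemma d_hom: "d \<in> mod_hom R A A" and d'_hom: "d' \<in> mod_hom R A A"
  by (rule matrix_map_hom[OF R_cring finite_S])+

lemma d_d: "f \<in> carrier A \<Longrightarrow> d (d f) = \<zero>\<^bsub>A\<^esub>"
  using matrix_map_comp[OF R_cring finite_S] matrix_map_zero[OF R_cring finite_S _ m_m]
  by (simp add: free_module_simps(2))

lemma ch_carrier: "c \<in> carrier (ch I p) \<longleftrightarrow>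
    (\<forall>F. c F \<in> carrier R) \<and> (\<forall>F. \<not> (F \<in> K \<and> F \<subseteq> I \<and> int (card F) = p + 1) \<longrightarrow> c F = \<zero>\<^bsub>R\<^esub>)"
  unfolding ch_def simplicial_chains_def finite_free_module_carrier[OF finite_faces]
  by (auto simp: faces_def full_subcomplex_def)

lemma ch_zero: "\<zero>\<^bsub>ch I p\<^esub> = (\<lambda>F. \<zero>\<^bsub>R\<^esub>)"
  by (simp add: ch_def simplicial_chains_def free_module_simps(2))

lemma A_carrier: "f \<in> carrier A \<longleftrightarrow> (\<forall>x. f x \<in> carrier R) \<and> (\<forall>x. x \<notin> S \<longrightarrow> f x = \<zero>\<^bsub>R\<^esub>)"
  by (rule finite_free_module_carrier[OF finite_S])

lemma supportD:
  assumes "f \<in> carrier A" "f (I, F) \<noteq> \<zero>\<^bsub>R\<^esub>" shows "I \<subseteq> V \<and> F \<in> K \<and> F \<subseteq> I"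
proof -
  have "(I, F) \<in> S" using assms unfolding A_carrier by blast
  then show ?thesis by (simp add: pairs_def)
qed

lemma slice_closed:
  assumes "f \<in> carrier A" shows "slice f I p \<in> carrier (ch I p)"
  unfolding ch_carrier
proof (intro conjI allI impI)
  show "slice f I p F \<in> carrier R" for F using assms by (simp add: slice_def A_carrier)
  show "slice f I p F = \<zero>\<^bsub>R\<^esub>" if "\<not> (F \<in> K \<and> F \<subseteq> I \<and> int (card F) = p + 1)" for F
    using supportD[OF assms, of I F] that by (auto simp: slice_def)
qed

lemma slice_hom: "I \<subseteq> V \<Longrightarrow> (\<lambda>f. slice f I p) \<in> mod_hom R A (ch I p)"
proof (rule mod_homI)
  fix f g assume "f \<in> carrier A" "g \<in> carrier A"
  then show "slice (f \<oplus>\<^bsub>A\<^esub> g) I p = slice f I p \<oplus>\<^bsub>ch I p\<^esub> slice g I p"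
    by (auto simp: slice_def ch_def simplicial_chains_def free_module_simps)
next
  fix a f assume "a \<in> carrier R" "f \<in> carrier A"
  then show "slice (a \<odot>\<^bsub>A\<^esub> f) I p = a \<odot>\<^bsub>ch I p\<^esub> slice f I p"
    by (auto simp: slice_def ch_def simplicial_chains_def free_module_simps)
qed (rule slice_closed)

lemma glue_closed:
  assumes "\<And>I p. I \<subseteq> V \<Longrightarrow> c I p \<in> carrier (ch I p)" shows "glue c \<in> carrier A"
  using assms unfolding A_carrier glue_def by (auto simp: pairs_def ch_carrier)

lemma slice_glue: "I \<subseteq> V \<Longrightarrow> c I p \<in> carrier (ch I p) \<Longrightarrow> slice (glue c) I p = c I p"
  by (rule ext) (auto simp: slice_def glue_def ch_carrier pairs_def)

lemma slice_ext:
  assumes "f \<in> carrier A" "g \<in> carrier A" "\<And>I p. I \<subseteq> V \<Longrightarrow> slice f I p = slice g I p"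
  shows "f = g"
proof
  fix x
  show "f x = g x"
  proof (cases "x \<in> S")
    case True
    then have "slice f (fst x) (int (card (snd x)) - 1) (snd x) = slice g (fst x) (int (card (snd x)) - 1) (snd x)"
      using assms(3) by (auto simp: pairs_def)
    then show ?thesis by (simp add: slice_def)
  next
    case False
    then show ?thesis using assms(1,2) unfolding A_carrier by metis
  qed
qed

lemma slice_liftE:
  assumes "I \<subseteq> V" "c \<in> carrier (ch I p)"
  obtains f where "f \<in> carrier A" "slice f I p = c"
proof -
  let ?c = "\<lambda>J q. if J = I \<and> q = p then c else \<zero>\<^bsub>ch J q\<^esub>"
  have z: "\<zero>\<^bsub>ch J q\<^esub> \<in> carrier (ch J q)" for J q by (simp add: ch_zero ch_carrier)
  show thesis
    by (rule that[of "glue ?c"]) (use assms z in \<open>auto intro!: glue_closed simp: slice_glue\<close>)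
qed

lemma op_slice': "f \<in> carrier A \<Longrightarrow> I \<subseteq> V \<Longrightarrow> op I (slice f I p) = slice (d f) I (p + e)"
  unfolding slice_def by (rule op_slice[symmetric])

text \<open>Every chain on one full subcomplex is a slice of an element of \<open>A\<close>, and
  \<open>op\<close> of a slice is a slice of the matrix map \<open>d\<close>, from which linearity
  is inherited.\<close>

lemma op_hom: assumes I: "I \<subseteq> V" shows "op I \<in> mod_hom R (ch I p) (ch I (p + e))"
proof (rule mod_homI)
  fix c assume "c \<in> carrier (ch I p)"
  with I obtain f where f: "f \<in> carrier A" "slice f I p = c" by (rule slice_liftE)
  have df: "d f \<in> carrier A" by (rule mod_hom_closed[OF d_hom f(1)])
  show "op I c \<in> carrier (ch I (p + e))"
    using op_slice'[OF f(1) I] slice_closed[OF df] f(2) by metis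
  { fix a assume a: "a \<in> carrier R"
    have eq: "a \<odot>\<^bsub>ch I p\<^esub> c = slice (a \<odot>\<^bsub>A\<^esub> f) I p"
      using mod_hom_smult[OF slice_hom[OF I] a f(1)] f(2) by simp
    have "op I (a \<odot>\<^bsub>ch I p\<^esub> c) = slice (d (a \<odot>\<^bsub>A\<^esub> f)) I (p + e)"
      unfolding eq by (rule op_slice'[OF A.smult_closed[OF a f(1)] I])
    also have "\<dots> = a \<odot>\<^bsub>ch I (p + e)\<^esub> slice (d f) I (p + e)"
      unfolding mod_hom_smult[OF d_hom a f(1)] by (rule mod_hom_smult[OF slice_hom[OF I] a df])
    also have "slice (d f) I (p + e) = op I c"
      using op_slice'[OF f(1) I, of p] f(2) by simp
    finally show "op I (a \<odot>\<^bsub>ch I p\<^esub> c) = a \<odot>\<^bsub>ch I (p + e)\<^esub> op I c" . }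
  fix c' assume "c' \<in> carrier (ch I p)"
  with I obtain f' where f': "f' \<in> carrier A" "slice f' I p = c'" by (rule slice_liftE)
  have df': "d f' \<in> carrier A" by (rule mod_hom_closed[OF d_hom f'(1)])
  have eq: "c \<oplus>\<^bsub>ch I p\<^esub> c' = slice (f \<oplus>\<^bsub>A\<^esub> f') I p"
    using mod_hom_add[OF slice_hom[OF I] f(1) f'(1)] f(2) f'(2) by simp
  have "op I (c \<oplus>\<^bsub>ch I p\<^esub> c') = slice (d (f \<oplus>\<^bsub>A\<^esub> f')) I (p + e)"
    unfolding eq by (rule op_slice'[OF A.M.a_closed[OF f(1) f'(1)] I])
  also have "\<dots> = slice (d f) I (p + e) \<oplus>\<^bsub>ch I (p + e)\<^esub> slice (d f') I (p + e)"
    unfolding mod_hom_add[OF d_hom f(1) f'(1)] by (rule mod_hom_add[OF slice_hom[OF I] df df'])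
  also have "slice (d f) I (p + e) = op I c" using op_slice'[OF f(1) I, of p] f(2) by simp
  also have "slice (d f') I (p + e) = op I c'" using op_slice'[OF f'(1) I, of p] f'(2) by simp
  finally show "op I (c \<oplus>\<^bsub>ch I p\<^esub> c') = op I c \<oplus>\<^bsub>ch I (p + e)\<^esub> op I c'" .
qed

lemma op_hom': assumes "I \<subseteq> V" shows "op I \<in> mod_hom R (ch I (p - e)) (ch I p)"
  using op_hom[OF assms, of "p - e"] by simp

lemma slice_zero: "slice \<zero>\<^bsub>A\<^esub> I p = (\<lambda>F. \<zero>\<^bsub>R\<^esub>)"
  by (simp add: slice_def free_module_simps(2))

lemma op_op: assumes "I \<subseteq> V" "c \<in> carrier (ch I p)" shows "op I (op I c) = (\<lambda>F. \<zero>\<^bsub>R\<^esub>)"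
proof -
  obtain f where f: "f \<in> carrier A" "slice f I p = c" using assms by (rule slice_liftE)
  have df: "d f \<in> carrier A" by (rule mod_hom_closed[OF d_hom f(1)])
  show ?thesis
    using op_slice'[OF f(1) assms(1), of p] op_slice'[OF df assms(1), of "p + e"] f by (simp add: d_d slice_zero)
qed

lemma cy_submodule: assumes "I \<subseteq> V" shows "submodule (cy I p) R (ch I p)"
  using submodule_kernel[OF ch_module ch_module op_hom[OF assms]] by (simp add: cy_def ch_zero)

lemma bd_submodule: assumes "I \<subseteq> V" shows "submodule (bd I p) R (ch I p)"
  unfolding bd_def by (rule submodule_image[OF ch_module ch_module op_hom'[OF assms]])

lemma bd_cy: assumes "I \<subseteq> V" shows "bd I p \<subseteq> cy I p"
  unfolding bd_def cy_def using op_op[OF assms] mod_hom_closed[OF op_hom'[OF assms]] by auto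

lemma M_alt: "M (I, p) = quot_module (ch I p\<lparr>carrier := cy I p\<rparr>) (bd I p)"
  by (simp add: M_eq cy_def bd_def ch_def)

lemma cy_module: assumes "I \<subseteq> V" shows "module R (ch I p\<lparr>carrier := cy I p\<rparr>)"
  by (rule submodule_module[OF ch_module cy_submodule[OF assms]])

lemma bd_cy_submodule: assumes "I \<subseteq> V" shows "submodule (bd I p) R (ch I p\<lparr>carrier := cy I p\<rparr>)"
  by (rule submodule_restrict[OF ch_module cy_submodule bd_submodule bd_cy]) fact+

lemma M_module: "I \<subseteq> V \<Longrightarrow> module R (M (I, p))"
  unfolding M_alt by (rule quot_module_module[OF cy_module bd_cy_submodule])

lemma proj_hom:
  assumes "I \<subseteq> V" shows "(\<lambda>c. bd I p +>\<^bsub>ch I p\<^esub> c) \<in> mod_hom R (ch I p\<lparr>carrier := cy I p\<rparr>) (M (I, p))"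
  using quot_module_proj[OF cy_module[OF assms] bd_cy_submodule[OF assms]]
  by (simp add: M_alt coset_carrier_update)

lemma M_carrier:
  assumes "I \<subseteq> V" shows "carrier (M (I, p)) = (\<lambda>c. bd I p +>\<^bsub>ch I p\<^esub> c) ` cy I p"
  using quot_module_carrier[OF cy_module[OF assms] bd_cy_submodule[OF assms]]
  by (simp add: M_alt coset_carrier_update)

lemma M_zero: "\<zero>\<^bsub>M (I, p)\<^esub> = bd I p"
  by (simp add: M_alt quot_module_zero quot_module_def)

lemma C_module: "module R (total C)"
  unfolding total_C by (rule direct_sum_module[OF R_cring]) (auto simp: hochster_index_def intro: M_module)

lemma cyc_slice:
  assumes "z \<in> carrier A" "d z = \<zero>\<^bsub>A\<^esub>" "I \<subseteq> V" shows "slice z I p \<in> cy I p"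
  using slice_closed[OF assms(1)] op_slice'[OF assms(1,3)] assms(2) by (simp add: cy_def slice_zero)

lemma hochster_index_iff: "(I, p) \<in> hochster_index V \<longleftrightarrow> I \<subseteq> V"
  by (simp add: hochster_index_def)

lemma coset_slice_zero:
  assumes "I \<subseteq> V" "slice f I p = (\<lambda>F. \<zero>\<^bsub>R\<^esub>)" shows "bd I p +>\<^bsub>ch I p\<^esub> slice f I p = \<zero>\<^bsub>M (I, p)\<^esub>"
  using coset_zero_iff[OF ch_module bd_submodule[OF assms(1)], of "slice f I p" p] assms(2)
    submodule_zero[OF bd_submodule[OF assms(1)], of p]
  by (simp add: M_zero ch_zero ch_carrier)

lemma pr_closed:
  assumes "z \<in> carrier A" "d z = \<zero>\<^bsub>A\<^esub>" shows "pr z \<in> carrier (total C)"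
  unfolding total_C direct_sum_carrier
proof (intro conjI ballI)
  show "pr z \<in> extensional (hochster_index V)" by (simp add: pr_def)
  show "pr z i \<in> carrier (M i)" if "i \<in> hochster_index V" for i
    using that cyc_slice[OF assms] by (cases i) (auto simp: pr_def hochster_index_iff M_carrier)
  show "finite {i \<in> hochster_index V. pr z i \<noteq> \<zero>\<^bsub>M i\<^esub>}"
  proof (rule finite_subset)
    \<comment> \<open>The index set contains all integer degrees, but a nonzero slice of degree
      \<open>p\<close> needs a face with \<open>p + 1\<close> vertices inside \<open>V\<close>, so
      finitely many degrees occur.\<close>
    show "{i \<in> hochster_index V. pr z i \<noteq> \<zero>\<^bsub>M i\<^esub>} \<subseteq> Pow V \<times> {-1..int (card V)}"
    proof
      fix i assume "i \<in> {i \<in> hochster_index V. pr z i \<noteq> \<zero>\<^bsub>M i\<^esub>}"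
      then obtain I p where i: "i = (I, p)" "I \<subseteq> V" "pr z (I, p) \<noteq> \<zero>\<^bsub>M (I, p)\<^esub>"
        by (cases i) (auto simp: hochster_index_iff)
      then have "slice z I p \<noteq> (\<lambda>F. \<zero>\<^bsub>R\<^esub>)"
        using coset_slice_zero[OF i(2)] by (auto simp: pr_def hochster_index_iff)
      then obtain F where "slice z I p F \<noteq> \<zero>\<^bsub>R\<^esub>" by (auto simp: fun_eq_iff)
      then have F: "int (card F) = p + 1" "z (I, F) \<noteq> \<zero>\<^bsub>R\<^esub>" by (auto simp: slice_def split: if_splits)
      then have "F \<subseteq> V" using supportD[OF assms(1)] by blast
      then have "card F \<le> card V" by (rule card_mono[OF finite_V])
      then show "i \<in> Pow V \<times> {-1..int (card V)}" using i F by auto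
    qed
  qed (simp add: finite_V)
qed

lemma pr_hom: "pr \<in> mod_hom R (A\<lparr>carrier := {x \<in> carrier A. d x = \<zero>\<^bsub>A\<^esub>}\<rparr>) (total C)"
proof (rule mod_homI)
  fix z assume "z \<in> carrier (A\<lparr>carrier := {x \<in> carrier A. d x = \<zero>\<^bsub>A\<^esub>}\<rparr>)"
  then have z: "z \<in> carrier A" "d z = \<zero>\<^bsub>A\<^esub>" by auto
  then show "pr z \<in> carrier (total C)" by (rule pr_closed)
  { fix a assume a: "a \<in> carrier R"
    have "bd I p +>\<^bsub>ch I p\<^esub> slice (a \<odot>\<^bsub>A\<^esub> z) I p = a \<odot>\<^bsub>M (I, p)\<^esub> (bd I p +>\<^bsub>ch I p\<^esub> slice z I p)"
      if I: "I \<subseteq> V" for I p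
      using mod_hom_smult[OF slice_hom[OF I] a z(1), of p] mod_hom_smult[OF proj_hom[OF I] a, of "slice z I p" p]
        cyc_slice[OF z I] by simp
    then show "pr (a \<odot>\<^bsub>A\<lparr>carrier := {x \<in> carrier A. d x = \<zero>\<^bsub>A\<^esub>}\<rparr>\<^esub> z) = a \<odot>\<^bsub>total C\<^esub> pr z"
      by (auto simp: total_C pr_def hochster_index_iff intro!: restrict_ext) }
  fix w assume "w \<in> carrier (A\<lparr>carrier := {x \<in> carrier A. d x = \<zero>\<^bsub>A\<^esub>}\<rparr>)"
  then have w: "w \<in> carrier A" "d w = \<zero>\<^bsub>A\<^esub>" by auto
  have "bd I p +>\<^bsub>ch I p\<^esub> slice (z \<oplus>\<^bsub>A\<^esub> w) I p =
      (bd I p +>\<^bsub>ch I p\<^esub> slice z I p) \<oplus>\<^bsub>M (I, p)\<^esub> (bd I p +>\<^bsub>ch I p\<^esub> slice w I p)" if I: "I \<subseteq> V" for I p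
    using mod_hom_add[OF slice_hom[OF I] z(1) w(1), of p] mod_hom_add[OF proj_hom[OF I], of "slice z I p" p "slice w I p"]
      cyc_slice[OF z I] cyc_slice[OF w I] by simp
  then show "pr (z \<oplus>\<^bsub>A\<lparr>carrier := {x \<in> carrier A. d x = \<zero>\<^bsub>A\<^esub>}\<rparr>\<^esub> w) = pr z \<oplus>\<^bsub>total C\<^esub> pr w"
    by (auto simp: total_C pr_def hochster_index_iff intro!: restrict_ext)
qed

text \<open>Representatives are chosen summand by summand, with the zero chain for the zero class.
  This normalisation makes the preimage of a homogeneous family homogeneous.\<close>

lemma pr_preimage:
  assumes x: "x \<in> carrier (total C)"
  obtains z where "z \<in> carrier A" "d z = \<zero>\<^bsub>A\<^esub>" "pr z = x"
    "\<And>I p. I \<subseteq> V \<Longrightarrow> x (I, p) = \<zero>\<^bsub>M (I, p)\<^esub> \<Longrightarrow> slice z I p = (\<lambda>F. \<zero>\<^bsub>R\<^esub>)"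
proof -
  have "\<exists>c. I \<subseteq> V \<longrightarrow> c \<in> cy I p \<and> x (I, p) = bd I p +>\<^bsub>ch I p\<^esub> c \<and>
      (x (I, p) = \<zero>\<^bsub>M (I, p)\<^esub> \<longrightarrow> c = (\<lambda>F. \<zero>\<^bsub>R\<^esub>))" for I p
  proof (cases "I \<subseteq> V \<and> x (I, p) = \<zero>\<^bsub>M (I, p)\<^esub>")
    case True
    have "(\<lambda>F. \<zero>\<^bsub>R\<^esub>) \<in> cy I p" using submodule_zero[OF cy_submodule[of I p]] True by (simp add: ch_zero)
    moreover have "bd I p +>\<^bsub>ch I p\<^esub> slice \<zero>\<^bsub>A\<^esub> I p = \<zero>\<^bsub>M (I, p)\<^esub>"
      by (rule coset_slice_zero) (use True in \<open>simp_all add: slice_zero\<close>)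
    ultimately show ?thesis using True by (intro exI[of _ "\<lambda>F. \<zero>\<^bsub>R\<^esub>"]) (simp add: slice_zero)
  next
    case False
    show ?thesis
    proof (cases "I \<subseteq> V")
      case True
      then have "x (I, p) \<in> carrier (M (I, p))" using x by (simp add: total_C direct_sum_carrier hochster_index_iff)
      then show ?thesis using True False by (auto simp: M_carrier)
    qed simp
  qed
  then obtain c where c: "\<And>I p. I \<subseteq> V \<Longrightarrow> c I p \<in> cy I p"
    "\<And>I p. I \<subseteq> V \<Longrightarrow> x (I, p) = bd I p +>\<^bsub>ch I p\<^esub> c I p"
    "\<And>I p. I \<subseteq> V \<Longrightarrow> x (I, p) = \<zero>\<^bsub>M (I, p)\<^esub> \<Longrightarrow> c I p = (\<lambda>F. \<zero>\<^bsub>R\<^esub>)" by metis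
  have cc: "c I p \<in> carrier (ch I p)" if "I \<subseteq> V" for I p using c(1)[OF that, of p] by (simp add: cy_def)
  have sg: "slice (glue c) I p = c I p" if "I \<subseteq> V" for I p by (rule slice_glue[where c = c, OF that cc[OF that]])
  have z: "glue c \<in> carrier A" by (rule glue_closed[where c = c, OF cc])
  show thesis
  proof (rule that[OF z])
    show "d (glue c) = \<zero>\<^bsub>A\<^esub>"
    proof (rule slice_ext)
      fix I p assume I: "I \<subseteq> V"
      have "slice (d (glue c)) I p = op I (c I (p - e))"
        using op_slice'[OF z I, of "p - e"] sg[OF I, of "p - e"] by simp
      then show "slice (d (glue c)) I p = slice \<zero>\<^bsub>A\<^esub> I p"
        using c(1)[OF I, of "p - e"] by (simp add: cy_def slice_zero)
    qed (use mod_hom_closed[OF d_hom z] in auto)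
    show "pr (glue c) = x"
    proof (rule extensionalityI)
      show "pr (glue c) \<in> extensional (hochster_index V)" by (simp add: pr_def)
      show "x \<in> extensional (hochster_index V)" using x by (simp add: total_C direct_sum_carrier)
      fix i assume "i \<in> hochster_index V"
      then show "pr (glue c) i = x i" by (cases i) (simp add: pr_def hochster_index_iff sg c(2))
    qed
    show "slice (glue c) I p = (\<lambda>F. \<zero>\<^bsub>R\<^esub>)" if "I \<subseteq> V" "x (I, p) = \<zero>\<^bsub>M (I, p)\<^esub>" for I p
      using that by (simp add: sg c(3))
  qed
qed

lemma pr_zero_iff:
  assumes z: "z \<in> carrier A" "d z = \<zero>\<^bsub>A\<^esub>"
  shows "pr z = \<zero>\<^bsub>total C\<^esub> \<longleftrightarrow> z \<in> d ` carrier A"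
proof
  have zc: "bd I p +>\<^bsub>ch I p\<^esub> slice z I p = \<zero>\<^bsub>M (I, p)\<^esub> \<longleftrightarrow> slice z I p \<in> bd I p" if "I \<subseteq> V" for I p
    using coset_zero_iff[OF ch_module bd_submodule[OF that] slice_closed[OF z(1)]] by (simp add: M_zero)
  have pz: "pr z = \<zero>\<^bsub>total C\<^esub> \<longleftrightarrow> (\<forall>I p. I \<subseteq> V \<longrightarrow> slice z I p \<in> bd I p)"
  proof
    assume "pr z = \<zero>\<^bsub>total C\<^esub>"
    then have "pr z i = \<zero>\<^bsub>M i\<^esub>" if "i \<in> hochster_index V" for i using that by (simp add: total_C)
    then show "\<forall>I p. I \<subseteq> V \<longrightarrow> slice z I p \<in> bd I p"
      using zc by (force simp: pr_def hochster_index_iff)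
  next
    assume "\<forall>I p. I \<subseteq> V \<longrightarrow> slice z I p \<in> bd I p"
    then show "pr z = \<zero>\<^bsub>total C\<^esub>"
      using zc by (auto simp: pr_def total_C hochster_index_iff intro!: restrict_ext)
  qed
  { assume "pr z = \<zero>\<^bsub>total C\<^esub>"
    then have "\<exists>c. I \<subseteq> V \<longrightarrow> c \<in> carrier (ch I (p - e)) \<and> slice z I p = op I c" for I p
      using pz unfolding bd_def by blast
    then obtain c0 where c0: "\<And>I p. I \<subseteq> V \<Longrightarrow> c0 I p \<in> carrier (ch I (p - e)) \<and> slice z I p = op I (c0 I p)" by metis
    \<comment> \<open>A boundary in degree \<open>p\<close> comes from degree \<open>p - e\<close>;
      reindexing by \<open>p + e\<close> arranges the chosen chains by their own degree.\<close>
    define c where "c I p = c0 I (p + e)" for I p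
    have cc: "c I p \<in> carrier (ch I p)" if "I \<subseteq> V" for I p using c0[OF that, of "p + e"] by (simp add: c_def)
    have a: "glue c \<in> carrier A" by (rule glue_closed[where c = c, OF cc])
    have "d (glue c) = z"
    proof (rule slice_ext)
      fix I p assume I: "I \<subseteq> V"
      show "slice (d (glue c)) I p = slice z I p"
        using op_slice'[OF a I, of "p - e"] slice_glue[where c = c, OF I cc[OF I], of "p - e"] c0[OF I, of p] by (simp add: c_def)
    qed (use mod_hom_closed[OF d_hom a] z in auto)
    then show "z \<in> d ` carrier A" using a by blast }
  assume "z \<in> d ` carrier A"
  then obtain a where a: "a \<in> carrier A" "z = d a" by blast
  have "slice z I p \<in> bd I p" if I: "I \<subseteq> V" for I p
    using op_slice'[OF a(1) I, of "p - e"] slice_closed[OF a(1), of I "p - e"] a(2) unfolding bd_def by (metis diff_add_cancel imageI)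
  then show "pr z = \<zero>\<^bsub>total C\<^esub>" using pz by blast
qed

lemma presented: "presented_homology R A (total C) d pr"
proof (rule presented_homology.intro)
  show "pr ` {x \<in> carrier A. d x = \<zero>\<^bsub>A\<^esub>} = carrier (total C)"
  proof (intro equalityI subsetI)
    fix x assume "x \<in> carrier (total C)"
    then obtain z where "z \<in> carrier A" "d z = \<zero>\<^bsub>A\<^esub>" "pr z = x" by (rule pr_preimage)
    then show "x \<in> pr ` {x \<in> carrier A. d x = \<zero>\<^bsub>A\<^esub>}" by blast
  qed (use pr_closed in blast)
qed (use A_module C_module d_hom d_d pr_hom pr_zero_iff in auto)

text \<open>In each summand the slice of \<open>d' z\<close> combines the slices of \<open>z\<close>
  at neighbouring supports, and taking cosets commutes with scalar multiples, sums and the chain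
  maps \<open>res\<close>.\<close>

lemma diff_pr:
  assumes z: "z \<in> carrier A" "d z = \<zero>\<^bsub>A\<^esub>"
  shows "diff C (pr z) = pr (d' z)"
  unfolding diff_C
proof (subst pr_def[of "d' z"], rule restrict_ext, clarify)
  fix I p assume "(I, p) \<in> hochster_index V"
  then have I: "I \<subseteq> V" by (simp add: hochster_index_iff)
  let ?c = "\<lambda>i. ring_int R (cf I p i) \<odot>\<^bsub>ch I p\<^esub> res I (slice z (nb I i) p)"
  have res: "res I \<in> mod_hom R (ch (nb I i) q) (ch I q)" if "i \<in> N I" for i q
    using res_hom[OF I that] by (simp add: ch_def)
  \<comment> \<open>Commutation with \<open>op\<close> makes \<open>res\<close> send cycles to
    cycles, so the sum can be formed among the cycles before passing to classes.\<close>
  have rc: "res I (slice z (nb I i) p) \<in> cy I p" if i: "i \<in> N I" for i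
  proof -
    note J = nb_sub[OF I i]
    have "op I (res I (slice z (nb I i) p)) = res I (op (nb I i) (slice z (nb I i) p))"
      by (rule res_op[OF I i slice_closed[OF z(1), unfolded ch_def], symmetric])
    also have "op (nb I i) (slice z (nb I i) p) = \<zero>\<^bsub>ch (nb I i) p\<^esub>"
      using cyc_slice[OF z J] by (simp add: cy_def ch_zero)
    also have "res I \<zero>\<^bsub>ch (nb I i) p\<^esub> = (\<lambda>F. \<zero>\<^bsub>R\<^esub>)"
      using mod_hom_zero[OF ch_module ch_module res[OF i]] by (simp add: ch_zero)
    finally show ?thesis using mod_hom_closed[OF res[OF i] slice_closed[OF z(1)]] by (simp add: cy_def)
  qed
  have c: "?c i \<in> cy I p" if "i \<in> N I" for i
    by (rule submodule_smult[OF cy_submodule[OF I] _ rc[OF that]]) simp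
  have "ring_int R (cf I p i) \<odot>\<^bsub>M (I, p)\<^esub> quot_map (ch I p) (bd I p) (res I) (pr z (nb I i, p)) =
      bd I p +>\<^bsub>ch I p\<^esub> ?c i" if i: "i \<in> N I" for i
  proof -
    note J = nb_sub[OF I i]
    have "quot_map (ch I p) (bd I p) (res I) (bd (nb I i) p +>\<^bsub>ch (nb I i) p\<^esub> slice z (nb I i) p) =
        bd I p +>\<^bsub>ch I p\<^esub> res I (slice z (nb I i) p)"
    proof (rule quot_map_coset[OF ch_module bd_submodule[OF J] ch_module bd_submodule[OF I]])
      show "res I \<in> mod_hom R (ch (nb I i) p\<lparr>carrier := carrier (ch (nb I i) p)\<rparr>) (ch I p)" using res[OF i] by simp
      show "submodule (carrier (ch (nb I i) p)) R (ch (nb I i) p)" by (rule module.carrier_is_submodule[OF ch_module])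
      show "bd (nb I i) p \<subseteq> carrier (ch (nb I i) p)" by (rule submodule_sub[OF bd_submodule[OF J]])
      show "slice z (nb I i) p \<in> carrier (ch (nb I i) p)" by (rule slice_closed[OF z(1)])
      fix b assume "b \<in> bd (nb I i) p"
      then obtain a where a: "a \<in> carrier (ch (nb I i) (p - e))" "b = op (nb I i) a" by (auto simp: bd_def)
      then have "res I b = op I (res I a)" using res_op[OF I i] by (simp add: ch_def)
      then show "res I b \<in> bd I p" using mod_hom_closed[OF res[OF i] a(1)] by (auto simp: bd_def)
    qed
    then show ?thesis
      using mod_hom_smult[OF proj_hom[OF I], of "ring_int R (cf I p i)" "res I (slice z (nb I i) p)" p] rc[OF i] J
      by (simp add: pr_def hochster_index_iff)
  qed
  then have "(\<Oplus>\<^bsub>M (I, p)\<^esub>i\<in>N I. ring_int R (cf I p i) \<odot>\<^bsub>M (I, p)\<^esub>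
      quot_map (ch I p) (bd I p) (res I) (pr z (nb I i, p))) =
      (\<Oplus>\<^bsub>M (I, p)\<^esub>i\<in>N I. bd I p +>\<^bsub>ch I p\<^esub> ?c i)"
    using c mod_hom_closed[OF proj_hom[OF I]] M_module[OF I, of p]
    by (intro abelian_monoid.finsum_cong') (auto simp: module_def abelian_group_def)
  also have "\<dots> = bd I p +>\<^bsub>ch I p\<^esub> (\<Oplus>\<^bsub>ch I p\<lparr>carrier := cy I p\<rparr>\<^esub>i\<in>N I. ?c i)"
    by (rule mod_hom_finsum[OF cy_module[OF I] M_module[OF I] proj_hom[OF I] finite_N[OF I], symmetric])
      (use c in auto)
  also have "(\<Oplus>\<^bsub>ch I p\<lparr>carrier := cy I p\<rparr>\<^esub>i\<in>N I. ?c i) = (\<Oplus>\<^bsub>ch I p\<^esub>i\<in>N I. ?c i)"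
    by (rule submodule_finsum_eq[OF ch_module cy_submodule[OF I] finite_N[OF I]]) (use c in auto)
  also have "\<dots> = slice (d' z) I p"
  proof
    fix F
    have cF: "?c i \<in> carrier (ch I p)" if "i \<in> N I" for i using c[OF that] by (simp add: cy_def)
    have "(\<Oplus>\<^bsub>ch I p\<^esub>i\<in>N I. ?c i) F = (\<Oplus>\<^bsub>R\<^esub>i\<in>N I. ?c i F)"
      using cF unfolding ch_def simplicial_chains_def
      by (intro free_module_finsum_apply[OF R_cring finite_N[OF I]]) auto
    also have "\<dots> = slice (d' z) I p F"
    proof (cases "int (card F) = p + 1")
      case True
      then show ?thesis using res_slice[OF z(1) I True]
        by (simp add: slice_def ch_def simplicial_chains_def)
    next
      case False
      then have "?c i F = \<zero>\<^bsub>R\<^esub>" if "i \<in> N I" for i using cF[OF that] by (simp add: ch_carrier)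
      then have "(\<Oplus>\<^bsub>R\<^esub>i\<in>N I. ?c i F) = (\<Oplus>\<^bsub>R\<^esub>i\<in>N I. \<zero>\<^bsub>R\<^esub>)" by (intro R.finsum_cong') auto
      then show ?thesis using False by (simp add: slice_def)
    qed
    finally show "(\<Oplus>\<^bsub>ch I p\<^esub>i\<in>N I. ?c i) F = slice (d' z) I p F" .
  qed
  finally show "(\<Oplus>\<^bsub>M (I, p)\<^esub>i\<in>N I. ring_int R (cf I p i) \<odot>\<^bsub>M (I, p)\<^esub>
      quot_map (simplicial_chains R (full_subcomplex K I) p)
        (op I ` carrier (simplicial_chains R (full_subcomplex K I) (p - e))) (res I) (pr z (nb I i, p))) =
      bd I p +>\<^bsub>ch I p\<^esub> slice (d' z) I p" by (simp add: ch_def bd_def)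
qed

lemma part_pr: "part C u = pr ` ({x \<in> carrier A. d x = \<zero>\<^bsub>A\<^esub>} \<inter> homogeneous R S pair_degree u)"
proof (intro equalityI subsetI)
  fix x assume "x \<in> part C u"
  then have x: "x \<in> carrier (total C)" "\<And>I p. I \<subseteq> V \<Longrightarrow> hochster_bidegree (I, p) \<noteq> u \<Longrightarrow> x (I, p) = \<zero>\<^bsub>M (I, p)\<^esub>"
    by (auto simp: part_C hochster_part_def total_C hochster_index_iff)
  obtain z where z: "z \<in> carrier A" "d z = \<zero>\<^bsub>A\<^esub>" "pr z = x"
    "\<And>I p. I \<subseteq> V \<Longrightarrow> x (I, p) = \<zero>\<^bsub>M (I, p)\<^esub> \<Longrightarrow> slice z I p = (\<lambda>F. \<zero>\<^bsub>R\<^esub>)"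
    by (rule pr_preimage[OF x(1)]) (rule that)
  \<comment> \<open>The normalised representative vanishes on basis pairs of other
    bidegrees.\<close>
  have "z s = \<zero>\<^bsub>R\<^esub>" if "s \<in> S" "pair_degree s \<noteq> u" for s
  proof -
    have "slice z (fst s) (int (card (snd s)) - 1) = (\<lambda>F. \<zero>\<^bsub>R\<^esub>)"
      using that by (intro z(4) x(2)) (auto simp: pairs_def pair_degree_def)
    then have "slice z (fst s) (int (card (snd s)) - 1) (snd s) = \<zero>\<^bsub>R\<^esub>" by simp
    then show ?thesis by (simp add: slice_def)
  qed
  then have "z \<in> homogeneous R S pair_degree u" using z(1) by (simp add: homogeneous_def)
  then show "x \<in> pr ` ({x \<in> carrier A. d x = \<zero>\<^bsub>A\<^esub>} \<inter> homogeneous R S pair_degree u)" using z by blast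
next
  fix x assume "x \<in> pr ` ({x \<in> carrier A. d x = \<zero>\<^bsub>A\<^esub>} \<inter> homogeneous R S pair_degree u)"
  then obtain z where z: "z \<in> carrier A" "d z = \<zero>\<^bsub>A\<^esub>" "z \<in> homogeneous R S pair_degree u" "x = pr z" by auto
  have "pr z (I, p) = \<zero>\<^bsub>M (I, p)\<^esub>" if I: "I \<subseteq> V" and ne: "hochster_bidegree (I, p) \<noteq> u" for I p
  proof -
    have "slice z I p F = \<zero>\<^bsub>R\<^esub>" for F
    proof (cases "int (card F) = p + 1 \<and> (I, F) \<in> S")
      case True
      then have "pair_degree (I, F) \<noteq> u" using ne by (simp add: pair_degree_def)
      then show ?thesis using z(3) True by (simp add: slice_def homogeneous_def)
    qed (use z(1) in \<open>auto simp: slice_def A_carrier\<close>)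
    then have "slice z I p = (\<lambda>F. \<zero>\<^bsub>R\<^esub>)" by auto
    then show ?thesis using coset_slice_zero[OF I] I by (simp add: pr_def hochster_index_iff)
  qed
  then show "x \<in> part C u"
    using pr_closed[OF z(1,2)] z(4) by (auto simp: part_C hochster_part_def total_C hochster_index_iff)
qed

theorem double_complex: "double_complex R S C m pr m' pair_degree (e, 0) e'"
proof (intro double_complex.intro double_complex_axioms.intro)
  note cyc = presented_homology.cyc_def[OF presented]
  show "part C u = pr ` (presented_homology.cyc A d \<inter> homogeneous R S pair_degree u)" for u
    unfolding cyc by (rule part_pr)
  show "diff C (pr f) = pr (d' f)" if "f \<in> presented_homology.cyc A d" for f
    using that unfolding cyc by (intro diff_pr) auto
qed (use presented finite_S degree_m degree_m' odd_e odd_e' m'_m' m_m' in auto)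

end

section \<open>Simplicial (co)boundaries as rows of the matrices, and the application to
  joins\<close>

lemma matrix_map_reindex:
  assumes "cring R" "finite S" "f \<in> carrier (free_module R S)" "x \<in> S" "finite J" "inj_on h J"
    and c: "\<And>j. j \<in> J \<Longrightarrow> h j \<in> S \<Longrightarrow> m x (h j) = c j"
    and zero: "\<And>y. y \<in> S \<Longrightarrow> y \<notin> h ` J \<Longrightarrow> m x y = 0"
  shows "matrix_map R S m f x = (\<Oplus>\<^bsub>R\<^esub>j\<in>J. ring_int R (c j) \<otimes>\<^bsub>R\<^esub> f (h j))"
proof -
  interpret cring R by fact
  have f: "f y \<in> carrier R" "y \<notin> S \<Longrightarrow> f y = \<zero>\<^bsub>R\<^esub>" for y
    using assms(3) by (auto simp: free_module_carrier)
  \<comment> \<open>Some \<open>h j\<close> may lie outside \<open>S\<close>, where \<open>f\<close>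
    vanishes. These indices are left out to rewrite the sum over \<open>S\<close> and restored at
    the end.\<close>
  let ?J = "{j \<in> J. h j \<in> S}"
  have "matrix_map R S m f x = (\<Oplus>\<^bsub>R\<^esub>y\<in>S. ring_int R (m x y) \<otimes>\<^bsub>R\<^esub> f y)"
    using assms(4) by (simp add: matrix_map_def)
  also have "\<dots> = (\<Oplus>\<^bsub>R\<^esub>y\<in>h ` ?J. ring_int R (m x y) \<otimes>\<^bsub>R\<^esub> f y)"
  proof (rule add.finprod_mono_neutral_cong_right[OF assms(2)])
    show "h ` ?J \<subseteq> S" by auto
    show "ring_int R (m x y) \<otimes>\<^bsub>R\<^esub> f y = \<zero>\<^bsub>R\<^esub>" if "y \<in> S - h ` ?J" for y
    proof -
      have "y \<notin> h ` J" using that by auto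
      then show ?thesis using zero[of y] that f(1) by simp
    qed
  qed (use f in auto)
  also have "\<dots> = (\<Oplus>\<^bsub>R\<^esub>j\<in>?J. ring_int R (m x (h j)) \<otimes>\<^bsub>R\<^esub> f (h j))"
    using f(1) assms(6) by (intro finsum_reindex) (auto simp: inj_on_def)
  also have "\<dots> = (\<Oplus>\<^bsub>R\<^esub>j\<in>?J. ring_int R (c j) \<otimes>\<^bsub>R\<^esub> f (h j))"
    using f c by (intro finsum_cong') auto
  also have "\<dots> = (\<Oplus>\<^bsub>R\<^esub>j\<in>J. ring_int R (c j) \<otimes>\<^bsub>R\<^esub> f (h j))"
    using f assms(5) by (intro add.finprod_mono_neutral_cong_left) auto
  finally show ?thesis .
qed

lemma matrix_map_outside: "x \<notin> S \<Longrightarrow> matrix_map R S m f x = \<zero>\<^bsub>R\<^esub>"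
  by (simp add: matrix_map_def)

text \<open>The sign counts predecessors other than \<open>j\<close>. This matches the sign in
  \<open>\<partial>'\<close>, taken with \<open>j\<close> outside the support, to the incidence
  number of the enlarged support.\<close>

lemma eps_self: "eps r j (X - {j}) = eps r j X" "eps r j (insert j X) = eps r j X"
proof -
  have "{k \<in> X - {j}. k \<noteq> j \<and> (k, j) \<in> r} = {k \<in> X. k \<noteq> j \<and> (k, j) \<in> r}"
    "{k \<in> insert j X. k \<noteq> j \<and> (k, j) \<in> r} = {k \<in> X. k \<noteq> j \<and> (k, j) \<in> r}" by auto
  then show "eps r j (X - {j}) = eps r j X" "eps r j (insert j X) = eps r j X" by (simp_all add: eps_def)
qed

lemma inc_insert: "finite X \<Longrightarrow> j \<notin> X \<Longrightarrow> inc r (insert j X) X = eps r j (insert j X)"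
  using inc_diff[of "insert j X" j r] by simp

lemma simplicial_joinI: "F \<in> K \<Longrightarrow> G \<in> L \<Longrightarrow> F <+> G \<in> simplicial_join K L"
  unfolding simplicial_join_def by auto

lemma simplicial_join_complex:
  assumes "simplicial_complex V K" "simplicial_complex W L"
  shows "simplicial_complex (V <+> W) (simplicial_join K L)"
  unfolding simplicial_complex_def
proof (intro conjI ballI allI impI)
  show "finite (V <+> W)" using assms by (auto simp: simplicial_complex_def)
  have "K \<subseteq> Pow V" "L \<subseteq> Pow W" using assms by (auto simp: simplicial_complex_def)
  show "simplicial_join K L \<subseteq> Pow (V <+> W)"
  proof
    fix X assume "X \<in> simplicial_join K L"
    then obtain F G where X: "X = F <+> G" "F \<in> K" "G \<in> L" by (auto simp: simplicial_join_def)
    then have "F \<subseteq> V" "G \<subseteq> W" using \<open>K \<subseteq> Pow V\<close> \<open>L \<subseteq> Pow W\<close> by auto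
    then show "X \<in> Pow (V <+> W)" unfolding X(1) by auto
  qed
  have "{} <+> {} \<in> simplicial_join K L" by (rule simplicial_joinI) (use assms in \<open>simp_all add: simplicial_complex_def\<close>)
  then show "{} \<in> simplicial_join K L" by (simp add: Plus_def)
  show "{v} \<in> simplicial_join K L" if "v \<in> V <+> W" for v
  proof (cases v)
    case (Inl a)
    then have "{v} = {a} <+> {}" "{a} \<in> K" "{} \<in> L" using that assms by (auto simp: simplicial_complex_def)
    then show ?thesis using simplicial_joinI by metis
  next
    case (Inr b)
    then have "{v} = {} <+> {b}" "{} \<in> K" "{b} \<in> L" using that assms by (auto simp: simplicial_complex_def)
    then show ?thesis using simplicial_joinI by metis
  qed
  fix X Y assume "X \<in> simplicial_join K L" "Y \<subseteq> X"
  then obtain F G where FG: "X = F <+> G" "F \<in> K" "G \<in> L" by (auto simp: simplicial_join_def)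
  have "Inl -` Y \<subseteq> F" "Inr -` Y \<subseteq> G" using \<open>Y \<subseteq> X\<close> FG(1) by auto
  moreover have "F' \<in> K" if "F' \<subseteq> F" for F' using assms(1) FG(2) that unfolding simplicial_complex_def by metis
  moreover have "G' \<in> L" if "G' \<subseteq> G" for G' using assms(2) FG(3) that unfolding simplicial_complex_def by metis
  ultimately have "Inl -` Y \<in> K" "Inr -` Y \<in> L" by blast+
  moreover have "Y = (Inl -` Y) <+> (Inr -` Y)" using Plus_eq_vimage[of "Inl -` Y" "Inr -` Y" Y] by simp
  ultimately show "Y \<in> simplicial_join K L" using simplicial_joinI by metis
qed

definition parity_sign :: "int \<Rightarrow> int" where "parity_sign k = (if even k then 1 else - 1)"

lemma parity_sign_card: "int (card F) = k \<Longrightarrow> parity_sign k = (- 1) ^ card F"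
  by (auto simp: parity_sign_def)

context
  fixes R :: "('r, 's) ring_scheme" and V :: "'v set" and r K
  assumes R: "cring R" and K: "simplicial_complex V K" and r: "linear_order_on V r"
begin

interpretation R: cring R by (rule R)

private abbreviation "S \<equiv> pairs V K"
private abbreviation "sub \<equiv> full_subcomplex K"

private lemma finite_S: "finite S" by (rule finite_pairs[OF K])
private lemma finite_V: "finite V" using K by (simp add: simplicial_complex_def)

private lemma S_iff: "I \<subseteq> V \<Longrightarrow> (I, F) \<in> S \<longleftrightarrow> F \<in> sub I"
  by (auto simp: pairs_def full_subcomplex_def)

private lemma sub_V: "F \<in> sub I \<Longrightarrow> F \<subseteq> V"
  using K by (auto simp: full_subcomplex_def simplicial_complex_def)

private lemma sub_finite: "F \<in> sub I \<Longrightarrow> finite F"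
  using finite_subset[OF sub_V finite_V] .

private lemma sub_remove: "F \<in> sub I \<Longrightarrow> F - {j} \<in> sub I"
  using K unfolding full_subcomplex_def simplicial_complex_def by blast

private lemma finite_sub_faces: "finite (faces (sub I) p)"
proof (rule finite_subset)
  show "faces (sub I) p \<subseteq> Pow V" using K by (auto simp: faces_def full_subcomplex_def simplicial_complex_def)
qed (simp add: finite_V)

private lemmas chains_carrier = finite_free_module_carrier[OF finite_sub_faces, folded simplicial_chains_def]

private lemma coef: "ring_sign R k \<otimes>\<^bsub>R\<^esub> vertex_sign R r i X = ring_int R (parity_sign k * eps r i X)"
  by (simp only: R.ring_int_mult R.ring_sign_eq R.vertex_sign_eq parity_sign_def)

lemma coface_sum:
  assumes f: "f \<in> carrier (free_module R S)" and I: "I \<subseteq> V" "F \<in> sub I"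
  shows "matrix_map R S (face_matrix r) f (I, F) = (\<Oplus>\<^bsub>R\<^esub>j\<in>F. ring_int R (eps r j F) \<otimes>\<^bsub>R\<^esub> f (I, F - {j}))"
proof (rule matrix_map_reindex[OF R finite_S f])
  show "(I, F) \<in> S" using I by (simp add: S_iff)
  show "finite F" by (rule sub_finite[OF I(2)])
  show "inj_on (\<lambda>j. (I, F - {j})) F" by (auto simp: inj_on_def)
  show "face_matrix r (I, F) (I, F - {j}) = eps r j F" if "j \<in> F" for j
    using that sub_finite[OF I(2)] by (simp add: face_matrix_def inc_diff)
  show "face_matrix r (I, F) y = 0" if "y \<notin> (\<lambda>j. (I, F - {j})) ` F" for y
  proof (rule ccontr)
    assume "face_matrix r (I, F) y \<noteq> 0"
    then have "fst y = I" "inc r F (snd y) \<noteq> 0" by (auto simp: face_matrix_def split: if_splits)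
    then obtain j where "j \<in> F" "y = (I, F - {j})" by (metis inc_nonzeroE prod.collapse)
    then show False using that by blast
  qed
qed

lemma face_sum:
  assumes f: "f \<in> carrier (free_module R S)" and I: "I \<subseteq> V" "F \<in> sub I"
  shows "matrix_map R S (\<lambda>x y. face_matrix r y x) f (I, F) =
    (\<Oplus>\<^bsub>R\<^esub>j\<in>{j. j \<notin> F \<and> insert j F \<in> sub I}. ring_int R (eps r j (insert j F)) \<otimes>\<^bsub>R\<^esub> f (I, insert j F))"
proof (rule matrix_map_reindex[OF R finite_S f])
  show "(I, F) \<in> S" using I by (simp add: S_iff)
  show "finite {j. j \<notin> F \<and> insert j F \<in> sub I}"
    by (rule finite_subset[OF _ finite_V]) (use K in \<open>auto simp: full_subcomplex_def simplicial_complex_def\<close>)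
  show "inj_on (\<lambda>j. (I, insert j F)) {j. j \<notin> F \<and> insert j F \<in> sub I}" by (auto simp: inj_on_def)
  show "face_matrix r (I, insert j F) (I, F) = eps r j (insert j F)" if "j \<in> {j. j \<notin> F \<and> insert j F \<in> sub I}" for j
    using that sub_finite[OF I(2)] by (simp add: face_matrix_def inc_insert)
  show "face_matrix r y (I, F) = 0"
    if "y \<in> S" "y \<notin> (\<lambda>j. (I, insert j F)) ` {j. j \<notin> F \<and> insert j F \<in> sub I}" for y
  proof (rule ccontr)
    assume "face_matrix r y (I, F) \<noteq> 0"
    then have "fst y = I" "inc r (snd y) F \<noteq> 0" by (auto simp: face_matrix_def split: if_splits)
    then obtain j where j: "j \<in> snd y" "y = (I, snd y)" "F = snd y - {j}" by (metis inc_nonzeroE prod.collapse)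
    then have "insert j F = snd y" "j \<notin> F" by auto
    then have y: "y = (I, insert j F)" "j \<notin> F" using j(2) by simp_all
    then have "insert j F \<in> sub I" using that(1) I(1) by (simp add: S_iff)
    then show False using that(2) y by blast
  qed
qed

lemma cosupport_sum:
  assumes f: "f \<in> carrier (free_module R S)" and I: "I \<subseteq> V" "F \<in> sub I"
  shows "matrix_map R S (support_matrix r) f (I, F) =
    (\<Oplus>\<^bsub>R\<^esub>i\<in>V - I. ring_int R ((- 1) ^ card F * eps r i (insert i I)) \<otimes>\<^bsub>R\<^esub> f (insert i I, F))"
proof (rule matrix_map_reindex[OF R finite_S f])
  show "(I, F) \<in> S" using I by (simp add: S_iff)
  show "finite (V - I)" using finite_V by simp
  show "inj_on (\<lambda>i. (insert i I, F)) (V - I)" by (auto simp: inj_on_def)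
  have "finite I" using I(1) finite_V finite_subset by blast
  then show "support_matrix r (I, F) (insert i I, F) = (- 1) ^ card F * eps r i (insert i I)" if "i \<in> V - I" for i
    using that by (simp add: support_matrix_def inc_insert)
  show "support_matrix r (I, F) y = 0" if "y \<in> S" "y \<notin> (\<lambda>i. (insert i I, F)) ` (V - I)" for y
  proof (rule ccontr)
    assume "support_matrix r (I, F) y \<noteq> 0"
    then have "snd y = F" "inc r (fst y) I \<noteq> 0" by (auto simp: support_matrix_def split: if_splits)
    then obtain i where i: "i \<in> fst y" "y = (fst y, F)" "I = fst y - {i}" by (metis inc_nonzeroE prod.collapse)
    moreover have "fst y \<subseteq> V" using that(1) by (auto simp: pairs_def)
    ultimately have "insert i I = fst y" "i \<in> V - I" by auto
    moreover from this have "y = (insert i I, F)" using i(2) by simp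
    ultimately show False using that(2) by blast
  qed
qed

lemma support_sum:
  assumes f: "f \<in> carrier (free_module R S)" and I: "I \<subseteq> V" "F \<in> sub I"
  shows "matrix_map R S (\<lambda>x y. support_matrix r y x) f (I, F) =
    (\<Oplus>\<^bsub>R\<^esub>i\<in>I. ring_int R ((- 1) ^ card F * eps r i (I - {i})) \<otimes>\<^bsub>R\<^esub> f (I - {i}, F))"
proof (rule matrix_map_reindex[OF R finite_S f])
  show "(I, F) \<in> S" using I by (simp add: S_iff)
  show fin: "finite I" using I(1) finite_V finite_subset by blast
  show "inj_on (\<lambda>i. (I - {i}, F)) I" by (auto simp: inj_on_def)
  show "support_matrix r (I - {i}, F) (I, F) = (- 1) ^ card F * eps r i (I - {i})" if "i \<in> I" for i
    using that fin by (simp add: support_matrix_def inc_diff eps_self)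
  show "support_matrix r y (I, F) = 0" if "y \<notin> (\<lambda>i. (I - {i}, F)) ` I" for y
  proof (rule ccontr)
    assume "support_matrix r y (I, F) \<noteq> 0"
    then have "snd y = F" "inc r I (fst y) \<noteq> 0" by (auto simp: support_matrix_def split: if_splits)
    then obtain i where "i \<in> I" "y = (I - {i}, F)" by (metis inc_nonzeroE prod.collapse)
    then show False using that by blast
  qed
qed

text \<open>The coboundary raises the degree of cochains by one. Classes reach \<open>I\<close> by
  restriction from the supports with one more vertex, and losing that vertex changes the bidegree by
  \<open>(1, - 2)\<close>.\<close>

lemma cohomology_hochster:
  "hochster_complex R V K (\<lambda>I. simplicial_coboundary R r (sub I)) 1 (1, - 2) (face_matrix r) (support_matrix r)
    (\<lambda>I. V - I) (\<lambda>I i. insert i I) (\<lambda>I p i. parity_sign (p + 1) * eps r i (insert i I))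
    (\<lambda>I f F. if F \<in> sub I then f F else \<zero>\<^bsub>R\<^esub>) (full_cohomology R r K) (CH_cohomology R V r K)"
proof (rule hochster_complex.intro)
  fix f I p assume f: "f \<in> carrier (free_module R S)" and I: "I \<subseteq> V"
  have fc: "f x \<in> carrier R" for x using f unfolding free_module_carrier by blast
  show "(\<lambda>F. if int (card F) = p + 1 + 1 then matrix_map R S (face_matrix r) f (I, F) else \<zero>\<^bsub>R\<^esub>) =
      simplicial_coboundary R r (sub I) (\<lambda>F. if int (card F) = p + 1 then f (I, F) else \<zero>\<^bsub>R\<^esub>)"
  proof
    fix F
    show "(if int (card F) = p + 1 + 1 then matrix_map R S (face_matrix r) f (I, F) else \<zero>\<^bsub>R\<^esub>) =
      simplicial_coboundary R r (sub I) (\<lambda>F. if int (card F) = p + 1 then f (I, F) else \<zero>\<^bsub>R\<^esub>) F"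
    proof (cases "F \<in> sub I")
      case True
      have card: "int (card (F - {j})) = p + 1 \<longleftrightarrow> int (card F) = p + 1 + 1" if "j \<in> F" for j
        using card_Suc_Diff1[OF sub_finite[OF True] that] by linarith
      have "(\<Oplus>\<^bsub>R\<^esub>j\<in>F. vertex_sign R r j F \<otimes>\<^bsub>R\<^esub> (if int (card (F - {j})) = p + 1 then f (I, F - {j}) else \<zero>\<^bsub>R\<^esub>)) =
          (\<Oplus>\<^bsub>R\<^esub>j\<in>F. if int (card F) = p + 1 + 1 then ring_int R (eps r j F) \<otimes>\<^bsub>R\<^esub> f (I, F - {j}) else \<zero>\<^bsub>R\<^esub>)"
        using fc card by (intro R.finsum_cong') (auto simp: R.vertex_sign_eq)
      then show ?thesis using True by (simp add: simplicial_coboundary_def coface_sum[OF f I])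
    next
      case False
      then show ?thesis using I by (simp add: simplicial_coboundary_def matrix_map_outside S_iff)
    qed
  qed
  fix F :: "'v set" assume F: "int (card F) = p + 1"
  show "matrix_map R S (support_matrix r) f (I, F) =
      (\<Oplus>\<^bsub>R\<^esub>i\<in>V - I. ring_int R (parity_sign (p + 1) * eps r i (insert i I)) \<otimes>\<^bsub>R\<^esub>
        (if F \<in> sub I then if int (card F) = p + 1 then f (insert i I, F) else \<zero>\<^bsub>R\<^esub> else \<zero>\<^bsub>R\<^esub>))"
  proof (cases "F \<in> sub I")
    case True
    then show ?thesis using F by (simp add: cosupport_sum[OF f I] parity_sign_card)
  next
    case False
    then show ?thesis using I by (simp add: matrix_map_outside S_iff)
  qed
next
  fix I i p assume I: "I \<subseteq> V"
  show "(\<lambda>f F. if F \<in> sub I then f F else \<zero>\<^bsub>R\<^esub>) \<in> mod_hom R (simplicial_chains R (sub (insert i I)) p) (simplicial_chains R (sub I) p)"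
  proof (rule mod_homI)
    fix c assume "c \<in> carrier (simplicial_chains R (sub (insert i I)) p)"
    then show "(\<lambda>F. if F \<in> sub I then c F else \<zero>\<^bsub>R\<^esub>) \<in> carrier (simplicial_chains R (sub I) p)"
      unfolding chains_carrier by (auto simp: faces_def)
  qed (auto simp: simplicial_chains_def free_module_simps)
  fix c assume "c \<in> carrier (simplicial_chains R (sub (insert i I)) p)"
  then have c: "c F \<in> carrier R" for F unfolding chains_carrier by simp
  show "(\<lambda>F. if F \<in> sub I then simplicial_coboundary R r (sub (insert i I)) c F else \<zero>\<^bsub>R\<^esub>) =
      simplicial_coboundary R r (sub I) (\<lambda>F. if F \<in> sub I then c F else \<zero>\<^bsub>R\<^esub>)"
  proof
    fix F
    have "F \<in> sub I \<Longrightarrow> F \<in> sub (insert i I)" by (auto simp: full_subcomplex_def)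
    \<comment> \<open>All subsets of a face of the subcomplex lie in it, so cutting the cochain down
      to the subcomplex leaves this sum unchanged.\<close>
    moreover have "(\<Oplus>\<^bsub>R\<^esub>j\<in>F. vertex_sign R r j F \<otimes>\<^bsub>R\<^esub> c (F - {j})) =
        (\<Oplus>\<^bsub>R\<^esub>j\<in>F. vertex_sign R r j F \<otimes>\<^bsub>R\<^esub> (if F - {j} \<in> sub I then c (F - {j}) else \<zero>\<^bsub>R\<^esub>))" if "F \<in> sub I"
      using c sub_remove[OF that] by (intro R.finsum_cong') (auto simp: R.vertex_sign_eq)
    ultimately show "(if F \<in> sub I then simplicial_coboundary R r (sub (insert i I)) c F else \<zero>\<^bsub>R\<^esub>) =
      simplicial_coboundary R r (sub I) (\<lambda>F. if F \<in> sub I then c F else \<zero>\<^bsub>R\<^esub>) F"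
      by (simp add: simplicial_coboundary_def)
  qed
next
  show "full_cohomology R r K (I, p) = quot_module (simplicial_chains R (sub I) p\<lparr>carrier :=
      {c \<in> carrier (simplicial_chains R (sub I) p). simplicial_coboundary R r (sub I) c = (\<lambda>F. \<zero>\<^bsub>R\<^esub>)}\<rparr>)
      (simplicial_coboundary R r (sub I) ` carrier (simplicial_chains R (sub I) (p - 1)))" for I p
    by (simp add: full_cohomology_def reduced_cohomology_def cocycles_def coboundaries_def)
  show "diff (CH_cohomology R V r K) = (\<lambda>x. \<lambda>(I, p)\<in>hochster_index V. \<Oplus>\<^bsub>full_cohomology R r K (I, p)\<^esub>i\<in>V - I.
      ring_int R (parity_sign (p + 1) * eps r i (insert i I)) \<odot>\<^bsub>full_cohomology R r K (I, p)\<^esub>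
        quot_map (simplicial_chains R (sub I) p) (simplicial_coboundary R r (sub I) ` carrier (simplicial_chains R (sub I) (p - 1)))
          (\<lambda>f F. if F \<in> sub I then f F else \<zero>\<^bsub>R\<^esub>) (x (insert i I, p)))"
    by (simp add: CH_cohomology_def cohomology_restriction_def coboundaries_def coef)
  show "face_matrix r x y \<noteq> 0 \<Longrightarrow> pair_degree x = (fst (pair_degree y) + 1, snd (pair_degree y) + 0)" for x y
    by (rule face_matrix_degree)
  show "support_matrix r x y \<noteq> 0 \<Longrightarrow>
      pair_degree x = (fst (pair_degree y) + fst (1, - 2), snd (pair_degree y) + snd (1, - 2))" for x y
    unfolding fst_conv snd_conv by (rule support_matrix_degree)
qed (auto simp: R K finite_V CH_cohomology_def ZK_cohomology_def
    face_matrix_square[OF K r] support_matrix_square[OF K r] face_support_anticommute[OF K r])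

text \<open>Transposed matrices reverse all degrees. Classes reach \<open>I\<close> by inclusion
  from the supports with one vertex fewer, and extension by zero is the identity on functions. The
  matrix identities are those for cohomology with the outer indices exchanged.\<close>

lemma homology_hochster:
  "hochster_complex R V K (\<lambda>I. simplicial_boundary R r (sub I)) (- 1) (- 1, 2)
    (\<lambda>x y. face_matrix r y x) (\<lambda>x y. support_matrix r y x)
    (\<lambda>I. I) (\<lambda>I i. I - {i}) (\<lambda>I p i. parity_sign (p + 1) * eps r i (I - {i}))
    (\<lambda>I c. c) (full_homology R r K) (CH_homology R V r K)"
proof (rule hochster_complex.intro)
  fix f I p assume f: "f \<in> carrier (free_module R S)" and I: "I \<subseteq> V"
  have fc: "f x \<in> carrier R" for x using f unfolding free_module_carrier by blast
  show "(\<lambda>F. if int (card F) = p + - 1 + 1 then matrix_map R S (\<lambda>x y. face_matrix r y x) f (I, F) else \<zero>\<^bsub>R\<^esub>) =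
      simplicial_boundary R r (sub I) (\<lambda>F. if int (card F) = p + 1 then f (I, F) else \<zero>\<^bsub>R\<^esub>)"
  proof
    fix F
    let ?J = "{j. j \<notin> F \<and> insert j F \<in> sub I}"
    show "(if int (card F) = p + - 1 + 1 then matrix_map R S (\<lambda>x y. face_matrix r y x) f (I, F) else \<zero>\<^bsub>R\<^esub>) =
      simplicial_boundary R r (sub I) (\<lambda>F. if int (card F) = p + 1 then f (I, F) else \<zero>\<^bsub>R\<^esub>) F"
    proof (cases "F \<in> sub I")
      case True
      have card: "int (card (insert j F)) = p + 1 \<longleftrightarrow> int (card F) = p" if "j \<in> ?J" for j
        using that sub_finite[OF True] by auto
      have "(\<Oplus>\<^bsub>R\<^esub>j\<in>?J. vertex_sign R r j (insert j F) \<otimes>\<^bsub>R\<^esub> (if int (card (insert j F)) = p + 1 then f (I, insert j F) else \<zero>\<^bsub>R\<^esub>)) =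
          (\<Oplus>\<^bsub>R\<^esub>j\<in>?J. if int (card F) = p then ring_int R (eps r j (insert j F)) \<otimes>\<^bsub>R\<^esub> f (I, insert j F) else \<zero>\<^bsub>R\<^esub>)"
        using fc card by (intro R.finsum_cong') (auto simp: R.vertex_sign_eq)
      then show ?thesis using True by (simp add: simplicial_boundary_def face_sum[OF f I])
    next
      case False
      then show ?thesis using I by (simp add: simplicial_boundary_def matrix_map_outside S_iff)
    qed
  qed
  fix F :: "'v set" assume F: "int (card F) = p + 1"
  show "matrix_map R S (\<lambda>x y. support_matrix r y x) f (I, F) =
      (\<Oplus>\<^bsub>R\<^esub>i\<in>I. ring_int R (parity_sign (p + 1) * eps r i (I - {i})) \<otimes>\<^bsub>R\<^esub>
        (if int (card F) = p + 1 then f (I - {i}, F) else \<zero>\<^bsub>R\<^esub>))"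
  proof (cases "F \<in> sub I")
    case True
    then show ?thesis using F by (simp add: support_sum[OF f I] parity_sign_card)
  next
    case False
    then have "(I - {i}, F) \<notin> S" for i by (auto simp: pairs_def full_subcomplex_def)
    then have "f (I - {i}, F) = \<zero>\<^bsub>R\<^esub>" for i using f unfolding free_module_carrier by blast
    then show ?thesis using I False F by (simp add: matrix_map_outside S_iff)
  qed
next
  fix I i p assume I: "I \<subseteq> V" "i \<in> I"
  have sub: "F \<in> sub (I - {i}) \<Longrightarrow> F \<in> sub I" for F by (auto simp: full_subcomplex_def)
  show "(\<lambda>c. c) \<in> mod_hom R (simplicial_chains R (sub (I - {i})) p) (simplicial_chains R (sub I) p)"
  proof (rule mod_homI)
    fix c assume "c \<in> carrier (simplicial_chains R (sub (I - {i})) p)"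
    then show "c \<in> carrier (simplicial_chains R (sub I) p)"
      unfolding chains_carrier using sub by (auto simp: faces_def)
  qed (auto simp: simplicial_chains_def free_module_simps)
  fix c assume "c \<in> carrier (simplicial_chains R (sub (I - {i})) p)"
  then have c: "c F \<in> carrier R" "F \<notin> sub (I - {i}) \<Longrightarrow> c F = \<zero>\<^bsub>R\<^esub>" for F
    unfolding chains_carrier by (auto simp: faces_def)
  show "simplicial_boundary R r (sub (I - {i})) c = simplicial_boundary R r (sub I) c"
  proof
    fix F
    let ?J = "{j. j \<notin> F \<and> insert j F \<in> sub I}" and ?J' = "{j. j \<notin> F \<and> insert j F \<in> sub (I - {i})}"
    have fin: "finite ?J"
      by (rule finite_subset[OF _ finite_V]) (use K in \<open>auto simp: full_subcomplex_def simplicial_complex_def\<close>)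
    have vs: "vertex_sign R r j X \<in> carrier R" for j X by (simp add: R.vertex_sign_eq)
    \<comment> \<open>The chain vanishes off the smaller subcomplex, so summing over the cofaces in
      the larger one changes nothing.\<close>
    have J: "(\<Oplus>\<^bsub>R\<^esub>j\<in>?J'. vertex_sign R r j (insert j F) \<otimes>\<^bsub>R\<^esub> c (insert j F)) =
        (\<Oplus>\<^bsub>R\<^esub>j\<in>?J. vertex_sign R r j (insert j F) \<otimes>\<^bsub>R\<^esub> c (insert j F))"
      using c vs sub by (intro R.add.finprod_mono_neutral_cong_left[OF fin]) auto
    \<comment> \<open>A coface in the smaller subcomplex would force \<open>F\<close> itself to lie
      there.\<close>
    have J': "?J' = {}" if "F \<notin> sub (I - {i})"
    proof -
      have "insert j F \<notin> sub (I - {i})" if "j \<notin> F" for j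
        using sub_remove[of "insert j F" "I - {i}" j] that \<open>F \<notin> sub (I - {i})\<close> by auto
      then show ?thesis by auto
    qed
    show "simplicial_boundary R r (sub (I - {i})) c F = simplicial_boundary R r (sub I) c F"
    proof (cases "F \<in> sub (I - {i})")
      case True
      then show ?thesis using sub J by (simp add: simplicial_boundary_def)
    next
      case False
      then show ?thesis using J J'[OF False] by (simp add: simplicial_boundary_def)
    qed
  qed
next
  show "full_homology R r K (I, p) = quot_module (simplicial_chains R (sub I) p\<lparr>carrier :=
      {c \<in> carrier (simplicial_chains R (sub I) p). simplicial_boundary R r (sub I) c = (\<lambda>F. \<zero>\<^bsub>R\<^esub>)}\<rparr>)
      (simplicial_boundary R r (sub I) ` carrier (simplicial_chains R (sub I) (p - - 1)))" for I p
    by (simp add: full_homology_def reduced_homology_def cycles_def boundaries_def)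
  show "diff (CH_homology R V r K) = (\<lambda>x. \<lambda>(I, p)\<in>hochster_index V. \<Oplus>\<^bsub>full_homology R r K (I, p)\<^esub>i\<in>I.
      ring_int R (parity_sign (p + 1) * eps r i (I - {i})) \<odot>\<^bsub>full_homology R r K (I, p)\<^esub>
        quot_map (simplicial_chains R (sub I) p) (simplicial_boundary R r (sub I) ` carrier (simplicial_chains R (sub I) (p - - 1)))
          (\<lambda>c. c) (x (I - {i}, p)))"
    by (simp add: CH_homology_def homology_inclusion_def boundaries_def coef)
  show "pair_degree x = (fst (pair_degree y) + - 1, snd (pair_degree y) + 0)" if "face_matrix r y x \<noteq> 0" for x y
    using face_matrix_degree[OF that] by (simp add: prod_eq_iff)
  show "pair_degree x = (fst (pair_degree y) + fst (- 1, 2), snd (pair_degree y) + snd (- 1, 2))"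
    if "support_matrix r y x \<noteq> 0" for x y
    using support_matrix_degree[OF that] by (simp add: prod_eq_iff)
  show "(\<Sum>y\<in>S. face_matrix r y x * face_matrix r z y) = 0" if "x \<in> S" "z \<in> S" for x z
    using face_matrix_square[OF K r that(2,1)] by (simp add: mult.commute)
  show "(\<Sum>y\<in>S. support_matrix r y x * support_matrix r z y) = 0" if "x \<in> S" "z \<in> S" for x z
    using support_matrix_square[OF K r that(2,1)] by (simp add: mult.commute)
  show "(\<Sum>y\<in>S. face_matrix r y x * support_matrix r z y) = - (\<Sum>y\<in>S. support_matrix r y x * face_matrix r z y)"
    if "x \<in> S" "z \<in> S" for x z
    using face_support_anticommute[OF K r that(2,1)] by (simp add: mult.commute)
qed (auto simp: R K finite_V CH_homology_def ZK_homology_def intro: finite_subset[OF _ finite_V])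

end

text \<open>The signs are their own inverses, so multiplying by both moves them to the opposite
  sides. For transposed matrices this gives the Leibniz rule with source and target
  exchanged.\<close>

lemma transposed_leibniz:
  fixes tau1 tau2 :: int
  assumes "a * tau1 = tau2 * b" "tau1 * tau1 = 1" "tau2 * tau2 = 1"
  shows "a * tau2 = tau1 * b"
proof -
  have "a * tau2 = a * (tau1 * tau1) * tau2" using assms(2) by simp
  also have "\<dots> = (a * tau1) * tau1 * tau2" by (simp add: mult_ac)
  also have "\<dots> = (tau2 * tau2) * tau1 * b" unfolding assms(1) by (simp add: mult_ac)
  finally show ?thesis using assms(3) by simp
qed

theorem theorem6p3:
  fixes R :: "('r, 's) ring_scheme"
    and V :: "'v set" and r :: "'v rel" and K :: "'v set set"
    and W :: "'w set" and s :: "'w rel" and L :: "'w set set"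
    and t :: "('v + 'w) rel"
  assumes "principal_domain R"
    and "simplicial_complex V K" and "linear_order_on V r"
    and "simplicial_complex W L" and "linear_order_on W s"
    and "linear_order_on (Sum_Type.Plus V W) t"
  shows
    "(projective R (total (ZK_cohomology R V r K)) \<or> projective R (total (ZK_cohomology R W s L)) \<longrightarrow>
        isomorphic_complexes R
          (CH_cohomology R (Sum_Type.Plus V W) t (simplicial_join K L))
          (complex_tensor R (CH_cohomology R V r K) (CH_cohomology R W s L))) \<and>
     (field R \<longrightarrow>
        isomorphic_bigraded R
          (HH_cohomology R (Sum_Type.Plus V W) t (simplicial_join K L))
          (bigraded_tensor R (HH_cohomology R V r K) (HH_cohomology R W s L))) \<and>
     (projective R (total (ZK_homology R V r K)) \<or> projective R (total (ZK_homology R W s L)) \<longrightarrow>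
        isomorphic_complexes R
          (CH_homology R (Sum_Type.Plus V W) t (simplicial_join K L))
          (complex_tensor R (CH_homology R V r K) (CH_homology R W s L))) \<and>
     (field R \<longrightarrow>
        isomorphic_bigraded R
          (HH_homology R (Sum_Type.Plus V W) t (simplicial_join K L))
          (bigraded_tensor R (HH_homology R V r K) (HH_homology R W s L)))"
proof -
  interpret principal_domain R by fact
  note R = is_cring and K = assms(2) and r = assms(3) and L = assms(4) and s = assms(5) and t = assms(6)
  note J = simplicial_join_complex[OF K L]
  let ?tau = "join_sign (sum_order V W r s) t"
  have fin: "finite V" "finite W" using K L by (auto simp: simplicial_complex_def)
  have ft: "free_tensor R (pairs V K) (pairs W L) (pairs (V <+> W) (simplicial_join K L)) pair_join ?tau"
    by (intro free_tensor.intro R finite_pairs K L pair_join_bij join_sign_sq)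
  note dg = pair_join_degree[OF _ _ fin]
  note fm = face_matrix_leibniz[OF K r L s t] and sm = support_matrix_leibniz[OF K r L s t]
  interpret coh: tensor_double_complex R "pairs V K" "CH_cohomology R V r K" "face_matrix r"
    "hochster_complex.pr R V K (\<lambda>I. simplicial_coboundary R r (full_subcomplex K I)) 1"
    "support_matrix r" pair_degree "(1, 0)" "(1, - 2)"
    "pairs W L" "CH_cohomology R W s L" "face_matrix s"
    "hochster_complex.pr R W L (\<lambda>I. simplicial_coboundary R s (full_subcomplex L I)) 1"
    "support_matrix s" pair_degree "(1, 0)" "(1, - 2)"
    "pairs (V <+> W) (simplicial_join K L)" "CH_cohomology R (V <+> W) t (simplicial_join K L)" "face_matrix t"
    "hochster_complex.pr R (V <+> W) (simplicial_join K L)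
      (\<lambda>I. simplicial_coboundary R t (full_subcomplex (simplicial_join K L) I)) 1"
    "support_matrix t" pair_degree "(1, 0)" "(1, - 2)" pair_join ?tau
    by (intro tensor_double_complex.intro tensor_double_complex_axioms.intro
        hochster_complex.double_complex[OF cohomology_hochster] R K L J r s t ft dg fm sm assms(1))
  interpret hom: tensor_double_complex R "pairs V K" "CH_homology R V r K" "\<lambda>x y. face_matrix r y x"
    "hochster_complex.pr R V K (\<lambda>I. simplicial_boundary R r (full_subcomplex K I)) (- 1)"
    "\<lambda>x y. support_matrix r y x" pair_degree "(- 1, 0)" "(- 1, 2)"
    "pairs W L" "CH_homology R W s L" "\<lambda>x y. face_matrix s y x"
    "hochster_complex.pr R W L (\<lambda>I. simplicial_boundary R s (full_subcomplex L I)) (- 1)"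
    "\<lambda>x y. support_matrix s y x" pair_degree "(- 1, 0)" "(- 1, 2)"
    "pairs (V <+> W) (simplicial_join K L)" "CH_homology R (V <+> W) t (simplicial_join K L)"
    "\<lambda>x y. face_matrix t y x"
    "hochster_complex.pr R (V <+> W) (simplicial_join K L)
      (\<lambda>I. simplicial_boundary R t (full_subcomplex (simplicial_join K L) I)) (- 1)"
    "\<lambda>x y. support_matrix t y x" pair_degree "(- 1, 0)" "(- 1, 2)" pair_join ?tau
  proof (intro tensor_double_complex.intro tensor_double_complex_axioms.intro
        hochster_complex.double_complex[OF homology_hochster] R K L J r s t ft dg assms(1))
    \<comment> \<open>As the matrices are transposed, the identities are used with primed and
      unprimed arguments exchanged. The degree sign stands only at terms with \<open>x = x'\<close>,
      so it is the same for both.\<close>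
    fix x x' y y' assume xy: "x \<in> pairs V K" "x' \<in> pairs V K" "y \<in> pairs W L" "y' \<in> pairs W L"
    show "face_matrix t (pair_join x' y') (pair_join x y) * ?tau x' y' =
        ?tau x y * ((if y = y' then face_matrix r x' x else 0) +
        (if x = x' then (if even (fst (pair_degree x) + snd (pair_degree x)) then 1 else - 1) * face_matrix s y' y else 0))"
      using transposed_leibniz[OF fm[OF xy(2,1,4,3)] join_sign_sq join_sign_sq] by (auto cong: if_cong)
    show "support_matrix t (pair_join x' y') (pair_join x y) * ?tau x' y' =
        ?tau x y * ((if y = y' then support_matrix r x' x else 0) +
        (if x = x' then (if even (fst (pair_degree x) + snd (pair_degree x)) then 1 else - 1) * support_matrix s y' y else 0))"
      using transposed_leibniz[OF sm[OF xy(2,1,4,3)] join_sign_sq join_sign_sq] by (auto cong: if_cong)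
  qed
  \<comment> \<open>Projectivity is assumed of the modules without differential; these are the total
    modules of the complexes.\<close>
  have "total (ZK_cohomology R V r K) = total (CH_cohomology R V r K)"
    "total (ZK_cohomology R W s L) = total (CH_cohomology R W s L)"
    "total (ZK_homology R V r K) = total (CH_homology R V r K)"
    "total (ZK_homology R W s L) = total (CH_homology R W s L)"
    by (simp_all add: CH_cohomology_def CH_homology_def)
  then show ?thesis
    using coh.complexes_isomorphic coh.homologies_isomorphic hom.complexes_isomorphic hom.homologies_isomorphic
    by (simp add: HH_cohomology_def HH_homology_def)
qed

end
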